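(* Let $d\ge 2$ and let $\{T(e):e\in\mathcal{E}\}$ be i.i.d. random variables with values in $[0,\infty]$ and common distribution $\mathcal{L}$ on the edges $\mathcal{E}$ of $\mathbb{Z}^d$. Assume that $\mathcal{L}$ is useful and that one of the following two conditions holds: (1) $\mathcal{L}(\{\infty\})>0$ and $\mathcal{L}([0,\infty))>p_c$; or (2) $\mathcal{L}(\{\infty\})=0$ and the support of $\mathcal{L}$ is unbounded. Let $\mathfrak{P}=(\Lambda,u^\Lambda,v^\Lambda,\mathcal{A}^\Lambda)$ be a valid pattern. Then there exist $\alpha>0$, $\beta_1>0$, $\beta_2>0$ such that for all $x\in\mathbb{Z}^d$, \[\mathbb{P}\big((0,x)\in\mathfrak{C}\text{ and there exists a geodesic }\gamma\text{ from }0\text{ to }x\text{ with }N^{\mathfrak{P}}(\gamma)<\alpha\|x\|_1\big)\le \beta_1 e^{-\beta_2\|x\|_1}.\]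
   Context: First-passage percolation on $\mathbb{Z}^d$: edges join $x,y$ with $\|x-y\|_1=1$. A path $\pi=(x_0,\dots,x_k)$ is a sequence of adjacent vertices; its passage time is $T(\pi)=\sum_{i=1}^k T(\{x_{i-1},x_i\})$. The geodesic time is $t(x,y)=\inf\{T(\pi):\pi\text{ path from }x\text{ to }y\}$, and $\mathfrak{C}=\{(x,y): t(x,y)<\infty\}$. A geodesic from $x$ to $y$ is a self-avoiding path $\gamma$ from $x$ to $y$ with $T(\gamma)=t(x,y)$. $p_c$ is the critical probability of Bernoulli bond percolation on $\mathbb{Z}^d$ and $\overrightarrow{p_c}$ that of oriented Bernoulli bond percolation on $\mathbb{Z}^d$. Let $t_{\min}$ be the minimum of the support of $\mathcal{L}$; $\mathcal{L}$ is useful if $\mathcal{L}(\{t_{\min}\})<p_c$ when $t_{\min}=0$ and $\mathcal{L}(\{t_{\min}\})<\overrightarrow{p_c}$ when $t_{\min}>0$. Patterns: $\Lambda=\prod_{i=1}^d\{0,\dots,L_i\}$ with nonnegative integers $L_i$, not all zero; $u^\Lambda\ne v^\Lambda$ are vertices of the boundary $\partial\Lambda$ (vertices of $\Lambda$ adjacent to a vertex outside $\Lambda$); $\mathcal{A}^\Lambda$ is an event depending only on the passage times of edges with both endpoints in $\Lambda$. For $x\in\mathbb{Z}^d$, $\theta_x y=y-x$, $\theta_x$ acts on edges and paths vertexwise, and $(\theta_xT)(e)=T(\theta_{-x}e)$. For a self-avoiding path $\pi$, $x$ satisfies the condition $(\pi;\mathfrak{P})$ if $\theta_x\pi$ visits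 $u^\Lambda$ and $v^\Lambda$, the subpath of $\theta_x\pi$ between $u^\Lambda$ and $v^\Lambda$ lies entirely in $\Lambda$, and $\theta_xT\in\mathcal{A}^\Lambda$. $N^{\mathfrak{P}}(\pi)=\sum_{x\in\mathbb{Z}^d}\mathbf{1}\{x\text{ satisfies }(\pi;\mathfrak{P})\}$. An external normal unit vector at $z\in\partial\Lambda$ is $\alpha\in\{\pm\epsilon_1,\dots,\pm\epsilon_d\}$ (canonical basis) with $z+\alpha\notin\Lambda$. The pattern is valid if: $\mathbb{P}(\mathcal{A}^\Lambda)>0$; on $\mathcal{A}^\Lambda$ there is a path from $u^\Lambda$ to $v^\Lambda$ inside $\Lambda$ with finite passage time; and either the support of $\mathcal{L}$ is unbounded or there exist two distinct external normal unit vectors, one associated with $u^\Lambda$ and one with $v^\Lambda$. *)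

theory Defs
  imports "HOL-Probability.Probability"
begin

definition l1 :: "int^'d \<Rightarrow> int" where
  "l1 x = (\<Sum>i\<in>UNIV. \<bar>x $ i\<bar>)"

definition adj :: "int^'d \<Rightarrow> int^'d \<Rightarrow> bool" where
  "adj x y \<longleftrightarrow> l1 (x - y) = 1"

definition lattice_edges :: "(int^'d) set set" where
  "lattice_edges = {{x, y} | x y. adj x y}"

definition is_path :: "(int^'d) list \<Rightarrow> bool" where
  "is_path p \<longleftrightarrow> p \<noteq> [] \<and> (\<forall>i. Suc i < length p \<longrightarrow> adj (p ! i) (p ! Suc i))"

definition path_from_to :: "(int^'d) list \<Rightarrow> int^'d \<Rightarrow> int^'d \<Rightarrow> bool" where
  "path_from_to p x y \<longleftrightarrow> is_path p \<and> hd p = x \<and> last p = y"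

definition ptime :: "((int^'d) set \<Rightarrow> ennreal) \<Rightarrow> (int^'d) list \<Rightarrow> ennreal" where
  "ptime t p = (\<Sum>i<length p - 1. t {p ! i, p ! Suc i})"

definition geotime :: "((int^'d) set \<Rightarrow> ennreal) \<Rightarrow> int^'d \<Rightarrow> int^'d \<Rightarrow> ennreal" where
  "geotime t x y = (INF p\<in>{p. path_from_to p x y}. ptime t p)"

definition is_geodesic :: "((int^'d) set \<Rightarrow> ennreal) \<Rightarrow> int^'d \<Rightarrow> int^'d \<Rightarrow> (int^'d) list \<Rightarrow> bool" where
  "is_geodesic t x y g \<longleftrightarrow> path_from_to g x y \<and> distinct g \<and> ptime t g = geotime t x y"

definition box :: "nat^'d \<Rightarrow> (int^'d) set" where
  "box Lv = {z. \<forall>i. 0 \<le> z $ i \<and> z $ i \<le> int (Lv $ i)}"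

definition boundary :: "(int^'d) set \<Rightarrow> (int^'d) set" where
  "boundary S = {z \<in> S. \<exists>y. adj z y \<and> y \<notin> S}"

definition edges_in :: "(int^'d) set \<Rightarrow> (int^'d) set set" where
  "edges_in S = {e \<in> lattice_edges. e \<subseteq> S}"

definition ext_normal :: "(int^'d) set \<Rightarrow> int^'d \<Rightarrow> int^'d \<Rightarrow> bool" where
  "ext_normal S z a \<longleftrightarrow> z \<in> boundary S \<and> (\<exists>i. a = axis i 1 \<or> a = - axis i 1) \<and> z + a \<notin> S"

text \<open>Shifted configuration: (theta_x t)(e) = t(theta_{-x} e) = t(e + x).\<close>
definition shift_conf :: "int^'d \<Rightarrow> ((int^'d) set \<Rightarrow> 'b) \<Rightarrow> (int^'d) set \<Rightarrow> 'b" where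
  "shift_conf x t e = t ((\<lambda>y. y + x) ` e)"

text \<open>The event A^Lambda is given as a measurable set A of configurations on the
  edges inside Lambda; a configuration t belongs to the event iff its restriction does.\<close>
definition in_event :: "nat^'d \<Rightarrow> ((int^'d) set \<Rightarrow> ennreal) set \<Rightarrow> ((int^'d) set \<Rightarrow> ennreal) \<Rightarrow> bool" where
  "in_event Lv A t \<longleftrightarrow> restrict t (edges_in (box Lv)) \<in> A"

definition satisfies_cond ::
  "nat^'d \<Rightarrow> int^'d \<Rightarrow> int^'d \<Rightarrow> ((int^'d) set \<Rightarrow> ennreal) set \<Rightarrow>
   ((int^'d) set \<Rightarrow> ennreal) \<Rightarrow> (int^'d) list \<Rightarrow> int^'d \<Rightarrow> bool" where
  "satisfies_cond Lv u v A t p x \<longleftrightarrow>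
     (let q = map (\<lambda>y. y - x) p in
       u \<in> set q \<and> v \<in> set q \<and>
       (\<forall>i j k. i < length q \<and> j < length q \<and> q ! i = u \<and> q ! j = v \<and>
                 min i j \<le> k \<and> k \<le> max i j \<longrightarrow> q ! k \<in> box Lv) \<and>
       in_event Lv A (shift_conf x t))"

definition N_pat ::
  "nat^'d \<Rightarrow> int^'d \<Rightarrow> int^'d \<Rightarrow> ((int^'d) set \<Rightarrow> ennreal) set \<Rightarrow>
   ((int^'d) set \<Rightarrow> ennreal) \<Rightarrow> (int^'d) list \<Rightarrow> nat" where
  "N_pat Lv u v A t p = card {x. satisfies_cond Lv u v A t p x}"

definition bond_perc :: "real \<Rightarrow> ((int^'d) set \<Rightarrow> bool) measure" where
  "bond_perc p = PiM lattice_edges (\<lambda>_. measure_pmf (bernoulli_pmf p))"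

definition open_cluster :: "((int^'d) set \<Rightarrow> bool) \<Rightarrow> (int^'d) set" where
  "open_cluster w = {y. (0, y) \<in> {(a, b). adj a b \<and> w {a, b}}\<^sup>*}"

definition bond_theta :: "'d::finite itself \<Rightarrow> real \<Rightarrow> real" where
  "bond_theta _ p = measure (bond_perc p :: ((int^'d) set \<Rightarrow> bool) measure)
      {w \<in> space (bond_perc p). infinite (open_cluster w)}"

definition p_c :: "'d::finite itself \<Rightarrow> real" where
  "p_c D = Sup {p \<in> {0..1}. bond_theta D p = 0}"

definition oriented_edges :: "((int^'d) \<times> (int^'d)) set" where
  "oriented_edges = {(a, a + axis i 1) | a i. True}"

definition oriented_perc :: "real \<Rightarrow> ((int^'d) \<times> (int^'d) \<Rightarrow> bool) measure" where
  "oriented_perc p = PiM oriented_edges (\<lambda>_. measure_pmf (bernoulli_pmf p))"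

definition oriented_cluster :: "((int^'d) \<times> (int^'d) \<Rightarrow> bool) \<Rightarrow> (int^'d) set" where
  "oriented_cluster w = {y. (0, y) \<in> {e. e \<in> oriented_edges \<and> w e}\<^sup>*}"

definition oriented_theta :: "'d::finite itself \<Rightarrow> real \<Rightarrow> real" where
  "oriented_theta _ p = measure (oriented_perc p :: ((int^'d) \<times> (int^'d) \<Rightarrow> bool) measure)
      {w \<in> space (oriented_perc p). infinite (oriented_cluster w)}"

definition oriented_p_c :: "'d::finite itself \<Rightarrow> real" where
  "oriented_p_c D = Sup {p \<in> {0..1}. oriented_theta D p = 0}"

definition support :: "ennreal measure \<Rightarrow> ennreal set" where
  "support L = {t. \<forall>U. open U \<longrightarrow> t \<in> U \<longrightarrow> emeasure L U > 0}"

definition support_unbounded :: "ennreal measure \<Rightarrow> bool" where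
  "support_unbounded L \<longleftrightarrow> (\<forall>r::real. \<exists>t\<in>support L. t > ennreal r)"

definition useful :: "'d::finite itself \<Rightarrow> ennreal measure \<Rightarrow> bool" where
  "useful D L \<longleftrightarrow>
     (let tmin = Inf (support L) in
       (tmin = 0 \<longrightarrow> measure L {tmin} < p_c D) \<and>
       (tmin > 0 \<longrightarrow> measure L {tmin} < oriented_p_c D))"

definition valid_pattern ::
  "'a measure \<Rightarrow> ((int^'d) set \<Rightarrow> 'a \<Rightarrow> ennreal) \<Rightarrow> ennreal measure \<Rightarrow>
   nat^'d \<Rightarrow> int^'d \<Rightarrow> int^'d \<Rightarrow> ((int^'d) set \<Rightarrow> ennreal) set \<Rightarrow> bool" where
  "valid_pattern M T L Lv u v A \<longleftrightarrow>
     Lv \<noteq> 0 \<and> u \<in> boundary (box Lv) \<and> v \<in> boundary (box Lv) \<and> u \<noteq> v \<and>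
     A \<in> sets (PiM (edges_in (box Lv)) (\<lambda>_. borel :: ennreal measure)) \<and>
     measure M {w \<in> space M. in_event Lv A (\<lambda>e. T e w)} > 0 \<and>
     (\<forall>w \<in> space M. in_event Lv A (\<lambda>e. T e w) \<longrightarrow>
        (\<exists>p. path_from_to p u v \<and> set p \<subseteq> box Lv \<and> ptime (\<lambda>e. T e w) p < \<infinity>)) \<and>
     (support_unbounded L \<or> (\<exists>a b. a \<noteq> b \<and> ext_normal (box Lv) u a \<and> ext_normal (box Lv) v b))"

end

theory Submission
  imports Defs
begin

text \<open>
  The proof is a modification argument. Call the \<open>\<ell>\<^sup>1\<close>-ball of radius \<open>R\<close> around \<open>y\<close> good if all its edges
  are cheaper than some constant and every path from \<open>y\<close> to its sphere takes time at least
  \<open>t\<^sub>m\<^sub>i\<^sub>n R + k\<^sub>0\<close>. A fast path to the sphere has boundedly many steps that are slow or (if \<open>t\<^sub>m\<^sub>i\<^sub>n > 0\<close>)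
  point in the wrong direction, hence contains a long piece of (oriented) percolation with a parameter
  that is subcritical because \<open>\<L>\<close> is useful. By sharpness such pieces are exponentially
  unlikely, so for large \<open>R\<close> almost all balls are good, and a Peierls argument on tiles of side \<open>R\<close>
  shows that every long geodesic passes through the centres of linearly many good balls, up to
  an event of exponentially small probability.

  Let a geodesic enter and leave a good ball for the first and the last time at \<open>a\<close> and \<open>b\<close>. Resample the
  ball: put a pattern in its middle, nearly minimal times on a corridor from \<open>a\<close> to \<open>b\<close> through the
  pattern, whose length exceeds \<open>2R\<close> by a constant only, and prohibitively large times on all other
  edges of the ball. Then every geodesic uses the corridor. This costs a constant factor \<open>\<eta>\<close> in probability and
  creates at most \<open>C\<close> patterns. Counting the centres in two ways bounds the probability of few patterns,
  \<open>p(k) = P(N < k)\<close>, by \<open>p(k) \<le> p(k + C) / 2\<close> up to an exponentially small error as long as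
  \<open>k + C\<close> is small compared with the distance, and iteration gives the theorem.
\<close>

section \<open>Lattice paths and geodesics\<close>

lemma l1_nonneg [simp]: "0 \<le> l1 x"
  by (simp add: l1_def sum_nonneg)

lemma l1_zero [simp]: "l1 0 = 0"
  by (simp add: l1_def)

lemma l1_eq_0_iff [simp]: "l1 x = 0 \<longleftrightarrow> x = 0"
  by (simp add: l1_def sum_nonneg_eq_0_iff vec_eq_iff)

lemma l1_minus [simp]: "l1 (- x) = l1 x"
  by (simp add: l1_def)

lemma l1_minus_commute: "l1 (x - y) = l1 (y - x)"
  using l1_minus[of "x - y"] by simp

lemma l1_triangle: "l1 (x + y) \<le> l1 x + l1 y"
  by (simp add: l1_def sum.distrib[symmetric] sum_mono abs_triangle_ineq)

lemma l1_diff_triangle: "l1 (x - z) \<le> l1 (x - y) + l1 (y - z)"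
  using l1_triangle[of "x - y" "y - z"] by simp

lemma l1_component_le: "\<bar>x $ i\<bar> \<le> l1 x"
  unfolding l1_def by (rule member_le_sum) auto

lemma l1_axis [simp]: "l1 (axis i c) = \<bar>c\<bar>"
proof -
  have "l1 (axis i c) = (\<Sum>j\<in>UNIV. if j = i then \<bar>c\<bar> else 0)"
    unfolding l1_def by (intro sum.cong) (auto simp: axis_def)
  then show ?thesis by simp
qed

lemma adj_sym: "adj x y \<longleftrightarrow> adj y x"
  by (simp add: adj_def l1_minus_commute)

lemma adj_irrefl [simp]: "\<not> adj x x"
  by (simp add: adj_def)

lemma adj_translate [simp]: "adj (x + z) (y + z) \<longleftrightarrow> adj x y"
  by (simp add: adj_def)

lemma adj_l1_diff: "adj x y \<Longrightarrow> \<bar>l1 (x - z) - l1 (y - z)\<bar> \<le> 1"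
  using l1_diff_triangle[of x z y] l1_diff_triangle[of y z x] l1_minus_commute[of x y]
  by (simp add: adj_def)

lemma adj_imp_axis:
  fixes x y :: "int^'d"
  assumes "adj x y"
  shows "\<exists>i c. \<bar>c\<bar> = 1 \<and> y = x + axis i c"
proof -
  let ?z = "y - x"
  have l: "l1 ?z = 1" using assms by (simp add: adj_def l1_minus_commute)
  then have "?z \<noteq> 0" by (metis l1_zero zero_neq_one)
  then obtain i where i: "?z $ i \<noteq> 0" by (auto simp: vec_eq_iff)
  have "l1 ?z = \<bar>?z $ i\<bar> + (\<Sum>j\<in>UNIV-{i}. \<bar>?z $ j\<bar>)"
    unfolding l1_def by (subst sum.remove[of _ i]) auto
  moreover have "0 \<le> (\<Sum>j\<in>UNIV-{i}. \<bar>?z $ j\<bar>)" by (rule sum_nonneg) auto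
  ultimately have 1: "\<bar>?z $ i\<bar> = 1" and 0: "(\<Sum>j\<in>UNIV-{i}. \<bar>?z $ j\<bar>) = 0"
    using l i by linarith+
  have "?z $ j = 0" if "j \<noteq> i" for j
    using 0 that by (subst (asm) sum_nonneg_eq_0_iff) auto
  then have "?z = axis i (?z $ i)" by (auto simp: vec_eq_iff axis_def)
  then have "y = x + axis i (?z $ i)" by (metis add.commute diff_add_cancel)
  with 1 show ?thesis by blast
qed

lemma adj_axis: "\<bar>c\<bar> = 1 \<Longrightarrow> adj x (x + axis i c)"
  by (simp add: adj_def)

lemma edge_in_lattice [simp]: "{x, y} \<in> lattice_edges \<longleftrightarrow> adj x y"
  by (auto simp: lattice_edges_def doubleton_eq_iff adj_sym)

lemma edges_in_iff [simp]: "{x, y} \<in> edges_in S \<longleftrightarrow> adj x y \<and> x \<in> S \<and> y \<in> S"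
  by (auto simp: edges_in_def)

lemma edges_in_subset: "edges_in S \<subseteq> lattice_edges"
  by (auto simp: edges_in_def)

lemma edges_in_mono: "S \<subseteq> S' \<Longrightarrow> edges_in S \<subseteq> edges_in S'"
  by (auto simp: edges_in_def)

lemma finite_edges_in [simp]: "finite S \<Longrightarrow> finite (edges_in S)"
  by (rule finite_subset[of _ "Pow S"]) (auto simp: edges_in_def)

definition ball1 :: "int^'d \<Rightarrow> int \<Rightarrow> (int^'d) set" where
  "ball1 y r = {x. l1 (x - y) \<le> r}"

lemma ball1_translate: "ball1 y r = (\<lambda>x. x + y) ` ball1 0 r"
proof (intro equalityI subsetI)
  fix x assume "x \<in> ball1 y r"
  then show "x \<in> (\<lambda>x. x + y) ` ball1 0 r"
    by (intro image_eqI[of _ _ "x - y"]) (auto simp: ball1_def)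
qed (auto simp: ball1_def)

lemma finite_int_cube: "finite {z :: int^'d. \<forall>i. l i \<le> z $ i \<and> z $ i \<le> h i}"
proof -
  have "finite (Pi\<^sub>E UNIV (\<lambda>i::'d. {l i..h i}))" by (intro finite_PiE) auto
  moreover have "{z :: int^'d. \<forall>i. l i \<le> z $ i \<and> z $ i \<le> h i}
      \<subseteq> vec_lambda ` (Pi\<^sub>E UNIV (\<lambda>i::'d. {l i..h i}))"
    by (auto intro!: image_eqI[of _ _ "vec_nth _"])
  ultimately show ?thesis by (rule finite_subset[rotated, OF finite_imageI])
qed

lemma finite_ball1 [simp]: "finite (ball1 (y :: int^'d) r)"
proof -
  have "ball1 y r \<subseteq> {z. \<forall>i. y $ i - r \<le> z $ i \<and> z $ i \<le> y $ i + r}"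
  proof (intro subsetI CollectI allI)
    fix x i assume "x \<in> ball1 y r"
    then show "y $ i - r \<le> x $ i \<and> x $ i \<le> y $ i + r"
      using l1_component_le[of "x - y" i] by (auto simp: ball1_def abs_if split: if_splits)
  qed
  then show ?thesis using finite_int_cube by (rule finite_subset)
qed

lemma card_ball1: "card (ball1 y r) = card (ball1 (0 :: int^'d) r)" for y :: "int^'d"
  using card_image[of "\<lambda>x. x + y" "ball1 0 r"] ball1_translate[of y r] by simp

lemma finite_box [simp]: "finite (box Lv)"
  unfolding box_def using finite_int_cube[of "\<lambda>_. 0" "\<lambda>i. int (Lv $ i)"] by simp

lemma is_path_iff: "is_path p \<longleftrightarrow> p \<noteq> [] \<and> successively adj p"
  by (auto simp: is_path_def successively_conv_nth)

lemma path_from_to_iff: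
  "path_from_to p x y \<longleftrightarrow> p \<noteq> [] \<and> successively adj p \<and> hd p = x \<and> last p = y"
  by (auto simp: path_from_to_def is_path_iff)

lemma ptime_simps [simp]:
  "ptime t [] = 0" "ptime t [x] = 0" "ptime t (x # y # p) = t {x, y} + ptime t (y # p)"
  by (simp_all add: ptime_def sum.lessThan_Suc_shift del: sum.lessThan_Suc)

lemma ptime_append: "ptime t (p @ x # q) = ptime t (p @ [x]) + ptime t (x # q)"
proof (induction p)
  case (Cons a p)
  then show ?case by (cases p) (auto simp: add.assoc)
qed simp

lemma ptime_rev: "ptime t (rev p) = ptime t p"
proof (induction p)
  case (Cons a p)
  show ?case
  proof (cases p)
    case (Cons b q)
    have "ptime t (rev (a # p)) = ptime t (rev q @ b # [a])" using Cons by simp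
    also have "\<dots> = ptime t (rev p) + t {b, a}" by (subst ptime_append) (simp add: Cons)
    finally show ?thesis using Cons.IH Cons by (simp add: insert_commute add.commute)
  qed simp
qed simp

lemma ptime_cong:
  assumes "successively adj p" "\<And>x y. adj x y \<Longrightarrow> x \<in> set p \<Longrightarrow> y \<in> set p \<Longrightarrow> t {x, y} = t' {x, y}"
  shows "ptime t p = ptime t' p"
  using assms
proof (induction p rule: induct_list012)
  case (3 x y zs)
  have "ptime t (y # zs) = ptime t' (y # zs)"
    using 3 by (intro "3.IH"(2)) auto
  moreover have "t {x, y} = t' {x, y}" using 3 by auto
  ultimately show ?case by simp
qed auto

lemma successively_adj_rev: "successively adj (rev p) \<longleftrightarrow> successively adj p" for p :: "(int^'d) list"
proof -
  have "(\<lambda>x y. adj y x) = (adj :: int^'d \<Rightarrow> _)" by (intro ext) (rule adj_sym)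
  then show ?thesis by (simp only: successively_rev)
qed

lemma path_rev: "path_from_to p x y \<Longrightarrow> path_from_to (rev p) y x"
  by (simp add: path_from_to_iff hd_rev last_rev successively_adj_rev del: successively_rev)

lemma path_append:
  "path_from_to (p @ [y]) x y \<Longrightarrow> path_from_to (y # q) y z \<Longrightarrow> path_from_to (p @ y # q) x z"
  by (auto simp: path_from_to_iff successively_append_iff hd_append)

lemma path_split:
  "path_from_to (p @ y # q) x z \<Longrightarrow> path_from_to (p @ [y]) x y \<and> path_from_to (y # q) y z"
  by (auto simp: path_from_to_iff successively_append_iff hd_append split: if_splits)

lemma loop_erase:
  assumes "path_from_to p x y"
  shows "\<exists>q. path_from_to q x y \<and> distinct q \<and> set q \<subseteq> set p \<and> ptime t q \<le> ptime t p"
  using assms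
proof (induction p arbitrary: x)
  case Nil
  then show ?case by (simp add: path_from_to_iff)
next
  case (Cons a p)
  then have a: "a = x" by (simp add: path_from_to_iff)
  show ?case
  proof (cases p)
    case Nil
    then show ?thesis using Cons.prems by (intro exI[of _ "[x]"]) (auto simp: path_from_to_iff)
  next
    case (Cons b p')
    then have "path_from_to p b y" "adj x b"
      using Cons.prems a by (auto simp: path_from_to_iff)
    then obtain q where q: "path_from_to q b y" "distinct q" "set q \<subseteq> set p" "ptime t q \<le> ptime t p"
      using Cons.IH by blast
    have qq: "q \<noteq> []" "hd q = b" using q by (auto simp: path_from_to_iff)
    have le: "ptime t q \<le> ptime t (a # p)" using q(4) Cons by (simp add: add_increasing)
    show ?thesis
    proof (cases "x \<in> set q")
      case True
      then obtain q1 q2 where qs: "q = q1 @ x # q2" by (meson split_list)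
      have "ptime t (x # q2) \<le> ptime t q" by (subst qs, subst ptime_append) simp
      then show ?thesis using q le qs a path_split[of q1 x q2 b y]
        by (intro exI[of _ "x # q2"]) (auto intro: order_trans)
    next
      case False
      have "ptime t (x # q) \<le> ptime t (a # p)"
        using q(4) qq a Cons by (cases q) (auto intro: add_left_mono)
      moreover have "path_from_to (x # q) x y"
        using q(1) qq \<open>adj x b\<close> by (auto simp: path_from_to_iff successively_Cons)
      ultimately show ?thesis using q False a by (intro exI[of _ "x # q"]) auto
    qed
  qed
qed

lemma geotime_le: "path_from_to p x y \<Longrightarrow> geotime t x y \<le> ptime t p"
  unfolding geotime_def by (rule INF_lower) simp

lemma geodesic_split:
  assumes g: "is_geodesic t x z (p @ y # q)" and fin: "geotime t x z < \<infinity>"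
  shows "ptime t (p @ [y]) = geotime t x y" "ptime t (y # q) = geotime t y z"
proof -
  have g': "path_from_to (p @ y # q) x z" "ptime t (p @ y # q) = geotime t x z"
    using g by (auto simp: is_geodesic_def)
  have sum: "ptime t (p @ [y]) + ptime t (y # q) = geotime t x z"
    using g'(2) by (subst ptime_append[symmetric]) simp
  have f: "ptime t (p @ [y]) < \<infinity>" "ptime t (y # q) < \<infinity>"
    using sum fin by (auto simp: less_top[symmetric])
  note sp = path_split[OF g'(1)]
  have "ptime t (p @ [y]) \<le> ptime t r" if r: "path_from_to r x y" for r
  proof -
    have "r = butlast r @ [y]" using r by (auto simp: path_from_to_iff)
    then have "path_from_to (butlast r @ y # q) x z" using r sp path_append by metis
    then have "geotime t x z \<le> ptime t (butlast r @ y # q)" by (rule geotime_le)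
    also have "\<dots> = ptime t r + ptime t (y # q)"
      by (subst ptime_append) (metis \<open>r = butlast r @ [y]\<close>)
    finally have "ptime t (y # q) + ptime t (p @ [y]) \<le> ptime t (y # q) + ptime t r"
      by (simp add: sum[symmetric] add.commute)
    then show ?thesis using f by (auto simp: ennreal_add_left_cancel_le)
  qed
  then show "ptime t (p @ [y]) = geotime t x y"
    unfolding geotime_def by (intro antisym INF_greatest INF_lower) (use sp in auto)
  have "ptime t (y # q) \<le> ptime t r" if r: "path_from_to r y z" for r
  proof -
    have r': "r = y # tl r" using r by (cases r) (auto simp: path_from_to_iff)
    then have "path_from_to (p @ y # tl r) x z" using r sp path_append by metis
    then have "geotime t x z \<le> ptime t (p @ y # tl r)" by (rule geotime_le)
    also have "\<dots> = ptime t (p @ [y]) + ptime t r"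
      by (subst ptime_append) (metis r')
    finally have "ptime t (p @ [y]) + ptime t (y # q) \<le> ptime t (p @ [y]) + ptime t r"
      by (simp add: sum[symmetric])
    then show ?thesis using f by (auto simp: ennreal_add_left_cancel_le)
  qed
  then show "ptime t (y # q) = geotime t y z"
    unfolding geotime_def by (intro antisym INF_greatest INF_lower) (use sp in auto)
qed

section \<open>Disjoint paths\<close>

lemma rtrancl_imp_distinct_path:
  assumes "(x, y) \<in> {(x, y). x \<in> S \<and> y \<in> S \<and> E x y}\<^sup>*" "y \<in> S"
  shows "\<exists>p. p \<noteq> [] \<and> successively E p \<and> distinct p \<and> set p \<subseteq> S \<and> hd p = x \<and> last p = y"
  using assms
proof (induction rule: converse_rtrancl_induct)
  case base
  then show ?case by (intro exI[of _ "[y]"]) auto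
next
  case (step x x')
  then obtain p where p: "p \<noteq> []" "successively E p" "distinct p" "set p \<subseteq> S" "hd p = x'" "last p = y"
    by blast
  show ?case
  proof (cases "x \<in> set p")
    case True
    then obtain p1 p2 where "p = p1 @ x # p2" by (meson split_list)
    then show ?thesis using p
      by (intro exI[of _ "x # p2"]) (auto simp: successively_append_iff)
  next
    case False
    then show ?thesis using p step(1)
      by (intro exI[of _ "x # p"]) (auto simp: successively_Cons)
  qed
qed

text \<open>A fan from \<open>a\<close>, \<open>b\<close> to \<open>v\<close>. It is moved along an edge from \<open>w\<close> to \<open>v\<close> by following a path
  to \<open>v\<close> that avoids \<open>w\<close>, from its last vertex on the fan.\<close>

definition is_fan :: "('v \<Rightarrow> 'v \<Rightarrow> bool) \<Rightarrow> 'v set \<Rightarrow> 'v \<Rightarrow> 'v \<Rightarrow> 'v \<Rightarrow> 'v list \<Rightarrow> 'v list \<Rightarrow> bool" where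
  "is_fan E S a b v P Q \<longleftrightarrow> P \<noteq> [] \<and> Q \<noteq> [] \<and> successively E P \<and> successively E Q \<and> distinct P \<and> distinct Q \<and>
     set P \<subseteq> S \<and> set Q \<subseteq> S \<and> hd P = a \<and> hd Q = b \<and> last P = v \<and> last Q = v \<and> set P \<inter> set Q = {v}"

lemma is_fan_swap: "is_fan E S a b v P Q \<longleftrightarrow> is_fan E S b a v Q P"
  unfolding is_fan_def by (metis inf_commute)

lemma fan_step:
  assumes F: "is_fan E S a b w P Q" and R: "successively E R" "distinct R" "set R \<subseteq> S" "last R = v"
    and R_eq: "R = r1 @ x # r2" and x: "x \<in> set P" "x \<noteq> w"
    and r2: "set r2 \<inter> (set P \<union> set Q) = {}" and wv: "E w v" "v \<noteq> w" "v \<in> S"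
  shows "\<exists>P Q. is_fan E S a b v P Q"
proof -
  obtain p1 p2 where P: "P = p1 @ x # p2" using x by (meson split_list)
  have f: "P \<noteq> []" "Q \<noteq> []" "successively E P" "successively E Q" "distinct P" "distinct Q"
     "set P \<subseteq> S" "set Q \<subseteq> S" "hd P = a" "hd Q = b" "last P = w" "last Q = w" "set P \<inter> set Q = {w}"
    using F by (auto simp: is_fan_def)
  have "p2 \<noteq> []" using f(11) P x by auto
  then have w: "w \<in> set p2" using f(11) P by auto
  have v: "v = last (x # r2)" using R R_eq by auto
  have vQ: "v \<notin> set Q"
  proof
    assume "v \<in> set Q"
    then have "v = x" using v r2 by (cases "r2 = []") (auto dest: last_in_set)
    then show False using f(13) x \<open>v \<in> set Q\<close> by auto
  qed
  have "is_fan E S a b v (p1 @ x # r2) (Q @ [v])"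
    unfolding is_fan_def
  proof (intro conjI)
    show "successively E (p1 @ x # r2)"
      using f(3) R(1) unfolding P R_eq by (auto simp: successively_append_iff)
    show "successively E (Q @ [v])" using f wv by (auto simp: successively_append_iff)
    show "distinct (p1 @ x # r2)" using f(5) R(2) r2 unfolding P R_eq by auto
    show "distinct (Q @ [v])" using f vQ by auto
    show "set (p1 @ x # r2) \<subseteq> S" "set (Q @ [v]) \<subseteq> S" using f R wv unfolding P R_eq by auto
    show "hd (p1 @ x # r2) = a" using f(9) P by (cases p1) auto
    show "hd (Q @ [v]) = b" using f by auto
    show "last (p1 @ x # r2) = v" using v by auto
    have "(set p1 \<union> {x}) \<inter> set Q = {}"
      using f(13) f(5) w unfolding P by auto
    then show "set (p1 @ x # r2) \<inter> set (Q @ [v]) = {v}"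
      using r2 v by (auto split: if_splits)
  qed auto
  then show ?thesis by blast
qed

lemma fan_exists:
  fixes E :: "'v \<Rightarrow> 'v \<Rightarrow> bool"
  defines "st \<equiv> (\<lambda>S. {(x, y). x \<in> S \<and> y \<in> S \<and> E x y}\<^sup>*)"
  assumes ab: "a \<in> S" "b \<in> S" "a \<noteq> b" and v: "v \<in> S"
    and conn: "\<And>x y. x \<in> S \<Longrightarrow> y \<in> S \<Longrightarrow> (x, y) \<in> st S"
    and conn2: "\<And>c x y. x \<in> S - {c} \<Longrightarrow> y \<in> S - {c} \<Longrightarrow> (x, y) \<in> st (S - {c})"
  shows "\<exists>P Q. is_fan E S a b v P Q"
proof -
  have "(a, v) \<in> {(x, y). x \<in> S \<and> y \<in> S \<and> E x y}\<^sup>*" using conn[OF ab(1) v] by (simp add: st_def)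
  then show ?thesis
  proof (induction rule: rtrancl_induct)
    case base
    obtain q where "q \<noteq> []" "successively E q" "distinct q" "set q \<subseteq> S" "hd q = b" "last q = a"
      using rtrancl_imp_distinct_path[of b a S E] conn[OF ab(2,1)] ab by (auto simp: st_def)
    then have "is_fan E S a b a [a] q" using ab by (auto simp: is_fan_def)
    then show ?case by blast
  next
    case (step w v)
    then obtain P Q where F: "is_fan E S a b w P Q" by blast
    have v: "v \<in> S" and wv: "E w v" using step by auto
    show ?case
    proof (cases "v = w")
      case False
      define z where "z = (if a = w then b else a)"
      have z: "z \<noteq> w" "z \<in> S" "z \<in> set P \<union> set Q" using ab F by (auto simp: z_def is_fan_def)
      obtain R where R: "R \<noteq> []" "successively E R" "distinct R" "set R \<subseteq> S - {w}" "hd R = z" "last R = v"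
        using rtrancl_imp_distinct_path[of z v "S - {w}" E] conn2[of z w v] z v False
        by (auto simp: st_def)
      have "\<exists>x\<in>set R. x \<in> set P \<union> set Q" using R z by (metis hd_in_set)
      then obtain r1 x r2 where r: "R = r1 @ x # r2" "x \<in> set P \<union> set Q" "\<forall>y\<in>set r2. y \<notin> set P \<union> set Q"
        using split_list_last_prop[of R "\<lambda>x. x \<in> set P \<union> set Q"] by blast
      have x: "x \<noteq> w" using r R by auto
      have sub: "set R \<subseteq> S" using R by auto
      consider "x \<in> set P" | "x \<in> set Q" using r by auto
      then show ?thesis
      proof cases
        case 1
        then show ?thesis
          using fan_step[OF F R(2,3) sub R(6) r(1) _ x _ wv False v] r by blast
      next
        case 2
        have "\<exists>P Q. is_fan E S b a v P Q"
          using fan_step[OF F[unfolded is_fan_swap[of E S a]] R(2,3) sub R(6) r(1) 2 x _ wv False v] r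
          by blast
        then show ?thesis using is_fan_swap[of E S a b v] by blast
      qed
    qed (use step in blast)
  qed
qed

text \<open>Add to \<open>H\<close> a vertex \<open>\<omega>\<close> joined to \<open>w1\<close> and \<open>w2\<close>, and take a fan to \<open>\<omega>\<close>.\<close>

lemma two_disjoint_paths:
  fixes E :: "'v \<Rightarrow> 'v \<Rightarrow> bool"
  defines "st \<equiv> (\<lambda>S. {(x, y). x \<in> S \<and> y \<in> S \<and> E x y}\<^sup>*)"
  assumes ab: "a \<in> H" "b \<in> H" "a \<noteq> b" and w: "w1 \<in> H" "w2 \<in> H" "w1 \<noteq> w2" and om: "\<omega> \<notin> H"
    and conn2: "\<And>c x y. x \<in> H - {c} \<Longrightarrow> y \<in> H - {c} \<Longrightarrow> (x, y) \<in> st (H - {c})"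
  shows "\<exists>P Q. P \<noteq> [] \<and> Q \<noteq> [] \<and> successively E P \<and> successively E Q \<and> distinct (P @ Q) \<and>
     set P \<subseteq> H \<and> set Q \<subseteq> H \<and> hd P = a \<and> hd Q = b \<and> {last P, last Q} = {w1, w2}"
proof -
  define E' where "E' x y \<longleftrightarrow> (E x y \<and> x \<in> H \<and> y \<in> H) \<or> (x = \<omega> \<and> y \<in> {w1, w2}) \<or> (y = \<omega> \<and> x \<in> {w1, w2})" for x y
  define S where "S = insert \<omega> H"
  define st' where "st' = (\<lambda>S. {(x, y). x \<in> S \<and> y \<in> S \<and> E' x y}\<^sup>*)"
  have mono: "(x, y) \<in> st' T'" if "(x, y) \<in> st T" "T \<subseteq> H" "T \<subseteq> T'" for x y T T'
    using that(1) unfolding st_def st'_def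
    by (rule subsetD[OF rtrancl_mono, rotated]) (use that in \<open>auto simp: E'_def\<close>)
  have c: "(x, y) \<in> st' (S - {c})" if x: "x \<in> S - {c}" "y \<in> S - {c}" for c x y
  proof -
    have HH: "(x, y) \<in> st' (S - {c})" if "x \<in> H - {c}" "y \<in> H - {c}" for x y
      by (rule mono[OF conn2[OF that]]) (auto simp: S_def)
    define w where "w = (if c = w1 then w2 else w1)"
    have wc: "w \<in> H - {c}" "w \<in> {w1, w2}" using w by (auto simp: w_def)
    have om': "(\<omega>, w) \<in> st' (S - {c})" "(w, \<omega>) \<in> st' (S - {c})" if "c \<noteq> \<omega>"
      using that wc by (auto simp: st'_def S_def E'_def intro!: r_into_rtrancl)
    have tr: "(x, z) \<in> st' T" if "(x, y) \<in> st' T" "(y, z) \<in> st' T" for x y z T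
      using that unfolding st'_def by (rule rtrancl_trans)
    show ?thesis
    proof (cases "x = \<omega>")
      case True
      then have "c \<noteq> \<omega>" using x by auto
      show ?thesis
      proof (cases "y = \<omega>")
        case False
        then have "y \<in> H - {c}" using x by (auto simp: S_def)
        from tr[OF om'(1)[OF \<open>c \<noteq> \<omega>\<close>] HH[OF wc(1) this]] show ?thesis using True by simp
      qed (use True in \<open>simp add: st'_def\<close>)
    next
      case False
      then have xH: "x \<in> H - {c}" using x by (auto simp: S_def)
      show ?thesis
      proof (cases "y = \<omega>")
        case True
        then have "c \<noteq> \<omega>" using x by auto
        from tr[OF HH[OF xH wc(1)] om'(2)[OF this]] show ?thesis using True by simp
      next
        case False
        then have "y \<in> H - {c}" using x by (auto simp: S_def)
        then show ?thesis using HH[OF xH] by blast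
      qed
    qed
  qed
  have c0: "(x, y) \<in> st' S" if "x \<in> S" "y \<in> S" for x y
  proof (cases "x = y")
    case False
    have s: "(x, y) \<in> st' T \<Longrightarrow> T \<subseteq> S \<Longrightarrow> (x, y) \<in> st' S" for x y T
      unfolding st'_def by (erule subsetD[OF rtrancl_mono, rotated]) auto
    have aw: "(a', y) \<in> st' S" if "a' \<in> {a, b} - {y}" "y \<in> S" for a' y
    proof -
      define b' where "b' = (if a' = a then b else a)"
      show ?thesis
      proof (cases "y = b'")
        case False
        then show ?thesis
          using s[OF c[of a' b' y]] that ab by (auto simp: b'_def S_def split: if_splits)
      next
        case True
        have "\<omega> \<noteq> a" "\<omega> \<noteq> b" using om ab by auto
        have "(a', y) \<in> st' (S - {\<omega>})"
          by (rule c) (use that ab True \<open>\<omega> \<noteq> a\<close> \<open>\<omega> \<noteq> b\<close> in \<open>auto simp: S_def b'_def\<close>)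
        then show ?thesis using s by blast
      qed
    qed
    have sy: "(y, x) \<in> st' S" if "(x, y) \<in> st' S" "x \<in> S" "y \<in> S" for x y
    proof -
      obtain d where d: "d \<in> {\<omega>, a, b}" "d \<noteq> x" "d \<noteq> y" using ab om by (metis insertCI)
      have "(y, x) \<in> st' (S - {d})" by (rule c) (use that d in auto)
      then show ?thesis using s by blast
    qed
    obtain d where d: "d \<in> {\<omega>, a, b}" "d \<noteq> x" "d \<noteq> y" using ab om by (metis insertCI)
    have "(x, y) \<in> st' (S - {d})" by (rule c) (use that d in auto)
    then show ?thesis using s by blast
  qed (simp add: st'_def)
  obtain P Q where F: "is_fan E' S a b \<omega> P Q"
    using fan_exists[of a S b \<omega> E'] ab c0 c by (auto simp: S_def st'_def)
  have part: "\<exists>P0. P = P0 @ [\<omega>] \<and> P0 \<noteq> [] \<and> successively E P0 \<and> distinct P0 \<and> set P0 \<subseteq> H \<and> hd P0 = hd P \<and> last P0 \<in> {w1, w2}"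
    if P: "P \<noteq> []" "successively E' P" "distinct P" "set P \<subseteq> S" "last P = \<omega>" "hd P \<noteq> \<omega>" for P
  proof -
    define P0 where "P0 = butlast P"
    have eq: "P = P0 @ [\<omega>]" using P by (metis P0_def append_butlast_last_id)
    have ne: "P0 \<noteq> []" using eq P by auto
    have su: "successively E' P0" "E' (last P0) \<omega>" using P(2) ne unfolding eq by (auto simp: successively_append_iff)
    have sub: "set P0 \<subseteq> H" using P(3,4) unfolding eq by (auto simp: S_def)
    have "successively E P0"
      by (rule successively_mono[OF su(1)]) (use sub om w in \<open>auto simp: E'_def\<close>)
    moreover have "last P0 \<in> {w1, w2}" using su(2) om w by (auto simp: E'_def)
    ultimately show ?thesis using eq ne sub P(3) by (intro exI[of _ P0]) auto
  qed
  have ne: "a \<noteq> \<omega>" "b \<noteq> \<omega>" using ab om by auto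
  obtain P0 where P0: "P = P0 @ [\<omega>]" "P0 \<noteq> []" "successively E P0" "distinct P0" "set P0 \<subseteq> H" "hd P0 = hd P" "last P0 \<in> {w1, w2}"
    using part[of P] F ne unfolding is_fan_def by blast
  obtain Q0 where Q0: "Q = Q0 @ [\<omega>]" "Q0 \<noteq> []" "successively E Q0" "distinct Q0" "set Q0 \<subseteq> H" "hd Q0 = hd Q" "last Q0 \<in> {w1, w2}"
    using part[of Q] F ne unfolding is_fan_def by blast
  have "set P \<inter> set Q = {\<omega>}" using F unfolding is_fan_def by blast
  moreover have "set P0 \<subseteq> set P" "set Q0 \<subseteq> set Q" unfolding P0(1) Q0(1) by auto
  ultimately have "set P0 \<inter> set Q0 \<subseteq> {\<omega>}" by blast
  moreover have "\<omega> \<notin> set P0" using P0(5) om by blast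
  ultimately have dis: "set P0 \<inter> set Q0 = {}" by blast
  then have "last P0 \<noteq> last Q0" using P0(2) Q0(2) by (metis disjoint_iff last_in_set)
  then have "{last P0, last Q0} = {w1, w2}" using P0(7) Q0(7) by auto
  moreover have "hd P = a" "hd Q = b" using F unfolding is_fan_def by blast+
  ultimately show ?thesis using P0(2-6) Q0(2-6) dis
    by (intro exI[of _ P0] exI[of _ Q0] conjI) simp_all
qed

abbreviation connected_in :: "(int^'d) set \<Rightarrow> ((int^'d) \<times> (int^'d)) set" where
  "connected_in S \<equiv> {(x, y). x \<in> S \<and> y \<in> S \<and> adj x y}\<^sup>*"

lemma axis_zero [simp]: "axis i (0::'a::zero) = 0"
  by (simp add: vec_eq_iff axis_def)

lemma axis_segment_connected:
  fixes x :: "int^'d"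
  assumes "\<And>k. min 0 c \<le> k \<Longrightarrow> k \<le> max 0 c \<Longrightarrow> x + axis i k \<in> S"
  shows "(x, x + axis i c) \<in> connected_in S"
proof -
  have *: "(x, x + axis i (s * int n)) \<in> connected_in S"
    if "\<bar>s\<bar> = 1" "\<And>k. k \<le> n \<Longrightarrow> x + axis i (s * int k) \<in> S" for n s
    using that(2)
  proof (induction n)
    case (Suc n)
    have "x + axis i (s * int (Suc n)) = (x + axis i (s * int n)) + axis i s"
      by (auto simp: vec_eq_iff axis_def algebra_simps)
    then have "adj (x + axis i (s * int n)) (x + axis i (s * int (Suc n)))"
      using adj_axis that(1) by metis
    moreover have "x + axis i (s * int n) \<in> S" "x + axis i (s * int (Suc n)) \<in> S"
      using Suc.prems le_refl by (simp_all only: le_SucI)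
    moreover have "(x, x + axis i (s * int n)) \<in> connected_in S" using Suc.prems by (intro Suc.IH) simp
    ultimately show ?case by (auto intro: rtrancl_into_rtrancl)
  qed simp
  show ?thesis
  proof (cases "c \<ge> 0")
    case True
    then show ?thesis using *[of 1 "nat c"] assms by auto
  next
    case False
    then show ?thesis using *[of "-1" "nat (-c)"] assms by auto
  qed
qed

definition cub :: "('d \<Rightarrow> int) \<Rightarrow> ('d \<Rightarrow> int) \<Rightarrow> (int^'d) set" where
  "cub l h = {z. \<forall>i. l i \<le> z $ i \<and> z $ i \<le> h i}"

lemma exists_other_index:
  fixes i :: "'d::finite"
  assumes "CARD('d) \<ge> 2" obtains j where "j \<noteq> i"
proof (cases "\<exists>j. j \<noteq> i")
  case False
  then have "(UNIV :: 'd set) = {i}" by auto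
  then have "CARD('d) = card {i}" by (rule arg_cong)
  then show ?thesis using assms by simp
qed (use that in blast)

lemma line_connected_avoiding:
  fixes x :: "int^'d"
  assumes d: "CARD('d) \<ge> 2" and lh: "\<And>i. l i < h i"
    and x: "x \<in> cub l h - {p}" and y: "x + axis i c \<in> cub l h - {p}"
  shows "(x, x + axis i c) \<in> connected_in (cub l h - {p})"
proof -
  have btw: "x + axis i k \<in> cub l h" if "min 0 c \<le> k" "k \<le> max 0 c" for k
    unfolding cub_def
  proof (intro CollectI allI)
    fix j
    have "l j \<le> x $ j" "x $ j \<le> h j" "l j \<le> (x + axis i c) $ j" "(x + axis i c) $ j \<le> h j"
      using x y by (auto simp: cub_def)
    then show "l j \<le> (x + axis i k) $ j \<and> (x + axis i k) $ j \<le> h j"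
      using that by (auto simp: axis_def)
  qed
  show ?thesis
  proof (cases "\<exists>k. p = x + axis i k")
    case False
    then show ?thesis by (intro axis_segment_connected) (use btw in auto)
  next
    case True
    then obtain k0 where p: "p = x + axis i k0" by blast
    obtain j where j: "j \<noteq> i" using exists_other_index[OF d] by metis
    obtain s :: int where s: "\<bar>s\<bar> = 1" "l j \<le> x $ j + s" "x $ j + s \<le> h j"
    proof (cases "x $ j < h j")
      case True
      moreover have "l j \<le> x $ j" using x by (auto simp: cub_def)
      ultimately show ?thesis using that[of 1] by auto
    next
      case False
      then have "x $ j = h j" using x by (auto simp: cub_def intro: antisym)
      then show ?thesis using that[of "-1"] lh[of j] by auto
    qed
    have ne: "x + axis j s + axis i k \<noteq> p" for k
      using s(1) j unfolding p by (auto simp: vec_eq_iff axis_def intro!: exI[of _ j])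
    have in': "x + axis j s + axis i k \<in> cub l h - {p}" if "min 0 c \<le> k" "k \<le> max 0 c" for k
    proof -
      have "l m \<le> (x + axis j s + axis i k) $ m \<and> (x + axis j s + axis i k) $ m \<le> h m" for m
      proof -
        have "l m \<le> (x + axis i k) $ m" "(x + axis i k) $ m \<le> h m" using btw[OF that] by (auto simp: cub_def)
        then show ?thesis using s j by (cases "m = j") (simp_all add: axis_def)
      qed
      then show ?thesis using ne by (auto simp: cub_def)
    qed
    have a1: "(x, x + axis j s) \<in> connected_in (cub l h - {p})"
      using x in'[of 0] s(1) by (intro r_into_rtrancl) (auto simp: adj_axis)
    have a2: "(x + axis j s, x + axis j s + axis i c) \<in> connected_in (cub l h - {p})"
      by (rule axis_segment_connected) (rule in')
    have e: "x + axis j s + axis i c = x + axis i c + axis j s" by simp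
    have "adj (x + axis j s + axis i c) (x + axis i c)"
      unfolding e adj_sym[of "_ + axis j s"] by (rule adj_axis[OF s(1)])
    then have "(x + axis j s + axis i c, x + axis i c) \<in> connected_in (cub l h - {p})"
      using y in'[of c] by (intro r_into_rtrancl) auto
    with a1 a2 show ?thesis by (meson rtrancl_trans)
  qed
qed

lemma cub_connected_avoiding:
  fixes x :: "int^'d"
  assumes d: "CARD('d) \<ge> 2" and lh: "\<And>i. l i < h i"
    and x: "x \<in> cub l h - {p}" and y: "y \<in> cub l h - {p}"
  shows "(x, y) \<in> connected_in (cub l h - {p})"
  using x
proof (induction "card {i. x $ i \<noteq> y $ i}" arbitrary: x rule: less_induct)
  case less
  define z where "z i = x + axis i (y $ i - x $ i)" for i
  have zc: "z i $ j = (if j = i then y $ j else x $ j)" for i j by (auto simp: z_def axis_def)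
  show ?case
  proof (cases "\<exists>i. x $ i \<noteq> y $ i \<and> z i \<noteq> p")
    case True
    then obtain i where i: "x $ i \<noteq> y $ i" "z i \<noteq> p" by blast
    have zi: "z i \<in> cub l h - {p}" using less.prems y i zc by (auto simp: cub_def)
    have "{j. z i $ j \<noteq> y $ j} \<subset> {j. x $ j \<noteq> y $ j}" using i zc by auto
    then have "card {j. z i $ j \<noteq> y $ j} < card {j. x $ j \<noteq> y $ j}"
      by (intro psubset_card_mono) auto
    then have "(z i, y) \<in> connected_in (cub l h - {p})" using less.hyps zi by blast
    moreover have "(x, z i) \<in> connected_in (cub l h - {p})"
      unfolding z_def by (rule line_connected_avoiding[OF d lh less.prems]) (use zi z_def in auto)
    ultimately show ?thesis by (meson rtrancl_trans)
  next
    case False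
    have "x = y"
    proof (rule ccontr)
      assume "x \<noteq> y"
      then obtain i where i: "x $ i \<noteq> y $ i" by (auto simp: vec_eq_iff)
      then have zp: "z i = p" using False by blast
      then have "z i \<noteq> y" using y by auto
      then obtain j where j: "z i $ j \<noteq> y $ j" by (auto simp: vec_eq_iff)
      then have j': "j \<noteq> i" "x $ j \<noteq> y $ j" using zc by (auto split: if_splits)
      then have "z j = z i" using False zp by blast
      then have "z j $ i = z i $ i" by simp
      then show False using i j' zc by auto
    qed
    then show ?thesis by simp
  qed
qed

lemma shell_connected_avoiding:
  fixes Lv :: "nat^'d" and m :: int
  assumes d: "CARD('d) \<ge> 2" and m: "\<And>i. m \<ge> int (Lv $ i) + 2"
  defines "H \<equiv> cub (\<lambda>_. - m) (\<lambda>_. m) - box Lv"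
  assumes x: "x \<in> H - {p}" and y: "y \<in> H - {p}"
  shows "(x, y) \<in> connected_in (H - {p})"
proof -
  define lo where "lo i (b::bool) j = (if b \<and> j = i then int (Lv $ i) + 1 else - m)" for b and i j :: 'd
  define hi where "hi i (b::bool) j = (if \<not> b \<and> j = i then -1 else m)" for b and i j :: 'd
  define slab where "slab i b = cub (lo i b) (hi i b)" for i b
  have m2: "m \<ge> 2" using m by (metis le_add_same_cancel2 of_nat_0_le_iff order_trans)
  have lh: "lo i b j < hi i b j" for i b j using m[of i] m2 by (auto simp: lo_def hi_def)
  have sub: "slab i b \<subseteq> H" for i b
  proof
    fix z assume z: "z \<in> slab i b"
    have "- m \<le> z $ j \<and> z $ j \<le> m" for j
    proof -
      have "- m \<le> lo i b j" "hi i b j \<le> m" using m[of i] m2 by (auto simp: lo_def hi_def)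
      moreover have "lo i b j \<le> z $ j" "z $ j \<le> hi i b j" using z by (auto simp: slab_def cub_def)
      ultimately show ?thesis by linarith
    qed
    moreover have "z $ i > int (Lv $ i) \<or> z $ i < 0"
      using z unfolding slab_def cub_def lo_def hi_def by (cases b) (auto dest!: spec[of _ i])
    ultimately show "z \<in> H" by (auto simp: H_def cub_def box_def not_le)
  qed
  have mono: "(u, v) \<in> connected_in (H - {p})" if "(u, v) \<in> connected_in (slab i b - {p})" for u v i b
    using that by (rule subsetD[OF rtrancl_mono, rotated]) (use sub in auto)
  have one: "(u, v) \<in> connected_in (H - {p})" if "u \<in> slab i b - {p}" "v \<in> slab i b - {p}" for u v i b
  proof (rule mono)
    show "(u, v) \<in> connected_in (slab i b - {p})"
      unfolding slab_def by (rule cub_connected_avoiding[OF d lh]) (use that in \<open>auto simp: slab_def\<close>)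
  qed
  have cov: "\<exists>i b. z \<in> slab i b" if zH: "z \<in> H" for z
  proof -
    obtain i where i: "z $ i < 0 \<or> z $ i > int (Lv $ i)" using zH by (auto simp: H_def box_def not_le)
    have "\<And>j. - m \<le> z $ j \<and> z $ j \<le> m" using zH by (auto simp: H_def cub_def)
    then have "z \<in> slab i (z $ i > int (Lv $ i))"
      using i unfolding slab_def cub_def lo_def hi_def by auto
    then show ?thesis by blast
  qed
  have meet: "\<exists>w. w \<in> slab i b \<inter> slab j b' - {p}" if ij: "i \<noteq> j" for i j b b'
  proof -
    define w where "w (t::int) = (\<chi> k. if k = i then (if b then m - t else - m + t) else if k = j then (if b' then m else - m) else 0)" for t
    have "w t \<in> slab i b \<inter> slab j b'" if "t \<in> {0, 1}" for t
      using that ij m[of i] m[of j] m2 unfolding slab_def cub_def lo_def hi_def w_def by auto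
    moreover have "w 0 $ i \<noteq> w 1 $ i" by (simp add: w_def)
    then have "w 0 \<noteq> w 1" by metis
    ultimately show ?thesis by (metis Diff_iff insertI1 insertI2 singletonD)
  qed
  have two: "(u, v) \<in> connected_in (H - {p})"
    if uv: "u \<in> slab i b - {p}" "v \<in> slab j b' - {p}" and ij: "i \<noteq> j" for u v i j b b'
  proof -
    obtain w where w: "w \<in> slab i b \<inter> slab j b' - {p}" using meet[OF ij] by blast
    have "(u, w) \<in> connected_in (H - {p})" by (rule one[of _ i b]) (use uv w in auto)
    moreover have "(w, v) \<in> connected_in (H - {p})" by (rule one[of _ j b']) (use uv w in auto)
    ultimately show ?thesis by (rule rtrancl_trans)
  qed
  obtain i b where i: "x \<in> slab i b" using cov x by blast
  obtain j b' where j: "y \<in> slab j b'" using cov y by blast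
  show ?thesis
  proof (cases "i = j")
    case False
    then show ?thesis using two[of x i b y j b'] i j x y by auto
  next
    case True
    obtain k where k: "k \<noteq> i" using exists_other_index[OF d] by metis
    obtain w where w: "w \<in> slab i b \<inter> slab k True - {p}" using meet[of i k b True] k by metis
    have "(x, w) \<in> connected_in (H - {p})" using one[of x i b w] i x w by auto
    moreover have "(w, y) \<in> connected_in (H - {p})" using two[of w k True y j b'] j y w k True by auto
    ultimately show ?thesis by (meson rtrancl_trans)
  qed
qed

section \<open>Corridors through a ball\<close>

definition dec_at :: "int^'d \<Rightarrow> 'd \<Rightarrow> int^'d" where
  "dec_at z i = z + axis i (- sgn (z $ i))"

lemma dec_at_nth: "dec_at z i $ j = (if j = i then z $ i - sgn (z $ i) else z $ j)"
  by (auto simp: dec_at_def axis_def)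

lemma dec_at_adj: "z $ i \<noteq> 0 \<Longrightarrow> adj z (dec_at z i)"
  unfolding dec_at_def by (intro adj_axis) (auto simp: sgn_if)

lemma l1_dec_at:
  assumes "z $ i \<noteq> 0" shows "l1 (dec_at z i) = l1 z - 1"
proof -
  have "l1 (dec_at z i) = \<bar>dec_at z i $ i\<bar> + (\<Sum>j\<in>UNIV-{i}. \<bar>dec_at z i $ j\<bar>)"
    unfolding l1_def by (subst sum.remove[of _ i]) auto
  also have "(\<Sum>j\<in>UNIV-{i}. \<bar>dec_at z i $ j\<bar>) = (\<Sum>j\<in>UNIV-{i}. \<bar>z $ j\<bar>)"
    by (intro sum.cong) (auto simp: dec_at_nth)
  also have "\<bar>dec_at z i $ i\<bar> = \<bar>z $ i\<bar> - 1"
    using assms by (auto simp: dec_at_nth sgn_if abs_if)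
  also have "\<bar>z $ i\<bar> - 1 + (\<Sum>j\<in>UNIV-{i}. \<bar>z $ j\<bar>) = l1 z - 1"
    unfolding l1_def by (subst sum.remove[of _ i]) auto
  finally show ?thesis .
qed

lemma nonzero_coordinate: "l1 z > 0 \<Longrightarrow> \<exists>i. z $ i \<noteq> 0"
  by (metis l1_zero less_irrefl vec_eq_iff zero_index)

lemma two_distinct_decrements:
  fixes a b :: "int^'d"
  assumes "a \<noteq> b" "l1 a = k" "l1 b = k" "k \<ge> 2"
  shows "\<exists>i j. a $ i \<noteq> 0 \<and> b $ j \<noteq> 0 \<and> dec_at a i \<noteq> dec_at b j"
proof -
  obtain i where i: "a $ i \<noteq> 0" using nonzero_coordinate[of a] assms by auto
  obtain j where j: "b $ j \<noteq> 0" using nonzero_coordinate[of b] assms by auto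
  show ?thesis
  proof (cases "dec_at a i = dec_at b j")
    case True
    define c where "c = dec_at a i"
    have "l1 c = k - 1" using l1_dec_at[OF i] assms by (simp add: c_def)
    then obtain l where l: "c $ l \<noteq> 0" using nonzero_coordinate[of c] assms by auto
    consider "l \<noteq> i" | "l \<noteq> j" | "l = i" "l = j" by blast
    then show ?thesis
    proof cases
      case 1
      have "a $ l = c $ l" using 1 by (simp add: c_def dec_at_nth)
      moreover have "dec_at a l $ i \<noteq> c $ i" using 1 i by (auto simp: c_def dec_at_nth sgn_if)
      then have "dec_at a l \<noteq> dec_at b j" using True c_def by metis
      ultimately show ?thesis using l j by metis
    next
      case 2
      have c: "c = dec_at b j" using True c_def by simp
      have "b $ l = c $ l" using 2 by (simp add: c dec_at_nth)
      moreover have "dec_at b l $ j \<noteq> c $ j" using 2 j by (auto simp: c dec_at_nth sgn_if)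
      then have "dec_at b l \<noteq> dec_at a i" using c_def by metis
      ultimately show ?thesis using l i by metis
    next
      case 3
      have "a $ m = b $ m" for m
      proof -
        have "dec_at a i $ m = dec_at b i $ m" "c $ i = dec_at a i $ i" "c $ i = dec_at b i $ i"
          using True 3 c_def by simp_all
        then show ?thesis using l 3 by (cases "m = i") (auto simp: dec_at_nth sgn_if split: if_splits)
      qed
      then show ?thesis using assms by (auto simp: vec_eq_iff)
    qed
  qed (use i j in blast)
qed

definition descent :: "(int^'d) list \<Rightarrow> int^'d \<Rightarrow> nat \<Rightarrow> bool" where
  "descent p a k \<longleftrightarrow> p \<noteq> [] \<and> successively adj p \<and> distinct p \<and> hd p = a \<and> l1 (last p) \<le> 1 \<and> length p = k \<and>
     l1 a = int k \<and> (\<forall>x\<in>set (tl p). l1 x < int k)"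

lemma descent_le: "descent p a k \<Longrightarrow> x \<in> set p \<Longrightarrow> l1 x \<le> int k"
  by (cases p) (auto simp: descent_def less_imp_le)

lemma descent_Cons:
  assumes "descent p a' k" "adj a a'" "l1 a = int (Suc k)"
  shows "descent (a # p) a (Suc k)"
proof -
  have "a \<notin> set p" using descent_le[OF assms(1)] assms(3) by fastforce
  moreover have "l1 x < int (Suc k)" if "x \<in> set p" for x using descent_le[OF assms(1) that] by simp
  ultimately show ?thesis using assms by (auto simp: descent_def successively_Cons)
qed

lemma disjoint_descents:
  fixes a b :: "int^'d"
  assumes "l1 a = int k" "l1 b = int k" "a \<noteq> b" "k \<ge> 1"
  shows "\<exists>p q. descent p a k \<and> descent q b k \<and> set p \<inter> set q = {}"
  using assms(4,1,2,3)
proof (induction k arbitrary: a b rule: nat_induct_at_least)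
  case base
  then show ?case by (intro exI[of _ "[a]"] exI[of _ "[b]"]) (auto simp: descent_def)
next
  case (Suc k)
  obtain i j where ij: "a $ i \<noteq> 0" "b $ j \<noteq> 0" "dec_at a i \<noteq> dec_at b j"
    using two_distinct_decrements[of a b "int (Suc k)"] Suc by auto
  obtain p q where pq: "descent p (dec_at a i) k" "descent q (dec_at b j) k" "set p \<inter> set q = {}"
    using Suc.IH[of "dec_at a i" "dec_at b j"] l1_dec_at ij Suc.prems by (auto simp: l1_dec_at)
  have "a \<notin> set q" "b \<notin> set p" using descent_le pq Suc.prems by fastforce+
  then have "set (a # p) \<inter> set (b # q) = {}" using pq(3) Suc.prems by auto
  moreover have "descent (a # p) a (Suc k)" "descent (b # q) b (Suc k)"
    using descent_Cons pq dec_at_adj ij Suc.prems by metis+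
  ultimately show ?case by blast
qed

lemma path_to_center:
  fixes a :: "int^'d"
  shows "\<exists>p. path_from_to p a 0 \<and> length p = nat (l1 a) + 1 \<and> (\<forall>x\<in>set p. l1 x \<le> l1 a)"
proof (induction "nat (l1 a)" arbitrary: a)
  case 0
  then have "a = 0" by (metis l1_eq_0_iff l1_nonneg nat_0_iff antisym)
  then show ?case by (intro exI[of _ "[0]"]) (auto simp: path_from_to_iff)
next
  case (Suc k)
  then have "l1 a > 0" by simp
  then obtain i where i: "a $ i \<noteq> 0" using nonzero_coordinate by blast
  have "k = nat (l1 (dec_at a i))" using Suc(2) l1_dec_at[OF i] by simp
  from Suc(1)[OF this] obtain p where p: "path_from_to p (dec_at a i) 0"
    "length p = nat (l1 (dec_at a i)) + 1" "\<forall>x\<in>set p. l1 x \<le> l1 (dec_at a i)" by blast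
  then show ?case using dec_at_adj[OF i] l1_dec_at[OF i] \<open>l1 a > 0\<close>
    by (intro exI[of _ "a # p"]) (auto simp: path_from_to_iff successively_Cons)
qed

lemma cut_at_first:
  assumes "successively E p" "p \<noteq> []" "hd p \<notin> Q" "last p \<in> Q" "distinct p"
  shows "\<exists>p1 c r. p = p1 @ c # r \<and> p1 \<noteq> [] \<and> c \<in> Q \<and> set p1 \<inter> Q = {}"
proof -
  have "\<exists>x\<in>set p. x \<in> Q" using assms by (metis last_in_set)
  then obtain p1 c r where p: "p = p1 @ c # r" "c \<in> Q" "\<forall>y\<in>set p1. y \<notin> Q"
    using split_list_first_prop[of p "\<lambda>x. x \<in> Q"] by blast
  have "p1 \<noteq> []" using p assms by auto
  with p show ?thesis by blast
qed

lemma external_neighbours_distinct: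
  fixes u v w w' :: "int^'d"
  assumes "u \<in> box Lv" "v \<in> box Lv" "u \<noteq> v" "adj u w" "adj v w'" "w \<notin> box Lv" "w' \<notin> box Lv"
  shows "w \<noteq> w'"
proof
  assume ww: "w = w'"
  obtain i c where ic: "\<bar>c\<bar> = 1" "w = u + axis i c" using adj_imp_axis[OF assms(4)] by blast
  obtain j c' where jc: "\<bar>c'\<bar> = 1" "w = v + axis j c'" using adj_imp_axis[OF assms(5)] ww by blast
  obtain k where k: "w $ k < 0 \<or> w $ k > int (Lv $ k)" using assms(6) by (auto simp: box_def not_le)
  have uk: "0 \<le> u $ k" "u $ k \<le> int (Lv $ k)" "0 \<le> v $ k" "v $ k \<le> int (Lv $ k)"
    using assms by (auto simp: box_def)
  have "k = i" using k uk ic by (cases "k = i") (auto simp: axis_def)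
  moreover have "k = j" using k uk jc by (cases "k = j") (auto simp: axis_def)
  moreover have "c = c'"
  proof -
    have "w $ k = u $ k + c" unfolding ic(2) \<open>k = i\<close> by (simp add: axis_def)
    moreover have "w $ k = v $ k + c'" unfolding jc(2) \<open>k = j\<close> by (simp add: axis_def)
    moreover have "c = 1 \<or> c = -1" "c' = 1 \<or> c' = -1" using ic(1) jc(1) by auto
    ultimately show ?thesis using k uk by auto
  qed
  ultimately have "u = v" using ic jc by simp
  then show False using assms by simp
qed

text \<open>The route of the modified geodesic through the ball of radius \<open>R\<close> around \<open>0\<close>: from \<open>a\<close> to one of
  the endpoints of the pattern along \<open>P1\<close>, and from the other endpoint to \<open>b\<close> along \<open>P2\<close>.\<close>

definition corridor ::
  "nat^'d \<Rightarrow> int \<Rightarrow> int^'d \<Rightarrow> int^'d \<Rightarrow> int^'d \<Rightarrow> int^'d \<Rightarrow> (int^'d) list \<Rightarrow> (int^'d) list \<Rightarrow> bool" where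
  "corridor Lv R a b u' v' P1 P2 \<longleftrightarrow>
     path_from_to P1 a u' \<and> path_from_to P2 v' b \<and> distinct (P1 @ P2) \<and>
     set P1 \<inter> box Lv = {u'} \<and> set P2 \<inter> box Lv = {v'} \<and>
     (\<forall>x\<in>set P1 \<union> set P2. x \<noteq> a \<and> x \<noteq> b \<longrightarrow> l1 x < R) \<and> l1 a = R \<and> l1 b = R \<and>
     (\<forall>x\<in>box Lv. l1 x < R)"

lemma corridor_exists:
  fixes Lv :: "nat^'d" and u v :: "int^'d"
  assumes d: "CARD('d) \<ge> 2" and u: "u \<in> boundary (box Lv)" and v: "v \<in> boundary (box Lv)" and uv: "u \<noteq> v"
  shows "\<exists>K0 r1. r1 \<ge> 1 \<and> (\<forall>R a b. R \<ge> r1 \<longrightarrow> l1 a = int R \<longrightarrow> l1 b = int R \<longrightarrow> a \<noteq> b \<longrightarrow>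
     (\<exists>P1 P2 u' v'. {u', v'} = {u, v} \<and> corridor Lv (int R) a b u' v' P1 P2 \<and>
        length P1 + length P2 \<le> 2 * R + K0))"
proof -
  define m where "m = int (\<Sum>i\<in>UNIV. Lv $ i) + 2"
  have m: "m \<ge> int (Lv $ i) + 2" for i
    using member_le_sum[of i UNIV "\<lambda>i. Lv $ i"] by (simp add: m_def del: of_nat_sum)
  have m2: "m \<ge> 2" by (simp add: m_def sum_nonneg)
  define Q where "Q = (cub (\<lambda>_. - m) (\<lambda>_. m) :: (int^'d) set)"
  define H where "H = Q - box Lv"
  have finQ: "finite Q" unfolding Q_def cub_def by (rule finite_int_cube)
  have boxQ: "box Lv \<subseteq> Q"
  proof
    fix x assume "x \<in> box Lv"
    then have "0 \<le> x $ i" "x $ i \<le> int (Lv $ i)" for i by (auto simp: box_def)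
    then have "- m \<le> x $ i \<and> x $ i \<le> m" for i using m[of i] m2 by (smt (verit))
    then show "x \<in> Q" by (auto simp: Q_def cub_def)
  qed
  obtain wu where wu: "adj u wu" "wu \<notin> box Lv" using u by (auto simp: boundary_def)
  obtain wv where wv: "adj v wv" "wv \<notin> box Lv" using v by (auto simp: boundary_def)
  have ub: "u \<in> box Lv" "v \<in> box Lv" using u v by (auto simp: boundary_def)
  have wne: "wu \<noteq> wv" using external_neighbours_distinct[OF ub uv] wu wv by blast
  have nbQ: "w \<in> Q" if xb: "x \<in> box Lv" and xw: "adj x w" for x w
  proof -
    obtain i c where ic: "\<bar>c\<bar> = 1" "w = x + axis i c" using adj_imp_axis[OF xw] by blast
    have "- m \<le> w $ j \<and> w $ j \<le> m" for j
    proof -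
      have "0 \<le> x $ j" "x $ j \<le> int (Lv $ j)" using xb by (auto simp: box_def)
      then show ?thesis using ic m[of j] m2 by (auto simp: axis_def)
    qed
    then show ?thesis by (auto simp: Q_def cub_def)
  qed
  have wH: "wu \<in> H" "wv \<in> H" using nbQ ub wu wv by (auto simp: H_def)
  define r1 where "r1 = nat (int CARD('d) * m + 1)"
  have Ql1: "l1 x \<le> int CARD('d) * m" if "x \<in> Q" for x
  proof -
    have "\<bar>x $ i\<bar> \<le> m" for i using that by (auto simp: Q_def cub_def abs_le_iff dest!: spec[of _ i])
    then show ?thesis unfolding l1_def using sum_bounded_above[of UNIV "\<lambda>i. \<bar>x $ i\<bar>" m] by simp
  qed
  have smallQ: "x \<in> Q" if "l1 x \<le> 1" for x
  proof -
    have "\<bar>x $ i\<bar> \<le> 1" for i using l1_component_le[of x i] that by linarith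
    then have "- m \<le> x $ i \<and> x $ i \<le> m" for i using m2 by (smt (verit))
    then show ?thesis by (auto simp: Q_def cub_def)
  qed
  have "0 \<le> int CARD('d) * m" using m2 by (intro mult_nonneg_nonneg) auto
  then have "r1 \<ge> 1" by (simp add: r1_def)
  moreover have "\<exists>P1 P2 u' v'. {u', v'} = {u, v} \<and> corridor Lv (int R) a b u' v' P1 P2 \<and>
        length P1 + length P2 \<le> 2 * R + (card Q + 2)"
    if R: "R \<ge> r1" and a: "l1 a = int R" and b: "l1 b = int R" and ab: "a \<noteq> b" for R a b
  proof -
    have Rm: "int R > int CARD('d) * m" using R by (simp add: r1_def)
    have QR: "l1 x < int R" if "x \<in> Q" for x using Ql1[OF that] Rm by simp
    have R1: "R \<ge> 1" using R \<open>r1 \<ge> 1\<close> by simp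
    obtain p q where p: "descent p a R" and q: "descent q b R" and pq: "set p \<inter> set q = {}"
      using disjoint_descents[OF a b ab R1] by blast
    have aQ: "a \<notin> Q" "b \<notin> Q" using QR a b by fastforce+
    obtain p1 a0 p2 where p1: "p = p1 @ a0 # p2" "p1 \<noteq> []" "a0 \<in> Q" "set p1 \<inter> Q = {}"
      using cut_at_first[of adj p Q] p aQ smallQ by (auto simp: descent_def)
    obtain q1 b0 q2 where q1: "q = q1 @ b0 # q2" "q1 \<noteq> []" "b0 \<in> Q" "set q1 \<inter> Q = {}"
      using cut_at_first[of adj q Q] q aQ smallQ by (auto simp: descent_def)
    text \<open>\<open>a0\<close> is outside the pattern box since its predecessor is outside \<open>Q\<close>.\<close>
    have nb: "x \<notin> box Lv" if "successively adj (r1 @ x # r2)" "r1 \<noteq> []" "set r1 \<inter> Q = {}" for x r1 r2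
    proof
      assume "x \<in> box Lv"
      moreover have "adj (last r1) x" using that by (auto simp: successively_append_iff)
      ultimately have "last r1 \<in> Q" using nbQ adj_sym by blast
      then show False using that last_in_set by blast
    qed
    have a0H: "a0 \<in> H" using nb[of p1 a0 p2] p p1 by (auto simp: H_def descent_def)
    have b0H: "b0 \<in> H" using nb[of q1 b0 q2] q q1 by (auto simp: H_def descent_def)
    have ab0: "a0 \<noteq> b0" using pq p1 q1 by auto
    have "0 \<in> box Lv" by (simp add: box_def)
    then have om: "0 \<notin> H" by (simp add: H_def)
    obtain S T where ST: "S \<noteq> []" "T \<noteq> []" "successively adj S" "successively adj T" "distinct (S @ T)"
      "set S \<subseteq> H" "set T \<subseteq> H" "hd S = a0" "hd T = b0" "{last S, last T} = {wu, wv}"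
      using two_disjoint_paths[OF a0H b0H ab0 wH wne om, of adj] shell_connected_avoiding[OF d m]
      unfolding H_def Q_def by blast
    obtain u' v' where u'v': "{u', v'} = {u, v}" "adj u' (last S)" "adj v' (last T)"
    proof (cases "last S = wu")
      case True
      then have "last T = wv" using ST(10) wne by (auto simp: doubleton_eq_iff)
      then show ?thesis using that[of u v] True wu wv by auto
    next
      case False
      then have "last S = wv" "last T = wu" using ST(10) by (auto simp: doubleton_eq_iff)
      then show ?thesis using that[of v u] wu wv by auto
    qed
    have u'b: "u' \<in> box Lv" "v' \<in> box Lv" "u' \<noteq> v'" using u'v' ub uv by (auto simp: doubleton_eq_iff)
    define P1 where "P1 = p1 @ S @ [u']"
    define P2 where "P2 = v' # rev T @ rev q1"
    have HQ: "H \<subseteq> Q" "H \<inter> box Lv = {}" by (auto simp: H_def)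
    have lastp1: "adj (last p1) a0" "successively adj p1" "hd p1 = a" "set p1 \<subseteq> set p" "distinct p1"
      using p p1 by (auto simp: descent_def successively_append_iff)
    have lastq1: "adj (last q1) b0" "successively adj q1" "hd q1 = b" "set q1 \<subseteq> set q" "distinct q1"
      using q q1 by (auto simp: descent_def successively_append_iff)
    have path1: "path_from_to P1 a u'"
      unfolding path_from_to_iff P1_def using lastp1 p1(2) ST u'v'(2)
      by (auto simp: successively_append_iff hd_append adj_sym)
    have "path_from_to (rev P2) b v'"
      unfolding path_from_to_iff P2_def using lastq1 q1(2) ST u'v'(3)
      by (auto simp: successively_append_iff hd_append adj_sym)
    then have path2: "path_from_to P2 v' b" using path_rev by fastforce
    have dist: "distinct (P1 @ P2)"
    proof -
      have SQ: "set S \<subseteq> Q" "set T \<subseteq> Q" using ST(6,7) HQ(1) by auto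
      have "set p1 \<inter> box Lv = {}" "set p1 \<inter> set S = {}" "set p1 \<inter> set T = {}"
        using p1(4) boxQ SQ by blast+
      moreover have "set q1 \<inter> box Lv = {}" "set q1 \<inter> set S = {}" "set q1 \<inter> set T = {}"
        using q1(4) boxQ SQ by blast+
      moreover have "set p1 \<inter> set q1 = {}" using pq lastp1(4) lastq1(4) by blast
      moreover have "set S \<inter> box Lv = {}" "set T \<inter> box Lv = {}" using ST(6,7) HQ(2) by blast+
      ultimately show ?thesis unfolding P1_def P2_def using ST(5) lastp1(5) lastq1(5) u'b by auto
    qed
    have len: "length P1 + length P2 \<le> 2 * R + (card Q + 2)"
    proof -
      have "length S + length T = card (set S \<union> set T)" using ST(5) distinct_card[of "S @ T"] by simp
      also have "\<dots> \<le> card Q" using ST HQ finQ by (intro card_mono) auto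
      finally have "length S + length T \<le> card Q" .
      moreover have "length p1 \<le> R" "length q1 \<le> R" using p q p1 q1 by (auto simp: descent_def)
      ultimately show ?thesis by (simp add: P1_def P2_def)
    qed
    have small: "l1 x < int R" if "x \<in> set P1 \<union> set P2" "x \<noteq> a" "x \<noteq> b" for x
    proof -
      have "x \<in> Q \<or> x \<in> set p1 \<or> x \<in> set q1"
        using that(1) ST(6,7) HQ(1) u'b(1,2) boxQ unfolding P1_def P2_def by auto
      moreover have "l1 x < int R" if "x \<in> set p1"
        using that p p1 \<open>x \<noteq> a\<close> by (cases p1) (auto simp: descent_def)
      moreover have "l1 x < int R" if "x \<in> set q1"
        using that q q1 \<open>x \<noteq> b\<close> by (cases q1) (auto simp: descent_def)
      ultimately show ?thesis using QR by blast
    qed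
    have "set S \<inter> box Lv = {}" "set T \<inter> box Lv = {}" using ST(6,7) HQ(2) by blast+
    moreover have "set p1 \<inter> box Lv = {}" "set q1 \<inter> box Lv = {}" using p1(4) q1(4) boxQ by blast+
    ultimately have "set P1 \<inter> box Lv = {u'}" "set P2 \<inter> box Lv = {v'}"
      using u'b unfolding P1_def P2_def by auto
    then have "corridor Lv (int R) a b u' v' P1 P2"
      unfolding corridor_def using path1 path2 dist small a b boxQ QR by blast
    then show ?thesis using u'v'(1) len by blast
  qed
  ultimately show ?thesis by blast
qed

section \<open>The modified geodesic\<close>

lemma path_join:
  assumes "path_from_to p x y" "path_from_to q y z"
  shows "path_from_to (butlast p @ q) x z"
proof -
  have "p = butlast p @ [y]" using assms(1) by (metis path_from_to_iff append_butlast_last_id)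
  moreover have "q = y # tl q" using assms(2) by (cases q) (auto simp: path_from_to_iff)
  ultimately show ?thesis using assms path_append by metis
qed

lemma ptime_join:
  assumes "path_from_to p x y" "path_from_to q y z"
  shows "ptime t (butlast p @ q) = ptime t p + ptime t q"
proof -
  have "p = butlast p @ [y]" using assms(1) by (metis path_from_to_iff append_butlast_last_id)
  moreover have "q = y # tl q" using assms(2) by (cases q) (auto simp: path_from_to_iff)
  ultimately show ?thesis using ptime_append by metis
qed

lemma successively_split_first:
  assumes "\<not> successively P p"
  shows "\<exists>l z w r. p = l @ z # w # r \<and> \<not> P z w \<and> successively P (l @ [z])"
  using assms
proof (induction p rule: induct_list012)
  case (3 x y zs)
  show ?case
  proof (cases "P x y")
    case True
    then obtain l z w r where s: "y # zs = l @ z # w # r" "\<not> P z w" "successively P (l @ [z])"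
      using 3 by auto
    then have "successively P ((x # l) @ [z])" using True by (cases l) auto
    then show ?thesis using s by (intro exI[of _ "x # l"]) auto
  next
    case False
    then show ?thesis by (intro exI[of _ "[]"]) auto
  qed
qed auto

definition consec :: "'a list \<Rightarrow> 'a \<Rightarrow> 'a \<Rightarrow> bool" where
  "consec p z w \<longleftrightarrow> (\<exists>l r. p = l @ z # w # r)"

lemma consec_in_set: "consec p z w \<Longrightarrow> z \<in> set p \<and> w \<in> set p"
  by (auto simp: consec_def)

lemma consec_rev: "consec (rev p) z w \<longleftrightarrow> consec p w z"
proof -
  have "consec (rev p) z w" if c: "consec p w z" for p :: "'a list" and z w
  proof -
    obtain l r where "p = l @ w # z # r" using c by (auto simp: consec_def)
    then have "rev p = rev r @ z # w # rev l" by simp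
    then show ?thesis unfolding consec_def by blast
  qed
  from this[of p w z] this[of "rev p" z w] show ?thesis by auto
qed

lemma consec_succ_unique:
  assumes "distinct p" "p = l @ z # w # r" "consec p z w'" shows "w' = w"
proof -
  obtain l' r' where p': "p = l' @ z # w' # r'" using assms by (auto simp: consec_def)
  have "l @ z # w # r = l' @ z # w' # r'" using assms(2) p' by simp
  moreover have "z \<notin> set l" "z \<notin> set (w # r)" using assms(1,2) by auto
  ultimately have "w # r = w' # r'" using append_Cons_eq_iff[of z l "w # r" l' "w' # r'"] by simp
  then show ?thesis by simp
qed

lemma consec_pred_unique:
  assumes "distinct p" "p = l @ w # z # r" "consec p w' z" shows "w' = w"
proof (rule consec_succ_unique)
  show "distinct (rev p)" using assms(1) by simp
  show "rev p = rev r @ z # w # rev l" using assms(2) by simp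
  show "consec (rev p) z w'" using assms(3) by (simp only: consec_rev)
qed

lemma follow_route:
  assumes "successively nw (q0 # q1 # \<rho>)" "distinct (q0 # q1 # \<rho>)"
    "\<And>l c0 c1 c2 r s. q0 # q1 # Q = l @ c0 # c1 # c2 # r \<Longrightarrow> nw c1 s \<Longrightarrow> s = c0 \<or> s = c2"
    "last (q0 # q1 # \<rho>) \<notin> set (butlast (q0 # q1 # Q))"
  shows "\<exists>\<rho>'. \<rho> = Q @ \<rho>'"
  using assms
proof (induction Q arbitrary: q0 q1 \<rho>)
  case (Cons q2 Q)
  have "\<rho> \<noteq> []" using Cons.prems(4) by auto
  then obtain s \<rho>1 where \<rho>: "\<rho> = s # \<rho>1" by (cases \<rho>) auto
  have "nw q1 s" using Cons.prems(1) \<rho> by auto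
  then have "s = q0 \<or> s = q2" using Cons.prems(3)[of "[]" q0 q1 q2 Q] by auto
  then have s: "s = q2" using Cons.prems(2) \<rho> by auto
  have "\<exists>\<rho>'. \<rho>1 = Q @ \<rho>'"
  proof (rule Cons.IH[of q1 q2])
    show "successively nw (q1 # q2 # \<rho>1)" "distinct (q1 # q2 # \<rho>1)"
      using Cons.prems(1,2) \<rho> s by auto
    show "s = c0 \<or> s = c2" if "q1 # q2 # Q = l @ c0 # c1 # c2 # r" "nw c1 s" for l c0 c1 c2 r s
      using Cons.prems(3)[of "q0 # l"] that by auto
    show "last (q1 # q2 # \<rho>1) \<notin> set (butlast (q1 # q2 # Q))"
      using Cons.prems(4) \<rho> s by (auto split: if_splits)
  qed
  then show ?case using \<rho> s by auto
qed auto

text \<open>In applications \<open>B\<close> is a ball, \<open>I\<close> its interior, and \<open>Lam\<close> the translated pattern box. A step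
  inside \<open>B\<close> that is not \<open>free\<close> will have to cross a prohibitively expensive edge.\<close>

locale route =
  fixes B I Lam :: "(int^'d) set" and a b u' v' :: "int^'d" and P1 P2 :: "(int^'d) list"
  assumes I_adj: "\<And>z w. z \<in> I \<Longrightarrow> adj z w \<Longrightarrow> w \<in> B"
    and I_B: "I \<subseteq> B" and Lam_I: "Lam \<subseteq> I" and a_B: "a \<in> B - I" and b_B: "b \<in> B - I"
    and P12: "set P1 \<union> set P2 \<subseteq> I \<union> {a, b}"
    and P1: "path_from_to P1 a u'" and P2: "path_from_to P2 v' b"
    and dist: "distinct (P1 @ P2)"
    and P1_Lam: "set P1 \<inter> Lam = {u'}" and P2_Lam: "set P2 \<inter> Lam = {v'}"
begin

definition on_route :: "int^'d \<Rightarrow> int^'d \<Rightarrow> bool" where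
  "on_route z w \<longleftrightarrow> consec P1 z w \<or> consec P1 w z \<or> consec P2 z w \<or> consec P2 w z \<or> (z \<in> Lam \<and> w \<in> Lam)"

definition free :: "int^'d \<Rightarrow> int^'d \<Rightarrow> bool" where
  "free z w \<longleftrightarrow> adj z w \<and> (z \<in> B \<and> w \<in> B \<longrightarrow> on_route z w)"

definition outside :: "int^'d \<Rightarrow> int^'d \<Rightarrow> bool" where
  "outside z w \<longleftrightarrow> \<not> (z \<in> B \<and> w \<in> B)"

lemma swapped: "route B I Lam b a v' u' (rev P2) (rev P1)"
  using I_adj I_B Lam_I a_B b_B P12 P1 P2 dist P1_Lam P2_Lam
  by unfold_locales (auto intro: path_rev)

lemma on_route_swapped: "route.on_route Lam (rev P2) (rev P1) = on_route"
  unfolding fun_eq_iff route.on_route_def[OF swapped] on_route_def consec_rev by blast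

lemma free_swapped: "route.free B Lam (rev P2) (rev P1) = free"
  unfolding fun_eq_iff route.free_def[OF swapped] free_def on_route_swapped by blast

lemma on_route_cases:
  "on_route z w \<Longrightarrow> (z \<in> set P1 \<and> w \<in> set P1) \<or> (z \<in> set P2 \<and> w \<in> set P2) \<or> (z \<in> Lam \<and> w \<in> Lam)"
  by (auto simp: on_route_def dest: consec_in_set)

lemma P_facts:
  shows "set P1 \<inter> set P2 = {}" "distinct P1" "distinct P2" "a \<in> set P1" "b \<in> set P2" "u' \<in> set P1" "v' \<in> set P2"
    "a \<notin> Lam" "b \<notin> Lam" "u' \<in> Lam" "v' \<in> Lam" "set P1 \<subseteq> B" "set P2 \<subseteq> B" "a \<noteq> u'" "b \<noteq> v'" "u' \<noteq> v'" "Lam \<subseteq> B"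
proof -
  show "set P1 \<inter> set P2 = {}" "distinct P1" "distinct P2" using dist by auto
  moreover show "a \<in> set P1" "b \<in> set P2" "u' \<in> set P1" "v' \<in> set P2" using P1 P2 by (auto simp: path_from_to_iff)
  moreover show "a \<notin> Lam" "b \<notin> Lam" "Lam \<subseteq> B" using a_B b_B Lam_I I_B by auto
  moreover show "u' \<in> Lam" "v' \<in> Lam" using P1_Lam P2_Lam by auto
  ultimately show "a \<noteq> u'" "b \<noteq> v'" "u' \<noteq> v'" by auto
  show "set P1 \<subseteq> B" "set P2 \<subseteq> B" using P12 I_B a_B b_B by auto
qed

lemma follow_P:
  assumes P: "P = q0 # q1 # Q" "P = P1 \<or> P = P2" and "successively free (q0 # q1 # \<rho>)"
    "distinct (q0 # q1 # \<rho>)" "last (q0 # q1 # \<rho>) \<notin> B"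
  shows "\<exists>\<rho>'. q0 # q1 # \<rho> = P @ \<rho>'"
proof -
  have PB: "set P \<subseteq> B" using P(2) P_facts by auto
  have "\<exists>\<rho>'. \<rho> = Q @ \<rho>'"
  proof (rule follow_route[OF assms(3,4)])
    show "last (q0 # q1 # \<rho>) \<notin> set (butlast (q0 # q1 # Q))"
      using assms(5) PB unfolding P(1) by (meson in_set_butlastD subsetD)
    fix l c0 c1 c2 r s assume eq: "q0 # q1 # Q = l @ c0 # c1 # c2 # r" and fr: "free c1 s"
    have Pe: "P = l @ c0 # c1 # c2 # r" using P(1) eq by simp
    have dP: "distinct P" using P(2) P_facts by auto
    have c1: "c1 \<in> set P" "c1 \<noteq> hd P" "c1 \<noteq> last P"
      using dP unfolding Pe by (auto simp: hd_append)
    have c1': "c1 \<notin> {a, b} \<and> c1 \<notin> Lam"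
      using c1 P(2) P_facts P1_Lam P2_Lam P1 P2 by (auto simp: path_from_to_iff)
    then have "c1 \<in> I" using c1 P12 P(2) by auto
    then have "s \<in> B" "c1 \<in> B" using fr I_adj I_B by (auto simp: free_def)
    then have "on_route c1 s" using fr by (auto simp: free_def)
    then have "consec P c1 s \<or> consec P s c1"
      using c1 c1' P(2) P_facts(1) by (auto simp: on_route_def dest: consec_in_set)
    then show "s = c0 \<or> s = c2"
      using consec_succ_unique[OF dP, of "l @ [c0]" c1 c2 r s] consec_pred_unique[OF dP Pe] Pe by auto
  qed
  then show ?thesis using P(1) by auto
qed

lemma traverse_from_a:
  assumes fr: "successively free \<pi>" and di: "distinct \<pi>" and la: "last \<pi> \<notin> B"
    and \<pi>: "\<pi> = \<pi>1 @ a # w # \<rho>" and w: "w \<in> B"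
  shows "\<exists>\<sigma> \<pi>3. path_from_to \<sigma> u' v' \<and> set \<sigma> \<subseteq> Lam \<and>
     \<pi> = \<pi>1 @ butlast P1 @ butlast \<sigma> @ butlast P2 @ b # \<pi>3 \<and> successively outside (b # \<pi>3)"
proof -
  have fr1: "successively free (a # w # \<rho>)" "distinct (a # w # \<rho>)" "last (a # w # \<rho>) \<notin> B"
    using fr di la unfolding \<pi> by (auto simp: successively_append_iff)
  obtain c Q where P1e: "P1 = a # c # Q"
    using P1 P_facts(14) by (cases P1; cases "tl P1") (auto simp: path_from_to_iff)
  have "free a w" using fr1 by auto
  then have "on_route a w" using w a_B by (auto simp: free_def)
  then have "consec P1 a w \<or> consec P1 w a" using P_facts by (auto simp: on_route_def dest: consec_in_set)
  moreover have "\<not> consec P1 w a"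
  proof
    assume "consec P1 w a"
    then obtain l r where "P1 = l @ w # a # r" by (auto simp: consec_def)
    then show False using P_facts(2) P1e by (cases l) auto
  qed
  ultimately have "w = c" using consec_succ_unique[OF P_facts(2), of "[]" a c Q w] P1e by auto
  then obtain \<rho>1 where \<rho>1: "a # w # \<rho> = P1 @ \<rho>1" using follow_P[of P1 a c Q \<rho>] P1e fr1 by auto
  define p where "p = butlast P1"
  have P1p: "P1 = p @ [u']" "p \<noteq> []" using P1 P1e by (auto simp: p_def path_from_to_iff)
  have fr2: "successively free (u' # \<rho>1)" "distinct (u' # \<rho>1)" "last (u' # \<rho>1) \<notin> B"
    "set p \<inter> set \<rho>1 = {}" "set P1 \<inter> set \<rho>1 = {}"
    using fr1 unfolding \<rho>1 unfolding P1p(1) by (auto simp: successively_append_iff)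
  have "last (u' # \<rho>1) \<notin> Lam" using fr2 P_facts by blast
  then obtain s1 x r where s1: "u' # \<rho>1 = s1 @ x # r" "s1 \<noteq> []" "x \<in> - Lam" "set s1 \<inter> - Lam = {}"
    using cut_at_first[OF fr2(1) _ _ _ fr2(2), of "- Lam"] P_facts by auto
  define s where "s = last s1"
  have s1s: "s1 = butlast s1 @ [s]" using s1 by (simp add: s_def)
  have sL: "s \<in> Lam" using s1 s_def last_in_set by fastforce
  have su: "successively free (butlast s1 @ s # x # r)" using fr2(1) s1(1) s1s by (metis append.assoc append_Cons append_Nil)
  then have "free s x" by (auto simp: successively_append_iff)
  then have "on_route s x" using sL Lam_I I_B I_adj by (auto simp: free_def)
  moreover have "x \<notin> set P1"
  proof -
    have "x \<in> set \<rho>1" using s1 by (cases s1) auto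
    then show ?thesis using fr2 by auto
  qed
  ultimately have cP2: "consec P2 s x \<or> consec P2 x s" using s1(3) by (auto simp: on_route_def dest: consec_in_set)
  then have sv: "s = v'" using sL P2_Lam by (auto dest: consec_in_set)
  obtain c2 Q2 where P2e: "P2 = v' # c2 # Q2"
    using P2 P_facts(15) by (cases P2; cases "tl P2") (auto simp: path_from_to_iff)
  have "\<not> consec P2 x v'"
  proof
    assume "consec P2 x v'"
    then obtain l r where "P2 = l @ x # v' # r" by (auto simp: consec_def)
    then show False using P_facts(3) P2e by (cases l) auto
  qed
  then have "x = c2" using cP2 sv consec_succ_unique[OF P_facts(3), of "[]" v' c2 Q2 x] P2e by auto
  have di2: "distinct (butlast s1 @ s # x # r)" "last (butlast s1 @ s # x # r) \<notin> B"
    using fr2 s1(1) s1s by (metis append.assoc append_Cons append_Nil)+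
  then obtain \<rho>3 where \<rho>3: "v' # x # r = P2 @ \<rho>3"
    using follow_P[of P2 v' c2 Q2 r] P2e su sv \<open>x = c2\<close> by (auto simp: successively_append_iff)
  define q where "q = butlast P2"
  have P2q: "P2 = q @ [b]" using P2 by (auto simp: q_def path_from_to_iff)
  have eq1: "u' # \<rho>1 = butlast s1 @ q @ b # \<rho>3" using s1 s1s sv \<rho>3 P2q by (metis append.assoc append_Cons append_Nil)
  have eq: "\<pi> = \<pi>1 @ butlast P1 @ butlast s1 @ butlast P2 @ b # \<rho>3"
    using \<pi> \<rho>1 P1p eq1 unfolding q_def[symmetric] p_def[symmetric] by simp
  have path\<sigma>: "path_from_to s1 u' v'"
  proof -
    have "successively free s1" using fr2(1) s1(1) by (simp add: successively_append_iff)
    then have "successively adj s1" by (rule successively_mono) (simp add: free_def)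
    moreover have "hd s1 = u'" using s1(1,2) by (cases s1) auto
    ultimately show ?thesis using s1(2) sv s_def by (simp add: path_from_to_iff)
  qed
  have d\<pi>: "distinct (\<pi>1 @ p @ butlast s1 @ q @ b # \<rho>3)" using di eq p_def q_def by simp
  have u's: "u' \<in> set (butlast s1)"
  proof -
    have "hd s1 = u'" using path\<sigma> by (auto simp: path_from_to_iff)
    then show ?thesis using s1s sv P_facts(16) by (cases "butlast s1") auto
  qed
  have used: "set P1 \<inter> set \<rho>3 = {}" "set P2 \<inter> set \<rho>3 = {}"
    using d\<pi> u's unfolding P1p(1) P2q by auto
  have frb: "successively free (b # \<rho>3)" using fr unfolding eq by (auto simp: successively_append_iff)
  have noLam: "set \<rho>3 \<inter> Lam = {}"
  proof (rule ccontr)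
    assume "set \<rho>3 \<inter> Lam \<noteq> {}"
    then have "\<exists>x\<in>set (b # \<rho>3). x \<in> Lam" by auto
    then obtain l z r where z: "b # \<rho>3 = l @ z # r" "z \<in> Lam" "\<forall>y\<in>set l. y \<notin> Lam"
      using split_list_first_prop[of "b # \<rho>3" "\<lambda>x. x \<in> Lam"] by blast
    have "l \<noteq> []" using z P_facts by auto
    then have zr: "z \<in> set \<rho>3" "last l \<notin> Lam" using z by (cases l; auto)+
    have f: "free (last l) z" using frb \<open>l \<noteq> []\<close> unfolding z(1) by (auto simp: successively_append_iff)
    then have "adj z (last l)" by (simp add: free_def adj_sym)
    then have "last l \<in> B" "z \<in> B" using I_adj z Lam_I I_B by blast+
    then have "on_route (last l) z" using f by (simp add: free_def)
    then show False using on_route_cases zr used by blast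
  qed
  have "successively outside (b # \<rho>3)"
  proof (rule ccontr)
    assume "\<not> successively outside (b # \<rho>3)"
    then obtain l z w' r where z: "b # \<rho>3 = l @ z # w' # r" "\<not> outside z w'"
      using successively_split_first by blast
    have "free z w'" using frb unfolding z(1) by (auto simp: successively_append_iff)
    then have "on_route z w'" using z(2) by (auto simp: free_def outside_def)
    moreover have "w' \<in> set \<rho>3" using z(1) by (cases l) auto
    ultimately show False using on_route_cases used noLam by blast
  qed
  then show ?thesis using path\<sigma> s1(4) eq by blast
qed

definition through :: "(int^'d) list \<Rightarrow> (int^'d) list \<Rightarrow> (int^'d) list \<Rightarrow> (int^'d) list \<Rightarrow> bool" where
  "through \<pi> \<pi>1 \<sigma> \<pi>3 \<longleftrightarrow> path_from_to \<sigma> u' v' \<and> set \<sigma> \<subseteq> Lam \<and>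
     \<pi> = \<pi>1 @ butlast P1 @ butlast \<sigma> @ butlast P2 @ b # \<pi>3 \<and>
     successively outside (\<pi>1 @ [a]) \<and> successively outside (b # \<pi>3)"

lemma traverse:
  assumes fr: "successively free \<pi>" and di: "distinct \<pi>" and ends: "hd \<pi> \<notin> B" "last \<pi> \<notin> B" "\<pi> \<noteq> []"
    and no: "\<not> successively outside \<pi>"
  shows "\<exists>\<pi>1 \<sigma> \<pi>3. through \<pi> \<pi>1 \<sigma> \<pi>3 \<or> route.through B Lam b a v' u' (rev P2) (rev P1) \<pi> \<pi>1 \<sigma> \<pi>3"
proof -
  obtain \<pi>1 z w \<rho> where \<pi>: "\<pi> = \<pi>1 @ z # w # \<rho>" "\<not> outside z w" "successively outside (\<pi>1 @ [z])"
    using successively_split_first[OF no] by blast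
  have zw: "z \<in> B" "w \<in> B" using \<pi>(2) by (auto simp: outside_def)
  have ne: "\<pi>1 \<noteq> []" using \<pi> ends zw by auto
  then have "outside (last \<pi>1) z" "adj (last \<pi>1) z"
    using \<pi>(3) fr unfolding \<pi>(1) by (auto simp: successively_append_iff free_def)
  then have zI: "z \<notin> I" using I_adj zw(1) adj_sym unfolding outside_def by blast
  have "free z w" using fr unfolding \<pi>(1) by (auto simp: successively_append_iff)
  then have "on_route z w" using zw by (simp add: free_def)
  then have "z = a \<or> z = b" using on_route_cases[of z w] zI P12 Lam_I by blast
  then show ?thesis
  proof
    assume "z = a"
    then show ?thesis using traverse_from_a[OF fr di ends(2), of \<pi>1 w \<rho>] \<pi> zw
      unfolding through_def by blast
  next
    assume "z = b"
    then have "\<exists>\<sigma> \<pi>3. path_from_to \<sigma> v' u' \<and> set \<sigma> \<subseteq> Lam \<and>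
       \<pi> = \<pi>1 @ butlast (rev P2) @ butlast \<sigma> @ butlast (rev P1) @ a # \<pi>3 \<and> successively outside (a # \<pi>3)"
      using route.traverse_from_a[OF swapped, of \<pi> \<pi>1 w \<rho>] fr di ends(2) \<pi> zw
      unfolding free_swapped route.outside_def[OF swapped, abs_def] outside_def[abs_def] by blast
    then show ?thesis using \<open>z = b\<close> \<pi>(3)
      unfolding route.through_def[OF swapped] route.outside_def[OF swapped, abs_def] outside_def[abs_def] by blast
  qed
qed

lemma through_joins:
  assumes "through \<pi> \<pi>1 \<sigma> \<pi>3" "path_from_to \<pi> p q"
  shows "path_from_to (\<pi>1 @ [a]) p a" "path_from_to (b # \<pi>3) b q"
    "ptime t \<pi> = ptime t (\<pi>1 @ [a]) + (ptime t P1 + (ptime t \<sigma> + (ptime t P2 + ptime t (b # \<pi>3))))"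
proof -
  have \<sigma>: "path_from_to \<sigma> u' v'" and \<pi>: "\<pi> = \<pi>1 @ butlast P1 @ butlast \<sigma> @ butlast P2 @ b # \<pi>3"
    using assms by (auto simp: through_def)
  show b3: "path_from_to (b # \<pi>3) b q"
    using assms(2) path_split[of "\<pi>1 @ butlast P1 @ butlast \<sigma> @ butlast P2" b \<pi>3 p q] \<pi> by simp
  have P1e: "butlast P1 = a # tl (butlast P1)"
    using P1 P_facts(14) by (cases P1; cases "tl P1") (auto simp: path_from_to_iff)
  show a1: "path_from_to (\<pi>1 @ [a]) p a"
    using assms(2) path_split[of \<pi>1 a "tl (butlast P1) @ butlast \<sigma> @ butlast P2 @ b # \<pi>3" p q] \<pi> P1e
    by (metis append_Cons)
  note j1 = path_join[OF P2 b3]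
  note j2 = path_join[OF \<sigma> j1]
  note j3 = path_join[OF P1 j2]
  show "ptime t \<pi> = ptime t (\<pi>1 @ [a]) + (ptime t P1 + (ptime t \<sigma> + (ptime t P2 + ptime t (b # \<pi>3))))"
    using ptime_join[OF a1 j3, of t] ptime_join[OF P1 j2, of t] ptime_join[OF \<sigma> j1, of t] ptime_join[OF P2 b3, of t] \<pi>
    by simp
qed

lemma through_sublist:
  assumes "through \<pi> \<pi>1 \<sigma> \<pi>3"
  shows "\<exists>p1 p2. \<pi> = p1 @ \<sigma> @ p2 \<and> \<sigma> \<noteq> [] \<and> {hd \<sigma>, last \<sigma>} = {u', v'}"
proof -
  have \<sigma>: "\<sigma> = butlast \<sigma> @ [v']" "\<sigma> \<noteq> []" "hd \<sigma> = u'" "last \<sigma> = v'"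
    using assms by (auto simp: through_def path_from_to_iff)
  have "butlast P2 @ [b] = v' # tl P2" using P2 by (auto simp: path_from_to_iff)
  then have "butlast P2 @ b # \<pi>3 = v' # tl P2 @ \<pi>3" by (metis append_Cons append_assoc append_Nil)
  then have "\<pi> = (\<pi>1 @ butlast P1) @ \<sigma> @ (tl P2 @ \<pi>3)"
    using assms \<sigma>(1) unfolding through_def by (metis append_Cons append_assoc append_Nil)
  then show ?thesis using \<sigma> by blast
qed

end

lemma set_butlast_distinct: "distinct p \<Longrightarrow> p \<noteq> [] \<Longrightarrow> set (butlast p) = set p - {last p}"
  by (cases p rule: rev_cases) auto

context route begin

text \<open>Crossing an expensive edge of \<open>B\<close> is worse than replacing everything between the first and the
  last visit to \<open>B\<close> by a path in the old environment \<open>t\<close>.\<close>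

lemma fast_imp_free:
  assumes agree: "\<And>z w. adj z w \<Longrightarrow> outside z w \<Longrightarrow> ts {z, w} = t {z, w}"
    and wall: "\<And>z w. adj z w \<Longrightarrow> z \<in> B \<Longrightarrow> w \<in> B \<Longrightarrow> \<not> on_route z w \<Longrightarrow> W \<le> ts {z, w}"
    and bridge: "\<And>z w. z \<in> B \<Longrightarrow> w \<in> B \<Longrightarrow> \<exists>p. path_from_to p z w \<and> ptime t p \<le> W"
    and \<pi>: "path_from_to \<pi> p q" "ptime ts \<pi> < geotime t p q"
  shows "successively free \<pi>"
proof (rule ccontr)
  assume "\<not> successively free \<pi>"
  then obtain l z w r where s: "\<pi> = l @ z # w # r" "\<not> free z w" using successively_split_first by blast
  have sp: "path_from_to (l @ [z]) p z" "path_from_to (z # w # r) z q"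
    using path_split[of l z "w # r" p q] \<pi> s by auto
  then have zw: "adj z w" and wr: "path_from_to (w # r) w q" by (auto simp: path_from_to_iff)
  then have B: "z \<in> B" "w \<in> B" "\<not> on_route z w" using s(2) by (auto simp: free_def)
  have "\<exists>x\<in>set (l @ [z]). x \<in> B" using B by auto
  then obtain l1 a' r1 where a': "l @ [z] = l1 @ a' # r1" "a' \<in> B" "\<forall>x\<in>set l1. x \<notin> B"
    using split_list_first_prop[of "l @ [z]" "\<lambda>x. x \<in> B"] by blast
  have "\<exists>x\<in>set (w # r). x \<in> B" using B by auto
  then obtain l2 b' r2 where b': "w # r = l2 @ b' # r2" "b' \<in> B" "\<forall>x\<in>set r2. x \<notin> B"
    using split_list_last_prop[of "w # r" "\<lambda>x. x \<in> B"] by blast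
  have pa: "path_from_to (l1 @ [a']) p a'" using path_split[of l1 a' r1 p z] sp(1) a'(1) by simp
  have pb: "path_from_to (b' # r2) b' q" using path_split[of l2 b' r2 w q] wr b'(1) by simp
  have out: "ptime ts p' = ptime t p'" if p': "successively adj p'" "set p' \<inter> B \<subseteq> {x}" for p' x
  proof (rule ptime_cong[OF p'(1)])
    fix z w assume zw: "adj z w" "z \<in> set p'" "w \<in> set p'"
    then have "z \<noteq> w" by auto
    then have "outside z w" using zw p'(2) unfolding outside_def by blast
    then show "ts {z, w} = t {z, w}" using agree zw(1) by blast
  qed
  have ta: "ptime ts (l1 @ [a']) = ptime t (l1 @ [a'])"
    by (rule out[of _ a']) (use pa a' in \<open>auto simp: path_from_to_iff\<close>)
  have tb: "ptime ts (b' # r2) = ptime t (b' # r2)"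
    by (rule out[of _ b']) (use pb b' in \<open>auto simp: path_from_to_iff\<close>)
  obtain br where br: "path_from_to br a' b'" "ptime t br \<le> W" using bridge a'(2) b'(2) by blast
  have "geotime t p q \<le> ptime t (butlast (l1 @ [a']) @ (butlast br @ (b' # r2)))"
    by (rule geotime_le[OF path_join[OF pa path_join[OF br(1) pb]]])
  also have "\<dots> = ptime t (l1 @ [a']) + (ptime t br + ptime t (b' # r2))"
    by (simp only: ptime_join[OF pa path_join[OF br(1) pb]] ptime_join[OF br(1) pb])
  also have "\<dots> \<le> ptime ts (l1 @ [a']) + (ts {z, w} + ptime ts (b' # r2))"
    unfolding ta tb using br(2) wall[OF zw B] by (intro add_mono) (auto intro: order_trans)
  also have "\<dots> \<le> ptime ts (l @ [z]) + (ts {z, w} + ptime ts (w # r))"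
  proof -
    have "ptime ts (l1 @ [a']) \<le> ptime ts (l @ [z])"
      using ptime_append[of ts l1 a' r1] a'(1) by simp
    moreover have "ptime ts (b' # r2) \<le> ptime ts (w # r)"
      using ptime_append[of ts l2 b' r2] b'(1) by simp
    ultimately show ?thesis by (intro add_mono order_refl)
  qed
  also have "\<dots> = ptime ts \<pi>"
    unfolding s(1) by (subst (2) ptime_append) simp
  finally show False using \<pi>(2) by simp
qed

lemma through_time_ge:
  assumes agree: "\<And>z w. adj z w \<Longrightarrow> outside z w \<Longrightarrow> ts {z, w} = t {z, w}"
    and th: "through \<pi> \<pi>1 \<sigma> \<pi>3" and \<pi>: "path_from_to \<pi> p q"
  shows "geotime t p a + (ptime ts P1 + (ptime ts \<sigma> + (ptime ts P2 + geotime t b q))) \<le> ptime ts \<pi>"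
proof -
  have out: "ptime ts p' = ptime t p'" if p': "successively adj p'" "successively outside p'" for p'
    using p'
  proof (induction p' rule: induct_list012)
    case (3 x y zs)
    then show ?case using agree[of x y] by simp
  qed auto
  note j = through_joins[OF th \<pi>]
  have "ptime ts (\<pi>1 @ [a]) = ptime t (\<pi>1 @ [a])" "ptime ts (b # \<pi>3) = ptime t (b # \<pi>3)"
    using j(1,2) th by (auto intro!: out simp: path_from_to_iff through_def)
  then have "geotime t p a \<le> ptime ts (\<pi>1 @ [a])" "geotime t b q \<le> ptime ts (b # \<pi>3)"
    using geotime_le j(1,2) by metis+
  then show ?thesis unfolding j(3) by (intro add_mono) auto
qed

lemma fast_passes:
  assumes agree: "\<And>z w. adj z w \<Longrightarrow> outside z w \<Longrightarrow> ts {z, w} = t {z, w}"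
    and wall: "\<And>z w. adj z w \<Longrightarrow> z \<in> B \<Longrightarrow> w \<in> B \<Longrightarrow> \<not> on_route z w \<Longrightarrow> W \<le> ts {z, w}"
    and bridge: "\<And>z w. z \<in> B \<Longrightarrow> w \<in> B \<Longrightarrow> \<exists>p. path_from_to p z w \<and> ptime t p \<le> W"
    and pq: "p \<notin> B" "q \<notin> B"
    and \<pi>: "path_from_to \<pi> p q" "distinct \<pi>" "ptime ts \<pi> < geotime t p q"
  shows "\<exists>\<pi>1 \<sigma> \<pi>3. through \<pi> \<pi>1 \<sigma> \<pi>3 \<or> route.through B Lam b a v' u' (rev P2) (rev P1) \<pi> \<pi>1 \<sigma> \<pi>3"
proof (rule traverse)
  show "successively free \<pi>" using fast_imp_free[OF agree wall bridge \<pi>(1,3)] by blast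
  show "hd \<pi> \<notin> B" "last \<pi> \<notin> B" "\<pi> \<noteq> []" using \<pi>(1) pq by (auto simp: path_from_to_iff)
  show "\<not> successively outside \<pi>"
  proof
    assume "successively outside \<pi>"
    then have "ptime ts \<pi> = ptime t \<pi>"
      using \<pi>(1) unfolding path_from_to_iff
    proof (elim conjE, induction \<pi> rule: induct_list012)
      case (3 x y zs)
      have "ptime ts zs' = ptime t zs'" if "successively outside zs'" "successively adj zs'" for zs'
        using that by (induction zs' rule: induct_list012) (auto simp: agree)
      then show ?case using 3 by blast
    qed auto
    then show False using \<pi>(3) geotime_le[OF \<pi>(1), of t] by simp
  qed
qed (use \<pi> in auto)

lemma modified_geodesic:
  assumes agree: "\<And>z w. adj z w \<Longrightarrow> outside z w \<Longrightarrow> ts {z, w} = t {z, w}"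
    and wall: "\<And>z w. adj z w \<Longrightarrow> z \<in> B \<Longrightarrow> w \<in> B \<Longrightarrow> \<not> on_route z w \<Longrightarrow> W \<le> ts {z, w}"
    and bridge: "\<And>z w. z \<in> B \<Longrightarrow> w \<in> B \<Longrightarrow> \<exists>p. path_from_to p z w \<and> ptime t p \<le> W"
    and pq: "p \<notin> B" "q \<notin> B" and finLam: "finite Lam"
    and geo: "is_geodesic t p q (\<gamma>1 @ a # \<gamma>2 @ b # \<gamma>3)" and fin: "geotime t p q < \<infinity>"
    and \<gamma>B: "set \<gamma>1 \<inter> B = {}" "set \<gamma>3 \<inter> B = {}"
    and \<sigma>0: "path_from_to \<sigma>0 u' v'" "set \<sigma>0 \<subseteq> Lam"
    and gain: "ptime ts P1 + (ptime ts \<sigma>0 + ptime ts P2) < ptime t (a # \<gamma>2 @ [b])"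
  shows "geotime ts p q < \<infinity>"
    and "\<exists>mid. mid \<noteq> [] \<and> set mid \<subseteq> B \<and> is_geodesic ts p q (\<gamma>1 @ mid @ \<gamma>3)"
    and "\<And>\<pi>. is_geodesic ts p q \<pi> \<Longrightarrow> \<exists>\<sigma> p1 p2. \<pi> = p1 @ \<sigma> @ p2 \<and> \<sigma> \<noteq> [] \<and> set \<sigma> \<subseteq> Lam \<and> {hd \<sigma>, last \<sigma>} = {u', v'}"
proof -
  define Ss where "Ss = {\<sigma>. path_from_to \<sigma> u' v' \<and> set \<sigma> \<subseteq> Lam \<and> distinct \<sigma>}"
  have "finite Ss" by (rule finite_subset[OF _ finite_subset_distinct[OF finLam]]) (auto simp: Ss_def)
  moreover have "Ss \<noteq> {}" using loop_erase[OF \<sigma>0(1), of t] \<sigma>0(2) by (auto simp: Ss_def)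
  ultimately obtain \<sigma>s where \<sigma>s: "\<sigma>s \<in> Ss" "\<And>\<sigma>. \<sigma> \<in> Ss \<Longrightarrow> ptime ts \<sigma>s \<le> ptime ts \<sigma>"
    using obtains_MIN[of Ss "ptime ts"] by (metis arg_min_if_finite(1) arg_min_least)
  have \<sigma>s_min: "ptime ts \<sigma>s \<le> ptime ts \<sigma>" if \<sigma>: "path_from_to \<sigma> u' v'" "set \<sigma> \<subseteq> Lam" for \<sigma>
  proof -
    obtain \<sigma>' where "path_from_to \<sigma>' u' v'" "distinct \<sigma>'" "set \<sigma>' \<subseteq> set \<sigma>" "ptime ts \<sigma>' \<le> ptime ts \<sigma>"
      using loop_erase[OF \<sigma>(1)] by blast
    moreover from this have "\<sigma>' \<in> Ss" using \<sigma>(2) by (auto simp: Ss_def)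
    ultimately show ?thesis using \<sigma>s(2)[of \<sigma>'] by (auto intro: order_trans)
  qed
  have \<sigma>sp: "path_from_to \<sigma>s u' v'" "set \<sigma>s \<subseteq> Lam" "distinct \<sigma>s" using \<sigma>s by (auto simp: Ss_def)
  define \<gamma> where "\<gamma> = \<gamma>1 @ a # \<gamma>2 @ b # \<gamma>3"
  have \<gamma>: "path_from_to \<gamma> p q" "distinct \<gamma>" "ptime t \<gamma> = geotime t p q"
    using geo by (auto simp: is_geodesic_def \<gamma>_def)
  have geo': "is_geodesic t p q ((\<gamma>1 @ a # \<gamma>2) @ b # \<gamma>3)" using geo by simp
  note g1 = geodesic_split[OF geo fin] and g2 = geodesic_split[OF geo' fin]
  have pa: "path_from_to (\<gamma>1 @ [a]) p a" and pab: "path_from_to ((a # \<gamma>2) @ b # \<gamma>3) a q"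
    using path_split[of \<gamma>1 a "\<gamma>2 @ b # \<gamma>3" p q] \<gamma>(1) by (auto simp: \<gamma>_def)
  have pb: "path_from_to (b # \<gamma>3) b q" using path_split[OF pab] by auto
  define gs where "gs = \<gamma>1 @ butlast P1 @ butlast \<sigma>s @ butlast P2 @ b # \<gamma>3"
  have outs: "ptime ts p' = ptime t p'" if p': "successively adj p'" "set p' \<inter> B \<subseteq> {x}" for p' x
  proof (rule ptime_cong[OF p'(1)])
    fix z w assume zw: "adj z w" "z \<in> set p'" "w \<in> set p'"
    then have "z \<noteq> w" by auto
    then have "outside z w" using zw p'(2) unfolding outside_def by blast
    then show "ts {z, w} = t {z, w}" using agree zw(1) by blast
  qed
  have t1: "ptime ts (\<gamma>1 @ [a]) = geotime t p a"
    unfolding g1(1)[symmetric] by (rule outs[of _ a]) (use pa \<gamma>B in \<open>auto simp: path_from_to_iff\<close>)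
  have t3: "ptime ts (b # \<gamma>3) = geotime t b q"
    unfolding g2(2)[symmetric] by (rule outs[of _ b]) (use pb \<gamma>B in \<open>auto simp: path_from_to_iff\<close>)
  note j1 = path_join[OF P2 pb]
  note j2 = path_join[OF \<sigma>sp(1) j1]
  note j3 = path_join[OF P1 j2]
  note j4 = path_join[OF pa j3]
  have gs_path: "path_from_to gs p q" using j4 by (simp add: gs_def)
  define c where "c = geotime t p a + (ptime ts P1 + (ptime ts \<sigma>s + (ptime ts P2 + geotime t b q)))"
  have gs_time: "ptime ts gs = c"
    using ptime_join[OF pa j3, of ts] ptime_join[OF P1 j2, of ts] ptime_join[OF \<sigma>sp(1) j1, of ts] ptime_join[OF P2 pb, of ts]
    by (simp add: gs_def c_def t1 t3)
  have "geotime t p q = geotime t p a + geotime t a q"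
    using ptime_append[of t \<gamma>1 a "\<gamma>2 @ b # \<gamma>3"] g1 \<gamma>(3) by (simp add: \<gamma>_def)
  also have "geotime t a q = ptime t (a # \<gamma>2 @ [b]) + geotime t b q"
    using ptime_append[of t "a # \<gamma>2" b \<gamma>3] g1(2) g2(2) by simp
  finally have tsum: "geotime t p q = geotime t p a + (ptime t (a # \<gamma>2 @ [b]) + geotime t b q)" .
  have fin': "geotime t p a < \<infinity>" "geotime t b q < \<infinity>"
    using fin unfolding tsum by (auto simp: less_top[symmetric])
  have "ptime ts P1 + (ptime ts \<sigma>s + ptime ts P2) \<le> ptime ts P1 + (ptime ts \<sigma>0 + ptime ts P2)"
    using \<sigma>s_min[OF \<sigma>0] by (intro add_mono) auto
  also note gain
  finally have c_less: "c < geotime t p q"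
    unfolding tsum c_def using fin'
    by (simp add: add.assoc[symmetric]) (metis ennreal_add_left_cancel_less add.assoc add.commute infinity_ennreal_def less_le)
  have le_b: "geotime t p a \<le> geotime t p b"
    using ptime_append[of t \<gamma>1 a "\<gamma>2 @ [b]"] g1(1) g2(1) by (simp add: le_iff_add) metis
  have le_a: "geotime t b q \<le> geotime t a q"
    using ptime_append[of t "a # \<gamma>2" b \<gamma>3] g1(2) g2(2) by (simp add: add_increasing)
  have lower: "c \<le> ptime ts \<pi>" if \<pi>: "path_from_to \<pi> p q" "distinct \<pi>" "ptime ts \<pi> < geotime t p q" for \<pi>
  proof -
    have sw: "route.outside B = outside" unfolding fun_eq_iff route.outside_def[OF swapped] outside_def by simp
    consider \<pi>1 \<sigma> \<pi>3 where "through \<pi> \<pi>1 \<sigma> \<pi>3"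
      | \<pi>1 \<sigma> \<pi>3 where "route.through B Lam b a v' u' (rev P2) (rev P1) \<pi> \<pi>1 \<sigma> \<pi>3"
      using fast_passes[OF agree wall bridge pq \<pi>] by blast
    then show ?thesis
    proof cases
      case 1
      then have "ptime ts \<sigma>s \<le> ptime ts \<sigma>" using \<sigma>s_min by (auto simp: through_def)
      then have "c \<le> geotime t p a + (ptime ts P1 + (ptime ts \<sigma> + (ptime ts P2 + geotime t b q)))"
        unfolding c_def by (intro add_mono) auto
      also have "\<dots> \<le> ptime ts \<pi>" by (rule through_time_ge[OF _ 1 \<pi>(1)]) (rule agree)
      finally show ?thesis .
    next
      case 2
      then have \<sigma>: "path_from_to \<sigma> v' u'" "set \<sigma> \<subseteq> Lam" by (auto simp: route.through_def[OF swapped])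
      have "ptime ts \<sigma>s \<le> ptime ts \<sigma>" using \<sigma>s_min[OF path_rev[OF \<sigma>(1)]] \<sigma>(2) by (simp add: ptime_rev)
      then have "c \<le> geotime t p b + (ptime ts P1 + (ptime ts \<sigma> + (ptime ts P2 + geotime t a q)))"
        unfolding c_def using le_a le_b by (intro add_mono) auto
      also have "\<dots> = geotime t p b + (ptime ts (rev P2) + (ptime ts \<sigma> + (ptime ts (rev P1) + geotime t a q)))"
        by (simp add: ptime_rev ac_simps)
      also have "\<dots> \<le> ptime ts \<pi>"
        by (rule route.through_time_ge[OF swapped _ 2 \<pi>(1)]) (use agree sw in auto)
      finally show ?thesis .
    qed
  qed
  have gs_min: "ptime ts gs \<le> ptime ts \<pi>" if \<pi>: "path_from_to \<pi> p q" for \<pi>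
  proof -
    obtain \<pi>' where \<pi>': "path_from_to \<pi>' p q" "distinct \<pi>'" "ptime ts \<pi>' \<le> ptime ts \<pi>"
      using loop_erase[OF \<pi>] by blast
    then have "c \<le> ptime ts \<pi>'" using lower c_less by (cases "ptime ts \<pi>' < geotime t p q") auto
    then show ?thesis using gs_time \<pi>'(3) by simp
  qed
  have geo_c: "geotime ts p q = c"
    unfolding gs_time[symmetric] using gs_min geotime_le[OF gs_path, of ts]
    unfolding geotime_def by (intro antisym INF_greatest) auto
  then show "geotime ts p q < \<infinity>" using c_less fin by simp
  have dgs: "distinct gs"
  proof -
    have s1: "set (butlast P1) \<subseteq> set P1 - {u'}" and s2: "set (butlast P2) \<subseteq> set P2 - {b}"
      and s3: "set (butlast \<sigma>s) \<subseteq> Lam - {v'}"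
      using set_butlast_distinct[of P1] set_butlast_distinct[of P2] set_butlast_distinct[of \<sigma>s]
        P1 P2 \<sigma>sp P_facts(2,3) by (auto simp: path_from_to_iff)
    have d: "distinct (butlast P1)" "distinct (butlast P2)" "distinct (butlast \<sigma>s)"
      using P_facts(2,3) \<sigma>sp(3) by (auto simp: distinct_butlast)
    have "distinct (\<gamma>1 @ b # \<gamma>3)" using \<gamma>(2) by (auto simp: \<gamma>_def)
    moreover have "set (butlast P1) \<inter> set (butlast P2) = {}" using s1 s2 P_facts(1) by blast
    moreover have "set (butlast P1) \<inter> set (butlast \<sigma>s) = {}" using s1 s3 P1_Lam by blast
    moreover have "set (butlast P2) \<inter> set (butlast \<sigma>s) = {}" using s2 s3 P2_Lam by blast
    moreover have "b \<notin> set (butlast P1)" using s1 P_facts(1,5) by blast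
    moreover have "b \<notin> set (butlast P2)" "b \<notin> set (butlast \<sigma>s)" using s2 s3 P_facts(9) by blast+
    moreover have "set (butlast P1) \<subseteq> B" "set (butlast P2) \<subseteq> B" "set (butlast \<sigma>s) \<subseteq> B"
      using s1 s2 s3 P_facts(12,13,17) by blast+
    then have "set (butlast P1) \<inter> set \<gamma>1 = {}" "set (butlast P2) \<inter> set \<gamma>1 = {}" "set (butlast \<sigma>s) \<inter> set \<gamma>1 = {}"
      "set (butlast P1) \<inter> set \<gamma>3 = {}" "set (butlast P2) \<inter> set \<gamma>3 = {}" "set (butlast \<sigma>s) \<inter> set \<gamma>3 = {}"
      using \<gamma>B by blast+
    ultimately show ?thesis unfolding gs_def using d by auto
  qed
  define mid where "mid = butlast P1 @ butlast \<sigma>s @ butlast P2 @ [b]"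
  have "set mid \<subseteq> B"
  proof -
    have "set (butlast P1) \<subseteq> B" "set (butlast P2) \<subseteq> B" "set (butlast \<sigma>s) \<subseteq> B"
      using P_facts(12,13,17) \<sigma>sp(2) by (meson in_set_butlastD subset_iff)+
    then show ?thesis using b_B by (auto simp: mid_def)
  qed
  moreover have "is_geodesic ts p q (\<gamma>1 @ mid @ \<gamma>3)"
    using gs_path dgs gs_time geo_c by (simp add: is_geodesic_def gs_def mid_def)
  ultimately show "\<exists>mid. mid \<noteq> [] \<and> set mid \<subseteq> B \<and> is_geodesic ts p q (\<gamma>1 @ mid @ \<gamma>3)"
    by (intro exI[of _ mid]) (auto simp: mid_def)
  fix \<pi> assume "is_geodesic ts p q \<pi>"
  then have \<pi>: "path_from_to \<pi> p q" "distinct \<pi>" "ptime ts \<pi> < geotime t p q"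
    using geo_c c_less by (auto simp: is_geodesic_def)
  consider \<pi>1 \<sigma> \<pi>3 where "through \<pi> \<pi>1 \<sigma> \<pi>3"
    | \<pi>1 \<sigma> \<pi>3 where "route.through B Lam b a v' u' (rev P2) (rev P1) \<pi> \<pi>1 \<sigma> \<pi>3"
    using fast_passes[OF agree wall bridge pq \<pi>] by blast
  then show "\<exists>\<sigma> p1 p2. \<pi> = p1 @ \<sigma> @ p2 \<and> \<sigma> \<noteq> [] \<and> set \<sigma> \<subseteq> Lam \<and> {hd \<sigma>, last \<sigma>} = {u', v'}"
  proof cases
    case 1
    then have "set \<sigma> \<subseteq> Lam" by (simp only: through_def)
    moreover obtain p1 p2 where "\<pi> = p1 @ \<sigma> @ p2" "\<sigma> \<noteq> []" "{hd \<sigma>, last \<sigma>} = {u', v'}"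
      using through_sublist[OF 1] by (elim exE conjE)
    ultimately show ?thesis by (rule_tac x=\<sigma> in exI, rule_tac x=p1 in exI, rule_tac x=p2 in exI) simp
  next
    case 2
    then have "set \<sigma> \<subseteq> Lam" by (simp only: route.through_def[OF swapped])
    moreover obtain p1 p2 where "\<pi> = p1 @ \<sigma> @ p2" "\<sigma> \<noteq> []" "{hd \<sigma>, last \<sigma>} = {v', u'}"
      using route.through_sublist[OF swapped 2] by (elim exE conjE)
    ultimately show ?thesis
      by (rule_tac x=\<sigma> in exI, rule_tac x=p1 in exI, rule_tac x=p2 in exI) (simp add: insert_commute)
  qed
qed

end

lemma satisfies_cond_iff:
  assumes "distinct p"
  shows "satisfies_cond Lv u v A t p x \<longleftrightarrow>
    (\<exists>p1 \<sigma> p2. p = p1 @ \<sigma> @ p2 \<and> \<sigma> \<noteq> [] \<and> {hd \<sigma>, last \<sigma>} = {u + x, v + x} \<and> (\<forall>y\<in>set \<sigma>. y - x \<in> box Lv)) \<and>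
    in_event Lv A (shift_conf x t)"
proof -
  define q where "q = map (\<lambda>y. y - x) p"
  have lenq: "length q = length p" by (simp add: q_def)
  have nthq: "q ! i = p ! i - x" if "i < length p" for i using that by (simp add: q_def)
  have "(u \<in> set q \<and> v \<in> set q \<and>
       (\<forall>i j k. i < length q \<and> j < length q \<and> q ! i = u \<and> q ! j = v \<and>
                 min i j \<le> k \<and> k \<le> max i j \<longrightarrow> q ! k \<in> box Lv)) \<longleftrightarrow>
    (\<exists>p1 \<sigma> p2. p = p1 @ \<sigma> @ p2 \<and> \<sigma> \<noteq> [] \<and> {hd \<sigma>, last \<sigma>} = {u + x, v + x} \<and> (\<forall>y\<in>set \<sigma>. y - x \<in> box Lv))"
    (is "?L \<longleftrightarrow> ?R")
  proof
    assume L: ?L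
    then obtain i0 j0 where ij: "i0 < length p" "j0 < length p" "q ! i0 = u" "q ! j0 = v"
      by (metis in_set_conv_nth lenq)
    define i where "i = min i0 j0"
    define j where "j = max i0 j0"
    have ij': "i \<le> j" "j < length p" using ij by (auto simp: i_def j_def)
    define \<sigma> where "\<sigma> = take (Suc j - i) (drop i p)"
    have len\<sigma>: "length \<sigma> = Suc j - i" using ij' by (simp add: \<sigma>_def)
    have nth\<sigma>: "\<sigma> ! k = p ! (i + k)" if "k < Suc j - i" for k using that ij' by (simp add: \<sigma>_def)
    have ne: "\<sigma> \<noteq> []" using len\<sigma> ij' by auto
    have hl: "hd \<sigma> = p ! i" "last \<sigma> = p ! j"
      using ne len\<sigma> nth\<sigma>[of 0] nth\<sigma>[of "j - i"] ij' by (auto simp: hd_conv_nth last_conv_nth)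
    have pu: "p ! i0 = u + x" "p ! j0 = v + x" using ij nthq by (auto simp: algebra_simps)
    have "{p ! i, p ! j} = {p ! i0, p ! j0}" by (auto simp: i_def j_def min_def max_def)
    then have "{hd \<sigma>, last \<sigma>} = {u + x, v + x}" using hl pu by simp
    moreover have "\<forall>y\<in>set \<sigma>. y - x \<in> box Lv"
    proof
      fix y assume "y \<in> set \<sigma>"
      then obtain k where k: "k < Suc j - i" "y = \<sigma> ! k" using len\<sigma> by (metis in_set_conv_nth)
      have "min i0 j0 \<le> i + k" "i + k \<le> max i0 j0" using k(1) ij' unfolding i_def j_def by linarith+
      then have "q ! (i + k) \<in> box Lv" using L ij lenq by metis
      then show "y - x \<in> box Lv" using k nth\<sigma> nthq[of "i + k"] ij' by simp
    qed
    moreover have "p = take i p @ \<sigma> @ drop (Suc j) p"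
    proof -
      have "drop i p = \<sigma> @ drop (Suc j - i) (drop i p)"
        unfolding \<sigma>_def by (rule append_take_drop_id[symmetric])
      moreover have "drop (Suc j - i) (drop i p) = drop (Suc j) p" using ij' by simp
      ultimately show ?thesis by (metis append_take_drop_id)
    qed
    ultimately show ?R using ne by blast
  next
    assume ?R
    then obtain p1 \<sigma> p2 where R: "p = p1 @ \<sigma> @ p2" "\<sigma> \<noteq> []" "{hd \<sigma>, last \<sigma>} = {u + x, v + x}"
      "\<forall>y\<in>set \<sigma>. y - x \<in> box Lv" by blast
    have in\<sigma>: "u + x \<in> set \<sigma>" "v + x \<in> set \<sigma>" using R(2,3) by (metis hd_in_set insertCI insertE last_in_set singletonD)+
    then have mem: "u \<in> set q" "v \<in> set q" using R(1) unfolding q_def by force+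
    define m where "m = length p1"
    define l where "l = length \<sigma> - 1"
    have ls: "length \<sigma> = Suc l" using R(2) by (cases \<sigma>) (auto simp: l_def)
    have ml: "m + l < length p" "p ! m = hd \<sigma>" "p ! (m + l) = last \<sigma>"
      using R(1,2) ls by (simp_all add: m_def nth_append hd_conv_nth last_conv_nth)
    have "q ! k \<in> box Lv"
      if k: "i < length q" "j < length q" "q ! i = u" "q ! j = v" "min i j \<le> k" "k \<le> max i j" for i j k
    proof -
      have pij: "p ! i = u + x" "p ! j = v + x" "i < length p" "j < length p"
        using k nthq lenq by (auto simp: algebra_simps)
      have cases: "n = m \<or> n = m + l" if n: "n < length p" "p ! n \<in> {hd \<sigma>, last \<sigma>}" for n
        using n ml assms nth_eq_iff_index_eq[OF assms, of n m] nth_eq_iff_index_eq[OF assms, of n "m + l"] by auto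
      have "i = m \<or> i = m + l" "j = m \<or> j = m + l" using cases pij R(3) by auto
      then have "m \<le> k" "k \<le> m + l" using k(5,6) by auto
      then have "p ! k = \<sigma> ! (k - m)" "k - m < length \<sigma>" using R(1) ls by (auto simp: nth_append m_def)
      then have "p ! k \<in> set \<sigma>" by simp
      then show ?thesis using R(4) nthq[of k] \<open>k \<le> m + l\<close> ml(1) by simp
    qed
    then show ?L using mem by blast
  qed
  then show ?thesis unfolding satisfies_cond_def Let_def q_def by blast
qed

lemma sublist_avoiding_middle:
  assumes eq: "l @ mid @ r = p1 @ \<sigma> @ p2" and ne: "mid \<noteq> []" "\<sigma> \<noteq> []" and dis: "set mid \<inter> set \<sigma> = {}"
  shows "(\<exists>r'. l = p1 @ \<sigma> @ r') \<or> (\<exists>l'. r = l' @ \<sigma> @ p2)"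
proof -
  have hd1: "hd mid \<notin> set \<sigma>" "hd \<sigma> \<notin> set mid" using ne dis by (meson disjoint_iff hd_in_set)+
  have "\<exists>us. l = p1 @ us \<and> us @ mid @ r = \<sigma> @ p2 \<or> l @ us = p1 \<and> mid @ r = us @ \<sigma> @ p2"
    using eq by (rule append_eq_append_conv2[THEN iffD1])
  then consider us where "l = p1 @ us" "us @ mid @ r = \<sigma> @ p2" | us where "p1 = l @ us" "mid @ r = us @ \<sigma> @ p2"
    by blast
  then show ?thesis
  proof cases
    case 1
    have "\<exists>vs. us = \<sigma> @ vs \<and> vs @ mid @ r = p2 \<or> us @ vs = \<sigma> \<and> mid @ r = vs @ p2"
      using 1(2) by (rule append_eq_append_conv2[THEN iffD1])
    then consider vs where "us = \<sigma> @ vs" | vs where "\<sigma> = us @ vs" "mid @ r = vs @ p2" by blast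
    then show ?thesis
    proof cases
      case 2
      have "vs = []"
      proof (rule ccontr)
        assume "vs \<noteq> []"
        then have "hd mid = hd vs" using 2(2) ne by (metis hd_append2)
        then show False using hd1(1) 2(1) \<open>vs \<noteq> []\<close> by simp
      qed
      then show ?thesis using 1(1) 2(1) by auto
    qed (use 1(1) in auto)
  next
    case 2
    have "\<exists>vs. mid = us @ vs \<and> vs @ r = \<sigma> @ p2 \<or> mid @ vs = us \<and> r = vs @ \<sigma> @ p2"
      using 2(2) by (rule append_eq_append_conv2[THEN iffD1])
    then consider vs where "us = mid @ vs" "r = vs @ \<sigma> @ p2" | vs where "mid = us @ vs" "vs @ r = \<sigma> @ p2" by blast
    then show ?thesis
    proof cases
      case 2
      have "vs = []"
      proof (rule ccontr)
        assume "vs \<noteq> []"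
        then have "hd \<sigma> = hd vs" using 2(2) ne by (metis hd_append2)
        then show False using hd1(2) 2(1) \<open>vs \<noteq> []\<close> by simp
      qed
      then show ?thesis using 2(2) by (intro disjI2 exI[of _ "[]"]) simp
    qed auto
  qed
qed

lemma finite_satisfies_cond: "finite {x. satisfies_cond Lv u v A t p x}"
proof (rule finite_subset)
  show "{x. satisfies_cond Lv u v A t p x} \<subseteq> (\<lambda>y. y - u) ` set p"
    by (auto simp: satisfies_cond_def Let_def intro!: image_eqI[of _ "\<lambda>y. y - u"])
qed simp

lemma in_event_shift_cong:
  assumes "\<And>z w. adj z w \<Longrightarrow> z - x \<in> box Lv \<Longrightarrow> w - x \<in> box Lv \<Longrightarrow> t {z, w} = t' {z, w}"
  shows "in_event Lv A (shift_conf x t) \<longleftrightarrow> in_event Lv A (shift_conf x t')"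
proof -
  have "restrict (shift_conf x t) (edges_in (box Lv)) = restrict (shift_conf x t') (edges_in (box Lv))"
  proof (rule restrict_ext)
    fix e assume "e \<in> edges_in (box Lv)"
    then obtain z w where "e = {z, w}" "adj z w" "z \<in> box Lv" "w \<in> box Lv"
      by (auto simp: edges_in_def lattice_edges_def)
    then show "shift_conf x t e = shift_conf x t' e"
      using assms[of "z + x" "w + x"] by (simp add: shift_conf_def)
  qed
  then show ?thesis by (simp add: in_event_def)
qed

lemma N_pat_modified:
  assumes d: "distinct (\<gamma>1 @ mid' @ \<gamma>3)" "distinct (\<gamma>1 @ mid @ \<gamma>3)" and mid: "mid \<noteq> []" "set mid \<subseteq> B"
    and agree: "\<And>z w. adj z w \<Longrightarrow> \<not> (z \<in> B \<and> w \<in> B) \<Longrightarrow> ts {z, w} = t {z, w}" and "finite B"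
  shows "N_pat Lv u v A ts (\<gamma>1 @ mid @ \<gamma>3) \<le> N_pat Lv u v A t (\<gamma>1 @ mid' @ \<gamma>3) + card B * card (box Lv)"
proof -
  let ?S = "{x. satisfies_cond Lv u v A ts (\<gamma>1 @ mid @ \<gamma>3) x}"
  let ?S' = "{x. satisfies_cond Lv u v A t (\<gamma>1 @ mid' @ \<gamma>3) x}"
  let ?N = "(\<lambda>(y, z). y - z) ` (B \<times> box Lv)"
  have "?S \<subseteq> ?S' \<union> ?N"
  proof
    fix x assume "x \<in> ?S"
    then obtain p1 \<sigma> p2 where R: "\<gamma>1 @ mid @ \<gamma>3 = p1 @ \<sigma> @ p2" "\<sigma> \<noteq> []" "{hd \<sigma>, last \<sigma>} = {u + x, v + x}"
      "\<forall>y\<in>set \<sigma>. y - x \<in> box Lv" and ev: "in_event Lv A (shift_conf x ts)"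
      unfolding mem_Collect_eq satisfies_cond_iff[OF d(2)] by blast
    show "x \<in> ?S' \<union> ?N"
    proof (cases "\<exists>y\<in>B. y - x \<in> box Lv")
      case True
      then obtain y where "y \<in> B" "y - x \<in> box Lv" by blast
      then have "x \<in> ?N" by (intro image_eqI[of _ _ "(y, y - x)"]) auto
      then show ?thesis by blast
    next
      case False
      then have "set mid \<inter> set \<sigma> = {}" using R(4) mid by blast
      then have "(\<exists>r'. \<gamma>1 = p1 @ \<sigma> @ r') \<or> (\<exists>l'. \<gamma>3 = l' @ \<sigma> @ p2)"
        using sublist_avoiding_middle[OF R(1) mid(1) R(2)] by blast
      then have "\<exists>p1 p2. \<gamma>1 @ mid' @ \<gamma>3 = p1 @ \<sigma> @ p2"
      proof
        assume "\<exists>r'. \<gamma>1 = p1 @ \<sigma> @ r'"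
        then show ?thesis by force
      next
        assume "\<exists>l'. \<gamma>3 = l' @ \<sigma> @ p2"
        then obtain l' where "\<gamma>3 = l' @ \<sigma> @ p2" by blast
        then have "\<gamma>1 @ mid' @ \<gamma>3 = (\<gamma>1 @ mid' @ l') @ \<sigma> @ p2" by simp
        then show ?thesis by blast
      qed
      moreover have "in_event Lv A (shift_conf x t)"
        using ev in_event_shift_cong[of x Lv ts t A] agree False by blast
      ultimately have "x \<in> ?S'" unfolding mem_Collect_eq satisfies_cond_iff[OF d(1)] using R by blast
      then show ?thesis by blast
    qed
  qed
  then have "card ?S \<le> card (?S' \<union> ?N)"
    using \<open>finite B\<close> finite_satisfies_cond by (intro card_mono) auto
  also have "\<dots> \<le> card ?S' + card ?N" by (rule card_Un_le)
  also have "card ?N \<le> card B * card (box Lv)"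
    using card_image_le[of "B \<times> box Lv" "\<lambda>(y, z). y - z"] \<open>finite B\<close> by (simp add: card_cartesian_product)
  finally show ?thesis by (simp add: N_pat_def)
qed

section \<open>Sharpness of the percolation threshold\<close>

definition ex :: "real \<Rightarrow> 'e set \<Rightarrow> ('e set \<Rightarrow> real) \<Rightarrow> real" where
  "ex p F g = (\<Sum>A\<in>Pow F. p ^ card A * (1 - p) ^ card (F - A) * g A)"

lemma ex_empty [simp]: "ex p {} g = g {}"
  by (simp add: ex_def)

lemma ex_insert:
  assumes "finite F" "e \<notin> F"
  shows "ex p (insert e F) g = p * ex p F (\<lambda>A. g (insert e A)) + (1 - p) * ex p F g"
proof -
  have inj: "inj_on (insert e) (Pow F)" using assms by (auto simp: inj_on_def)
  have "ex p (insert e F) g =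
      (\<Sum>A\<in>Pow F. p ^ card A * (1 - p) ^ card (insert e F - A) * g A) +
      (\<Sum>A\<in>insert e ` Pow F. p ^ card A * (1 - p) ^ card (insert e F - A) * g A)"
    unfolding ex_def Pow_insert by (rule sum.union_disjoint) (use assms in auto)
  also have "(\<Sum>A\<in>insert e ` Pow F. p ^ card A * (1 - p) ^ card (insert e F - A) * g A) = p * ex p F (\<lambda>A. g (insert e A))"
    unfolding ex_def sum.reindex[OF inj] sum_distrib_left o_def
  proof (rule sum.cong)
    fix A assume "A \<in> Pow F"
    then have "card (insert e A) = Suc (card A)" "insert e F - insert e A = F - A"
      using assms by (auto simp: card_insert_if finite_subset)
    then show "p ^ card (insert e A) * (1 - p) ^ card (insert e F - insert e A) * g (insert e A) =
         p * (p ^ card A * (1 - p) ^ card (F - A) * g (insert e A))" by simp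
  qed simp
  also have "(\<Sum>A\<in>Pow F. p ^ card A * (1 - p) ^ card (insert e F - A) * g A) = (1 - p) * ex p F g"
    unfolding ex_def sum_distrib_left
  proof (rule sum.cong)
    fix A assume A: "A \<in> Pow F"
    then have "insert e F - A = insert e (F - A)" using assms by auto
    then have "card (insert e F - A) = Suc (card (F - A))" using assms by (simp add: card_insert_if)
    then show "p ^ card A * (1 - p) ^ card (insert e F - A) * g A = (1 - p) * (p ^ card A * (1 - p) ^ card (F - A) * g A)"
      by simp
  qed simp
  finally show ?thesis by simp
qed

lemma ex_cong: "(\<And>A. A \<subseteq> F \<Longrightarrow> g A = h A) \<Longrightarrow> ex p F g = ex p F h"
  by (simp add: ex_def)

lemma ex_diff: "ex p F (\<lambda>A. g A - h A) = ex p F g - ex p F h"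
  by (simp add: ex_def sum_subtractf right_diff_distrib)

lemma ex_cmult: "ex p F (\<lambda>A. c * g A) = c * ex p F g"
  by (simp add: ex_def sum_distrib_left algebra_simps)

lemma ex_sum: "ex p F (\<lambda>A. \<Sum>i\<in>I. g i A) = (\<Sum>i\<in>I. ex p F (g i))"
  unfolding ex_def by (subst sum.swap) (simp add: sum_distrib_left)

lemma ex_const: "finite F \<Longrightarrow> ex p F (\<lambda>_. c) = c"
  by (induction F rule: finite_induct) (auto simp: ex_insert algebra_simps)

lemma ex_mono:
  assumes "0 \<le> p" "p \<le> 1" "\<And>A. A \<subseteq> F \<Longrightarrow> g A \<le> h A"
  shows "ex p F g \<le> ex p F h"
  unfolding ex_def by (intro sum_mono mult_left_mono) (use assms in auto)

lemma ex_nonneg: "0 \<le> p \<Longrightarrow> p \<le> 1 \<Longrightarrow> (\<And>A. A \<subseteq> F \<Longrightarrow> 0 \<le> g A) \<Longrightarrow> 0 \<le> ex p F g"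
  unfolding ex_def by (intro sum_nonneg mult_nonneg_nonneg) auto

lemma ex_indep:
  assumes "finite F1" "finite F2" "F1 \<inter> F2 = {}"
  shows "ex p (F1 \<union> F2) (\<lambda>A. g (A \<inter> F1) * h (A \<inter> F2)) = ex p F1 g * ex p F2 h"
  using assms
proof (induction F1 arbitrary: g rule: finite_induct)
  case empty
  have "ex p F2 (\<lambda>A. g {} * h (A \<inter> F2)) = ex p F2 (\<lambda>A. g {} * h A)"
    by (rule ex_cong) (simp add: Int_absorb2)
  then show ?case by (simp add: ex_cmult)
next
  case (insert e F1)
  have e: "e \<notin> F1 \<union> F2" using insert by auto
  have "ex p (insert e F1 \<union> F2) (\<lambda>A. g (A \<inter> insert e F1) * h (A \<inter> F2)) =
     p * ex p (F1 \<union> F2) (\<lambda>A. g (insert e A \<inter> insert e F1) * h (insert e A \<inter> F2)) +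
     (1 - p) * ex p (F1 \<union> F2) (\<lambda>A. g (A \<inter> insert e F1) * h (A \<inter> F2))"
    using ex_insert[of "F1 \<union> F2" e p] insert e by simp
  also have "ex p (F1 \<union> F2) (\<lambda>A. g (insert e A \<inter> insert e F1) * h (insert e A \<inter> F2)) =
      ex p (F1 \<union> F2) (\<lambda>A. g (insert e (A \<inter> F1)) * h (A \<inter> F2))"
  proof (rule ex_cong)
    fix A
    have "insert e A \<inter> insert e F1 = insert e (A \<inter> F1)" "insert e A \<inter> F2 = A \<inter> F2" using e by auto
    then show "g (insert e A \<inter> insert e F1) * h (insert e A \<inter> F2) = g (insert e (A \<inter> F1)) * h (A \<inter> F2)"
      by (simp only:)
  qed
  also have "\<dots> = ex p F1 (\<lambda>A. g (insert e A)) * ex p F2 h"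
    using insert by (intro insert.IH) auto
  also have "ex p (F1 \<union> F2) (\<lambda>A. g (A \<inter> insert e F1) * h (A \<inter> F2)) = ex p (F1 \<union> F2) (\<lambda>A. g (A \<inter> F1) * h (A \<inter> F2))"
  proof (rule ex_cong)
    fix A assume "A \<subseteq> F1 \<union> F2"
    then have "A \<inter> insert e F1 = A \<inter> F1" using e by auto
    then show "g (A \<inter> insert e F1) * h (A \<inter> F2) = g (A \<inter> F1) * h (A \<inter> F2)" by simp
  qed
  also have "\<dots> = ex p F1 g * ex p F2 h" using insert by (intro insert.IH) auto
  finally show ?case unfolding ex_insert[OF insert.hyps] by (simp only: distrib_right mult.assoc)
qed

lemma ex_local:
  assumes "finite F" "F' \<subseteq> F" "\<And>A. A \<subseteq> F \<Longrightarrow> g A = g (A \<inter> F')"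
  shows "ex p F g = ex p F' g"
proof -
  have f: "finite F'" "finite (F - F')" using assms finite_subset by auto
  have "ex p F g = ex p (F' \<union> (F - F')) (\<lambda>A. g (A \<inter> F') * 1)"
    using assms by (simp add: Un_absorb1) (rule ex_cong, auto)
  also have "\<dots> = ex p F' g * ex p (F - F') (\<lambda>_. 1)"
    using ex_indep[OF f, of p g "\<lambda>_. 1"] by auto
  finally show ?thesis using ex_const[OF f(2)] by simp
qed

lemma ex_indep_subset:
  assumes "finite F" "F1 \<subseteq> F" "F2 \<subseteq> F" "F1 \<inter> F2 = {}"
  shows "ex p F (\<lambda>A. g (A \<inter> F1) * h (A \<inter> F2)) = ex p F1 g * ex p F2 h"
proof -
  have f: "finite F1" "finite F2" by (rule finite_subset[OF assms(2,1)], rule finite_subset[OF assms(3,1)])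
  have "ex p F (\<lambda>A. g (A \<inter> F1) * h (A \<inter> F2)) = ex p (F1 \<union> F2) (\<lambda>A. g (A \<inter> F1) * h (A \<inter> F2))"
  proof (rule ex_local)
    fix A
    have "A \<inter> (F1 \<union> F2) \<inter> F1 = A \<inter> F1" "A \<inter> (F1 \<union> F2) \<inter> F2 = A \<inter> F2" by auto
    then show "g (A \<inter> F1) * h (A \<inter> F2) = g (A \<inter> (F1 \<union> F2) \<inter> F1) * h (A \<inter> (F1 \<union> F2) \<inter> F2)" by simp
  qed (use assms in auto)
  then show ?thesis using ex_indep[OF f assms(4)] by simp
qed

lemma ex_reindex:
  assumes "inj_on \<tau> F" "finite F"
  shows "ex p (\<tau> ` F) g = ex p F (\<lambda>A. g (\<tau> ` A))"
  using assms(2,1)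
proof (induction F arbitrary: g rule: finite_induct)
  case (insert e F)
  then have "\<tau> e \<notin> \<tau> ` F" "inj_on \<tau> F" by auto
  then show ?case using insert by (simp add: ex_insert)
qed simp

lemma ex_deriv:
  assumes "finite F"
  shows "((\<lambda>p. ex p F g) has_real_derivative (\<Sum>e\<in>F. ex p (F - {e}) (\<lambda>A. g (insert e A) - g A))) (at p)"
  using assms
proof (induction F arbitrary: g rule: finite_induct)
  case (insert x F)
  let ?D = "\<lambda>g. \<Sum>e\<in>F. ex p (F - {e}) (\<lambda>A. g (insert e A) - g A)"
  let ?g1 = "\<lambda>A. g (insert x A)"
  have "((\<lambda>p. p * ex p F ?g1 + (1 - p) * ex p F g) has_real_derivative
      (1 * ex p F ?g1 + p * ?D ?g1) + ((-1) * ex p F g + (1 - p) * ?D g)) (at p)"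
    by (auto intro!: derivative_eq_intros insert.IH)
  moreover have "(\<lambda>p. ex p (insert x F) g) = (\<lambda>p. p * ex p F ?g1 + (1 - p) * ex p F g)"
    using insert by (simp add: ex_insert)
  moreover have "(1 * ex p F ?g1 + p * ?D ?g1) + ((-1) * ex p F g + (1 - p) * ?D g) =
     (\<Sum>e\<in>insert x F. ex p (insert x F - {e}) (\<lambda>A. g (insert e A) - g A))"
  proof -
    have "ex p (insert x F - {e}) (\<lambda>A. g (insert e A) - g A) =
       p * ex p (F - {e}) (\<lambda>A. ?g1 (insert e A) - ?g1 A) + (1 - p) * ex p (F - {e}) (\<lambda>A. g (insert e A) - g A)"
      if e: "e \<in> F" for e
    proof -
      have "insert x F - {e} = insert x (F - {e})" using e insert by auto
      then show ?thesis using insert by (simp add: ex_insert insert_commute)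
    qed
    then have "(\<Sum>e\<in>F. ex p (insert x F - {e}) (\<lambda>A. g (insert e A) - g A)) = p * ?D ?g1 + (1 - p) * ?D g"
      by (simp add: sum.distrib sum_distrib_left)
    moreover have "insert x F - {x} = F" using insert by auto
    ultimately show ?thesis using insert by (simp add: ex_diff)
  qed
  ultimately show ?case by simp
qed simp

lemma ex_mono_param:
  assumes F: "finite F" and p: "0 \<le> p" "p \<le> q" "q \<le> 1" and inc: "\<And>A A'. A \<subseteq> A' \<Longrightarrow> g A \<le> g A'"
  shows "ex p F g \<le> ex q F g"
proof (rule DERIV_nonneg_imp_nondecreasing[OF p(2)])
  fix r assume r: "p \<le> r" "r \<le> q"
  have "0 \<le> (\<Sum>e\<in>F. ex r (F - {e}) (\<lambda>A. g (insert e A) - g A))"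
    using r p by (intro sum_nonneg ex_nonneg) (auto intro!: inc)
  then show "\<exists>y. ((\<lambda>p. ex p F g) has_real_derivative y) (at r) \<and> 0 \<le> y"
    using ex_deriv[OF F] by blast
qed

text \<open>Bernoulli percolation for undirected (\<open>E = adj\<close>, \<open>f x y = {x, y}\<close>) and oriented
  (\<open>f x y = (x, y)\<close>) bonds at once. A configuration is the set of open bonds.\<close>

locale percolation =
  fixes E :: "int^'d \<Rightarrow> int^'d \<Rightarrow> bool" and f :: "int^'d \<Rightarrow> int^'d \<Rightarrow> 'e" and \<tau> :: "int^'d \<Rightarrow> 'e \<Rightarrow> 'e"
  assumes E_adj: "E x y \<Longrightarrow> adj x y"
    and E_translate: "E (x + z) (y + z) \<longleftrightarrow> E x y"
    and f_inj: "E x y \<Longrightarrow> E x' y' \<Longrightarrow> f x y = f x' y' \<Longrightarrow> (x = x' \<and> y = y') \<or> (x = y' \<and> y = x')"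
    and f_translate: "f (x + z) (y + z) = \<tau> z (f x y)"
    and \<tau>_inj: "inj (\<tau> z)"
begin

definition reach :: "'e set \<Rightarrow> (int^'d) set \<Rightarrow> ((int^'d) \<times> (int^'d)) set" where
  "reach A S = {(x, y). x \<in> S \<and> y \<in> S \<and> E x y \<and> f x y \<in> A}\<^sup>*"

definition bonds :: "(int^'d) set \<Rightarrow> 'e set" where
  "bonds W = {f x y | x y. E x y \<and> x \<in> W \<and> y \<in> W}"

definition outf :: "int^'d \<Rightarrow> nat \<Rightarrow> 'e set \<Rightarrow> bool" where
  "outf x n A \<longleftrightarrow> (\<exists>y. l1 (y - x) = int n \<and> (x, y) \<in> reach A (ball1 x n))"

definition theta :: "nat \<Rightarrow> real \<Rightarrow> real" where
  "theta n p = ex p (bonds (ball1 0 (int n))) (\<lambda>A. of_bool (outf 0 n A))"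

definition nbr :: "int^'d \<Rightarrow> (int^'d) set" where
  "nbr x = {y. E x y}"

definition phi :: "(int^'d) set \<Rightarrow> real \<Rightarrow> real" where
  "phi S p = (\<Sum>x\<in>S. \<Sum>y\<in>nbr x - S. ex p (bonds S) (\<lambda>A. of_bool ((0, x) \<in> reach A S)))"

lemma finite_nbr [simp]: "finite (nbr x)"
proof (rule finite_subset)
  show "nbr x \<subseteq> ball1 x 1"
  proof
    fix y assume "y \<in> nbr x"
    then have "adj x y" using E_adj by (simp add: nbr_def)
    then show "y \<in> ball1 x 1" by (simp add: ball1_def adj_def l1_minus_commute[of y x])
  qed
qed simp

lemma finite_bonds [simp]: "finite W \<Longrightarrow> finite (bonds W)"
proof (rule finite_subset)
  show "bonds W \<subseteq> (\<lambda>(x, y). f x y) ` (W \<times> W)" by (auto simp: bonds_def)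
qed simp

lemma bonds_mono: "W \<subseteq> W' \<Longrightarrow> bonds W \<subseteq> bonds W'"
  by (auto simp: bonds_def)

lemma f_in_bonds_iff: "E x y \<Longrightarrow> f x y \<in> bonds W \<longleftrightarrow> x \<in> W \<and> y \<in> W"
  unfolding bonds_def using f_inj by blast

lemma reach_mono: "A \<subseteq> A' \<Longrightarrow> S \<subseteq> S' \<Longrightarrow> reach A S \<subseteq> reach A' S'"
  unfolding reach_def by (rule rtrancl_mono) auto

lemma reach_step: "(x, y) \<in> reach A S \<Longrightarrow> y \<in> S \<Longrightarrow> z \<in> S \<Longrightarrow> E y z \<Longrightarrow> f y z \<in> A \<Longrightarrow> (x, z) \<in> reach A S"
  unfolding reach_def by (rule rtrancl_into_rtrancl) auto

lemma reach_bonds: "S \<subseteq> W \<Longrightarrow> reach (A \<inter> bonds W) S = reach A S"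
proof -
  assume "S \<subseteq> W"
  then have "{(x, y). x \<in> S \<and> y \<in> S \<and> E x y \<and> f x y \<in> A \<inter> bonds W} = {(x, y). x \<in> S \<and> y \<in> S \<and> E x y \<and> f x y \<in> A}"
    using f_in_bonds_iff by auto
  then show ?thesis by (simp add: reach_def)
qed

lemma outf_mono: "A \<subseteq> A' \<Longrightarrow> outf x n A \<Longrightarrow> outf x n A'"
  unfolding outf_def using reach_mono by blast

lemma outf_bonds: "outf x n (A \<inter> bonds (ball1 x (int n))) \<longleftrightarrow> outf x n A"
  by (simp add: outf_def reach_bonds)

lemma exit_ball:
  assumes "(x, y) \<in> reach A S" "l1 (y - x) \<ge> int n"
  shows "outf x n A"
proof -
  have "outf x n A \<or> ((x, y) \<in> reach A (ball1 x n) \<and> l1 (y - x) < int n)"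
    using assms(1) unfolding reach_def[of A S]
  proof (induction rule: rtrancl_induct)
    case base
    then show ?case
      by (cases "n = 0") (auto simp: outf_def reach_def intro!: exI[of _ x])
  next
    case (step y z)
    then show ?case
    proof (elim disjE conjE)
      assume y: "(x, y) \<in> reach A (ball1 x n)" "l1 (y - x) < int n"
      have Eyz: "E y z" "f y z \<in> A" using step by auto
      have z: "l1 (z - x) \<le> int n" using adj_l1_diff[OF E_adj[OF Eyz(1)], of x] y by linarith
      have r: "(x, z) \<in> reach A (ball1 x n)"
        by (rule reach_step[OF y(1)]) (use y Eyz z in \<open>auto simp: ball1_def\<close>)
      then show ?thesis using z by (cases "l1 (z - x) = int n") (auto simp: outf_def)
    qed simp
  qed
  then show ?thesis using assms(2) by auto
qed

lemma reach_translate: "(x + z, y + z) \<in> reach (\<tau> z ` A) ((\<lambda>x. x + z) ` S) \<longleftrightarrow> (x, y) \<in> reach A S"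
proof -
  have e: "{(x, y). x \<in> (\<lambda>x. x + z) ` S \<and> y \<in> (\<lambda>x. x + z) ` S \<and> E x y \<and> f x y \<in> \<tau> z ` A} =
     (\<lambda>(x, y). (x + z, y + z)) ` {(x, y). x \<in> S \<and> y \<in> S \<and> E x y \<and> f x y \<in> A}"
    by (auto simp: E_translate f_translate inj_image_mem_iff[OF \<tau>_inj] image_iff inj_eq[OF \<tau>_inj])
  have f: "inj (\<lambda>x. x + z)" by (simp add: inj_on_def)
  have im: "((\<lambda>(x, y). (x + z, y + z)) ` R)\<^sup>* \<supseteq> (\<lambda>(x, y). (x + z, y + z)) ` R\<^sup>*" for R :: "((int^'d) \<times> (int^'d)) set"
  proof
    fix q assume "q \<in> (\<lambda>(x, y). (x + z, y + z)) ` R\<^sup>*"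
    then obtain a b where "(a, b) \<in> R\<^sup>*" "q = (a + z, b + z)" by auto
    then show "q \<in> ((\<lambda>(x, y). (x + z, y + z)) ` R)\<^sup>*"
    proof (induction arbitrary: q rule: rtrancl_induct)
      case (step b c)
      then show ?case by (metis (no_types, lifting) case_prod_conv image_eqI rtrancl.rtrancl_into_rtrancl)
    qed auto
  qed
  have "(x, y) \<in> R\<^sup>*" if "(x + z, y + z) \<in> ((\<lambda>(x, y). (x + z, y + z)) ` R)\<^sup>*" for R x y
  proof -
    have "(a - z, b - z) \<in> R\<^sup>*" if "(a, b) \<in> ((\<lambda>(x, y). (x + z, y + z)) ` R)\<^sup>*" for a b
      using that by (induction rule: rtrancl_induct) (auto intro: rtrancl_into_rtrancl)
    from this[OF that] show ?thesis by simp
  qed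
  then show ?thesis unfolding reach_def e using im by blast
qed

lemma bonds_translate: "bonds ((\<lambda>x. x + z) ` W) = \<tau> z ` bonds W"
proof
  show "bonds ((\<lambda>x. x + z) ` W) \<subseteq> \<tau> z ` bonds W"
    unfolding bonds_def by (fastforce simp: E_translate f_translate)
  show "\<tau> z ` bonds W \<subseteq> bonds ((\<lambda>x. x + z) ` W)"
  proof
    fix e assume "e \<in> \<tau> z ` bonds W"
    then obtain x y where "e = \<tau> z (f x y)" "E x y" "x \<in> W" "y \<in> W" by (auto simp: bonds_def)
    then show "e \<in> bonds ((\<lambda>x. x + z) ` W)"
      using f_in_bonds_iff[of "x + z" "y + z" "(\<lambda>x. x + z) ` W"] by (simp add: f_translate E_translate)
  qed
qed

lemma outf_translate: "outf z n (\<tau> z ` A) \<longleftrightarrow> outf 0 n A"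
proof
  assume "outf z n (\<tau> z ` A)"
  then obtain y where "l1 (y - z) = int n" "(0 + z, (y - z) + z) \<in> reach (\<tau> z ` A) (ball1 z n)"
    by (auto simp: outf_def)
  then show "outf 0 n A"
    unfolding outf_def ball1_translate[of z] reach_translate by (intro exI[of _ "y - z"]) auto
next
  assume "outf 0 n A"
  then obtain y where "l1 y = int n" "(0, y) \<in> reach A (ball1 0 n)" by (auto simp: outf_def)
  then show "outf z n (\<tau> z ` A)"
    unfolding outf_def ball1_translate[of z] using reach_translate[of 0 z y A "ball1 0 n"]
    by (intro exI[of _ "y + z"]) auto
qed

lemma theta_translate: "ex p (bonds (ball1 z (int n))) (\<lambda>A. of_bool (outf z n A)) = theta n p"
proof -
  have "bonds (ball1 z (int n)) = \<tau> z ` bonds (ball1 0 (int n))"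
    by (subst ball1_translate) (rule bonds_translate)
  then show ?thesis unfolding theta_def
    by (simp add: ex_reindex inj_on_subset[OF \<tau>_inj] outf_translate)
qed

lemma theta_bounds: "0 \<le> p \<Longrightarrow> p \<le> 1 \<Longrightarrow> 0 \<le> theta n p \<and> theta n p \<le> 1"
proof -
  assume p: "0 \<le> p" "p \<le> 1"
  have "theta n p \<le> ex p (bonds (ball1 0 (int n))) (\<lambda>_. 1)"
    unfolding theta_def by (rule ex_mono) (use p in auto)
  then show ?thesis using p by (auto simp: theta_def ex_const intro!: ex_nonneg)
qed

definition clus :: "(int^'d) set \<Rightarrow> 'e set \<Rightarrow> (int^'d) set" where
  "clus S A = {x \<in> S. (0, x) \<in> reach A S}"

definition clus_bonds :: "(int^'d) set \<Rightarrow> (int^'d) set \<Rightarrow> 'e set" where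
  "clus_bonds S C = {f u v | u v. E u v \<and> u \<in> C \<and> v \<in> S}"

lemma clus_mono: "A \<subseteq> A' \<Longrightarrow> clus S A \<subseteq> clus S A'"
  unfolding clus_def using reach_mono[of A A' S S] by blast

lemma clus_local:
  assumes "0 \<in> S" shows "clus S A = C \<longleftrightarrow> clus S (A \<inter> clus_bonds S C) = C"
proof
  assume C: "clus S A = C"
  have "(0, x) \<in> reach (A \<inter> clus_bonds S C) S" if "(0, x) \<in> reach A S" for x
    using that unfolding reach_def[of A S]
  proof (induction rule: rtrancl_induct)
    case (step y z)
    then have "y \<in> C" using C by (auto simp: clus_def reach_def)
    show ?case by (rule reach_step[OF step.IH]) (use step \<open>y \<in> C\<close> in \<open>auto simp: clus_bonds_def\<close>)
  qed (simp add: reach_def)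
  then have "clus S A \<subseteq> clus S (A \<inter> clus_bonds S C)" by (simp add: clus_def subset_iff)
  then show "clus S (A \<inter> clus_bonds S C) = C"
    using C clus_mono[of "A \<inter> clus_bonds S C" A S] by simp
next
  assume C: "clus S (A \<inter> clus_bonds S C) = C"
  have "x \<in> C" if "(0, x) \<in> reach A S" for x
    using that unfolding reach_def[of A S]
  proof (induction rule: rtrancl_induct)
    case base
    then show ?case using assms C by (auto simp: clus_def reach_def)
  next
    case (step y z)
    then have yz: "y \<in> C" "z \<in> S" "y \<in> S" "E y z" "f y z \<in> A" by auto
    then have "(0, y) \<in> reach (A \<inter> clus_bonds S C) S" using C by (auto simp: clus_def)
    then have "(0, z) \<in> reach (A \<inter> clus_bonds S C) S"
      by (rule reach_step) (use yz in \<open>auto simp: clus_bonds_def\<close>)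
    then show ?case using C yz by (auto simp: clus_def)
  qed
  then have "clus S A \<subseteq> C" by (simp add: clus_def subset_iff)
  then show "clus S A = C"
    using C clus_mono[of "A \<inter> clus_bonds S C" A S] by simp
qed

text \<open>Decompose a path leaving a large ball at its last vertex in the cluster \<open>C\<close> of \<open>0\<close> in \<open>S\<close>: it
  leaves \<open>S\<close> there, and its remainder avoids \<open>C\<close>.\<close>

lemma last_exit:
  assumes "0 \<in> S" "(0, z) \<in> reach A V" "z \<notin> S"
  shows "\<exists>x\<in>clus S A. \<exists>y\<in>nbr x - S. f x y \<in> A \<and> (y, z) \<in> reach A (V - clus S A)"
proof -
  let ?C = "clus S A"
  have "z \<in> ?C \<or> (\<exists>x\<in>?C. \<exists>y\<in>nbr x - S. f x y \<in> A \<and> (y, z) \<in> reach A (V - ?C))"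
    using assms(2) unfolding reach_def[of A V]
  proof (induction rule: rtrancl_induct)
    case base
    then show ?case using assms(1) by (auto simp: clus_def reach_def)
  next
    case (step z w)
    then have zw: "z \<in> V" "w \<in> V" "E z w" "f z w \<in> A" by auto
    show ?case
    proof (cases "w \<in> ?C")
      case False
      show ?thesis
      proof (cases "z \<in> ?C")
        case True
        have "w \<notin> S"
        proof
          assume "w \<in> S"
          have "(0, w) \<in> reach A S" by (rule reach_step[of 0 z]) (use \<open>w \<in> S\<close> True zw in \<open>auto simp: clus_def\<close>)
          then show False using False \<open>w \<in> S\<close> by (auto simp: clus_def)
        qed
        then show ?thesis using True zw
          by (intro disjI2 bexI[of _ z] bexI[of _ w]) (auto simp: nbr_def reach_def)
      next
        case zC: False
        then obtain x y where xy: "x \<in> ?C" "y \<in> nbr x - S" "f x y \<in> A" "(y, z) \<in> reach A (V - ?C)"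
          using step.IH by blast
        have "(y, w) \<in> reach A (V - ?C)" by (rule reach_step[OF xy(4)]) (use zC False zw in auto)
        then show ?thesis using xy by blast
      qed
    qed simp
  qed
  then show ?thesis using assms(3) by (auto simp: clus_def)
qed

lemma theta_decay:
  assumes p: "0 \<le> p" "p \<le> 1" and S: "finite S" "0 \<in> S" "\<And>x. x \<in> S \<Longrightarrow> l1 x < int L"
  shows "theta (n + L) p \<le> p * phi S p * theta n p"
proof -
  define V where "V = ball1 (0 :: int^'d) (int (n + L))"
  define F where "F = bonds V"
  have finF: "finite F" by (simp add: F_def V_def)
  have SV: "S \<subseteq> V" using S(3) by (fastforce simp: V_def ball1_def)
  have nbrL: "l1 y \<le> int L" if "x \<in> S" "y \<in> nbr x" for x y
    using adj_l1_diff[OF E_adj[of x y], of 0] that S(3)[of x] by (auto simp: nbr_def)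
  define B3 where "B3 C = bonds (V - C)" for C
  define G where "G C x y A = (of_bool (clus S (A \<inter> clus_bonds S C) = C) *
     (of_bool (f x y \<in> A \<inter> {f x y}) * of_bool (outf y n (A \<inter> B3 C))) :: real)" for C x y A
  have pointwise: "of_bool (outf 0 (n + L) A) \<le> (\<Sum>C\<in>Pow S. \<Sum>x\<in>C. \<Sum>y\<in>nbr x - S. G C x y A)" (is "_ \<le> ?R") for A
  proof (cases "outf 0 (n + L) A")
    case True
    then obtain z where z: "l1 z = int (n + L)" "(0, z) \<in> reach A V" by (auto simp: outf_def V_def)
    then have "z \<notin> S" using S(3)[of z] by auto
    let ?C = "clus S A"
    obtain x y where xy: "x \<in> ?C" "y \<in> nbr x - S" "f x y \<in> A" "(y, z) \<in> reach A (V - ?C)"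
      using last_exit[OF S(2) z(2) \<open>z \<notin> S\<close>] by blast
    have CS: "?C \<subseteq> S" by (auto simp: clus_def)
    have "l1 y \<le> int L" using nbrL xy CS by auto
    then have "int n \<le> l1 (z - y)" using z(1) l1_diff_triangle[of z 0 y] by simp
    moreover have "(y, z) \<in> reach (A \<inter> B3 ?C) (V - ?C)" using xy(4) unfolding B3_def by (simp add: reach_bonds)
    ultimately have "outf y n (A \<inter> B3 ?C)" by (rule exit_ball[rotated])
    moreover have "clus S (A \<inter> clus_bonds S ?C) = ?C" using clus_local[OF S(2), of A ?C] by simp
    ultimately have "G ?C x y A = 1" using xy(3) by (simp add: G_def)
    moreover have "G ?C x y A \<le> (\<Sum>y\<in>nbr x - S. G ?C x y A)"
      using xy by (intro member_le_sum) (auto simp: G_def)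
    moreover have "(\<Sum>y\<in>nbr x - S. G ?C x y A) \<le> (\<Sum>x\<in>?C. \<Sum>y\<in>nbr x - S. G ?C x y A)"
      using xy finite_subset[OF CS S(1)]
      by (intro member_le_sum[of x ?C "\<lambda>x. \<Sum>y\<in>nbr x - S. G ?C x y A"]) (auto simp: G_def intro!: sum_nonneg)
    moreover have "(\<Sum>x\<in>?C. \<Sum>y\<in>nbr x - S. G ?C x y A) \<le> ?R"
      using CS S(1)
      by (intro member_le_sum[of ?C "Pow S" "\<lambda>C. \<Sum>x\<in>C. \<Sum>y\<in>nbr x - S. G C x y A"]) (auto simp: G_def intro!: sum_nonneg)
    ultimately show ?thesis using True by simp
  qed (auto simp: G_def intro!: sum_nonneg)
  have exG: "ex p F (G C x y) \<le> ex p F (\<lambda>A. of_bool (clus S A = C)) * (p * theta n p)"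
    if C: "C \<subseteq> S" "x \<in> C" and y: "y \<in> nbr x - S" for C x y
  proof -
    have Exy: "E x y" using y by (simp add: nbr_def)
    have yV: "y \<in> V" using nbrL[of x y] C y by (auto simp: V_def ball1_def)
    have sub: "clus_bonds S C \<subseteq> F" "f x y \<in> F" "B3 C \<subseteq> F"
      using C SV yV Exy by (auto simp: clus_bonds_def F_def bonds_def B3_def)
    have n1: "f x y \<notin> clus_bonds S C"
      using f_inj[OF Exy] C y by (auto simp: clus_bonds_def)
    have n2: "f x y \<notin> B3 C" using f_in_bonds_iff[OF Exy] C by (auto simp: B3_def)
    have n3: "clus_bonds S C \<inter> B3 C = {}" using f_in_bonds_iff by (auto simp: B3_def clus_bonds_def)
    have "ex p F (G C x y) = ex p F (\<lambda>A. of_bool (clus S (A \<inter> clus_bonds S C) = C) *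
       (\<lambda>A'. of_bool (f x y \<in> A' \<inter> {f x y}) * of_bool (outf y n (A' \<inter> B3 C))) (A \<inter> insert (f x y) (B3 C)))"
    proof (rule ex_cong)
      fix A :: "'e set"
      have "A \<inter> insert (f x y) (B3 C) \<inter> {f x y} = A \<inter> {f x y}" "A \<inter> insert (f x y) (B3 C) \<inter> B3 C = A \<inter> B3 C"
        by auto
      then show "G C x y A = of_bool (clus S (A \<inter> clus_bonds S C) = C) *
       (\<lambda>A'. of_bool (f x y \<in> A' \<inter> {f x y}) * of_bool (outf y n (A' \<inter> B3 C))) (A \<inter> insert (f x y) (B3 C))"
        by (simp only: G_def)
    qed
    also have "\<dots> = ex p (clus_bonds S C) (\<lambda>A. of_bool (clus S A = C)) *
        ex p (insert (f x y) (B3 C)) (\<lambda>A'. of_bool (f x y \<in> A' \<inter> {f x y}) * of_bool (outf y n (A' \<inter> B3 C)))"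
      by (rule ex_indep_subset[OF finF sub(1), where h = "\<lambda>A'. of_bool (f x y \<in> A' \<inter> {f x y}) * of_bool (outf y n (A' \<inter> B3 C))"])
        (use sub n1 n3 in auto)
    also have "ex p (clus_bonds S C) (\<lambda>A. of_bool (clus S A = C) :: real) = ex p F (\<lambda>A. of_bool (clus S A = C))"
      by (rule ex_local[symmetric, OF finF sub(1)]) (simp add: clus_local[OF S(2), symmetric])
    also have "ex p (insert (f x y) (B3 C)) (\<lambda>A'. of_bool (f x y \<in> A' \<inter> {f x y}) * of_bool (outf y n (A' \<inter> B3 C))) =
        ex p {f x y} (\<lambda>A. of_bool (f x y \<in> A)) * ex p (B3 C) (\<lambda>A. of_bool (outf y n A))"
      by (rule ex_indep_subset[where g = "\<lambda>A. of_bool (f x y \<in> A)" and h = "\<lambda>A. of_bool (outf y n A)"])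
        (use n2 sub finF finite_subset in auto)
    also have "ex p {f x y} (\<lambda>A. of_bool (f x y \<in> A)) = p"
      using ex_insert[of "{}" "f x y" p "\<lambda>A. of_bool (f x y \<in> A)"] by simp
    finally have eq: "ex p F (G C x y) = ex p F (\<lambda>A. of_bool (clus S A = C)) * (p * ex p (B3 C) (\<lambda>A. of_bool (outf y n A)))" .
    have "ex p (B3 C) (\<lambda>A. of_bool (outf y n A)) \<le> theta n p"
    proof -
      define F' where "F' = B3 C \<union> bonds (ball1 y (int n))"
      have finF': "finite F'" using finite_subset[OF sub(3) finF] by (simp add: F'_def)
      have "ex p (B3 C) (\<lambda>A. of_bool (outf y n A)) = ex p (B3 C) (\<lambda>A. of_bool (outf y n (A \<inter> B3 C)))"
        by (rule ex_cong) (simp add: Int_absorb2)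
      also have "\<dots> = ex p F' (\<lambda>A. of_bool (outf y n (A \<inter> B3 C)))"
        by (rule ex_local[symmetric, OF finF']) (auto simp: F'_def)
      also have "\<dots> \<le> ex p F' (\<lambda>A. of_bool (outf y n A))"
        by (rule ex_mono[OF p]) (auto intro: outf_mono[rotated])
      also have "\<dots> = ex p (bonds (ball1 y (int n))) (\<lambda>A. of_bool (outf y n A))"
        by (rule ex_local[OF finF']) (auto simp: F'_def outf_bonds)
      finally show ?thesis by (simp add: theta_translate)
    qed
    then show ?thesis
      unfolding eq using p by (intro mult_left_mono mult_nonneg_nonneg ex_nonneg) auto
  qed
  have "theta (n + L) p \<le> ex p F (\<lambda>A. \<Sum>C\<in>Pow S. \<Sum>x\<in>C. \<Sum>y\<in>nbr x - S. G C x y A)"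
    unfolding theta_def F_def V_def by (rule ex_mono[OF p]) (rule pointwise)
  also have "\<dots> = (\<Sum>C\<in>Pow S. \<Sum>x\<in>C. \<Sum>y\<in>nbr x - S. ex p F (G C x y))"
    by (simp add: ex_sum)
  also have "\<dots> \<le> (\<Sum>C\<in>Pow S. \<Sum>x\<in>C. \<Sum>y\<in>nbr x - S. ex p F (\<lambda>A. of_bool (clus S A = C)) * (p * theta n p))"
    by (intro sum_mono exG) auto
  also have "\<dots> = (\<Sum>C\<in>Pow S. \<Sum>x\<in>S. of_bool (x \<in> C) * (\<Sum>y\<in>nbr x - S. ex p F (\<lambda>A. of_bool (clus S A = C)) * (p * theta n p)))"
  proof (rule sum.cong)
    fix C assume "C \<in> Pow S"
    then show "(\<Sum>x\<in>C. \<Sum>y\<in>nbr x - S. ex p F (\<lambda>A. of_bool (clus S A = C)) * (p * theta n p)) =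
       (\<Sum>x\<in>S. of_bool (x \<in> C) * (\<Sum>y\<in>nbr x - S. ex p F (\<lambda>A. of_bool (clus S A = C)) * (p * theta n p)))"
      using S(1) by (intro sum.mono_neutral_cong_left) auto
  qed simp
  also have "\<dots> = (\<Sum>C\<in>Pow S. \<Sum>x\<in>S. \<Sum>y\<in>nbr x - S. (of_bool (x \<in> C) * (ex p F (\<lambda>A. of_bool (clus S A = C)) * (p * theta n p))))"
    by (simp only: sum_distrib_left)
  also have "\<dots> = (\<Sum>x\<in>S. \<Sum>C\<in>Pow S. \<Sum>y\<in>nbr x - S. (of_bool (x \<in> C) * (ex p F (\<lambda>A. of_bool (clus S A = C)) * (p * theta n p))))"
    by (rule sum.swap)
  also have "\<dots> = (\<Sum>x\<in>S. \<Sum>y\<in>nbr x - S. \<Sum>C\<in>Pow S. (of_bool (x \<in> C) * (ex p F (\<lambda>A. of_bool (clus S A = C)) * (p * theta n p))))"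
    by (intro sum.cong refl) (rule sum.swap)
  also have "\<dots> = (\<Sum>x\<in>S. \<Sum>y\<in>nbr x - S. p * theta n p * (\<Sum>C\<in>Pow S. of_bool (x \<in> C) * ex p F (\<lambda>A. of_bool (clus S A = C))))"
    by (simp add: sum_distrib_left mult_ac)
  also have "\<dots> = (\<Sum>x\<in>S. \<Sum>y\<in>nbr x - S. p * theta n p * ex p (bonds S) (\<lambda>A. of_bool ((0, x) \<in> reach A S)))"
  proof (intro sum.cong refl arg_cong2[of _ _ _ _ "(*)"])
    fix x assume x: "x \<in> S"
    have "(\<Sum>C\<in>Pow S. of_bool (x \<in> C) * ex p F (\<lambda>A. of_bool (clus S A = C) :: real)) =
       ex p F (\<lambda>A. \<Sum>C\<in>Pow S. of_bool (x \<in> C) * of_bool (clus S A = C))"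
      by (simp only: ex_sum ex_cmult)
    also have "\<dots> = ex p F (\<lambda>A. of_bool ((0, x) \<in> reach A S))"
    proof (rule ex_cong)
      fix A
      have "(\<Sum>C\<in>Pow S. of_bool (x \<in> C) * of_bool (clus S A = C)) = (\<Sum>C\<in>Pow S. if clus S A = C then of_bool (x \<in> C) else (0::real))"
        by (intro sum.cong) auto
      also have "\<dots> = of_bool (x \<in> clus S A)"
        using S(1) by (subst sum.delta') (auto simp: clus_def)
      finally show "(\<Sum>C\<in>Pow S. of_bool (x \<in> C) * of_bool (clus S A = C)) = (of_bool ((0, x) \<in> reach A S) :: real)"
        using x by (simp add: clus_def)
    qed
    also have "\<dots> = ex p (bonds S) (\<lambda>A. of_bool ((0, x) \<in> reach A S))"
      by (rule ex_local[OF finF]) (use SV in \<open>auto simp: F_def bonds_mono reach_bonds\<close>)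
    finally show "(\<Sum>C\<in>Pow S. of_bool (x \<in> C) * ex p F (\<lambda>A. of_bool (clus S A = C) :: real)) =
       ex p (bonds S) (\<lambda>A. of_bool ((0, x) \<in> reach A S))" .
  qed
  also have "\<dots> = p * phi S p * theta n p"
    unfolding phi_def by (simp add: sum_distrib_left sum_distrib_right mult_ac)
  finally show ?thesis .
qed

end

context percolation begin

definition blocked :: "nat \<Rightarrow> 'e set \<Rightarrow> (int^'d) set" where
  "blocked n A = {x \<in> ball1 0 (int n). \<not> (\<exists>z. l1 z = int n \<and> (x, z) \<in> reach A (ball1 0 n))}"

lemma blocked_small: "x \<in> blocked n A \<Longrightarrow> l1 x < int n"
  using reach_def[of A "ball1 0 n"] by (force simp: blocked_def ball1_def less_le)

lemma reach_trans: "(x, y) \<in> reach A S \<Longrightarrow> (y, z) \<in> reach A S \<Longrightarrow> (x, z) \<in> reach A S"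
  unfolding reach_def by (rule rtrancl_trans)

lemma reach_single: "x \<in> S \<Longrightarrow> y \<in> S \<Longrightarrow> E x y \<Longrightarrow> f x y \<in> A \<Longrightarrow> (x, y) \<in> reach A S"
  unfolding reach_def by (rule r_into_rtrancl) auto

lemma not_blocked_reach:
  assumes "(x, z) \<in> reach A (ball1 0 n)" "l1 z = int n"
  shows "(x, z) \<in> reach (A - bonds (blocked n A)) (ball1 0 n)"
  using assms(1) unfolding reach_def[of A]
proof (induction rule: converse_rtrancl_induct)
  case (step x y)
  then have xy: "x \<in> ball1 0 n" "y \<in> ball1 0 n" "E x y" "f x y \<in> A"
    and yz: "(y, z) \<in> reach A (ball1 0 n)" by (auto simp: reach_def)
  have "y \<notin> blocked n A" using yz assms(2) by (auto simp: blocked_def)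
  then have "f x y \<in> A - bonds (blocked n A)" using xy f_in_bonds_iff by auto
  then have "(x, y) \<in> reach (A - bonds (blocked n A)) (ball1 0 n)" using xy by (intro reach_single) auto
  then show ?case using step.IH by (rule reach_trans)
qed (simp add: reach_def)

lemma blocked_mono: "A \<subseteq> A' \<Longrightarrow> blocked n A' \<subseteq> blocked n A"
  unfolding blocked_def using reach_mono[of A A' "ball1 0 n" "ball1 0 n"] by blast

lemma blocked_local: "blocked n A = S \<longleftrightarrow> blocked n (A - bonds S) = S"
proof
  assume S: "blocked n A = S"
  have "blocked n A \<subseteq> blocked n (A - bonds S)" by (rule blocked_mono) auto
  moreover have "blocked n (A - bonds S) \<subseteq> blocked n A"
    using not_blocked_reach[of _ _ A n] S by (auto simp: blocked_def)
  ultimately show "blocked n (A - bonds S) = S" using S by simp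
next
  assume S: "blocked n (A - bonds S) = S"
  have "blocked n A \<subseteq> S" using blocked_mono[of "A - bonds S" A n] S by simp
  moreover have out: "z \<notin> S \<and> x \<notin> S" if "(x, z) \<in> reach A (ball1 0 n)" "l1 z = int n" "x \<in> ball1 0 n" for x z
    using that(1,3) unfolding reach_def[of A]
  proof (induction rule: converse_rtrancl_induct)
    case base
    have "z \<notin> blocked n (A - bonds S)" using blocked_small[of z n "A - bonds S"] that(2) by auto
    then show ?case using S by simp
  next
    case (step x y)
    then have xy: "x \<in> ball1 0 n" "y \<in> ball1 0 n" "E x y" "f x y \<in> A" and yS: "y \<notin> S" "z \<notin> S" by auto
    have "y \<notin> blocked n (A - bonds S)" using yS S by simp
    then obtain w where w: "l1 w = int n" "(y, w) \<in> reach (A - bonds S) (ball1 0 n)"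
      using xy by (auto simp: blocked_def)
    have "f x y \<in> A - bonds S" using xy yS f_in_bonds_iff by auto
    then have "(x, y) \<in> reach (A - bonds S) (ball1 0 n)" using xy by (intro reach_single) auto
    then have "(x, w) \<in> reach (A - bonds S) (ball1 0 n)" using w(2) by (rule reach_trans)
    then have "x \<notin> blocked n (A - bonds S)" using w(1) by (auto simp: blocked_def)
    then show ?case using S yS by simp
  qed
  have "S \<subseteq> ball1 0 n" using S by (auto simp: blocked_def)
  then have "S \<subseteq> blocked n A" using out by (auto simp: blocked_def)
  ultimately show "blocked n A = S" by simp
qed

lemma outf_iff_blocked: "outf 0 n A \<longleftrightarrow> 0 \<notin> blocked n A"
  by (auto simp: outf_def blocked_def ball1_def)

text \<open>Given \<open>blocked n A = S\<close>, the open bonds inside \<open>S\<close> are undisturbed, and every bond that leaves \<open>S\<close>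
  from the cluster of \<open>0\<close> in \<open>S\<close> is closed and pivotal.\<close>

lemma pivotal:
  assumes S: "blocked n A = S" and xy: "x \<in> S" "y \<in> nbr x - S" "(0, x) \<in> reach A S"
  shows "f x y \<notin> A" "f x y \<in> bonds (ball1 0 n)" "outf 0 n (insert (f x y) A)"
proof -
  have E: "E x y" using xy by (simp add: nbr_def)
  have x: "l1 x < int n" using blocked_small xy(1) S by blast
  have y: "y \<in> ball1 0 n" using adj_l1_diff[OF E_adj[OF E], of 0] x by (simp add: ball1_def)
  then obtain w where w: "l1 w = int n" "(y, w) \<in> reach A (ball1 0 n)"
    using xy(2) S by (auto simp: blocked_def)
  have xB: "x \<in> ball1 0 n" using x by (simp add: ball1_def)
  show "f x y \<notin> A"
  proof
    assume "f x y \<in> A"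
    then have "(x, y) \<in> reach A (ball1 0 n)" using xB y E by (intro reach_single) auto
    then have "(x, w) \<in> reach A (ball1 0 n)" using w(2) by (rule reach_trans)
    then show False using w(1) xy(1) S by (auto simp: blocked_def)
  qed
  show "f x y \<in> bonds (ball1 0 n)" using f_in_bonds_iff[OF E] xB y by simp
  let ?A = "insert (f x y) A"
  have "S \<subseteq> ball1 0 n" using S by (auto simp: blocked_def)
  then have "(0, x) \<in> reach ?A (ball1 0 n)" using xy(3) reach_mono[of A ?A S "ball1 0 n"] by blast
  moreover have "(x, y) \<in> reach ?A (ball1 0 n)" using xB y E by (intro reach_single) auto
  moreover have "(y, w) \<in> reach ?A (ball1 0 n)"
    using w(2) reach_mono[of A ?A "ball1 0 n" "ball1 0 n"] by blast
  ultimately have "(0, w) \<in> reach ?A (ball1 0 n)" by (meson reach_trans)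
  then show "outf 0 n ?A" using w(1) by (auto simp: outf_def)
qed

text \<open>The differential inequality of Duminil-Copin and Tassion.\<close>

lemma theta_deriv_ge:
  assumes p: "0 \<le> p" "p \<le> 1" and n: "n \<ge> 1"
    and phi: "\<And>S. finite S \<Longrightarrow> 0 \<in> S \<Longrightarrow> phi S p \<ge> 1"
  shows "\<exists>D. (theta n has_real_derivative D) (at p) \<and> 1 - theta n p \<le> D"
proof -
  define V where "V = ball1 (0 :: int^'d) (int n)"
  define F where "F = bonds V"
  have finV: "finite V" and finF: "finite F" by (simp_all add: F_def V_def)
  define g :: "'e set \<Rightarrow> real" where "g A = of_bool (outf 0 n A)" for A
  define piv :: "'e \<Rightarrow> 'e set \<Rightarrow> real" where "piv e A = of_bool (e \<notin> A \<and> outf 0 n (insert e A) \<and> \<not> outf 0 n A)" for e A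
  define D where "D = (\<Sum>e\<in>F. ex p (F - {e}) (\<lambda>A. g (insert e A) - g A))"
  have der: "(theta n has_real_derivative D) (at p)"
    using ex_deriv[OF finF, of g p] unfolding theta_def[abs_def] D_def F_def V_def g_def .
  have D_ge: "(\<Sum>e\<in>F. ex p F (piv e)) \<le> D"
    unfolding D_def
  proof (rule sum_mono)
    fix e assume e: "e \<in> F"
    have F: "F = insert e (F - {e})" using e by auto
    have "ex p F (piv e) = p * ex p (F - {e}) (\<lambda>A. piv e (insert e A)) + (1 - p) * ex p (F - {e}) (piv e)"
      by (subst F, rule ex_insert) (use finF in auto)
    also have "ex p (F - {e}) (\<lambda>A. piv e (insert e A)) = 0" by (simp add: piv_def ex_def)
    also have "(1 - p) * ex p (F - {e}) (piv e) \<le> 1 * ex p (F - {e}) (piv e)"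
      using p by (intro mult_right_mono ex_nonneg) (auto simp: piv_def)
    also have "ex p (F - {e}) (piv e) \<le> ex p (F - {e}) (\<lambda>A. g (insert e A) - g A)"
      by (rule ex_mono[OF p]) (auto simp: piv_def g_def intro: outf_mono[rotated])
    finally show "ex p F (piv e) \<le> ex p (F - {e}) (\<lambda>A. g (insert e A) - g A)" by simp
  qed
  define \<S> where "\<S> = {S \<in> Pow V. 0 \<in> S}"
  define H :: "(int^'d) set \<Rightarrow> 'e set \<Rightarrow> real" where
    "H S A = (\<Sum>x\<in>S. \<Sum>y\<in>nbr x - S. of_bool ((0, x) \<in> reach A S))" for S A
  have fin\<S>: "finite \<S>" using finV by (simp add: \<S>_def)
  have pw: "(\<Sum>S\<in>\<S>. of_bool (blocked n A = S) * H S A) \<le> (\<Sum>e\<in>F. piv e A)" if "A \<subseteq> F" for A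
  proof (cases "outf 0 n A")
    case True
    then have "(\<Sum>S\<in>\<S>. of_bool (blocked n A = S) * H S A) = 0"
      by (intro sum.neutral) (auto simp: outf_iff_blocked \<S>_def)
    then show ?thesis by (auto simp: piv_def intro!: sum_nonneg)
  next
    case False
    define S where "S = blocked n A"
    have S: "S \<in> \<S>" using False by (auto simp: outf_iff_blocked \<S>_def S_def blocked_def V_def)
    have finS: "finite S" using S finV by (auto simp: \<S>_def intro: finite_subset)
    have "(\<Sum>T\<in>\<S>. of_bool (blocked n A = T) * H T A) = (\<Sum>T\<in>\<S>. if S = T then H T A else 0)"
      by (intro sum.cong) (auto simp: S_def)
    also have "\<dots> = H S A" using S fin\<S> by (simp add: sum.delta)
    also have "\<dots> = (\<Sum>(x, y)\<in>(SIGMA x:S. nbr x - S). of_bool ((0, x) \<in> reach A S))"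
      unfolding H_def by (rule sum.Sigma) (use finS in auto)
    also have "\<dots> = (\<Sum>z\<in>{z \<in> (SIGMA x:S. nbr x - S). (0, fst z) \<in> reach A S}. 1)"
    proof -
      have fs: "finite (SIGMA x:S. nbr x - S)" using finS by auto
      show ?thesis by (subst sum.inter_filter[OF fs]) (auto intro!: sum.cong)
    qed
    also have "\<dots> = (\<Sum>z\<in>{z \<in> (SIGMA x:S. nbr x - S). (0, fst z) \<in> reach A S}. piv (f (fst z) (snd z)) A)"
    proof (rule sum.cong)
      fix z assume "z \<in> {z \<in> (SIGMA x:S. nbr x - S). (0, fst z) \<in> reach A S}"
      then have "fst z \<in> S" "snd z \<in> nbr (fst z) - S" "(0, fst z) \<in> reach A S" by auto
      from pivotal[OF S_def[symmetric] this] show "1 = piv (f (fst z) (snd z)) A"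
        using False by (simp add: piv_def)
    qed simp
    also have "\<dots> = (\<Sum>e\<in>(\<lambda>z. f (fst z) (snd z)) ` {z \<in> (SIGMA x:S. nbr x - S). (0, fst z) \<in> reach A S}. piv e A)"
    proof (subst sum.reindex)
      show "inj_on (\<lambda>z. f (fst z) (snd z)) {z \<in> (SIGMA x:S. nbr x - S). (0, fst z) \<in> reach A S}"
      proof (rule inj_onI)
        fix z w assume z: "z \<in> {z \<in> (SIGMA x:S. nbr x - S). (0, fst z) \<in> reach A S}"
          and w: "w \<in> {z \<in> (SIGMA x:S. nbr x - S). (0, fst z) \<in> reach A S}"
          and eq: "f (fst z) (snd z) = f (fst w) (snd w)"
        have "E (fst z) (snd z)" "E (fst w) (snd w)" "fst z \<in> S" "snd z \<notin> S" "fst w \<in> S" "snd w \<notin> S"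
          using z w by (auto simp: nbr_def)
        then show "z = w" using f_inj[OF _ _ eq] by (metis prod.expand)
      qed
    qed simp
    also have "\<dots> \<le> (\<Sum>e\<in>F. piv e A)"
    proof (rule sum_mono2[OF finF])
      show "(\<lambda>z. f (fst z) (snd z)) ` {z \<in> (SIGMA x:S. nbr x - S). (0, fst z) \<in> reach A S} \<subseteq> F"
      proof
        fix e assume "e \<in> (\<lambda>z. f (fst z) (snd z)) ` {z \<in> (SIGMA x:S. nbr x - S). (0, fst z) \<in> reach A S}"
        then obtain z where "e = f (fst z) (snd z)" "fst z \<in> S" "snd z \<in> nbr (fst z) - S" "(0, fst z) \<in> reach A S"
          by auto
        then show "e \<in> F" using pivotal(2)[OF S_def[symmetric]] unfolding F_def V_def by blast
      qed
    qed (simp add: piv_def)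
    finally show ?thesis .
  qed
  have exH: "ex p F (\<lambda>A. of_bool (blocked n A = S) * H S A) \<ge> ex p F (\<lambda>A. of_bool (blocked n A = S))"
    if S: "S \<in> \<S>" for S
  proof -
    have SV: "S \<subseteq> V" "0 \<in> S" and finS: "finite S" using S finV by (auto simp: \<S>_def intro: finite_subset)
    have sub: "F - bonds S \<subseteq> F" "bonds S \<subseteq> F" "(F - bonds S) \<inter> bonds S = {}"
      using bonds_mono[OF SV(1)] by (auto simp: F_def)
    have bl: "of_bool (blocked n A = S) = (of_bool (blocked n (A \<inter> (F - bonds S)) = S) :: real)" if "A \<subseteq> F" for A
    proof -
      have "A \<inter> (F - bonds S) = A - bonds S" using that by auto
      then show ?thesis using blocked_local[of n A S] by simp
    qed
    have "ex p F (\<lambda>A. of_bool (blocked n A = S) * H S A) =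
        ex p F (\<lambda>A. of_bool (blocked n (A \<inter> (F - bonds S)) = S) * H S (A \<inter> bonds S))"
      by (rule ex_cong) (simp add: bl H_def reach_bonds)
    also have "\<dots> = ex p (F - bonds S) (\<lambda>A. of_bool (blocked n A = S)) * ex p (bonds S) (H S)"
      by (rule ex_indep_subset[OF finF sub, of p "\<lambda>A. of_bool (blocked n A = S)" "H S"])
    also have "ex p (F - bonds S) (\<lambda>A. of_bool (blocked n A = S)) = ex p F (\<lambda>A. of_bool (blocked n A = S) :: real)"
      by (rule ex_local[symmetric, OF finF sub(1)]) (rule bl)
    also have "ex p (bonds S) (H S) = phi S p"
      unfolding H_def[abs_def] phi_def by (simp only: ex_sum)
    finally show ?thesis
      using mult_left_mono[OF phi[OF finS SV(2)], of "ex p F (\<lambda>A. of_bool (blocked n A = S))"] p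
      by (simp add: ex_nonneg)
  qed
  have "theta n p = ex p F g" by (simp add: theta_def F_def V_def g_def[abs_def])
  then have "1 - theta n p = ex p F (\<lambda>A. 1 - g A)" by (simp only: ex_diff ex_const[OF finF])
  also have "\<dots> = ex p F (\<lambda>A. \<Sum>S\<in>\<S>. of_bool (blocked n A = S))"
  proof (rule ex_cong)
    fix A
    have "(\<Sum>S\<in>\<S>. of_bool (blocked n A = S)) = (\<Sum>S\<in>\<S>. if blocked n A = S then 1 else (0::real))"
      by (intro sum.cong) auto
    also have "\<dots> = of_bool (blocked n A \<in> \<S>)" using fin\<S> by (simp add: sum.delta)
    also have "blocked n A \<in> \<S> \<longleftrightarrow> \<not> outf 0 n A"
      by (auto simp: \<S>_def outf_iff_blocked blocked_def V_def)
    finally show "1 - g A = (\<Sum>S\<in>\<S>. of_bool (blocked n A = S))" by (simp add: g_def)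
  qed
  also have "\<dots> = (\<Sum>S\<in>\<S>. ex p F (\<lambda>A. of_bool (blocked n A = S)))" by (rule ex_sum)
  also have "\<dots> \<le> (\<Sum>S\<in>\<S>. ex p F (\<lambda>A. of_bool (blocked n A = S) * H S A))"
    by (rule sum_mono) (rule exH)
  also have "\<dots> = ex p F (\<lambda>A. \<Sum>S\<in>\<S>. of_bool (blocked n A = S) * H S A)" by (rule ex_sum[symmetric])
  also have "\<dots> \<le> ex p F (\<lambda>A. \<Sum>e\<in>F. piv e A)" by (rule ex_mono[OF p pw])
  also have "\<dots> = (\<Sum>e\<in>F. ex p F (piv e))" by (rule ex_sum)
  also note D_ge
  finally show ?thesis using der by blast
qed

lemma reach_mono_config: "A \<subseteq> A' \<Longrightarrow> (x, y) \<in> reach A S \<Longrightarrow> (x, y) \<in> reach A' S"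
  using reach_mono[of A A' S S] by blast

lemma phi_mono:
  assumes "finite S" "0 \<le> p" "p \<le> q" "q \<le> 1" shows "phi S p \<le> phi S q"
  unfolding phi_def
  by (intro sum_mono ex_mono_param assms finite_bonds) (auto simp: of_bool_def intro: reach_mono_config)

lemma theta_exp_bound:
  assumes S: "finite S" "0 \<in> S" "p * phi S p < 1" and p: "0 \<le> p" "p \<le> 1"
  shows "\<exists>C \<rho>. 0 \<le> \<rho> \<and> \<rho> < 1 \<and> (\<forall>n. theta n p \<le> C * \<rho> ^ n)"
proof -
  define L where "L = nat (Max (l1 ` S)) + 1"
  have L: "l1 x < int L" if "x \<in> S" for x
  proof -
    have "l1 x \<le> Max (l1 ` S)" using that S(1) by simp
    moreover from this have "0 \<le> Max (l1 ` S)" using l1_nonneg[of x] by linarith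
    ultimately show ?thesis by (simp add: L_def)
  qed
  have "L \<ge> 1" by (simp add: L_def)
  define r where "r = max (p * phi S p) (1 / 2)"
  have r: "r > 0" "r < 1" "p * phi S p \<le> r" using S(3) by (auto simp: r_def)
  have step: "theta (n + L) p \<le> r * theta n p" for n
    using theta_decay[OF p S(1,2) L, of n] r(3) theta_bounds[OF p, of n]
    by (meson mult_right_mono order_trans)
  have it: "theta (k * L + m) p \<le> r ^ k" for k m
  proof (induction k)
    case (Suc k)
    have "theta (Suc k * L + m) p \<le> r * theta (k * L + m) p"
      using step[of "k * L + m"] by (simp add: algebra_simps)
    also have "\<dots> \<le> r * r ^ k" using Suc r by (intro mult_left_mono) auto
    finally show ?case by simp
  qed (use theta_bounds[OF p] in simp)
  define \<rho> where "\<rho> = root L r"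
  have \<rho>: "\<rho> ^ L = r" "0 < \<rho>" "\<rho> < 1" using \<open>L \<ge> 1\<close> r by (auto simp: \<rho>_def)
  have "theta n p \<le> (1 / r) * \<rho> ^ n" for n
  proof -
    have "theta n p \<le> r ^ (n div L)" using it[of "n div L" "n mod L"] by simp
    also have "\<dots> = (1 / r) * \<rho> ^ (L * Suc (n div L))" unfolding power_mult \<rho>(1) using r by simp
    also have "\<dots> \<le> (1 / r) * \<rho> ^ n"
    proof (intro mult_left_mono power_decreasing)
      show "n \<le> L * Suc (n div L)"
        using \<open>L \<ge> 1\<close> by (metis add.commute div_mult_mod_eq less_imp_le mod_less_divisor mult.commute mult_Suc_right nat_add_left_cancel_le zero_less_one order_less_le_trans)
    qed (use \<rho> r in auto)
    finally show ?thesis .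
  qed
  then show ?thesis using \<rho> by (intro exI[of _ "1 / r"] exI[of _ \<rho>]) auto
qed

theorem sharpness:
  assumes p: "0 \<le> p0" "p0 < p1" "p1 \<le> 1" and zero: "\<And>\<epsilon>. \<epsilon> > 0 \<Longrightarrow> \<exists>n\<ge>1. theta n p1 < \<epsilon>"
  shows "\<exists>C \<rho>. 0 \<le> \<rho> \<and> \<rho> < 1 \<and> (\<forall>n. theta n p0 \<le> C * \<rho> ^ n)"
proof (cases "\<exists>S. finite S \<and> 0 \<in> S \<and> p0 * phi S p0 < 1")
  case True
  then show ?thesis using theta_exp_bound[of _ p0] p by auto
next
  case False
  have ph: "phi S q \<ge> 1" if "p0 \<le> q" "q \<le> p1" "finite S" "0 \<in> S" for q S
  proof -
    have "0 \<le> phi S p0" unfolding phi_def using p by (intro sum_nonneg ex_nonneg) auto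
    then have "p0 * phi S p0 \<le> 1 * phi S p0" using p by (intro mult_right_mono) auto
    then have "1 \<le> phi S p0" using False that by force
    also have "\<dots> \<le> phi S q" using phi_mono that p by auto
    finally show ?thesis .
  qed
  define \<epsilon> where "\<epsilon> = 1 - exp (- (p1 - p0))"
  have "\<epsilon> > 0" using p by (simp add: \<epsilon>_def)
  then obtain n where n: "n \<ge> 1" "theta n p1 < \<epsilon>" using zero by blast
  have "exp p1 * (1 - theta n p1) \<le> exp p0 * (1 - theta n p0)"
  proof (rule DERIV_nonpos_imp_nonincreasing[where f = "\<lambda>q. exp q * (1 - theta n q)"])
    show "p0 \<le> p1" using p by simp
    fix q assume q: "p0 \<le> q" "q \<le> p1"
    obtain D where D: "(theta n has_real_derivative D) (at q)" "1 - theta n q \<le> D"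
      using theta_deriv_ge[of q n] ph[OF q] q p n by auto
    have "((\<lambda>q. exp q * (1 - theta n q)) has_real_derivative exp q * (1 - theta n q) + exp q * (0 - D)) (at q)"
      by (auto intro!: derivative_eq_intros D(1))
    moreover have "exp q * (1 - theta n q) + exp q * (0 - D) \<le> 0"
      using mult_left_mono[OF D(2), of "exp q"] by simp
    ultimately show "\<exists>y. ((\<lambda>q. exp q * (1 - theta n q)) has_real_derivative y) (at q) \<and> y \<le> 0" by blast
  qed
  also have "\<dots> \<le> exp p0 * 1" using theta_bounds[of p0 n] p by (intro mult_left_mono) auto
  finally have "1 - theta n p1 \<le> exp (- (p1 - p0))"
    by (simp add: exp_diff field_simps exp_minus)
  then show ?thesis using n(2) by (simp add: \<epsilon>_def)
qed

end

section \<open>Independent families on product spaces\<close>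

locale iid_product = prob_space N for N :: "'b measure" +
  fixes I :: "'i set"
begin

abbreviation PP :: "'i set \<Rightarrow> ('i \<Rightarrow> 'b) measure" where "PP J \<equiv> PiM J (\<lambda>_. N)"

sublocale P: product_prob_space "\<lambda>_. N" I by unfold_locales

lemma prob_PP: "prob_space (PP J)"
  by (rule prob_space_PiM) (rule prob_space_axioms)

lemma measurable_merge_I:
  assumes "J \<subseteq> I" shows "merge J (I - J) \<in> PP J \<Otimes>\<^sub>M PP (I - J) \<rightarrow>\<^sub>M PP I"
proof -
  have "J \<union> (I - J) = I" using assms by auto
  then show ?thesis using measurable_merge[of J "I - J" "\<lambda>_. N"] by simp
qed

lemma distr_merge_I:
  assumes J: "J \<subseteq> I"
  shows "distr (PP J \<Otimes>\<^sub>M PP (I - J)) (PP I) (merge J (I - J)) = PP I"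
proof (rule P.PiM_eq)
  interpret A: prob_space "PP J" by (rule prob_PP)
  interpret B: prob_space "PP (I - J)" by (rule prob_PP)
  fix K F assume K: "finite K" "K \<subseteq> I" and F: "\<And>j. j \<in> K \<Longrightarrow> F j \<in> sets N"
  let ?X = "prod_emb I (\<lambda>_. N) K (Pi\<^sub>E K F)"
  let ?A = "prod_emb J (\<lambda>_. N) (K \<inter> J) (Pi\<^sub>E (K \<inter> J) F)"
  let ?B = "prod_emb (I - J) (\<lambda>_. N) (K - J) (Pi\<^sub>E (K - J) F)"
  have X: "?X \<in> sets (PP I)" using K F by (intro sets_PiM_I) auto
  have sA: "?A \<in> sets (PP J)" using K F by (intro sets_PiM_I) auto
  have sB: "?B \<in> sets (PP (I - J))" using K F by (intro sets_PiM_I) auto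
  have "merge J (I - J) -` ?X \<inter> space (PP J \<Otimes>\<^sub>M PP (I - J)) = ?A \<times> ?B" (is "?L = ?R")
  proof (intro set_eqI)
    fix z show "z \<in> ?L \<longleftrightarrow> z \<in> ?R"
    proof (cases z)
      case (Pair x y)
      have "(\<forall>i\<in>K. merge J (I - J) (x, y) i \<in> F i) \<longleftrightarrow> (\<forall>i\<in>K \<inter> J. x i \<in> F i) \<and> (\<forall>i\<in>K - J. y i \<in> F i)"
        using K(2) by (auto simp: merge_def)
      moreover have "merge J (I - J) (x, y) \<in> space (PP I)" if "x \<in> space (PP J)" "y \<in> space (PP (I - J))"
        using measurable_space[OF measurable_merge_I[OF J], of "(x, y)"] that by (simp add: space_pair_measure)
      ultimately show ?thesis
        using K(2) unfolding Pair by (auto simp: prod_emb_def space_pair_measure space_PiM PiE_iff)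
    qed
  qed
  then have "emeasure (distr (PP J \<Otimes>\<^sub>M PP (I - J)) (PP I) (merge J (I - J))) ?X = emeasure (PP J \<Otimes>\<^sub>M PP (I - J)) (?A \<times> ?B)"
    using X measurable_merge_I[OF J] by (simp add: emeasure_distr)
  also have "\<dots> = emeasure (PP J) ?A * emeasure (PP (I - J)) ?B"
    by (rule B.emeasure_pair_measure_Times[OF sA sB])
  also have "emeasure (PP J) ?A = (\<Prod>i\<in>K \<inter> J. emeasure N (F i))"
    using K F by (intro emeasure_PiM_emb prob_space_axioms) auto
  also have "emeasure (PP (I - J)) ?B = (\<Prod>i\<in>K - J. emeasure N (F i))"
    using K F by (intro emeasure_PiM_emb prob_space_axioms) auto
  also have "(\<Prod>i\<in>K \<inter> J. emeasure N (F i)) * (\<Prod>i\<in>K - J. emeasure N (F i)) = (\<Prod>i\<in>K. emeasure N (F i))"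
    using prod.Int_Diff[OF K(1), of "\<lambda>i. emeasure N (F i)" J] by simp
  finally show "emeasure (distr (PP J \<Otimes>\<^sub>M PP (I - J)) (PP I) (merge J (I - J))) ?X = (\<Prod>j\<in>K. emeasure N (F j))" .
qed simp

definition depends_on :: "'i set \<Rightarrow> ('i \<Rightarrow> 'b) set \<Rightarrow> bool" where
  "depends_on J X \<longleftrightarrow> (\<forall>t\<in>space (PP I). \<forall>s\<in>space (PP I). (\<forall>e\<in>J. t e = s e) \<longrightarrow> t \<in> X \<longrightarrow> s \<in> X)"

lemma depends_onI:
  "(\<And>t s. t \<in> space (PP I) \<Longrightarrow> s \<in> space (PP I) \<Longrightarrow> (\<And>e. e \<in> J \<Longrightarrow> t e = s e) \<Longrightarrow> t \<in> X \<Longrightarrow> s \<in> X) \<Longrightarrow> depends_on J X"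
  unfolding depends_on_def by blast

lemma depends_onD:
  "depends_on J X \<Longrightarrow> t \<in> space (PP I) \<Longrightarrow> s \<in> space (PP I) \<Longrightarrow> (\<And>e. e \<in> J \<Longrightarrow> t e = s e) \<Longrightarrow> t \<in> X \<Longrightarrow> s \<in> X"
  unfolding depends_on_def by blast

lemma depends_on_mono: "depends_on J X \<Longrightarrow> J \<subseteq> J' \<Longrightarrow> depends_on J' X"
  unfolding depends_on_def by blast

lemma depends_on_Int: "depends_on J X \<Longrightarrow> depends_on J Y \<Longrightarrow> depends_on J (X \<inter> Y)"
  unfolding depends_on_def by blast

lemma measure_via_merge:
  assumes J: "J \<subseteq> I" and X: "X \<in> sets (PP I)"
  shows "emeasure (PP I) X = emeasure (PP J \<Otimes>\<^sub>M PP (I - J)) (merge J (I - J) -` X \<inter> space (PP J \<Otimes>\<^sub>M PP (I - J)))"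
  using emeasure_distr[OF measurable_merge_I[OF J] X] distr_merge_I[OF J] by simp

lemma space_merge:
  assumes "J \<subseteq> I" "x \<in> space (PP J)" "y \<in> space (PP (I - J))"
  shows "merge J (I - J) (x, y) \<in> space (PP I)"
  using measurable_space[OF measurable_merge_I[OF assms(1)], of "(x, y)"] assms by (simp add: space_pair_measure)

lemma depends_on_left:
  assumes J: "J \<subseteq> I" and X: "X \<in> sets (PP I)" "depends_on J X"
  shows "\<exists>X'\<in>sets (PP J). (\<forall>x\<in>space (PP J). \<forall>y\<in>space (PP (I - J)). merge J (I - J) (x, y) \<in> X \<longleftrightarrow> x \<in> X') \<and>
     emeasure (PP I) X = emeasure (PP J) X'"
proof -
  interpret B: prob_space "PP (I - J)" by (rule prob_PP)
  obtain y0 where y0: "y0 \<in> space (PP (I - J))" using B.not_empty by blast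
  define X' where "X' = (\<lambda>x. merge J (I - J) (x, y0)) -` X \<inter> space (PP J)"
  have "(\<lambda>x. merge J (I - J) (x, y0)) \<in> PP J \<rightarrow>\<^sub>M PP I"
    by (rule measurable_compose[OF measurable_Pair2'[OF y0] measurable_merge_I[OF J]])
  then have X': "X' \<in> sets (PP J)" unfolding X'_def using X(1) by (rule measurable_sets)
  have iff: "merge J (I - J) (x, y) \<in> X \<longleftrightarrow> x \<in> X'" if "x \<in> space (PP J)" "y \<in> space (PP (I - J))" for x y
  proof -
    have "merge J (I - J) (x, y) e = merge J (I - J) (x, y0) e" if "e \<in> J" for e using that by (simp add: merge_def)
    then show ?thesis
      using depends_onD[OF X(2) space_merge[OF J that] space_merge[OF J that(1) y0]]
        depends_onD[OF X(2) space_merge[OF J that(1) y0] space_merge[OF J that]] that(1)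
      by (auto simp: X'_def)
  qed
  have "merge J (I - J) -` X \<inter> space (PP J \<Otimes>\<^sub>M PP (I - J)) = X' \<times> space (PP (I - J))"
    using iff X'_def by (auto simp: space_pair_measure)
  then have "emeasure (PP I) X = emeasure (PP J) X'"
    using measure_via_merge[OF J X(1)] B.emeasure_pair_measure_Times[OF X' sets.top] by (simp add: B.emeasure_space_1)
  then show ?thesis using X' iff by blast
qed

lemma depends_on_right:
  assumes J: "J \<subseteq> I" and X: "X \<in> sets (PP I)" "depends_on (I - J) X"
  shows "\<exists>X'\<in>sets (PP (I - J)). (\<forall>x\<in>space (PP J). \<forall>y\<in>space (PP (I - J)). merge J (I - J) (x, y) \<in> X \<longleftrightarrow> y \<in> X') \<and>
     emeasure (PP I) X = emeasure (PP (I - J)) X'"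
proof -
  interpret A: prob_space "PP J" by (rule prob_PP)
  interpret B: prob_space "PP (I - J)" by (rule prob_PP)
  obtain x0 where x0: "x0 \<in> space (PP J)" using A.not_empty by blast
  define X' where "X' = (\<lambda>y. merge J (I - J) (x0, y)) -` X \<inter> space (PP (I - J))"
  have "(\<lambda>y. merge J (I - J) (x0, y)) \<in> PP (I - J) \<rightarrow>\<^sub>M PP I"
    by (rule measurable_compose[OF measurable_Pair1'[OF x0] measurable_merge_I[OF J]])
  then have X': "X' \<in> sets (PP (I - J))" unfolding X'_def using X(1) by (rule measurable_sets)
  have iff: "merge J (I - J) (x, y) \<in> X \<longleftrightarrow> y \<in> X'" if "x \<in> space (PP J)" "y \<in> space (PP (I - J))" for x y
  proof -
    have "merge J (I - J) (x, y) e = merge J (I - J) (x0, y) e" if "e \<in> I - J" for e using that by (simp add: merge_def)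
    then show ?thesis
      using depends_onD[OF X(2) space_merge[OF J that] space_merge[OF J x0 that(2)]]
        depends_onD[OF X(2) space_merge[OF J x0 that(2)] space_merge[OF J that]] that(2)
      by (auto simp: X'_def)
  qed
  have "merge J (I - J) -` X \<inter> space (PP J \<Otimes>\<^sub>M PP (I - J)) = space (PP J) \<times> X'"
    using iff X'_def by (auto simp: space_pair_measure)
  then have "emeasure (PP I) X = emeasure (PP (I - J)) X'"
    using measure_via_merge[OF J X(1)] B.emeasure_pair_measure_Times[OF sets.top[of "PP J"] X'] by (simp add: A.emeasure_space_1)
  then show ?thesis using X' iff by blast
qed

lemma indep_depends_on:
  assumes J: "J \<subseteq> I" and X: "X \<in> sets (PP I)" "depends_on J X" and Y: "Y \<in> sets (PP I)" "depends_on K Y"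
    and JK: "J \<inter> K = {}" "K \<subseteq> I"
  shows "measure (PP I) (X \<inter> Y) = measure (PP I) X * measure (PP I) Y"
proof -
  interpret B: prob_space "PP (I - J)" by (rule prob_PP)
  have Y': "depends_on (I - J) Y" by (rule depends_on_mono[OF Y(2)]) (use JK in auto)
  obtain X' where X': "X' \<in> sets (PP J)" "emeasure (PP I) X = emeasure (PP J) X'"
    "\<forall>x\<in>space (PP J). \<forall>y\<in>space (PP (I - J)). merge J (I - J) (x, y) \<in> X \<longleftrightarrow> x \<in> X'"
    using depends_on_left[OF J X] by blast
  obtain Y' where Y': "Y' \<in> sets (PP (I - J))" "emeasure (PP I) Y = emeasure (PP (I - J)) Y'"
    "\<forall>x\<in>space (PP J). \<forall>y\<in>space (PP (I - J)). merge J (I - J) (x, y) \<in> Y \<longleftrightarrow> y \<in> Y'"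
    using depends_on_right[OF J Y(1) Y'] by blast
  have "merge J (I - J) -` (X \<inter> Y) \<inter> space (PP J \<Otimes>\<^sub>M PP (I - J)) = X' \<times> Y'"
  proof -
    have sp: "a \<in> space (PP J)" "b \<in> space (PP (I - J))" if "a \<in> X'" "b \<in> Y'" for a b
      using that sets.sets_into_space[OF X'(1)] sets.sets_into_space[OF Y'(1)] by auto
    show ?thesis using X'(3) Y'(3) by (auto simp: space_pair_measure sp)
  qed
  then have "emeasure (PP I) (X \<inter> Y) = emeasure (PP I) X * emeasure (PP I) Y"
    using measure_via_merge[OF J, of "X \<inter> Y"] X Y B.emeasure_pair_measure_Times[OF X'(1) Y'(1)] X'(2) Y'(2) by simp
  then show ?thesis by (simp add: measure_def enn2real_mult)
qed

text \<open>Resampling the coordinates in \<open>J\<close>: if replacing the \<open>J\<close>-part of any configuration in \<open>F\<close> by one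
  in \<open>H\<close> leads to \<open>G\<close>, then \<open>G\<close> is at least as likely as \<open>F\<close> and \<open>H\<close> for independent configurations.\<close>

lemma resample:
  assumes J: "J \<subseteq> I" and F: "F \<in> sets (PP I)" and H: "H \<in> sets (PP I)" "depends_on J H" and G: "G \<in> sets (PP I)"
    and imp: "\<And>t s r. t \<in> F \<Longrightarrow> s \<in> H \<Longrightarrow> r \<in> space (PP I) \<Longrightarrow> (\<And>e. e \<in> J \<Longrightarrow> r e = s e) \<Longrightarrow>
       (\<And>e. e \<in> I - J \<Longrightarrow> r e = t e) \<Longrightarrow> r \<in> G"
  shows "measure (PP I) F * measure (PP I) H \<le> measure (PP I) G"
proof -
  interpret A: prob_space "PP J" by (rule prob_PP)
  interpret B: prob_space "PP (I - J)" by (rule prob_PP)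
  interpret AB: pair_sigma_finite "PP J" "PP (I - J)" by unfold_locales
  obtain H' where H': "H' \<in> sets (PP J)" "emeasure (PP I) H = emeasure (PP J) H'"
    "\<forall>x\<in>space (PP J). \<forall>y\<in>space (PP (I - J)). merge J (I - J) (x, y) \<in> H \<longleftrightarrow> x \<in> H'"
    using depends_on_left[OF J H] by blast
  define F' where "F' = merge J (I - J) -` F \<inter> space (PP J \<Otimes>\<^sub>M PP (I - J))"
  have F': "F' \<in> sets (PP J \<Otimes>\<^sub>M PP (I - J))"
    unfolding F'_def using measurable_merge_I[OF J] F by (rule measurable_sets)
  define m where "m y = emeasure (PP J) ((\<lambda>x. (x, y)) -` F')" for y
  have m: "m \<in> borel_measurable (PP (I - J))"
    unfolding m_def using F' by (rule AB.measurable_emeasure_Pair2)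
  define Z where "Z = {y \<in> space (PP (I - J)). m y > 0}"
  have Z: "Z \<in> sets (PP (I - J))" unfolding Z_def using m by measurable
  have "emeasure (PP I) F = (\<integral>\<^sup>+ y. m y \<partial>PP (I - J))"
    unfolding m_def measure_via_merge[OF J F] F'_def[symmetric] by (rule AB.emeasure_pair_measure_alt2[OF F'])
  also have "\<dots> \<le> (\<integral>\<^sup>+ y. indicator Z y \<partial>PP (I - J))"
  proof (rule nn_integral_mono)
    fix y assume "y \<in> space (PP (I - J))"
    then show "m y \<le> indicator Z y"
      unfolding m_def using A.measure_le_1 by (auto simp: Z_def indicator_def m_def A.emeasure_le_1 split: if_splits)
  qed
  also have "\<dots> = emeasure (PP (I - J)) Z" using Z by simp
  finally have FZ: "emeasure (PP I) F \<le> emeasure (PP (I - J)) Z" .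
  define G' where "G' = merge J (I - J) -` G \<inter> space (PP J \<Otimes>\<^sub>M PP (I - J))"
  have G': "G' \<in> sets (PP J \<Otimes>\<^sub>M PP (I - J))"
    unfolding G'_def using measurable_merge_I[OF J] G by (rule measurable_sets)
  have sub: "H' \<times> Z \<subseteq> G'"
  proof
    fix z assume "z \<in> H' \<times> Z"
    then obtain x y where z: "z = (x, y)" "x \<in> H'" "y \<in> Z" by auto
    have xs: "x \<in> space (PP J)" using z(2) sets.sets_into_space[OF H'(1)] by auto
    have ys: "y \<in> space (PP (I - J))" using z(3) by (simp add: Z_def)
    have "(\<lambda>x. (x, y)) -` F' \<noteq> {}"
    proof
      assume "(\<lambda>x. (x, y)) -` F' = {}"
      then have "m y = 0" by (simp add: m_def)
      then show False using z(3) by (simp add: Z_def)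
    qed
    then obtain x' where "(x', y) \<in> F'" by auto
    then have x': "x' \<in> space (PP J)" "merge J (I - J) (x', y) \<in> F" by (auto simp: F'_def space_pair_measure)
    have "merge J (I - J) (x, y) \<in> G"
    proof (rule imp[OF x'(2)])
      show "merge J (I - J) (x, y) \<in> H" using H'(3) xs ys z(2) by blast
      show "merge J (I - J) (x, y) \<in> space (PP I)" by (rule space_merge[OF J xs ys])
    qed (auto simp: merge_def)
    then show "z \<in> G'" using z(1) xs ys by (simp add: G'_def space_pair_measure)
  qed
  have "emeasure (PP I) F * emeasure (PP I) H \<le> emeasure (PP (I - J)) Z * emeasure (PP J) H'"
    using FZ H'(2) by (intro mult_mono) auto
  also have "\<dots> = emeasure (PP J \<Otimes>\<^sub>M PP (I - J)) (H' \<times> Z)"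
    using B.emeasure_pair_measure_Times[OF H'(1) Z] by (simp add: mult.commute)
  also have "\<dots> \<le> emeasure (PP J \<Otimes>\<^sub>M PP (I - J)) G'"
    by (rule emeasure_mono[OF sub G'])
  also have "\<dots> = emeasure (PP I) G" by (simp add: measure_via_merge[OF J G] G'_def)
  finally have "emeasure (PP I) F * emeasure (PP I) H \<le> emeasure (PP I) G" .
  then show ?thesis
    by (simp add: P.emeasure_eq_measure ennreal_mult[symmetric])
qed

lemma cylinder_law:
  assumes U: "U \<in> sets N" and F: "finite F" "F \<subseteq> I"
  shows "measure (PP I) {w \<in> space (PP I). Q {e \<in> F. w e \<in> U}} = ex (measure N U) F (\<lambda>A. of_bool (Q A))"
    and "{w \<in> space (PP I). Q {e \<in> F. w e \<in> U}} \<in> sets (PP I)"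
proof -
  define X where "X A e = (if e \<in> A then U else space N - U)" for A and e :: 'i
  define C where "C A = {w \<in> space (PP I). \<forall>e\<in>F. w e \<in> X A e}" for A
  have Xs: "X A e \<in> sets N" for A e using U by (auto simp: X_def)
  have eq: "{w \<in> space (PP I). Q {e \<in> F. w e \<in> U}} = (\<Union>A\<in>{A \<in> Pow F. Q A}. C A)" (is "?L = ?R")
  proof
    show "?L \<subseteq> ?R"
    proof
      fix w assume w: "w \<in> ?L"
      then have "w e \<in> space N" if "e \<in> F" for e using that F(2) by (auto simp: space_PiM PiE_iff)
      then have "w \<in> C {e \<in> F. w e \<in> U}" using w by (auto simp: C_def X_def)
      then show "w \<in> ?R" using w by (intro UN_I[of "{e \<in> F. w e \<in> U}"]) auto
    qed
    show "?R \<subseteq> ?L"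
    proof
      fix w assume "w \<in> ?R"
      then obtain A where A: "A \<subseteq> F" "Q A" "w \<in> C A" by auto
      have "w e \<in> U \<longleftrightarrow> e \<in> A" if "e \<in> F" for e
        using A(3) that by (auto simp: C_def X_def split: if_splits dest!: bspec[of F _ e])
      then have "{e \<in> F. w e \<in> U} = A" using A(1) by auto
      then show "w \<in> ?L" using A by (auto simp: C_def)
    qed
  qed
  have Ce: "C A = prod_emb I (\<lambda>_. N) F (Pi\<^sub>E F (X A))" for A
    unfolding C_def prod_emb_def using F by (auto simp: space_PiM Pi_iff)
  have Cs: "C A \<in> sets (PP I)" for A unfolding Ce using F Xs by (intro sets_PiM_I) auto
  have Cm: "measure (PP I) (C A) = measure N U ^ card A * (1 - measure N U) ^ card (F - A)" if "A \<subseteq> F" for A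
  proof -
    have "measure (PP I) (C A) = (\<Prod>e\<in>F. measure N (X A e))"
      unfolding Ce by (rule P.measure_PiM_emb) (use F Xs in auto)
    also have "\<dots> = (\<Prod>e\<in>F. if e \<in> A then measure N U else 1 - measure N U)"
      using prob_compl[OF U] by (intro prod.cong) (auto simp: X_def)
    also have "\<dots> = (\<Prod>e\<in>F \<inter> A. measure N U) * (\<Prod>e\<in>F - A. 1 - measure N U)"
      using F(1) by (subst prod.If_cases) (auto simp: Int_def Diff_eq Collect_mem_eq intro!: arg_cong2[where f = "(*)"] prod.cong)
    finally show ?thesis using that by (simp add: Int_absorb1)
  qed
  show "{w \<in> space (PP I). Q {e \<in> F. w e \<in> U}} \<in> sets (PP I)"
    unfolding eq using F(1) Cs by (intro sets.finite_UN) auto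
  have dj: "disjoint_family_on C {A \<in> Pow F. Q A}"
    unfolding disjoint_family_on_def
  proof (intro ballI impI)
    fix A B assume AB: "A \<in> {A \<in> Pow F. Q A}" "B \<in> {A \<in> Pow F. Q A}" "A \<noteq> B"
    then obtain e where "e \<in> F" "e \<in> A \<longleftrightarrow> e \<notin> B" by auto
    then show "C A \<inter> C B = {}" by (auto simp: C_def X_def dest!: bspec[of F _ e])
  qed
  have "measure (PP I) (\<Union>A\<in>{A \<in> Pow F. Q A}. C A) = (\<Sum>A\<in>{A \<in> Pow F. Q A}. measure (PP I) (C A))"
    by (rule P.finite_measure_finite_Union) (use F Cs dj in auto)
  also have "\<dots> = (\<Sum>A\<in>Pow F. if Q A then measure (PP I) (C A) else 0)"
    by (rule sum.inter_filter) (use F(1) in simp)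
  also have "\<dots> = ex (measure N U) F (\<lambda>A. of_bool (Q A))"
    unfolding ex_def by (intro sum.cong) (auto simp: Cm)
  finally show "measure (PP I) {w \<in> space (PP I). Q {e \<in> F. w e \<in> U}} = ex (measure N U) F (\<lambda>A. of_bool (Q A))"
    unfolding eq .
qed

lemma measure_reindex:
  fixes I' :: "'j set"
  assumes f: "inj_on f I'" "f \<in> I' \<rightarrow> I" and X: "X \<in> sets (PiM I' (\<lambda>_. N))"
  shows "measure (PP I) {w \<in> space (PP I). (\<lambda>n\<in>I'. w (f n)) \<in> X} = measure (PiM I' (\<lambda>_. N)) X"
    and "{w \<in> space (PP I). (\<lambda>n\<in>I'. w (f n)) \<in> X} \<in> sets (PP I)"
proof -
  have mm: "(\<lambda>w. \<lambda>n\<in>I'. w (f n)) \<in> PP I \<rightarrow>\<^sub>M PiM I' (\<lambda>_. N)"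
    using f(2) by (intro measurable_restrict measurable_component_singleton) auto
  have eq: "{w \<in> space (PP I). (\<lambda>n\<in>I'. w (f n)) \<in> X} = (\<lambda>w. \<lambda>n\<in>I'. w (f n)) -` X \<inter> space (PP I)" by auto
  show "{w \<in> space (PP I). (\<lambda>n\<in>I'. w (f n)) \<in> X} \<in> sets (PP I)"
    unfolding eq using mm X by (rule measurable_sets)
  have "distr (PP I) (PiM I' (\<lambda>_. N)) (\<lambda>w. \<lambda>n\<in>I'. w (f n)) = PiM I' (\<lambda>_. N)"
    using distr_PiM_reindex[of I "\<lambda>_. N" f I'] f prob_space_axioms by simp
  then show "measure (PP I) {w \<in> space (PP I). (\<lambda>n\<in>I'. w (f n)) \<in> X} = measure (PiM I' (\<lambda>_. N)) X"
    unfolding eq using measure_distr[OF mm X] by simp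
qed

end

context percolation begin

definition perc :: "'e set \<Rightarrow> real \<Rightarrow> ('e \<Rightarrow> bool) measure" where
  "perc I p = PiM I (\<lambda>_. measure_pmf (bernoulli_pmf p))"

definition infinite_event :: "'e set \<Rightarrow> real \<Rightarrow> ('e \<Rightarrow> bool) set" where
  "infinite_event I p = {w \<in> space (perc I p). infinite {y. (0, y) \<in> reach {e. w e} UNIV}}"

lemma infinite_iff_outf: "infinite {y. (0, y) \<in> reach A UNIV} \<longleftrightarrow> (\<forall>n. outf 0 n A)"
proof
  assume inf: "infinite {y. (0, y) \<in> reach A UNIV}"
  show "\<forall>n. outf 0 n A"
  proof
    fix n :: nat
    have "\<not> {y. (0, y) \<in> reach A UNIV} \<subseteq> ball1 0 (int n)" using inf finite_subset finite_ball1 by blast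
    then obtain y where y: "(0, y) \<in> reach A UNIV" "l1 y > int n"
      by (auto simp: ball1_def) (meson not_le)
    show "outf 0 n A" by (rule exit_ball[OF y(1)]) (use y(2) in simp)
  qed
next
  assume out: "\<forall>n. outf 0 n A"
  show "infinite {y. (0, y) \<in> reach A UNIV}"
  proof
    assume fin: "finite {y. (0, y) \<in> reach A UNIV}"
    define m where "m = Max (insert 0 (l1 ` {y. (0, y) \<in> reach A UNIV}))"
    have m: "l1 y \<le> m" if "(0, y) \<in> reach A UNIV" for y
      unfolding m_def using fin that by (intro Max_ge) auto
    define k where "k = nat m + 1"
    have "outf 0 k A" using out by blast
    then obtain y where y: "l1 y = int k" "(0, y) \<in> reach A (ball1 0 (int k))" by (auto simp: outf_def)
    have "(0, y) \<in> reach A UNIV" using y(2) reach_mono[of A A "ball1 0 (int k)" UNIV] by auto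
    then have "l1 y \<le> m" by (rule m)
    then show False using y(1) by (simp add: k_def split: if_splits)
  qed
qed

lemma bernoulli_True: "0 \<le> p \<Longrightarrow> p \<le> 1 \<Longrightarrow> measure (measure_pmf (bernoulli_pmf p)) {True} = p"
  by (simp add: measure_pmf_single)

lemma theta_tendsto:
  assumes I: "\<And>W. finite W \<Longrightarrow> bonds W \<subseteq> I" and p: "0 \<le> p" "p \<le> 1"
  shows "(\<lambda>n. theta n p) \<longlonglongrightarrow> measure (perc I p) (infinite_event I p)"
    and "measure (perc I p) (infinite_event I p) \<le> theta n p"
proof -
  interpret iid_product "measure_pmf (bernoulli_pmf p)" I
    by (simp add: iid_product_def measure_pmf.prob_space_axioms)
  have eqM: "perc I p = PP I" by (simp add: perc_def)
  define F where "F n = bonds (ball1 (0 :: int^'d) (int n))" for n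
  define X where "X n = {w \<in> space (PP I). outf 0 n {e \<in> F n. w e \<in> {True}}}" for n
  have Xm: "measure (PP I) (X n) = theta n p" for n
    unfolding X_def theta_def F_def
    using cylinder_law(1)[of "{True}" "bonds (ball1 0 (int n))" "outf 0 n"] I bernoulli_True[OF p] by simp
  have Xs: "X n \<in> sets (PP I)" for n
    unfolding X_def F_def by (rule cylinder_law(2)) (use I in auto)
  have Xo: "w \<in> X n \<longleftrightarrow> w \<in> space (PP I) \<and> outf 0 n {e. w e}" for w n
  proof -
    have "{e \<in> F n. w e \<in> {True}} = {e. w e} \<inter> bonds (ball1 0 (int n))" by (auto simp: F_def)
    then show ?thesis by (simp add: X_def outf_bonds)
  qed
  have inf: "infinite_event I p = (\<Inter>n. X n)"
    by (auto simp: infinite_event_def infinite_iff_outf Xo eqM)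
  have "decseq X"
  proof (rule decseq_SucI)
    fix n
    show "X (Suc n) \<subseteq> X n"
    proof
      fix w assume "w \<in> X (Suc n)"
      then have w: "w \<in> space (PP I)" "outf 0 (Suc n) {e. w e}" by (auto simp: Xo)
      then obtain y where "l1 y = int (Suc n)" "(0, y) \<in> reach {e. w e} (ball1 0 (int (Suc n)))" by (auto simp: outf_def)
      then have "outf 0 n {e. w e}" by (intro exit_ball[of 0 y]) auto
      then show "w \<in> X n" using w by (simp add: Xo)
    qed
  qed
  then have lim: "(\<lambda>n. measure (PP I) (X n)) \<longlonglongrightarrow> measure (PP I) (\<Inter>n. X n)"
    using Xs by (intro P.finite_Lim_measure_decseq) auto
  then show "(\<lambda>n. theta n p) \<longlonglongrightarrow> measure (perc I p) (infinite_event I p)"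
    unfolding inf Xm eqM .
  have "measure (PP I) (\<Inter>n. X n) \<le> measure (PP I) (X n)"
    using Xs by (intro P.finite_measure_mono) auto
  then show "measure (perc I p) (infinite_event I p) \<le> theta n p" unfolding inf Xm eqM .
qed

lemma theta_one_zero: "theta 1 0 = 0"
proof -
  define F where "F = bonds (ball1 (0 :: int^'d) (int 1))"
  have fin: "finite F" by (simp add: F_def)
  have "theta 1 0 = (\<Sum>A\<in>Pow F. (0::real) ^ card A * (1 - 0) ^ card (F - A) * of_bool (outf 0 1 A))"
    by (simp add: theta_def ex_def F_def)
  also have "\<dots> = 0"
  proof (rule sum.neutral, rule ballI)
    fix A assume "A \<in> Pow F"
    then have finA: "finite A" using fin finite_subset by auto
    show "(0::real) ^ card A * (1 - 0) ^ card (F - A) * of_bool (outf 0 1 A) = 0"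
    proof (cases "A = {}")
      case True
      have "{(x, y). x \<in> ball1 0 (int 1) \<and> y \<in> ball1 0 (int 1) \<and> E x y \<and> f x y \<in> {}} = {}" by auto
      then have "\<not> outf 0 1 {}" by (auto simp: outf_def reach_def)
      then show ?thesis using True by simp
    qed (use finA in auto)
  qed
  finally show ?thesis .
qed

lemma subcritical_decay:
  assumes I: "\<And>W. finite W \<Longrightarrow> bonds W \<subseteq> I"
    and q: "0 \<le> q" "q < Sup {p \<in> {0..1}. measure (perc I p) (infinite_event I p) = 0}"
  shows "\<exists>C \<rho>. 0 \<le> \<rho> \<and> \<rho> < 1 \<and> (\<forall>n. theta n q \<le> C * \<rho> ^ n)"
proof -
  let ?Z = "{p \<in> {0..1}. measure (perc I p) (infinite_event I p) = 0}"
  have "measure (perc I 0) (infinite_event I 0) \<le> 0"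
    using theta_tendsto(2)[of I 0 1] I theta_one_zero by simp
  then have "0 \<in> ?Z" by (simp add: measure_le_0_iff)
  moreover have "bdd_above ?Z" by (rule bdd_aboveI[of _ 1]) auto
  ultimately obtain p1 where p1: "p1 \<in> ?Z" "q < p1" using q(2) less_cSup_iff[of ?Z q] by blast
  show ?thesis
  proof (rule sharpness[OF q(1) p1(2)])
    show "p1 \<le> 1" using p1(1) by simp
    fix \<epsilon> :: real assume "\<epsilon> > 0"
    have "(\<lambda>n. theta n p1) \<longlonglongrightarrow> 0" using theta_tendsto(1)[of I p1] I p1(1) by simp
    then have "eventually (\<lambda>n. theta n p1 < \<epsilon>) sequentially" using \<open>\<epsilon> > 0\<close> by (rule order_tendstoD(2))
    then obtain N where "\<And>n. n \<ge> N \<Longrightarrow> theta n p1 < \<epsilon>" by (auto simp: eventually_sequentially)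
    then show "\<exists>n\<ge>1. theta n p1 < \<epsilon>" by (intro exI[of _ "max N 1"]) auto
  qed
qed

end

definition step_up :: "int^'d \<Rightarrow> int^'d \<Rightarrow> bool" where
  "step_up x y \<longleftrightarrow> (\<exists>i. y = x + axis i 1)"

interpretation und: percolation "adj :: int^'d \<Rightarrow> int^'d \<Rightarrow> bool" "\<lambda>x y. {x, y}" "\<lambda>z. image (\<lambda>x. x + z)"
  by unfold_locales (auto simp: doubleton_eq_iff inj_image_eq_iff intro!: injI)

interpretation ori: percolation "step_up :: int^'d \<Rightarrow> int^'d \<Rightarrow> bool" Pair "\<lambda>z (x, y). (x + z, y + z)"
  by unfold_locales (auto simp: step_up_def adj_axis algebra_simps intro!: injI)

lemma und_bonds_subset: "und.bonds W \<subseteq> lattice_edges"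
  by (auto simp: und.bonds_def)

lemma ori_bonds_subset: "ori.bonds W \<subseteq> oriented_edges"
  by (auto simp: ori.bonds_def oriented_edges_def step_up_def)

lemma undirected_decay:
  assumes "0 \<le> q" "q < p_c TYPE('d::finite)"
  shows "\<exists>C \<rho>. 0 \<le> \<rho> \<and> \<rho> < 1 \<and> (\<forall>n. und.theta TYPE('d) n q \<le> C * \<rho> ^ n)"
proof (rule und.subcritical_decay[OF und_bonds_subset assms(1)])
  have "{(x :: int^'d, y). x \<in> UNIV \<and> y \<in> UNIV \<and> adj x y \<and> {x, y} \<in> {e. w e}} = {(a, b). adj a b \<and> w {a, b}}" for w
    by auto
  then show "q < Sup {p \<in> {0..1}. measure (und.perc (lattice_edges :: (int^'d) set set) p) (und.infinite_event lattice_edges p) = 0}"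
    using assms(2)
    unfolding p_c_def bond_theta_def und.infinite_event_def und.perc_def bond_perc_def open_cluster_def und.reach_def by simp
qed

lemma oriented_decay:
  assumes "0 \<le> q" "q < oriented_p_c TYPE('d::finite)"
  shows "\<exists>C \<rho>. 0 \<le> \<rho> \<and> \<rho> < 1 \<and> (\<forall>n. ori.theta TYPE('d) n q \<le> C * \<rho> ^ n)"
proof (rule ori.subcritical_decay[OF ori_bonds_subset assms(1)])
  have "{(x :: int^'d, y). x \<in> UNIV \<and> y \<in> UNIV \<and> step_up x y \<and> (x, y) \<in> {e. w e}} = {e. e \<in> oriented_edges \<and> w e}" for w
    by (auto simp: step_up_def oriented_edges_def)
  then show "q < Sup {p \<in> {0..1}. measure (ori.perc (oriented_edges :: ((int^'d) \<times> (int^'d)) set) p) (ori.infinite_event oriented_edges p) = 0}"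
    using assms(2)
    unfolding oriented_p_c_def oriented_theta_def ori.infinite_event_def ori.perc_def oriented_perc_def oriented_cluster_def ori.reach_def by simp
qed

section \<open>Speed of ball crossings\<close>

fun defects :: "('v \<Rightarrow> 'v \<Rightarrow> bool) \<Rightarrow> 'v list \<Rightarrow> nat" where
  "defects D (x # y # p) = (if D x y then 1 else 0) + defects D (y # p)"
| "defects D _ = 0"

lemma defects_split: "defects D (l @ z # w # r) \<ge> (if D z w then 1 else 0) + defects D (w # r)"
proof (induction l)
  case (Cons a l)
  then show ?case by (cases l) auto
qed simp

lemma defect_free_piece:
  fixes f :: "'v \<Rightarrow> int"
  assumes "p \<noteq> []" "defects D p \<le> k" "f (last p) - f (hd p) \<ge> int ((k + 1) * h + k)"
    "\<And>x y. E x y \<Longrightarrow> \<bar>f x - f y\<bar> \<le> 1" "successively E p"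
  shows "\<exists>l p' r. p = l @ p' @ r \<and> p' \<noteq> [] \<and> successively (\<lambda>x y. \<not> D x y) p' \<and> f (last p') - f (hd p') \<ge> int h"
  using assms
proof (induction k arbitrary: p)
  case 0
  have "successively (\<lambda>x y. \<not> D x y) p"
  proof (rule ccontr)
    assume "\<not> successively (\<lambda>x y. \<not> D x y) p"
    then obtain l z w r where "p = l @ z # w # r" "D z w" using successively_split_first[of "\<lambda>x y. \<not> D x y" p] by blast
    then show False using defects_split[of D z w r l] 0 by auto
  qed
  then show ?case using 0 by (intro exI[of _ "[]"] exI[of _ p]) auto
next
  case (Suc k)
  show ?case
  proof (cases "successively (\<lambda>x y. \<not> D x y) p")
    case True
    have "int h \<le> int ((Suc k + 1) * h + Suc k)" unfolding of_nat_le_iff by simp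
    then have "f (last p) - f (hd p) \<ge> int h" using Suc.prems(3) by linarith
    then show ?thesis using Suc.prems True by (intro exI[of _ "[]"] exI[of _ p]) auto
  next
    case False
    then obtain l z w r where s: "p = l @ z # w # r" "D z w" "successively (\<lambda>x y. \<not> D x y) (l @ [z])"
      using successively_split_first[OF False] by auto
    have hdp: "hd (l @ [z]) = hd p" using s(1) by (cases l) auto
    show ?thesis
    proof (cases "f z - f (hd p) \<ge> int h")
      case True
      then show ?thesis using s hdp by (intro exI[of _ "[]"] exI[of _ "l @ [z]"] exI[of _ "w # r"]) auto
    next
      case False
      have "E z w" using Suc.prems(5) s(1) by (auto simp: successively_append_iff)
      then have "\<bar>f z - f w\<bar> \<le> 1" using Suc.prems(4) by blast
      moreover have "f (last p) - f (hd p) \<ge> int ((k + 1) * h + k) + int h + 1" using Suc.prems(3) by (simp add: algebra_simps)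
      ultimately have "f (last p) - f w \<ge> int ((k + 1) * h + k)" using False by linarith
      moreover have "last (w # r) = last p" using s(1) by simp
      ultimately have 1: "f (last (w # r)) - f (hd (w # r)) \<ge> int ((k + 1) * h + k)" by simp
      have 2: "defects D (w # r) \<le> k" using defects_split[of D z w r l] s Suc.prems(2) by auto
      have 3: "successively E (w # r)" using Suc.prems(5) s(1) by (auto simp: successively_append_iff)
      obtain l' p' r' where "w # r = l' @ p' @ r'" "p' \<noteq> []" "successively (\<lambda>x y. \<not> D x y) p'" "f (last p') - f (hd p') \<ge> int h"
        using Suc.IH[OF _ 2 1 Suc.prems(4) 3] by auto
      then show ?thesis using s(1) by (intro exI[of _ "l @ z # l'"] exI[of _ p'] exI[of _ r']) auto
    qed
  qed
qed

lemma ennreal_add_le: "ennreal (a + b) \<le> ennreal a + ennreal b"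
proof (cases "a \<ge> 0 \<and> b \<ge> 0")
  case False
  then have "a < 0 \<or> b < 0" by auto
  then show ?thesis
  proof
    assume "a < 0"
    then have "ennreal (a + b) \<le> ennreal b" by (intro ennreal_leI) simp
    then show ?thesis by (rule order_trans) simp
  next
    assume "b < 0"
    then have "ennreal (a + b) \<le> ennreal a" by (intro ennreal_leI) simp
    then show ?thesis by (rule order_trans) simp
  qed
qed simp

lemma ptime_defects_bound:
  fixes f :: "int^'d \<Rightarrow> int"
  assumes "\<And>x y. adj x y \<Longrightarrow> x \<in> set p \<Longrightarrow> y \<in> set p \<Longrightarrow>
      ennreal (\<tau> * real_of_int (f y - f x) + \<kappa> * of_bool (D x y)) \<le> t {x, y}"
    "successively adj p" "p \<noteq> []"
  shows "ennreal (\<tau> * real_of_int (f (last p) - f (hd p)) + \<kappa> * real (defects D p)) \<le> ptime t p"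
  using assms
proof (induction p rule: induct_list012)
  case (3 x y zs)
  let ?r = "\<tau> * real_of_int (f (last (y # zs)) - f y) + \<kappa> * real (defects D (y # zs))"
  let ?s = "\<tau> * real_of_int (f y - f x) + \<kappa> * of_bool (D x y)"
  have "ennreal ?r \<le> ptime t (y # zs)" using "3.IH"(2) "3.prems" by auto
  moreover have "ennreal ?s \<le> t {x, y}" using "3.prems" by auto
  ultimately have "ennreal (?s + ?r) \<le> t {x, y} + ptime t (y # zs)"
    using ennreal_add_le[of ?s ?r] by (meson add_mono order_trans)
  moreover have "?s + ?r = \<tau> * real_of_int (f (last (x # y # zs)) - f (hd (x # y # zs))) + \<kappa> * real (defects D (x # y # zs))"
    by (simp add: algebra_simps)
  ultimately show ?case by simp
qed auto

lemma power_times_geometric_tendsto_0: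
  fixes \<rho> :: real
  assumes "0 \<le> \<rho>" "\<rho> < 1"
  shows "(\<lambda>n. real n ^ m * \<rho> ^ n) \<longlonglongrightarrow> 0"
proof (cases "\<rho> = 0")
  case True
  have "eventually (\<lambda>n. real n ^ m * \<rho> ^ n = 0) sequentially"
    using eventually_gt_at_top[of 0] by eventually_elim (simp add: True)
  then show ?thesis by (rule tendsto_eventually)
next
  case False
  define c where "c = - ln \<rho>"
  have c: "c > 0" using assms False by (simp add: c_def)
  have "filterlim (\<lambda>n. c * real n) at_top sequentially"
    using c by (intro filterlim_tendsto_pos_mult_at_top[OF tendsto_const] filterlim_real_sequentially)
  from filterlim_compose[OF tendsto_power_div_exp_0[of m] this]
  have "(\<lambda>n. (1 / c ^ m) * ((c * real n) ^ m / exp (c * real n))) \<longlonglongrightarrow> (1 / c ^ m) * 0"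
    by (intro tendsto_mult tendsto_const)
  moreover have "(1 / c ^ m) * ((c * real n) ^ m / exp (c * real n)) = real n ^ m * \<rho> ^ n" for n
  proof -
    have "exp (c * real n) = 1 / \<rho> ^ n"
      using assms False by (simp add: c_def exp_minus mult.commute[of _ "real n"] exp_of_nat_mult[symmetric] inverse_eq_divide power_one_over)
        (simp add: exp_of_nat_mult exp_minus power_inverse inverse_eq_divide)
    then show ?thesis using c assms False by (simp add: power_mult_distrib)
  qed
  ultimately show ?thesis by simp
qed

lemma slowed_geometric_tendsto_0:
  fixes \<rho> C :: real
  assumes "0 \<le> \<rho>" "\<rho> < 1"
  shows "(\<lambda>R. real R ^ m * (C * \<rho> ^ ((R - k) div (k + 1)))) \<longlonglongrightarrow> 0"
proof -
  define \<rho>1 where "\<rho>1 = max \<rho> (1 / 2)"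
  have \<rho>1: "0 < \<rho>1" "\<rho>1 < 1" "\<rho> \<le> \<rho>1" using assms by (auto simp: \<rho>1_def)
  define r where "r = root (k + 1) \<rho>1"
  have r: "r ^ (k + 1) = \<rho>1" "0 < r" "r < 1" using \<rho>1 by (auto simp: r_def simp del: power_Suc)
  have bound: "\<rho> ^ ((R - k) div (k + 1)) \<le> (1 / r ^ (2 * k + 1)) * r ^ R" for R
  proof -
    define h where "h = (R - k) div (k + 1)"
    have "R - k = h * (k + 1) + (R - k) mod (k + 1)" unfolding h_def by (rule div_mult_mod_eq[symmetric])
    moreover have "(R - k) mod (k + 1) < k + 1" by simp
    ultimately have "R - k \<le> h * (k + 1) + k" by linarith
    then have le: "R \<le> (k + 1) * h + (2 * k + 1)" by (simp add: algebra_simps)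
    have "\<rho> ^ h \<le> \<rho>1 ^ h" using assms \<rho>1 by (intro power_mono) auto
    also have "\<dots> = r ^ ((k + 1) * h)" by (simp only: power_mult r(1))
    also have "\<dots> = (1 / r ^ (2 * k + 1)) * r ^ ((k + 1) * h + (2 * k + 1))" using r(2) by (simp add: power_add)
    also have "\<dots> \<le> (1 / r ^ (2 * k + 1)) * r ^ R"
      using r le by (intro mult_left_mono power_decreasing) auto
    finally show ?thesis by (simp add: h_def)
  qed
  show ?thesis
  proof (rule Lim_null_comparison)
    show "eventually (\<lambda>R. norm (real R ^ m * (C * \<rho> ^ ((R - k) div (k + 1)))) \<le> \<bar>C\<bar> * (1 / r ^ (2 * k + 1)) * (real R ^ m * r ^ R)) sequentially"
    proof (intro always_eventually allI)
      fix R
      have "norm (real R ^ m * (C * \<rho> ^ ((R - k) div (k + 1)))) = \<bar>C\<bar> * real R ^ m * \<rho> ^ ((R - k) div (k + 1))"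
        using assms by (simp add: abs_mult)
      also have "\<dots> \<le> \<bar>C\<bar> * real R ^ m * ((1 / r ^ (2 * k + 1)) * r ^ R)"
        by (intro mult_left_mono bound) auto
      finally show "norm (real R ^ m * (C * \<rho> ^ ((R - k) div (k + 1)))) \<le> \<bar>C\<bar> * (1 / r ^ (2 * k + 1)) * (real R ^ m * r ^ R)"
        by (simp only: mult_ac)
    qed
    show "(\<lambda>R. \<bar>C\<bar> * (1 / r ^ (2 * k + 1)) * (real R ^ m * r ^ R)) \<longlonglongrightarrow> 0"
      using tendsto_mult[OF tendsto_const power_times_geometric_tendsto_0[of r m]] r by auto
  qed
qed

lemma card_ball1_le:
  fixes y :: "int^'d"
  shows "card (ball1 y (int R)) \<le> (2 * R + 1) ^ CARD('d)"
proof -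
  have "ball1 0 (int R) \<subseteq> vec_lambda ` (Pi\<^sub>E UNIV (\<lambda>i::'d. {- int R..int R}))"
  proof
    fix x :: "int^'d" assume "x \<in> ball1 0 (int R)"
    then have "\<bar>x $ i\<bar> \<le> int R" for i using l1_component_le[of x i] by (simp add: ball1_def)
    then have "vec_nth x \<in> Pi\<^sub>E UNIV (\<lambda>i::'d. {- int R..int R})" by (auto simp: abs_le_iff) (metis minus_le_iff)
    then show "x \<in> vec_lambda ` (Pi\<^sub>E UNIV (\<lambda>i::'d. {- int R..int R}))"
      by (intro image_eqI[of _ _ "vec_nth x"]) auto
  qed
  then have "card (ball1 (0 :: int^'d) (int R)) \<le> card (Pi\<^sub>E UNIV (\<lambda>i::'d. {- int R..int R}))"
    by (rule surj_card_le[rotated]) (intro finite_PiE, auto)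
  also have "\<dots> = (2 * R + 1) ^ CARD('d)"
  proof -
    have "card {- int R..int R} = 2 * R + 1" by (simp add: nat_eq_iff)
    then show ?thesis by (simp add: card_PiE)
  qed
  finally show ?thesis by (simp add: card_ball1[of y])
qed

locale fpp = prob_space L for L :: "ennreal measure" +
  fixes D :: "'d::finite itself"
  assumes sets_L [measurable_cong]: "sets L = sets borel"
begin

sublocale iid_product L "lattice_edges :: (int^'d) set set" by unfold_locales

abbreviation Om :: "((int^'d) set \<Rightarrow> ennreal) measure" where
  "Om \<equiv> PiM lattice_edges (\<lambda>_. L)"

lemma space_L [simp]: "space L = UNIV"
  using sets_eq_imp_space_eq[OF sets_L] by simp

lemma coordinate_measurable [measurable]: "e \<in> lattice_edges \<Longrightarrow> (\<lambda>t. t e) \<in> borel_measurable Om"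
  using measurable_component_singleton[of e lattice_edges "\<lambda>_. L"] by (simp add: measurable_cong_sets[OF refl sets_L])

lemma ptime_measurable: "successively adj p \<Longrightarrow> (\<lambda>t. ptime t p) \<in> borel_measurable Om"
proof (induction p rule: induct_list012)
  case (3 x y zs)
  then have "(\<lambda>t. t {x, y}) \<in> borel_measurable Om" "(\<lambda>t. ptime t (y # zs)) \<in> borel_measurable Om"
    by (auto intro!: coordinate_measurable)
  then show ?case by simp
qed auto

lemma all_measurable:
  fixes P :: "'x::countable \<Rightarrow> bool"
  assumes "\<And>i. P i \<Longrightarrow> {t \<in> space Om. Q i t} \<in> sets Om"
  shows "{t \<in> space Om. \<forall>i. P i \<longrightarrow> Q i t} \<in> sets Om"
proof (rule sets.sets_Collect_countable_All)
  fix i show "{t \<in> space Om. P i \<longrightarrow> Q i t} \<in> sets Om" using assms[of i] by (cases "P i") auto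
qed

lemma ex_measurable:
  fixes P :: "'x::countable \<Rightarrow> bool"
  assumes "\<And>i. P i \<Longrightarrow> {t \<in> space Om. Q i t} \<in> sets Om"
  shows "{t \<in> space Om. \<exists>i. P i \<and> Q i t} \<in> sets Om"
proof (rule sets.sets_Collect_countable_Ex)
  fix i show "{t \<in> space Om. P i \<and> Q i t} \<in> sets Om" using assms[of i] by (cases "P i") auto
qed

definition crossing :: "int^'d \<Rightarrow> nat \<Rightarrow> (int^'d) list \<Rightarrow> bool" where
  "crossing y R p \<longleftrightarrow> p \<noteq> [] \<and> successively adj p \<and> hd p = y \<and> set p \<subseteq> ball1 y (int R) \<and> l1 (last p - y) = int R"

definition slow :: "ennreal \<Rightarrow> int^'d \<Rightarrow> nat \<Rightarrow> ((int^'d) set \<Rightarrow> ennreal) set" where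
  "slow c y R = {t \<in> space Om. \<forall>p. crossing y R p \<longrightarrow> c \<le> ptime t p}"

lemma slow_sets: "slow c y R \<in> sets Om"
  unfolding slow_def
proof (rule all_measurable)
  fix p assume "crossing y R p"
  then have "(\<lambda>t. ptime t p) \<in> borel_measurable Om" by (auto simp: crossing_def intro: ptime_measurable)
  then show "{t \<in> space Om. c \<le> ptime t p} \<in> sets Om" by measurable
qed

lemma measure_event_L: "e \<in> lattice_edges \<Longrightarrow> U \<in> sets borel \<Longrightarrow>
    measure Om {t \<in> space Om. t e \<in> U} = measure L U \<and> {t \<in> space Om. t e \<in> U} \<in> sets Om"
proof -
  assume e: "e \<in> lattice_edges" and U: "U \<in> sets borel"
  have "emeasure Om {t \<in> space Om. t e \<in> U} = emeasure L U"
    using P.emeasure_PiM_Collect_single[OF e] U sets_L by simp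
  moreover have "{t \<in> space Om. t e \<in> U} \<in> sets Om" using e U by measurable
  ultimately show ?thesis by (simp add: measure_def)
qed

lemma undirected_event:
  assumes U: "U \<in> sets borel"
  shows "measure Om {t \<in> space Om. und.outf w h {e \<in> lattice_edges. t e \<in> U}} = und.theta TYPE('d) h (measure L U)"
    and "{t \<in> space Om. und.outf (w :: int^'d) h {e \<in> lattice_edges. t e \<in> U}} \<in> sets Om"
proof -
  define F where "F = und.bonds (ball1 w (int h))"
  have eq: "{t \<in> space Om. und.outf w h {e \<in> lattice_edges. t e \<in> U}} = {t \<in> space Om. und.outf w h {e \<in> F. t e \<in> U}}"
  proof -
    have "{e \<in> F. t e \<in> U} = {e \<in> lattice_edges. t e \<in> U} \<inter> und.bonds (ball1 w (int h))" for t :: "(int^'d) set \<Rightarrow> ennreal"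
      using und_bonds_subset by (auto simp: F_def)
    then show ?thesis by (simp add: und.outf_bonds)
  qed
  have F: "finite F" "F \<subseteq> lattice_edges" using und_bonds_subset by (auto simp: F_def)
  have U': "U \<in> sets L" using U sets_L by simp
  show "{t \<in> space Om. und.outf w h {e \<in> lattice_edges. t e \<in> U}} \<in> sets Om"
    unfolding eq by (rule cylinder_law(2)[OF U' F])
  show "measure Om {t \<in> space Om. und.outf w h {e \<in> lattice_edges. t e \<in> U}} = und.theta TYPE('d) h (measure L U)"
    unfolding eq cylinder_law(1)[OF U' F] unfolding F_def by (rule und.theta_translate)
qed

text \<open>Oriented paths from \<open>w\<close> in the orthant with signs \<open>\<sigma>\<close>, pulled back to the standard orthant at \<open>0\<close>.\<close>

definition refl :: "('d \<Rightarrow> int) \<Rightarrow> int^'d \<Rightarrow> int^'d" where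
  "refl \<sigma> z = (\<chi> i. \<sigma> i * z $ i)"

definition obond :: "('d \<Rightarrow> int) \<Rightarrow> int^'d \<Rightarrow> (int^'d) \<times> (int^'d) \<Rightarrow> (int^'d) set" where
  "obond \<sigma> w = (\<lambda>(a, b). {w + refl \<sigma> a, w + refl \<sigma> b})"

definition signs :: "('d \<Rightarrow> int) set" where
  "signs = {\<sigma>. \<forall>i. \<sigma> i = 1 \<or> \<sigma> i = -1}"

lemma finite_signs: "finite signs"
proof -
  have "signs \<subseteq> Pi\<^sub>E UNIV (\<lambda>i::'d. {1, -1})" by (auto simp: signs_def)
  then show ?thesis by (rule finite_subset) (intro finite_PiE, auto)
qed

lemma sign_cases: "\<sigma> \<in> signs \<Longrightarrow> \<sigma> i = 1 \<or> \<sigma> i = -1"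
  by (simp add: signs_def)

lemma sign_square: "\<sigma> \<in> signs \<Longrightarrow> \<sigma> i * \<sigma> i = 1"
  using sign_cases[of \<sigma> i] by auto

lemma sign_abs: "\<sigma> \<in> signs \<Longrightarrow> \<bar>\<sigma> i\<bar> = 1"
  using sign_cases[of \<sigma> i] by auto

lemma refl_refl: "\<sigma> \<in> signs \<Longrightarrow> refl \<sigma> (refl \<sigma> z) = z"
  by (simp add: refl_def vec_eq_iff mult.assoc[symmetric] sign_square)

lemma refl_add: "refl \<sigma> (x + y) = refl \<sigma> x + refl \<sigma> y"
  by (simp add: refl_def vec_eq_iff distrib_left)

lemma refl_axis: "refl \<sigma> (axis i c) = axis i (\<sigma> i * c)"
  by (auto simp: refl_def vec_eq_iff axis_def)

lemma l1_refl: "\<sigma> \<in> signs \<Longrightarrow> l1 (refl \<sigma> z) = l1 z"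
  unfolding l1_def refl_def by (intro sum.cong) (auto simp: abs_mult sign_abs)

lemma refl_inj: "\<sigma> \<in> signs \<Longrightarrow> refl \<sigma> a = refl \<sigma> b \<longleftrightarrow> a = b"
  by (metis refl_refl)

lemma oriented_no_return: "axis i (1::int) + axis j 1 \<noteq> (0 :: int^'d)"
proof
  assume "axis i (1::int) + axis j 1 = (0 :: int^'d)"
  then have "(axis i (1::int) + axis j 1 :: int^'d) $ i = 0" by simp
  then show False by (auto simp: axis_def split: if_splits)
qed

lemma obond_inj:
  assumes "\<sigma> \<in> signs" shows "inj_on (obond \<sigma> w) oriented_edges"
proof (rule inj_onI)
  fix e e' assume e: "e \<in> oriented_edges" "e' \<in> oriented_edges" "obond \<sigma> w e = obond \<sigma> w e'"
  obtain a i where a: "e = (a, a + axis i 1)" using e(1) by (auto simp: oriented_edges_def)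
  obtain b j where b: "e' = (b, b + axis j 1)" using e(2) by (auto simp: oriented_edges_def)
  have "(a = b \<and> a + axis i 1 = b + axis j 1) \<or> (a = b + axis j 1 \<and> a + axis i 1 = b)"
    using e(3) assms by (auto simp: a b obond_def doubleton_eq_iff refl_inj)
  then show "e = e'"
  proof
    assume ab: "a = b + axis j 1 \<and> a + axis i 1 = b"
    then have "b + (axis j 1 + axis i 1) = b + 0" by (metis add.assoc add.right_neutral)
    then have "axis j (1::int) + axis i 1 = (0 :: int^'d)" by (simp only: add_left_cancel)
    then show ?thesis using oriented_no_return by blast
  qed (auto simp: a b)
qed

lemma obond_lattice: "\<sigma> \<in> signs \<Longrightarrow> obond \<sigma> w \<in> oriented_edges \<rightarrow> lattice_edges"
  by (auto simp: obond_def oriented_edges_def refl_add refl_axis sign_abs add.assoc[symmetric] intro!: adj_axis)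

definition oset :: "('d \<Rightarrow> int) \<Rightarrow> int^'d \<Rightarrow> ennreal set \<Rightarrow> ((int^'d) set \<Rightarrow> ennreal) \<Rightarrow> ((int^'d) \<times> (int^'d)) set" where
  "oset \<sigma> w U t = {e \<in> oriented_edges. t (obond \<sigma> w e) \<in> U}"

lemma oriented_event:
  assumes U: "U \<in> sets borel" and \<sigma>: "\<sigma> \<in> signs"
  shows "measure Om {t \<in> space Om. ori.outf 0 h (oset \<sigma> w U t)} = ori.theta TYPE('d) h (measure L U)"
    and "{t \<in> space Om. ori.outf 0 h (oset \<sigma> w U t)} \<in> sets Om"
proof -
  interpret O: iid_product L "oriented_edges :: ((int^'d) \<times> (int^'d)) set" by unfold_locales
  define F where "F = ori.bonds (ball1 (0 :: int^'d) (int h))"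
  have F: "finite F" "F \<subseteq> oriented_edges" using ori_bonds_subset by (auto simp: F_def)
  have U': "U \<in> sets L" using U sets_L by simp
  define X where "X = {s \<in> space (PiM oriented_edges (\<lambda>_. L)). ori.outf 0 h {e \<in> F. s e \<in> U}}"
  have X: "measure (PiM oriented_edges (\<lambda>_. L)) X = ori.theta TYPE('d) h (measure L U)" "X \<in> sets (PiM oriented_edges (\<lambda>_. L))"
    unfolding X_def O.cylinder_law(1)[OF U' F] using O.cylinder_law(2)[OF U' F]
    by (simp_all add: F_def ori.theta_def)
  have eq: "{t \<in> space Om. ori.outf 0 h (oset \<sigma> w U t)} = {t \<in> space Om. (\<lambda>n\<in>oriented_edges. t (obond \<sigma> w n)) \<in> X}"
  proof -
    have "(\<lambda>n\<in>oriented_edges. t (obond \<sigma> w n)) \<in> X \<longleftrightarrow> ori.outf 0 h (oset \<sigma> w U t)" for t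
    proof -
      have "{e \<in> F. (\<lambda>n\<in>oriented_edges. t (obond \<sigma> w n)) e \<in> U} = oset \<sigma> w U t \<inter> ori.bonds (ball1 0 (int h))"
        using F(2) by (auto simp: oset_def F_def)
      then show ?thesis by (simp add: X_def space_PiM ori.outf_bonds)
    qed
    then show ?thesis by simp
  qed
  show "measure Om {t \<in> space Om. ori.outf 0 h (oset \<sigma> w U t)} = ori.theta TYPE('d) h (measure L U)"
    unfolding eq measure_reindex(1)[OF obond_inj[OF \<sigma>] obond_lattice[OF \<sigma>] X(2)] X(1) ..
  show "{t \<in> space Om. ori.outf 0 h (oset \<sigma> w U t)} \<in> sets Om"
    unfolding eq by (rule measure_reindex(2)[OF obond_inj[OF \<sigma>] obond_lattice[OF \<sigma>] X(2)])
qed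

definition height :: "('d \<Rightarrow> int) \<Rightarrow> int^'d \<Rightarrow> int" where
  "height \<sigma> x = (\<Sum>i\<in>UNIV. \<sigma> i * x $ i)"

lemma height_diff_le: "\<sigma> \<in> signs \<Longrightarrow> height \<sigma> x - height \<sigma> y \<le> l1 (x - y)"
proof -
  assume \<sigma>: "\<sigma> \<in> signs"
  have "height \<sigma> x - height \<sigma> y = (\<Sum>i\<in>UNIV. \<sigma> i * (x - y) $ i)"
    by (simp add: height_def sum_subtractf right_diff_distrib)
  also have "\<dots> \<le> (\<Sum>i\<in>UNIV. \<bar>(x - y) $ i\<bar>)"
  proof (rule sum_mono)
    fix i
    have "\<sigma> i = 1 \<or> \<sigma> i = -1" using \<sigma> by (simp add: signs_def)
    then show "\<sigma> i * (x - y) $ i \<le> \<bar>(x - y) $ i\<bar>" by auto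
  qed
  finally show ?thesis by (simp add: l1_def)
qed

lemma height_lipschitz: "\<sigma> \<in> signs \<Longrightarrow> adj x y \<Longrightarrow> \<bar>height \<sigma> x - height \<sigma> y\<bar> \<le> 1"
  using height_diff_le[of \<sigma> x y] height_diff_le[of \<sigma> y x] by (simp add: adj_def l1_minus_commute[of y x])

lemma height_axis: "height \<sigma> (x + axis i c) = height \<sigma> x + \<sigma> i * c"
proof -
  have "(\<Sum>j\<in>UNIV. \<sigma> j * (axis i c :: int^'d) $ j) = (\<Sum>j\<in>UNIV. if j = i then \<sigma> i * c else 0)"
    by (intro sum.cong) (auto simp: axis_def)
  then show ?thesis by (simp add: height_def distrib_left sum.distrib)
qed

lemma exists_sign: "\<exists>\<sigma>\<in>signs. height \<sigma> x - height \<sigma> y = l1 (x - y)"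
proof -
  define \<sigma> where "\<sigma> i = (if (x - y) $ i \<ge> 0 then 1 else - 1 :: int)" for i
  have "height \<sigma> x - height \<sigma> y = (\<Sum>i\<in>UNIV. \<sigma> i * (x - y) $ i)"
    by (simp add: height_def sum_subtractf right_diff_distrib)
  also have "\<dots> = l1 (x - y)" unfolding l1_def by (intro sum.cong) (auto simp: \<sigma>_def)
  finally show ?thesis by (intro bexI[of _ \<sigma>]) (auto simp: \<sigma>_def signs_def)
qed

end

lemma successively_imp_connected:
  assumes "\<And>x y. Q x y \<Longrightarrow> (g x, g y) \<in> r\<^sup>*" "successively Q p" "p \<noteq> []"
  shows "(g (hd p), g (last p)) \<in> r\<^sup>*"
  using assms(2,3)
proof (induction p rule: induct_list012)
  case (3 x y zs)
  then have "(g x, g y) \<in> r\<^sup>*" "(g y, g (last (y # zs))) \<in> r\<^sup>*" using assms(1) by auto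
  then show ?case by (auto intro: rtrancl_trans)
qed auto

context fpp begin

lemma exists_threshold:
  assumes \<tau>: "0 \<le> \<tau>" "measure L {..<ennreal \<tau>} = 0" and c: "measure L {ennreal \<tau>} < c"
  shows "\<exists>s>0. measure L {..<ennreal (\<tau> + s)} < c"
proof -
  define X where "X n = {..<ennreal (\<tau> + 1 / real (Suc n))}" for n
  have Xs: "X n \<in> sets L" for n using sets_L by (simp add: X_def)
  have "decseq X"
  proof (rule decseq_SucI)
    fix n
    have "\<tau> + 1 / real (Suc (Suc n)) \<le> \<tau> + 1 / real (Suc n)" by (simp add: frac_le)
    then have "ennreal (\<tau> + 1 / real (Suc (Suc n))) \<le> ennreal (\<tau> + 1 / real (Suc n))" by (rule ennreal_leI)
    then show "X (Suc n) \<subseteq> X n" by (auto simp: X_def)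
  qed
  then have lim: "(\<lambda>n. measure L (X n)) \<longlonglongrightarrow> measure L (\<Inter>n. X n)"
    using Xs by (intro finite_Lim_measure_decseq) auto
  have "(\<Inter>n. X n) \<subseteq> {..<ennreal \<tau>} \<union> {ennreal \<tau>}"
  proof
    fix x assume x: "x \<in> (\<Inter>n. X n)"
    have "(\<lambda>n. \<tau> + 1 / real (Suc n)) \<longlonglongrightarrow> \<tau> + 0"
      using LIMSEQ_inverse_real_of_nat by (intro tendsto_add tendsto_const) (simp add: inverse_eq_divide)
    then have "(\<lambda>n. ennreal (\<tau> + 1 / real (Suc n))) \<longlonglongrightarrow> ennreal \<tau>" by (intro tendsto_ennrealI) simp
    then have "x \<le> ennreal \<tau>"
      by (rule LIMSEQ_le_const) (use x in \<open>auto simp: X_def less_imp_le\<close>)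
    then show "x \<in> {..<ennreal \<tau>} \<union> {ennreal \<tau>}" by auto
  qed
  then have "measure L (\<Inter>n. X n) \<le> measure L ({..<ennreal \<tau>} \<union> {ennreal \<tau>})"
    using sets_L by (intro finite_measure_mono) auto
  also have "\<dots> \<le> measure L {..<ennreal \<tau>} + measure L {ennreal \<tau>}"
    using sets_L by (intro measure_subadditive) auto
  also have "\<dots> < c" using \<tau>(2) c by simp
  finally have "eventually (\<lambda>n. measure L (X n) < c) sequentially" by (rule order_tendstoD(2)[OF lim])
  then obtain n where "measure L (X n) < c" by (auto simp: eventually_sequentially)
  then show ?thesis by (intro exI[of _ "1 / real (Suc n)"]) (auto simp: X_def)
qed

text \<open>A fast crossing of a ball has boundedly many defects (closed bonds and, if \<open>\<tau> > 0\<close>, steps in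
  the wrong direction), so it contains a long piece without defects.\<close>

lemma fast_crossing:
  assumes \<tau>: "0 \<le> \<tau>" and s: "s > 0" and ge: "\<And>e. e \<in> edges_in (ball1 y (int R)) \<Longrightarrow> ennreal \<tau> \<le> t e"
    and p: "crossing y R p" "ptime t p < ennreal (\<tau> * real R + k0)"
    and \<kappa>: "\<kappa> = (if \<tau> = 0 then s else min s (2 * \<tau>))" and k: "k0 \<le> \<kappa> * real k"
    and h: "(k + 1) * h + k \<le> R"
  defines "U \<equiv> {..<ennreal (\<tau> + s)}"
  shows "if \<tau> = 0 then \<exists>w\<in>ball1 y (int R). und.outf w h {e \<in> lattice_edges. t e \<in> U}
     else \<exists>\<sigma>\<in>signs. \<exists>w\<in>ball1 y (int R). ori.outf 0 h (oset \<sigma> w U t)"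
proof -
  have pp: "p \<noteq> []" "successively adj p" "hd p = y" "set p \<subseteq> ball1 y (int R)" "l1 (last p - y) = int R"
    using p(1) by (auto simp: crossing_def)
  obtain \<sigma> where \<sigma>: "\<sigma> \<in> signs" "height \<sigma> (last p) - height \<sigma> y = l1 (last p - y)" using exists_sign by blast
  define D where "D x z \<longleftrightarrow> t {x, z} \<notin> U \<or> (\<tau> > 0 \<and> \<not> (\<exists>i. z = x + axis i (\<sigma> i)))" for x z
  have \<kappa>pos: "\<kappa> > 0" using \<kappa> s \<tau> by auto
  have "ennreal (\<tau> * real_of_int (height \<sigma> (last p) - height \<sigma> (hd p)) + \<kappa> * real (defects D p)) \<le> ptime t p"
  proof (rule ptime_defects_bound[OF _ pp(2,1)])
    fix x z assume xz: "adj x z" "x \<in> set p" "z \<in> set p"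
    have t\<tau>: "ennreal \<tau> \<le> t {x, z}" by (rule ge) (use xz pp(4) in auto)
    obtain i c where ic: "\<bar>c\<bar> = 1" "z = x + axis i c" using adj_imp_axis[OF xz(1)] by blast
    have hd: "height \<sigma> z - height \<sigma> x = \<sigma> i * c" by (simp add: ic height_axis)
    have cU: "ennreal (\<tau> + s) \<le> t {x, z}" if "t {x, z} \<notin> U" using that by (simp add: U_def not_less)
    have "c = 1 \<or> c = -1" using ic(1) by linarith
    then consider "c = \<sigma> i" | "c = - \<sigma> i" using sign_cases[OF \<sigma>(1), of i] by auto
    then show "ennreal (\<tau> * real_of_int (height \<sigma> z - height \<sigma> x) + \<kappa> * of_bool (D x z)) \<le> t {x, z}"
    proof cases
      case 1
      then have h1: "height \<sigma> z - height \<sigma> x = 1" using hd sign_square[OF \<sigma>(1)] by simp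
      have "D x z \<longleftrightarrow> t {x, z} \<notin> U" using 1 ic by (auto simp: D_def)
      moreover have "ennreal (\<tau> + \<kappa>) \<le> ennreal (\<tau> + s)" using \<kappa> by (intro ennreal_leI) auto
      ultimately show ?thesis using h1 t\<tau> cU by (auto intro: order_trans)
    next
      case 2
      then have h1: "height \<sigma> z - height \<sigma> x = -1" using hd sign_square[OF \<sigma>(1)] by simp
      show ?thesis
      proof (cases "\<tau> = 0")
        case True
        then show ?thesis using cU \<kappa> by (auto simp: D_def h1)
      next
        case False
        have "ennreal (\<tau> * (-1) + \<kappa> * of_bool (D x z)) \<le> ennreal \<tau>"
          using False \<kappa> \<tau> \<kappa>pos by (intro ennreal_leI) (auto simp: of_bool_def)
        then show ?thesis using t\<tau> h1 by (auto intro: order_trans)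
      qed
    qed
  qed
  also note p(2)
  finally have "\<tau> * real R + \<kappa> * real (defects D p) < \<tau> * real R + k0"
    using \<sigma>(2) pp(3,5) \<tau> \<kappa>pos by (subst (asm) ennreal_less_iff) auto
  then have "\<kappa> * real (defects D p) < \<kappa> * real k" using k by linarith
  then have dk: "defects D p \<le> k" using \<kappa>pos by simp
  have "height \<sigma> (last p) - height \<sigma> (hd p) \<ge> int ((k + 1) * h + k)"
  proof -
    have "int ((k + 1) * h + k) \<le> int R" using h by (simp only: of_nat_le_iff)
    then show ?thesis using \<sigma>(2) pp(3,5) by simp
  qed
  then obtain l p' r where p': "p = l @ p' @ r" "p' \<noteq> []" "successively (\<lambda>x y. \<not> D x y) p'"
      "height \<sigma> (last p') - height \<sigma> (hd p') \<ge> int h"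
    using defect_free_piece[OF pp(1) dk _ _ pp(2), where f = "height \<sigma>" and h = h] height_lipschitz[OF \<sigma>(1)] by blast
  define w where "w = hd p'"
  have wB: "w \<in> ball1 y (int R)" using p'(1,2) pp(4) by (auto simp: w_def)
  have adjp': "successively adj p'" using pp(2) p'(1) by (auto simp: successively_append_iff)
  then have su: "successively (\<lambda>x z. adj x z \<and> \<not> D x z) p'"
    using p'(3) by (simp add: successively_conv_nth)
  have far: "l1 (last p' - w) \<ge> int h"
    using p'(4) height_diff_le[OF \<sigma>(1), of "last p'" w] by (simp add: w_def)
  show ?thesis
  proof (cases "\<tau> = 0")
    case True
    have "(id (hd p'), id (last p')) \<in> und.reach {e \<in> lattice_edges. t e \<in> U} UNIV"
      unfolding und.reach_def
      by (rule successively_imp_connected[OF _ su p'(2)], rule r_into_rtrancl) (auto simp: D_def)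
    then have "und.outf w h {e \<in> lattice_edges. t e \<in> U}"
      using far by (intro und.exit_ball[of w "last p'"]) (auto simp: w_def)
    then show ?thesis using True wB by auto
  next
    case False
    define g where "g x = refl \<sigma> (x - w)" for x
    have "(g (hd p'), g (last p')) \<in> ori.reach (oset \<sigma> w U t) UNIV"
      unfolding ori.reach_def
    proof (rule successively_imp_connected[OF _ su p'(2)], rule r_into_rtrancl)
      fix x z assume xz: "adj x z \<and> \<not> D x z"
      then obtain i where i: "z = x + axis i (\<sigma> i)" and U: "t {x, z} \<in> U" using False \<tau> by (auto simp: D_def)
      have gz: "g z = g x + axis i 1"
      proof -
        have e: "z - w = (x - w) + axis i (\<sigma> i)" by (simp add: i)
        show ?thesis unfolding g_def e by (simp add: refl_add refl_axis sign_square[OF \<sigma>(1)])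
      qed
      have "step_up (g x) (g z)" unfolding gz step_up_def by blast
      moreover have "obond \<sigma> w (g x, g z) = {x, z}" by (simp add: obond_def g_def refl_refl[OF \<sigma>(1)])
      moreover have "(g x, g z) \<in> oriented_edges" unfolding gz oriented_edges_def by blast
      ultimately show "(g x, g z) \<in> {(x, y). x \<in> UNIV \<and> y \<in> UNIV \<and> step_up x y \<and> (x, y) \<in> oset \<sigma> w U t}"
        using U by (simp add: oset_def)
    qed
    moreover have "g (hd p') = 0" by (simp add: g_def w_def refl_def vec_eq_iff)
    moreover have "l1 (g (last p')) \<ge> int h" using far by (simp add: g_def l1_refl[OF \<sigma>(1)])
    ultimately have "ori.outf 0 h (oset \<sigma> w U t)" using ori.exit_ball[of 0 "g (last p')" "oset \<sigma> w U t" UNIV h] by simp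
    then show ?thesis using False wB \<sigma>(1) by auto
  qed
qed

theorem crossing_speed:
  assumes \<tau>: "0 \<le> \<tau>" "measure L {..<ennreal \<tau>} = 0"
    and crit: "\<tau> = 0 \<Longrightarrow> measure L {ennreal \<tau>} < p_c TYPE('d)" "\<tau> > 0 \<Longrightarrow> measure L {ennreal \<tau>} < oriented_p_c TYPE('d)"
  shows "\<exists>a. (\<forall>R y. measure Om (space Om - slow (ennreal (\<tau> * real R + k0)) y R) \<le> a R) \<and>
     (\<forall>m. (\<lambda>R. real R ^ m * a R) \<longlonglongrightarrow> 0)"
proof -
  define c where "c = (if \<tau> = 0 then p_c TYPE('d) else oriented_p_c TYPE('d))"
  have "measure L {ennreal \<tau>} < c" using crit \<tau>(1) by (auto simp: c_def)
  then obtain s where s: "s > 0" "measure L {..<ennreal (\<tau> + s)} < c" using exists_threshold[OF \<tau>] by blast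
  define U where "U = {..<ennreal (\<tau> + s)}"
  have U: "U \<in> sets borel" by (simp add: U_def)
  define th where "th h = (if \<tau> = 0 then und.theta TYPE('d) h (measure L U) else ori.theta TYPE('d) h (measure L U))" for h
  have "\<exists>C \<rho>. 0 \<le> \<rho> \<and> \<rho> < 1 \<and> (\<forall>n. th n \<le> C * \<rho> ^ n)"
  proof (cases "\<tau> = 0")
    case True
    then show ?thesis
      using undirected_decay[of "measure L U", where ?'d = 'd] s(2) unfolding th_def c_def U_def by simp
  next
    case False
    then show ?thesis
      using oriented_decay[of "measure L U", where ?'d = 'd] s(2) unfolding th_def c_def U_def by simp
  qed
  then obtain C \<rho> where C\<rho>: "0 \<le> \<rho>" "\<rho> < 1" "\<And>n. th n \<le> C * \<rho> ^ n" by blast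
  have th0: "0 \<le> th n" for n
    unfolding th_def using und.theta_bounds[of "measure L U" n] ori.theta_bounds[of "measure L U" n] by auto
  define \<kappa> where "\<kappa> = (if \<tau> = 0 then s else min s (2 * \<tau>))"
  have \<kappa>: "\<kappa> > 0" using s \<tau> by (auto simp: \<kappa>_def)
  obtain k :: nat where "k0 / \<kappa> \<le> real k" using real_arch_simple by blast
  then have k: "k0 \<le> \<kappa> * real k" using \<kappa> by (simp add: field_simps)
  define a where "a R = (if R < k then 1 else real (card signs) * real ((2 * R + 1) ^ CARD('d)) * (C * \<rho> ^ ((R - k) div (k + 1))))" for R
  have bound: "measure Om (space Om - slow (ennreal (\<tau> * real R + k0)) y R) \<le> a R" for R y
  proof (cases "R < k")
    case True
    then show ?thesis by (simp add: a_def)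
  next
    case False
    define h where "h = (R - k) div (k + 1)"
    have "(k + 1) * h \<le> R - k" unfolding h_def by (rule times_div_less_eq_dividend)
    then have h: "(k + 1) * h + k \<le> R" using False by linarith
    let ?B = "ball1 y (int R)"
    define N0 where "N0 e = {t \<in> space Om. t e \<in> {..<ennreal \<tau>}}" for e
    define G where "G \<sigma> w = (if \<tau> = 0 then {t \<in> space Om. und.outf w h {e \<in> lattice_edges. t e \<in> U}}
        else {t \<in> space Om. ori.outf 0 h (oset \<sigma> w U t)})" for \<sigma> w
    have N0: "measure Om (N0 e) = 0 \<and> N0 e \<in> sets Om" if "e \<in> edges_in ?B" for e
    proof -
      have "e \<in> lattice_edges" using that edges_in_subset by blast
      then show ?thesis unfolding N0_def using measure_event_L[of e "{..<ennreal \<tau>}"] \<tau>(2) by simp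
    qed
    have G: "measure Om (G \<sigma> w) = th h \<and> G \<sigma> w \<in> sets Om" if "\<sigma> \<in> signs" for \<sigma> w
      unfolding G_def th_def using undirected_event[OF U] oriented_event[OF U that] by auto
    have ne: "signs \<noteq> {}" using exists_sign by blast
    have sub: "space Om - slow (ennreal (\<tau> * real R + k0)) y R \<subseteq> (\<Union>e\<in>edges_in ?B. N0 e) \<union> (\<Union>z\<in>signs \<times> ?B. G (fst z) (snd z))"
    proof
      fix t assume t: "t \<in> space Om - slow (ennreal (\<tau> * real R + k0)) y R"
      show "t \<in> (\<Union>e\<in>edges_in ?B. N0 e) \<union> (\<Union>z\<in>signs \<times> ?B. G (fst z) (snd z))"
      proof (cases "\<exists>e\<in>edges_in ?B. t e < ennreal \<tau>")
        case True
        then show ?thesis using t by (auto simp: N0_def)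
      next
        case F: False
        obtain p where p: "crossing y R p" "ptime t p < ennreal (\<tau> * real R + k0)" using t by (auto simp: slow_def not_le)
        have "if \<tau> = 0 then \<exists>w\<in>?B. und.outf w h {e \<in> lattice_edges. t e \<in> U}
           else \<exists>\<sigma>\<in>signs. \<exists>w\<in>?B. ori.outf 0 h (oset \<sigma> w U t)"
          unfolding U_def by (rule fast_crossing[OF \<tau>(1) s(1) _ p \<kappa>_def k h]) (use F in \<open>auto simp: not_less\<close>)
        then have "\<exists>\<sigma>\<in>signs. \<exists>w\<in>?B. t \<in> G \<sigma> w" using t ne by (auto simp: G_def split: if_splits)
        then show ?thesis by force
      qed
    qed
    have "measure Om (space Om - slow (ennreal (\<tau> * real R + k0)) y R) \<le>
       measure Om ((\<Union>e\<in>edges_in ?B. N0 e) \<union> (\<Union>z\<in>signs \<times> ?B. G (fst z) (snd z)))"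
      using sub N0 G finite_signs by (intro P.finite_measure_mono sets.Un sets.finite_UN) auto
    also have "\<dots> \<le> measure Om (\<Union>e\<in>edges_in ?B. N0 e) + measure Om (\<Union>z\<in>signs \<times> ?B. G (fst z) (snd z))"
      using N0 G finite_signs by (intro measure_subadditive sets.finite_UN) auto
    also have "measure Om (\<Union>e\<in>edges_in ?B. N0 e) \<le> (\<Sum>e\<in>edges_in ?B. measure Om (N0 e))"
      using N0 by (intro P.finite_measure_subadditive_finite) auto
    also have "(\<Sum>e\<in>edges_in ?B. measure Om (N0 e)) = 0" using N0 by simp
    also have "measure Om (\<Union>z\<in>signs \<times> ?B. G (fst z) (snd z)) \<le> (\<Sum>z\<in>signs \<times> ?B. measure Om (G (fst z) (snd z)))"
      using G finite_signs by (intro P.finite_measure_subadditive_finite) auto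
    also have "(\<Sum>z\<in>signs \<times> ?B. measure Om (G (fst z) (snd z))) = real (card signs) * real (card ?B) * th h"
    proof -
      have "(\<Sum>z\<in>signs \<times> ?B. measure Om (G (fst z) (snd z))) = (\<Sum>z\<in>signs \<times> ?B. th h)"
        using G by (intro sum.cong) auto
      then show ?thesis by (simp add: card_cartesian_product)
    qed
    also have "\<dots> \<le> real (card signs) * real ((2 * R + 1) ^ CARD('d)) * (C * \<rho> ^ h)"
      using card_ball1_le[of y R] C\<rho>(3)[of h] th0[of h]
      by (intro mult_mono) (auto simp del: of_nat_power)
    also have "\<dots> = a R" using False by (simp add: a_def h_def)
    finally show ?thesis by simp
  qed
  have "(\<lambda>R. real R ^ m * a R) \<longlonglongrightarrow> 0" for m
  proof (rule Lim_null_comparison)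
    let ?d = "CARD('d)"
    have "(\<lambda>R. real (card signs) * 3 ^ ?d * (real R ^ (m + ?d) * (\<bar>C\<bar> * \<rho> ^ ((R - k) div (k + 1))))) \<longlonglongrightarrow> real (card signs) * 3 ^ ?d * 0"
      by (intro tendsto_mult tendsto_const slowed_geometric_tendsto_0 C\<rho>)
    then show "(\<lambda>R. real (card signs) * 3 ^ ?d * (real R ^ (m + ?d) * (\<bar>C\<bar> * \<rho> ^ ((R - k) div (k + 1))))) \<longlonglongrightarrow> 0" by simp
    show "eventually (\<lambda>R. norm (real R ^ m * a R) \<le> real (card signs) * 3 ^ ?d * (real R ^ (m + ?d) * (\<bar>C\<bar> * \<rho> ^ ((R - k) div (k + 1))))) sequentially"
      using eventually_ge_at_top[of "max k 1"]
    proof eventually_elim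
      case (elim R)
      define q where "q = \<rho> ^ ((R - k) div (k + 1))"
      have q: "q \<ge> 0" using C\<rho> by (simp add: q_def)
      have "norm (real R ^ m * a R) = real R ^ m * (real (card signs) * real ((2 * R + 1) ^ ?d) * (\<bar>C\<bar> * q))"
        using elim q by (simp add: a_def q_def abs_mult)
      also have "real ((2 * R + 1) ^ ?d) \<le> (3 * real R) ^ ?d"
        unfolding of_nat_power using elim by (intro power_mono) auto
      then have "real R ^ m * (real (card signs) * real ((2 * R + 1) ^ ?d) * (\<bar>C\<bar> * q)) \<le>
         real R ^ m * (real (card signs) * (3 * real R) ^ ?d * (\<bar>C\<bar> * q))"
        using q by (intro mult_left_mono mult_right_mono) auto
      also have "\<dots> = real (card signs) * 3 ^ ?d * (real R ^ (m + ?d) * (\<bar>C\<bar> * q))"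
        by (simp add: power_mult_distrib power_add)
      finally show ?case by (simp add: q_def)
    qed
  qed
  then show ?thesis using bound by blast
qed

end

section \<open>Tiles and the Peierls argument\<close>

definition saws :: "nat \<Rightarrow> int^'d \<Rightarrow> (int^'d) list set" where
  "saws m x = {js. length js = Suc m \<and> hd js = x \<and> successively adj js \<and> distinct js}"

lemma walks_count:
  fixes x :: "int^'d"
  shows "finite {js. length js = Suc m \<and> hd js = x \<and> successively adj js} \<and>
    card {js. length js = Suc m \<and> hd js = x \<and> successively adj js} \<le> card (ball1 (0 :: int^'d) 1) ^ m"
proof (induction m arbitrary: x)
  case 0
  have "{js. length js = Suc 0 \<and> hd js = x \<and> successively adj js} = {[x]}"
    by (auto simp: length_Suc_conv)
  then show ?case by simp
next
  case (Suc m)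
  let ?W = "\<lambda>m x. {js. length js = Suc m \<and> hd js = x \<and> successively adj js}"
  have sub: "?W (Suc m) x \<subseteq> (\<Union>y\<in>ball1 x 1. (#) x ` ?W m y)"
  proof
    fix js assume js: "js \<in> ?W (Suc m) x"
    then obtain y r where e: "js = x # y # r" by (cases js; cases "tl js") auto
    then have "adj x y" using js by auto
    then have "y \<in> ball1 x 1" by (simp add: ball1_def adj_def l1_minus_commute[of y x])
    moreover have "js \<in> (#) x ` ?W m y" using js e by auto
    ultimately show "js \<in> (\<Union>y\<in>ball1 x 1. (#) x ` ?W m y)" by blast
  qed
  have fin: "finite (\<Union>y\<in>ball1 x 1. (#) x ` ?W m y)" using Suc.IH by auto
  have "card (?W (Suc m) x) \<le> card (\<Union>y\<in>ball1 x 1. (#) x ` ?W m y)" by (rule card_mono[OF fin sub])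
  also have "\<dots> \<le> (\<Sum>y\<in>ball1 x 1. card ((#) x ` ?W m y))" by (rule card_UN_le) simp
  also have "\<dots> \<le> (\<Sum>y\<in>ball1 x 1. card (ball1 (0 :: int^'d) 1) ^ m)"
    using Suc.IH by (intro sum_mono order_trans[OF card_image_le]) auto
  also have "\<dots> = card (ball1 (0 :: int^'d) 1) ^ Suc m" using card_ball1[of x 1] by simp
  finally show ?case using finite_subset[OF sub fin] by blast
qed

lemma saws_count:
  "finite (saws m (x :: int^'d))" "card (saws m (x :: int^'d)) \<le> card (ball1 (0 :: int^'d) 1) ^ m"
proof -
  have sub: "saws m x \<subseteq> {js. length js = Suc m \<and> hd js = x \<and> successively adj js}" by (auto simp: saws_def)
  show "finite (saws m x)" using finite_subset[OF sub] walks_count by blast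
  show "card (saws m x) \<le> card (ball1 (0 :: int^'d) 1) ^ m"
    using card_mono[OF _ sub] walks_count[of m x] by linarith
qed

context iid_product begin

lemma measure_Inter_indep:
  assumes S: "finite S" and Z: "\<And>j. j \<in> S \<Longrightarrow> Z j \<in> sets (PP I)" "\<And>j. j \<in> S \<Longrightarrow> depends_on (N' j) (Z j)"
    and N': "\<And>j. j \<in> S \<Longrightarrow> N' j \<subseteq> I" "\<And>i j. i \<in> S \<Longrightarrow> j \<in> S \<Longrightarrow> i \<noteq> j \<Longrightarrow> N' i \<inter> N' j = {}"
    and \<epsilon>: "\<And>j. j \<in> S \<Longrightarrow> measure (PP I) (Z j) \<le> \<epsilon>"
  shows "measure (PP I) (space (PP I) \<inter> (\<Inter>j\<in>S. Z j)) \<le> \<epsilon> ^ card S \<and> space (PP I) \<inter> (\<Inter>j\<in>S. Z j) \<in> sets (PP I) \<and>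
     depends_on (\<Union>j\<in>S. N' j) (space (PP I) \<inter> (\<Inter>j\<in>S. Z j))"
  using S Z N' \<epsilon>
proof (induction S rule: finite_induct)
  case empty
  show ?case by (simp add: depends_on_def P.prob_space)
next
  case (insert j S)
  let ?Y = "space (PP I) \<inter> (\<Inter>j\<in>S. Z j)"
  have IH: "measure (PP I) ?Y \<le> \<epsilon> ^ card S" "?Y \<in> sets (PP I)" "depends_on (\<Union>j\<in>S. N' j) ?Y"
    using insert.IH insert.prems by auto
  have eq: "space (PP I) \<inter> (\<Inter>j\<in>insert j S. Z j) = Z j \<inter> ?Y"
    using sets.sets_into_space[OF insert.prems(1)[of j]] by auto
  have d: "N' j \<inter> (\<Union>j\<in>S. N' j) = {}" using insert.prems(4)[of j] insert.hyps by blast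
  have "measure (PP I) (Z j \<inter> ?Y) = measure (PP I) (Z j) * measure (PP I) ?Y"
  proof (rule indep_depends_on[OF _ _ _ _ _ d])
    show "(\<Union>j\<in>S. N' j) \<subseteq> I" using insert.prems(3) by blast
  qed (use insert.prems IH in auto)
  also have "\<dots> \<le> \<epsilon> * \<epsilon> ^ card S"
    using insert.prems(5)[of j] IH(1) by (intro mult_mono) (auto intro: order_trans[OF measure_nonneg])
  finally have 1: "measure (PP I) (Z j \<inter> ?Y) \<le> \<epsilon> ^ card (insert j S)" using insert.hyps by simp
  have 2: "depends_on (\<Union>j\<in>insert j S. N' j) (Z j \<inter> ?Y)"
  proof (rule depends_on_Int)
    have "depends_on (N' j) (Z j)" using insert.prems(2) by simp
    then show "depends_on (\<Union>j\<in>insert j S. N' j) (Z j)" by (rule depends_on_mono) auto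
    show "depends_on (\<Union>j\<in>insert j S. N' j) ?Y" by (rule depends_on_mono[OF IH(3)]) auto
  qed
  show ?case unfolding eq using 1 2 insert.prems(1)[of j] IH(2) by auto
qed

lemma peierls:
  fixes Z :: "int^'d \<Rightarrow> ('i \<Rightarrow> 'b) set" and cls :: "int^'d \<Rightarrow> 'c"
  assumes Z: "\<And>j. Z j \<in> sets (PP I)" "\<And>j. depends_on (N' j) (Z j)" "\<And>j. measure (PP I) (Z j) \<le> \<epsilon>"
    and N': "\<And>j. N' j \<subseteq> I" "\<And>i j. cls i = cls j \<Longrightarrow> i \<noteq> j \<Longrightarrow> N' i \<inter> N' j = {}"
    and C: "finite C" "\<And>j. cls j \<in> C" and K: "card C \<le> K"
    and \<epsilon>: "\<epsilon> * real (2 * card (ball1 (0 :: int^'d) 1)) ^ (2 * K) \<le> 1 / 2" "0 \<le> \<epsilon>"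
  shows "\<exists>G\<in>sets (PP I). measure (PP I) G \<le> 2 * (1 / 2) ^ h \<and>
    (\<forall>t\<in>space (PP I) - G. \<forall>js\<in>saws (2 * K * h) (0 :: int^'d). card {j \<in> set js. t \<in> Z j} \<le> K * h)"
proof -
  define b where "b = card (ball1 (0 :: int^'d) 1)"
  define m where "m = 2 * K * h"
  define \<S> where "\<S> js = {S. S \<subseteq> set js \<and> card S = h \<and> (\<forall>i\<in>S. \<forall>j\<in>S. cls i = cls j)}" for js :: "(int^'d) list"
  define A where "A S = space (PP I) \<inter> (\<Inter>j\<in>S. Z j)" for S
  define G where "G = (\<Union>js\<in>saws m 0. \<Union>S\<in>\<S> js. A S)"
  have fin\<S>: "finite (\<S> js)" "card (\<S> js) \<le> 2 ^ length js" for js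
  proof -
    have sub: "\<S> js \<subseteq> Pow (set js)" by (auto simp: \<S>_def)
    then show "finite (\<S> js)" by (rule finite_subset) simp
    have "card (\<S> js) \<le> card (Pow (set js))" using sub by (intro card_mono) auto
    also have "\<dots> = 2 ^ card (set js)" by (simp add: card_Pow)
    also have "\<dots> \<le> 2 ^ length js" using card_length by (intro power_increasing) auto
    finally show "card (\<S> js) \<le> 2 ^ length js" .
  qed
  have AS: "measure (PP I) (A S) \<le> \<epsilon> ^ h" "A S \<in> sets (PP I)" if "S \<in> \<S> js" for S js
  proof -
    have S0: "S \<subseteq> set js" "card S = h" "\<forall>i\<in>S. \<forall>j\<in>S. cls i = cls j" using that unfolding \<S>_def by blast+
    then have S: "finite S" "card S = h" using finite_subset[of S "set js"] by blast+
    have dj: "N' i \<inter> N' j = {}" if "i \<in> S" "j \<in> S" "i \<noteq> j" for i j using N'(2) S0(3) that by blast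
    have "measure (PP I) (A S) \<le> \<epsilon> ^ card S \<and> A S \<in> sets (PP I) \<and> depends_on (\<Union>j\<in>S. N' j) (A S)"
      unfolding A_def by (rule measure_Inter_indep[OF S(1) Z(1,2) N'(1) dj Z(3)])
    then show "measure (PP I) (A S) \<le> \<epsilon> ^ h" "A S \<in> sets (PP I)" using S(2) by auto
  qed
  have sG: "G \<in> sets (PP I)"
    unfolding G_def using saws_count(1) fin\<S>(1) AS(2) by (intro sets.finite_UN) auto
  have "measure (PP I) G \<le> (\<Sum>js\<in>saws m 0. measure (PP I) (\<Union>S\<in>\<S> js. A S))"
    unfolding G_def using saws_count(1) fin\<S>(1) AS(2)
    by (intro P.finite_measure_subadditive_finite) (auto intro!: sets.finite_UN)
  also have "\<dots> \<le> (\<Sum>js\<in>saws m (0 :: int^'d). 2 ^ Suc m * \<epsilon> ^ h)"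
  proof (rule sum_mono)
    fix js :: "(int^'d) list" assume js: "js \<in> saws m 0"
    have "measure (PP I) (\<Union>S\<in>\<S> js. A S) \<le> (\<Sum>S\<in>\<S> js. measure (PP I) (A S))"
      using fin\<S>(1) AS(2) by (intro P.finite_measure_subadditive_finite) auto
    also have "\<dots> \<le> (\<Sum>S\<in>\<S> js. \<epsilon> ^ h)" by (intro sum_mono AS(1))
    also have "\<dots> = real (card (\<S> js)) * \<epsilon> ^ h" by simp
    also have "\<dots> \<le> real (2 ^ Suc m) * \<epsilon> ^ h"
      using fin\<S>(2)[of js] js \<epsilon>(2) by (intro mult_right_mono, unfold of_nat_le_iff) (auto simp: saws_def)
    finally show "measure (PP I) (\<Union>S\<in>\<S> js. A S) \<le> 2 ^ Suc m * \<epsilon> ^ h" by simp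
  qed
  also have "\<dots> = real (card (saws m (0 :: int^'d))) * (2 ^ Suc m * \<epsilon> ^ h)" by simp
  also have "\<dots> \<le> real (b ^ m) * (2 ^ Suc m * \<epsilon> ^ h)"
    using saws_count(2)[of m "0 :: int^'d"] \<epsilon>(2) unfolding b_def
    by (intro mult_right_mono, unfold of_nat_le_iff) auto
  also have "\<dots> = 2 * (real (2 * b) ^ m * \<epsilon> ^ h)" by (simp add: power_mult_distrib)
  also have "real (2 * b) ^ m * \<epsilon> ^ h = (\<epsilon> * real (2 * b) ^ (2 * K)) ^ h"
    unfolding m_def power_mult[of _ "2 * K" h] by (simp only: power_mult_distrib mult.commute)
  also have "2 * (\<epsilon> * real (2 * b) ^ (2 * K)) ^ h \<le> 2 * (1 / 2) ^ h"
    using \<epsilon> unfolding b_def by (intro mult_left_mono power_mono) auto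
  finally have mG: "measure (PP I) G \<le> 2 * (1 / 2) ^ h" .
  have "card {j \<in> set js. t \<in> Z j} \<le> K * h"
    if t: "t \<in> space (PP I) - G" and js: "js \<in> saws m (0 :: int^'d)" for t js
  proof (rule ccontr)
    assume big: "\<not> card {j \<in> set js. t \<in> Z j} \<le> K * h"
    let ?B = "{j \<in> set js. t \<in> Z j}"
    have "\<exists>c\<in>C. card {j \<in> ?B. cls j = c} \<ge> h"
    proof (rule ccontr)
      assume "\<not> (\<exists>c\<in>C. card {j \<in> ?B. cls j = c} \<ge> h)"
      then have small: "card {j \<in> ?B. cls j = c} \<le> h" if "c \<in> C" for c using that by auto
      have "card ?B = card (\<Union>c\<in>C. {j \<in> ?B. cls j = c})"
        by (rule arg_cong[where f = card]) (use C(2) in auto)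
      also have "\<dots> \<le> (\<Sum>c\<in>C. card {j \<in> ?B. cls j = c})" by (rule card_UN_le[OF C(1)])
      also have "\<dots> \<le> (\<Sum>c\<in>C. h)" by (intro sum_mono small)
      also have "\<dots> \<le> K * h" using K by simp
      finally show False using big by simp
    qed
    then obtain c where c: "h \<le> card {j \<in> ?B. cls j = c}" by blast
    obtain S where S: "S \<subseteq> {j \<in> ?B. cls j = c}" "card S = h"
      using obtain_subset_with_card_n[OF c] by blast
    have cc: "cls i = c" if "i \<in> S" for i using S(1) that by blast
    have "S \<subseteq> set js" using S(1) by blast
    then have "S \<in> \<S> js" using S(2) by (simp add: \<S>_def cc)
    moreover have "t \<in> A S" using S t by (auto simp: A_def)
    ultimately have "t \<in> G" using js by (auto simp: G_def)
    then show False using t by simp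
  qed
  then show ?thesis using sG mG unfolding m_def by blast
qed

end

definition tile :: "int \<Rightarrow> int^'d \<Rightarrow> int^'d" where
  "tile s x = (\<chi> i. x $ i div s)"

lemma tile_zero [simp]: "tile s 0 = 0"
  by (simp add: tile_def vec_eq_iff)

lemma tile_adj:
  assumes s: "s > 0" and xy: "adj x y" and ne: "tile s x \<noteq> tile s y"
  shows "adj (tile s x) (tile s y)"
proof -
  obtain i c where ic: "\<bar>c\<bar> = 1" "y = x + axis i c" using adj_imp_axis[OF xy] by blast
  define e where "e = y $ i div s - x $ i div s"
  have eq: "tile s y = tile s x + axis i e" by (auto simp: tile_def vec_eq_iff axis_def ic e_def)
  have y: "y $ i = x $ i + c" by (simp add: ic axis_def)
  have c1: "c = 1 \<or> c = -1" using ic(1) by linarith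
  have "\<bar>e\<bar> \<le> 1"
  proof -
    have xm: "x $ i = s * (x $ i div s) + x $ i mod s" "0 \<le> x $ i mod s" "x $ i mod s < s" using s by auto
    have ym: "y $ i = s * (y $ i div s) + y $ i mod s" "0 \<le> y $ i mod s" "y $ i mod s < s" using s by auto
    have "s * e = c + x $ i mod s - y $ i mod s" using xm(1) ym(1) y by (simp add: e_def algebra_simps)
    moreover have "-1 \<le> c" "c \<le> 1" using c1 by auto
    ultimately have "s * e < s * 2" "s * (-2) < s * e" using xm(2,3) ym(2,3) s by linarith+
    then show ?thesis using s by (simp only: mult_less_cancel_left_pos)
  qed
  moreover have "e \<noteq> 0" using ne eq by auto
  ultimately have "\<bar>e\<bar> = 1" by linarith
  then show ?thesis unfolding eq by (rule adj_axis)
qed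

lemma coarse_path:
  assumes s: "s > 0" and p: "p \<noteq> []" "successively adj p"
  shows "\<exists>js. js \<noteq> [] \<and> hd js = tile s (hd p) \<and> last js = tile s (last p) \<and> distinct js \<and>
    successively adj js \<and> set js \<subseteq> tile s ` set p"
  using p
proof (induction p rule: induct_list012)
  case (2 x)
  then show ?case by (intro exI[of _ "[tile s x]"]) auto
next
  case (3 x y zs)
  then obtain js where js: "js \<noteq> []" "hd js = tile s y" "last js = tile s (last (y # zs))" "distinct js"
    "successively adj js" "set js \<subseteq> tile s ` set (y # zs)" by auto
  show ?case
  proof (cases "tile s x \<in> set js")
    case True
    then obtain l r where lr: "js = l @ tile s x # r" by (meson split_list)
    show ?thesis
      using js lr by (intro exI[of _ "tile s x # r"]) (auto simp: successively_append_iff)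
  next
    case False
    then have "adj (tile s x) (tile s y)" using tile_adj[OF s, of x y] 3 js by (metis hd_in_set successively.simps(3))
    then show ?thesis using js False
      by (intro exI[of _ "tile s x # js"]) (auto simp: successively_Cons)
  qed
qed simp

lemma path_length_l1:
  "p \<noteq> [] \<Longrightarrow> successively adj p \<Longrightarrow> l1 (last p - hd p) \<le> int (length p) - 1"
proof (induction p rule: induct_list012)
  case (3 x y zs)
  then have "l1 (last (y # zs) - y) \<le> int (length (y # zs)) - 1" by auto
  moreover have "l1 (y - x) = 1" using 3 by (simp add: adj_def l1_minus_commute[of y x])
  ultimately show ?case using l1_diff_triangle[of "last (y # zs)" x y] by auto
qed auto

lemma l1_tile:
  fixes x :: "int^'d"
  assumes s: "s > 0"
  shows "l1 x \<le> s * (l1 (tile s x) + int CARD('d))"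
proof -
  have "l1 x \<le> (\<Sum>i\<in>UNIV. s * (\<bar>tile s x $ i\<bar> + 1))"
    unfolding l1_def
  proof (rule sum_mono)
    fix i
    have m: "x $ i = s * (x $ i div s) + x $ i mod s" "0 \<le> x $ i mod s" "x $ i mod s < s" using s by auto
    have "\<bar>x $ i\<bar> \<le> \<bar>s * (x $ i div s)\<bar> + \<bar>x $ i mod s\<bar>" by (metis m(1) abs_triangle_ineq)
    also have "\<bar>s * (x $ i div s)\<bar> = s * \<bar>x $ i div s\<bar>" using s by (simp add: abs_mult)
    also have "s * \<bar>x $ i div s\<bar> + \<bar>x $ i mod s\<bar> \<le> s * \<bar>x $ i div s\<bar> + s" using m(2,3) by linarith
    finally show "\<bar>x $ i\<bar> \<le> s * (\<bar>tile s x $ i\<bar> + 1)" by (simp add: tile_def distrib_left)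
  qed
  also have "\<dots> = s * (l1 (tile s x) + int CARD('d))"
    by (simp add: sum_distrib_left[symmetric] sum.distrib l1_def)
  finally show ?thesis .
qed

lemma coarse_saw:
  fixes x :: "int^'d"
  assumes s: "s > 0" and p: "path_from_to p 0 x" and m: "int m \<le> l1 (tile s x)"
  shows "\<exists>js\<in>saws m 0. set js \<subseteq> tile s ` set p"
proof -
  obtain js where js: "js \<noteq> []" "hd js = tile s 0" "last js = tile s x" "distinct js"
    "successively adj js" "set js \<subseteq> tile s ` set p"
    using coarse_path[OF s, of p] p by (auto simp: path_from_to_iff)
  have "int m \<le> int (length js) - 1" using path_length_l1[OF js(1,5)] js(2,3) m by simp
  then have len: "Suc m \<le> length js" by linarith
  have "successively adj (take (Suc m) js)"
    using js(5) by (metis append_take_drop_id successively_append_iff)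
  moreover have "hd (take (Suc m) js) = 0" using js by (cases js) auto
  moreover have "set (take (Suc m) js) \<subseteq> tile s ` set p" using js(6) set_take_subset by fastforce
  ultimately show ?thesis using len js(4) by (intro bexI[of _ "take (Suc m) js"]) (auto simp: saws_def)
qed

text \<open>Tiles that agree modulo 3 are so far apart that the balls around their points are disjoint.\<close>

lemma tile_neighbourhoods_disjoint:
  fixes j j' :: "int^'d"
  assumes R: "R > 0" and cl: "\<And>i. j $ i mod 3 = j' $ i mod 3" and ne: "j \<noteq> j'"
    and y: "tile R y = j" "l1 (z - y) \<le> R" and y': "tile R y' = j'" "l1 (z - y') \<le> R"
  shows False
proof -
  obtain i where i: "j $ i \<noteq> j' $ i" using ne by (auto simp: vec_eq_iff)
  have rng: "R * (k $ i) \<le> w $ i" "w $ i < R * (k $ i) + R" if "tile R w = k" for w k :: "int^'d"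
  proof -
    have "w $ i = R * (w $ i div R) + w $ i mod R" "0 \<le> w $ i mod R" "w $ i mod R < R" using R by auto
    moreover have "w $ i div R = k $ i" using that by (auto simp: tile_def)
    ultimately show "R * (k $ i) \<le> w $ i" "w $ i < R * (k $ i) + R" by auto
  qed
  have "\<bar>z $ i - y $ i\<bar> \<le> R" "\<bar>z $ i - y' $ i\<bar> \<le> R"
    using l1_component_le[of "z - y" i] l1_component_le[of "z - y'" i] y y' by auto
  then have "R * (j $ i) < R * (j' $ i) + R * 3" "R * (j' $ i) < R * (j $ i) + R * 3"
    using rng[OF y(1)] rng[OF y'(1)] by linarith+
  then have "R * (j $ i) < R * (j' $ i + 3)" "R * (j' $ i) < R * (j $ i + 3)" by (simp_all add: distrib_left)
  then have "j $ i < j' $ i + 3" "j' $ i < j $ i + 3" using R by simp_all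
  moreover have "(j $ i - j' $ i) mod 3 = 0" using cl[of i] by (simp add: mod_eq_dvd_iff)
  ultimately show False using i by presburger
qed

section \<open>Events of first-passage percolation\<close>

context fpp begin

lemma geotime_measurable: "(\<lambda>t. geotime t x y) \<in> borel_measurable Om" for x y :: "int^'d"
  unfolding geotime_def
  by (rule borel_measurable_INF) (auto simp: path_from_to_iff intro: ptime_measurable)

lemma is_geodesic_sets: "{t \<in> space Om. is_geodesic t x y g} \<in> sets Om" for x y :: "int^'d"
proof (cases "path_from_to g x y \<and> distinct g")
  case True
  then have "(\<lambda>t. ptime t g) \<in> borel_measurable Om" by (auto simp: path_from_to_iff intro: ptime_measurable)
  then have "{t \<in> space Om. ptime t g = geotime t x y} \<in> sets Om" using geotime_measurable by measurable
  then show ?thesis using True by (simp add: is_geodesic_def)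
qed (auto simp: is_geodesic_def)

lemma finite_time_sets: "{t \<in> space Om. geotime t x y < \<infinity>} \<in> sets Om" for x y :: "int^'d"
  using geotime_measurable[of x y] by measurable

lemma translate_lattice_edges: "e \<in> lattice_edges \<Longrightarrow> (\<lambda>z. z + x) ` e \<in> lattice_edges" for x :: "int^'d"
  by (auto simp: lattice_edges_def) (metis adj_translate)

lemma in_event_shift_sets:
  fixes x :: "int^'d"
  assumes A: "A \<in> sets (PiM (edges_in (box Lv)) (\<lambda>_. borel :: ennreal measure))"
  shows "{t \<in> space Om. in_event Lv A (shift_conf x t)} \<in> sets Om"
proof -
  have "(\<lambda>t. \<lambda>e\<in>edges_in (box Lv). t ((\<lambda>z. z + x) ` e)) \<in> Om \<rightarrow>\<^sub>M PiM (edges_in (box Lv)) (\<lambda>_. borel)"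
    using edges_in_subset translate_lattice_edges by (intro measurable_restrict coordinate_measurable) blast
  from measurable_sets[OF this A] show ?thesis
    by (simp add: in_event_def shift_conf_def[abs_def] vimage_def Int_def conj_commute)
qed

lemma satisfies_cond_sets:
  fixes x :: "int^'d"
  assumes A: "A \<in> sets (PiM (edges_in (box Lv)) (\<lambda>_. borel :: ennreal measure))"
  shows "{t \<in> space Om. satisfies_cond Lv u v A t p x} \<in> sets Om"
proof -
  define q where "q = map (\<lambda>y. y - x) p"
  define c where "c \<longleftrightarrow> u \<in> set q \<and> v \<in> set q \<and>
       (\<forall>i j k. i < length q \<and> j < length q \<and> q ! i = u \<and> q ! j = v \<and>
                 min i j \<le> k \<and> k \<le> max i j \<longrightarrow> q ! k \<in> box Lv)"
  have "{t \<in> space Om. satisfies_cond Lv u v A t p x} = (if c then {t \<in> space Om. in_event Lv A (shift_conf x t)} else {})"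
    unfolding satisfies_cond_def Let_def q_def[symmetric] c_def by auto
  then show ?thesis using in_event_shift_sets[OF A] by simp
qed

lemma N_pat_sets:
  fixes p :: "(int^'d) list"
  assumes A: "A \<in> sets (PiM (edges_in (box Lv)) (\<lambda>_. borel :: ennreal measure))"
  shows "{t \<in> space Om. P (N_pat Lv u v A t p)} \<in> sets Om"
proof -
  define S where "S = (\<lambda>y. y - u) ` set p"
  have S: "finite S" by (simp add: S_def)
  have sub: "{x. satisfies_cond Lv u v A t p x} \<subseteq> S" for t
    by (auto simp: satisfies_cond_def Let_def S_def intro!: image_eqI[of _ "\<lambda>y. y - u"])
  have eq: "{t \<in> space Om. P (N_pat Lv u v A t p)} =
     (\<Union>X\<in>{X \<in> Pow S. P (card X)}. {t \<in> space Om. \<forall>x\<in>S. satisfies_cond Lv u v A t p x \<longleftrightarrow> x \<in> X})" (is "?l = ?r")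
  proof
    show "?l \<subseteq> ?r"
    proof
      fix t assume "t \<in> ?l"
      then show "t \<in> ?r" using sub[of t]
        by (intro UN_I[of "{x. satisfies_cond Lv u v A t p x}"]) (auto simp: N_pat_def)
    qed
    show "?r \<subseteq> ?l"
    proof
      fix t assume "t \<in> ?r"
      then obtain X where X: "X \<subseteq> S" "P (card X)" "t \<in> space Om" "\<forall>x\<in>S. satisfies_cond Lv u v A t p x \<longleftrightarrow> x \<in> X" by auto
      then have "{x. satisfies_cond Lv u v A t p x} = X" using sub[of t] by blast
      then show "t \<in> ?l" using X by (simp add: N_pat_def)
    qed
  qed
  have "{t \<in> space Om. \<forall>x\<in>S. satisfies_cond Lv u v A t p x \<longleftrightarrow> x \<in> X} \<in> sets Om" for X
  proof (rule sets.sets_Collect_finite_All[OF _ S])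
    fix x
    have "{t \<in> space Om. \<not> satisfies_cond Lv u v A t p x} \<in> sets Om"
      using satisfies_cond_sets[OF A] by (rule sets.sets_Collect_neg)
    then show "{t \<in> space Om. satisfies_cond Lv u v A t p x \<longleftrightarrow> x \<in> X} \<in> sets Om"
      using satisfies_cond_sets[OF A] by (cases "x \<in> X") auto
  qed
  then show ?thesis unfolding eq using S by (intro sets.finite_UN) auto
qed

end

locale fpp_pattern = fpp L D for L and D :: "'d::finite itself" +
  fixes Lv :: "nat^'d" and u v :: "int^'d" and A :: "((int^'d) set \<Rightarrow> ennreal) set" and \<tau> :: real
  assumes dim: "CARD('d) \<ge> 2"
    and uv: "u \<in> boundary (box Lv)" "v \<in> boundary (box Lv)" "u \<noteq> v"
    and A: "A \<in> sets (PiM (edges_in (box Lv)) (\<lambda>_. borel :: ennreal measure))"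
    and pattern_pos: "measure Om {t \<in> space Om. in_event Lv A t \<and>
        (\<exists>p. path_from_to p u v \<and> set p \<subseteq> box Lv \<and> ptime t p < \<infinity>)} > 0"
    and \<tau>: "0 \<le> \<tau>" "measure L {..<ennreal \<tau>} = 0" "\<And>\<delta>. \<delta> > 0 \<Longrightarrow> measure L {..ennreal (\<tau> + \<delta>)} > 0"
    and crit: "\<tau> = 0 \<Longrightarrow> measure L {ennreal \<tau>} < p_c TYPE('d)" "\<tau> > 0 \<Longrightarrow> measure L {ennreal \<tau>} < oriented_p_c TYPE('d)"
    and wall: "\<And>\<epsilon> n. \<epsilon> > 0 \<Longrightarrow> \<exists>b. measure L {b<..} \<le> \<epsilon> \<and> measure L {of_nat n * b..} > 0"
begin

definition Lam :: "int^'d \<Rightarrow> (int^'d) set" where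
  "Lam y = {z. z - y \<in> box Lv}"

definition pat :: "real \<Rightarrow> int^'d \<Rightarrow> ((int^'d) set \<Rightarrow> ennreal) set" where
  "pat K y = {t \<in> space Om. in_event Lv A (shift_conf y t) \<and>
     (\<exists>p. path_from_to p (u + y) (v + y) \<and> set p \<subseteq> Lam y \<and> ptime t p \<le> ennreal K)}"

lemma finite_Lam: "finite (Lam y)"
proof -
  have "Lam y \<subseteq> (\<lambda>z. z + y) ` box Lv" by (auto simp: Lam_def intro!: image_eqI[of _ _ "_ - y"])
  then show ?thesis by (rule finite_subset) simp
qed

lemma pat_sets: "pat K y \<in> sets Om"
proof -
  have "{t \<in> space Om. \<exists>p. (path_from_to p (u + y) (v + y) \<and> set p \<subseteq> Lam y) \<and> ptime t p \<le> ennreal K} \<in> sets Om"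
  proof (rule ex_measurable)
    fix p assume "path_from_to p (u + y) (v + y) \<and> set p \<subseteq> Lam y"
    then have "(\<lambda>t. ptime t p) \<in> borel_measurable Om" by (auto simp: path_from_to_iff intro: ptime_measurable)
    then show "{t \<in> space Om. ptime t p \<le> ennreal K} \<in> sets Om" by measurable
  qed
  moreover have "pat K y = {t \<in> space Om. in_event Lv A (shift_conf y t)} \<inter>
     {t \<in> space Om. \<exists>p. (path_from_to p (u + y) (v + y) \<and> set p \<subseteq> Lam y) \<and> ptime t p \<le> ennreal K}"
    by (auto simp: pat_def)
  ultimately show ?thesis using in_event_shift_sets[OF A, of y] by simp
qed

lemma pat_depends: "depends_on (edges_in (Lam y)) (pat K y)"
proof (rule depends_onI)
  fix t s assume t: "t \<in> space Om" "s \<in> space Om" and ts: "\<And>e. e \<in> edges_in (Lam y) \<Longrightarrow> t e = s e" and tp: "t \<in> pat K y"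
  obtain p where p: "path_from_to p (u + y) (v + y)" "set p \<subseteq> Lam y" "ptime t p \<le> ennreal K"
    and ev: "in_event Lv A (shift_conf y t)" using tp by (auto simp: pat_def)
  have "ptime t p = ptime s p"
  proof (rule ptime_cong)
    show "successively adj p" using p(1) by (simp add: path_from_to_iff)
    show "t {x, z} = s {x, z}" if "adj x z" "x \<in> set p" "z \<in> set p" for x z
      using that p(2) by (intro ts) auto
  qed
  moreover have "in_event Lv A (shift_conf y s)"
    using ev in_event_shift_cong[of y Lv t s A] ts by (auto simp: Lam_def)
  ultimately show "s \<in> pat K y" using t p by (auto simp: pat_def)
qed

lemma ptime_map:
  fixes y :: "int^'d"
  assumes "successively adj p"
  shows "ptime (\<lambda>e\<in>lattice_edges. t ((\<lambda>z. z + y) ` e)) p = ptime t (map (\<lambda>z. z + y) p)"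
  using assms by (induction p rule: induct_list012) auto

lemma path_map: "path_from_to (map (\<lambda>z. z + y) p) (a + y) (b + y) \<longleftrightarrow> path_from_to p a b" for y :: "int^'d"
  by (auto simp: path_from_to_iff successively_map hd_map last_map)

lemma pat_translate: "measure Om (pat K y) = measure Om (pat K 0)"
proof -
  define f where "f e = (\<lambda>z. z + y) ` e" for e :: "(int^'d) set"
  have f: "inj_on f lattice_edges" "f \<in> lattice_edges \<rightarrow> lattice_edges"
    using translate_lattice_edges by (auto simp: f_def inj_on_def inj_image_eq_iff)
  have eq: "{t \<in> space Om. (\<lambda>n\<in>lattice_edges. t (f n)) \<in> pat K 0} = pat K y"
  proof -
    have "(\<lambda>n\<in>lattice_edges. t (f n)) \<in> pat K 0 \<longleftrightarrow> t \<in> pat K y" if t: "t \<in> space Om" for t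
    proof -
      define t' where "t' = (\<lambda>n\<in>lattice_edges. t (f n))"
      have t': "t' \<in> space Om" by (simp add: t'_def space_PiM)
      have ev: "in_event Lv A (shift_conf 0 t') \<longleftrightarrow> in_event Lv A (shift_conf y t)"
      proof -
        have "restrict (shift_conf 0 t') (edges_in (box Lv)) = restrict (shift_conf y t) (edges_in (box Lv))"
          by (rule restrict_ext) (use edges_in_subset in \<open>auto simp: shift_conf_def t'_def f_def\<close>)
        then show ?thesis by (simp add: in_event_def)
      qed
      have "(\<exists>p. path_from_to p (u + 0) (v + 0) \<and> set p \<subseteq> Lam 0 \<and> ptime t' p \<le> ennreal K) \<longleftrightarrow>
         (\<exists>p. path_from_to p (u + y) (v + y) \<and> set p \<subseteq> Lam y \<and> ptime t p \<le> ennreal K)" (is "?l \<longleftrightarrow> ?r")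
      proof
        assume ?l
        then obtain p where p: "path_from_to p u v" "set p \<subseteq> Lam 0" "ptime t' p \<le> ennreal K" by auto
        then have "ptime t (map (\<lambda>z. z + y) p) \<le> ennreal K"
          using ptime_map[of p t y] by (simp add: path_from_to_iff t'_def f_def)
        then show ?r using p by (intro exI[of _ "map (\<lambda>z. z + y) p"]) (auto simp: path_map Lam_def)
      next
        assume ?r
        then obtain p where p: "path_from_to p (u + y) (v + y)" "set p \<subseteq> Lam y" "ptime t p \<le> ennreal K" by auto
        define q where "q = map (\<lambda>z. z + (- y)) p"
        have pq: "p = map (\<lambda>z. z + y) q" by (simp add: q_def o_def)
        then have q: "path_from_to q u v" using p(1) path_map by simp
        then have "ptime t' q \<le> ennreal K"
          using ptime_map[of q t y] p(3) pq by (simp add: path_from_to_iff t'_def f_def)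
        then show ?l using q p(2) unfolding pq by (intro exI[of _ q]) (auto simp: Lam_def)
      qed
      then show ?thesis using ev t t' unfolding t'_def[symmetric] by (simp add: pat_def)
    qed
    moreover have "pat K y \<subseteq> space Om" by (auto simp: pat_def)
    ultimately show ?thesis by blast
  qed
  show ?thesis using measure_reindex(1)[OF f pat_sets[of K 0]] eq by simp
qed

lemma pat_pos: "\<exists>K\<ge>0. measure Om (pat K 0) > 0"
proof (rule ccontr)
  assume "\<not> (\<exists>K\<ge>0. measure Om (pat K 0) > 0)"
  then have "measure Om (pat (real n) 0) = 0" for n
    by (metis measure_nonneg of_nat_0_le_iff order_le_less)
  then have "emeasure Om (pat (real n) 0) = 0" for n by (simp add: P.emeasure_eq_measure)
  then have 0: "emeasure Om (\<Union>n. pat (real n) 0) = 0"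
    using pat_sets by (intro emeasure_UN_eq_0) auto
  have s0: "shift_conf 0 t = t" for t :: "(int^'d) set \<Rightarrow> ennreal" by (rule ext) (simp add: shift_conf_def)
  have "{t \<in> space Om. in_event Lv A t \<and> (\<exists>p. path_from_to p u v \<and> set p \<subseteq> box Lv \<and> ptime t p < \<infinity>)}
     \<subseteq> (\<Union>n. pat (real n) 0)"
  proof
    fix t assume "t \<in> {t \<in> space Om. in_event Lv A t \<and> (\<exists>p. path_from_to p u v \<and> set p \<subseteq> box Lv \<and> ptime t p < \<infinity>)}"
    then obtain p where p: "t \<in> space Om" "in_event Lv A t" "path_from_to p u v" "set p \<subseteq> box Lv" "ptime t p < \<infinity>" by auto
    obtain r where r: "ptime t p = ennreal r" using p(5) by (cases "ptime t p") auto
    obtain n :: nat where "r \<le> real n" using real_arch_simple by blast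
    then have "ptime t p \<le> ennreal (real n)" unfolding r by (rule ennreal_leI)
    then have "t \<in> pat (real n) 0" using p s0 by (auto simp: pat_def Lam_def)
    then show "t \<in> (\<Union>n. pat (real n) 0)" by blast
  qed
  then have "measure Om {t \<in> space Om. in_event Lv A t \<and> (\<exists>p. path_from_to p u v \<and> set p \<subseteq> box Lv \<and> ptime t p < \<infinity>)}
     \<le> measure Om (\<Union>n. pat (real n) 0)"
    using pat_sets by (intro P.finite_measure_mono) auto
  also have "\<dots> = 0" using 0 by (simp add: measure_def)
  finally show False using pattern_pos by simp
qed

end

lemma ptime_le_const:
  assumes "\<And>z w. consec p z w \<Longrightarrow> t {z, w} \<le> c"
  shows "ptime t p \<le> of_nat (length p - 1) * c"
  using assms
proof (induction p rule: induct_list012)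
  case (3 x y zs)
  have "consec (y # zs) z w \<Longrightarrow> consec (x # y # zs) z w" for z w
    unfolding consec_def by (metis append_Cons)
  then have "ptime t (y # zs) \<le> of_nat (length (y # zs) - 1) * c" using 3 by blast
  moreover have "consec (x # y # zs) x y" unfolding consec_def by (rule exI[of _ "[]"], rule exI[of _ zs]) simp
  then have "t {x, y} \<le> c" using 3 by blast
  ultimately have "t {x, y} + ptime t (y # zs) \<le> c + of_nat (length (y # zs) - 1) * c" by (rule add_mono[rotated])
  then show ?case by (simp add: distrib_right)
qed auto

lemma consec_adj: "successively adj p \<Longrightarrow> consec p z w \<Longrightarrow> adj z w"
  by (auto simp: consec_def successively_append_iff)

lemma ball_crossing_decomposition:
  fixes y :: "int^'d"
  assumes R: "R \<ge> 1" and g: "path_from_to g p q" "distinct g" and pq: "p \<notin> ball1 y (int R)" "q \<notin> ball1 y (int R)"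
    and y: "y \<in> set g"
  shows "\<exists>\<gamma>1 a \<gamma>2 b \<gamma>3. g = \<gamma>1 @ a # \<gamma>2 @ b # \<gamma>3 \<and> set \<gamma>1 \<inter> ball1 y (int R) = {} \<and> set \<gamma>3 \<inter> ball1 y (int R) = {} \<and>
    l1 (a - y) = int R \<and> l1 (b - y) = int R \<and> a \<noteq> b \<and> y \<in> set \<gamma>2"
proof -
  let ?B = "ball1 y (int R)"
  have yB: "y \<in> ?B" by (simp add: ball1_def)
  have su: "successively adj g" using g by (simp add: path_from_to_iff)
  have sphere: "l1 (a - y) = int R" if "adj c a" "c \<notin> ?B" "a \<in> ?B" for a c
    using adj_l1_diff[OF that(1), of y] that(2,3) by (auto simp: ball1_def)
  obtain \<gamma>1 a r where a: "g = \<gamma>1 @ a # r" "a \<in> ?B" "\<forall>z\<in>set \<gamma>1. z \<notin> ?B"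
    using split_list_first_prop[of g "\<lambda>z. z \<in> ?B"] y yB by blast
  have "\<gamma>1 \<noteq> []" using a g pq by (auto simp: path_from_to_iff)
  then have "adj (last \<gamma>1) a" "last \<gamma>1 \<notin> ?B" using su a by (auto simp: successively_append_iff)
  then have la: "l1 (a - y) = int R" using sphere a(2) by blast
  then have "y \<noteq> a" using R by auto
  then have "y \<in> set r" using y a yB by auto
  then obtain \<gamma>2 b \<gamma>3 where b: "r = \<gamma>2 @ b # \<gamma>3" "b \<in> ?B" "\<forall>z\<in>set \<gamma>3. z \<notin> ?B"
    using split_list_last_prop[of r "\<lambda>z. z \<in> ?B"] yB by blast
  have "\<gamma>3 \<noteq> []" using a b g pq by (auto simp: path_from_to_iff)
  then obtain c \<gamma>3' where c: "\<gamma>3 = c # \<gamma>3'" by (cases \<gamma>3) auto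
  have "successively adj ((\<gamma>1 @ a # \<gamma>2) @ (b # c # \<gamma>3'))" using su a(1) b(1) c by simp
  then have "adj b c" unfolding successively_append_iff by simp
  then have "adj c b" "c \<notin> ?B" using c b(3) adj_sym by auto
  then have lb: "l1 (b - y) = int R" using sphere b(2) by blast
  then have "y \<noteq> b" using R by auto
  then have "y \<in> set \<gamma>2" using \<open>y \<in> set r\<close> b yB by auto
  moreover have "a \<noteq> b" using g(2) a b by auto
  ultimately show ?thesis using a b la lb by blast
qed

context fpp begin

lemma crossing_prefix:
  assumes R: "R \<ge> 1" and q: "path_from_to q y z" "l1 (z - y) \<ge> int R"
  shows "\<exists>q1 r. crossing y R q1 \<and> ptime t q1 \<le> ptime t q"
proof -
  have "z \<in> set q" using q by (auto simp: path_from_to_iff)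
  then obtain l w r where s: "q = l @ w # r" "l1 (w - y) \<ge> int R" "\<forall>x\<in>set l. \<not> l1 (x - y) \<ge> int R"
    using split_list_first_prop[of q "\<lambda>x. l1 (x - y) \<ge> int R"] q(2) by blast
  have "l \<noteq> []" using s q R by (auto simp: path_from_to_iff)
  have pw: "path_from_to (l @ [w]) y w" using path_split[of l w r y z] q(1) s(1) by simp
  then have "adj (last l) w" using \<open>l \<noteq> []\<close> by (auto simp: path_from_to_iff successively_append_iff)
  moreover have "l1 (last l - y) < int R" using s(3) \<open>l \<noteq> []\<close> by (auto simp: not_le)
  ultimately have lw: "l1 (w - y) = int R" using adj_l1_diff[of "last l" w y] s(2) by linarith
  have "crossing y R (l @ [w])"
    using pw lw s(3) by (auto simp: crossing_def path_from_to_iff ball1_def not_le less_imp_le)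
  moreover have "ptime t (l @ [w]) \<le> ptime t q" unfolding s(1) by (subst (2) ptime_append) simp
  ultimately show ?thesis by blast
qed

lemma slow_passage:
  assumes R: "R \<ge> 1" and t: "t \<in> slow c y R" and p: "successively adj (a # \<gamma>2 @ [b])" "y \<in> set \<gamma>2"
    and ab: "l1 (a - y) = int R" "l1 (b - y) = int R"
  shows "c + c \<le> ptime t (a # \<gamma>2 @ [b])"
proof -
  obtain \<delta>1 \<delta>2 where s: "\<gamma>2 = \<delta>1 @ y # \<delta>2" using p(2) by (meson split_list)
  have "path_from_to ((a # \<delta>1) @ y # (\<delta>2 @ [b])) a b" using p(1) s by (simp add: path_from_to_iff)
  note sp = path_split[OF this]
  have 1: "c \<le> ptime t ((a # \<delta>1) @ [y])"
  proof -
    obtain q1 where "crossing y R q1" "ptime t q1 \<le> ptime t (rev ((a # \<delta>1) @ [y]))"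
      using crossing_prefix[OF R path_rev[OF conjunct1[OF sp]]] ab by auto
    then show ?thesis using t unfolding ptime_rev by (auto simp: slow_def intro: order_trans)
  qed
  have 2: "c \<le> ptime t (y # \<delta>2 @ [b])"
  proof -
    obtain q1 where "crossing y R q1" "ptime t q1 \<le> ptime t (y # \<delta>2 @ [b])"
      using crossing_prefix[OF R conjunct2[OF sp]] ab by auto
    then show ?thesis using t by (auto simp: slow_def intro: order_trans)
  qed
  have "ptime t (a # \<gamma>2 @ [b]) = ptime t ((a # \<delta>1) @ [y]) + ptime t (y # \<delta>2 @ [b])"
    using ptime_append[of t "a # \<delta>1" y "\<delta>2 @ [b]"] s by simp
  then show ?thesis using 1 2 by (simp add: add_mono)
qed

end

context fpp_pattern begin

definition good :: "ennreal \<Rightarrow> real \<Rightarrow> nat \<Rightarrow> int^'d \<Rightarrow> ((int^'d) set \<Rightarrow> ennreal) set" where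
  "good b k0 R y = slow (ennreal (\<tau> * real R + k0)) y R \<inter> {t \<in> space Om. \<forall>e\<in>edges_in (ball1 y (int R)). t e \<le> b}"

definition few :: "int^'d \<Rightarrow> nat \<Rightarrow> ((int^'d) set \<Rightarrow> ennreal) set" where
  "few x k = {t \<in> space Om. geotime t 0 x < \<infinity> \<and> (\<exists>g. is_geodesic t 0 x g \<and> N_pat Lv u v A t g < k)}"

definition forced :: "int^'d \<Rightarrow> int^'d \<Rightarrow> ((int^'d) set \<Rightarrow> ennreal) set" where
  "forced x y = {t \<in> space Om. \<forall>g. is_geodesic t 0 x g \<longrightarrow> satisfies_cond Lv u v A t g y}"

definition passes :: "nat \<Rightarrow> int^'d \<Rightarrow> int^'d \<Rightarrow> int^'d \<Rightarrow> (int^'d) list \<Rightarrow> bool" where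
  "passes R y a b g \<longleftrightarrow> (\<exists>\<gamma>1 \<gamma>2 \<gamma>3. g = \<gamma>1 @ a # \<gamma>2 @ b # \<gamma>3 \<and> set \<gamma>1 \<inter> ball1 y (int R) = {} \<and> set \<gamma>3 \<inter> ball1 y (int R) = {} \<and>
    l1 (a - y) = int R \<and> l1 (b - y) = int R \<and> a \<noteq> b \<and> y \<in> set \<gamma>2)"

definition visit :: "ennreal \<Rightarrow> real \<Rightarrow> nat \<Rightarrow> int^'d \<Rightarrow> nat \<Rightarrow> int^'d \<Rightarrow> int^'d \<Rightarrow> int^'d \<Rightarrow> ((int^'d) set \<Rightarrow> ennreal) set" where
  "visit bd k0 R x k y a b = good bd k0 R y \<inter> {t \<in> space Om. geotime t 0 x < \<infinity> \<and>
     (\<exists>g. is_geodesic t 0 x g \<and> N_pat Lv u v A t g < k \<and> passes R y a b g)}"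

lemma good_sets: "good b k0 R y \<in> sets Om"
proof -
  have "{t \<in> space Om. \<forall>e\<in>edges_in (ball1 y (int R)). t e \<le> b} \<in> sets Om"
  proof (rule sets.sets_Collect_finite_All)
    fix e assume "e \<in> edges_in (ball1 y (int R))"
    then have "e \<in> lattice_edges" using edges_in_subset by blast
    from coordinate_measurable[OF this] show "{t \<in> space Om. t e \<le> b} \<in> sets Om" by measurable
  qed simp
  then show ?thesis unfolding good_def using slow_sets by (rule sets.Int[rotated])
qed

lemma geodesic_event_sets:
  "{t \<in> space Om. geotime t 0 x < \<infinity> \<and> (\<exists>g. is_geodesic t 0 x g \<and> N_pat Lv u v A t g < k \<and> Q g)} \<in> sets Om"
proof -
  have 1: "{t \<in> space Om. \<exists>g. Q g \<and> (is_geodesic t 0 x g \<and> N_pat Lv u v A t g < k)} \<in> sets Om"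
    by (rule ex_measurable) (rule sets.sets_Collect_conj[OF N_pat_sets[OF A] is_geodesic_sets])
  have "{t \<in> space Om. geotime t 0 x < \<infinity> \<and> (\<exists>g. is_geodesic t 0 x g \<and> N_pat Lv u v A t g < k \<and> Q g)} =
     {t \<in> space Om. geotime t 0 x < \<infinity>} \<inter> {t \<in> space Om. \<exists>g. Q g \<and> (is_geodesic t 0 x g \<and> N_pat Lv u v A t g < k)}"
    by auto
  then show ?thesis using 1 finite_time_sets by (simp only: sets.Int)
qed

lemma few_sets: "few x k \<in> sets Om"
  using geodesic_event_sets[of x k "\<lambda>_. True"] by (simp add: few_def)

lemma visit_sets: "visit bd k0 R x k y a b \<in> sets Om"
  unfolding visit_def using good_sets geodesic_event_sets by (rule sets.Int)

lemma forced_sets: "forced x y \<in> sets Om"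
proof -
  have "{t \<in> space Om. is_geodesic t 0 x g \<longrightarrow> satisfies_cond Lv u v A t g y} \<in> sets Om" for g
    using satisfies_cond_sets[OF A] is_geodesic_sets by (rule sets.sets_Collect_imp)
  then show ?thesis unfolding forced_def by (rule sets.sets_Collect_countable_All)
qed

end

section \<open>Resampling a ball\<close>

lemma card_edges_in_le: "finite B \<Longrightarrow> card (edges_in B) \<le> card B * card B"
proof -
  assume B: "finite B"
  have "edges_in B \<subseteq> (\<lambda>(a, b). {a, b}) ` (B \<times> B)" by (auto simp: edges_in_def lattice_edges_def)
  then have "card (edges_in B) \<le> card (B \<times> B)" using B by (intro surj_card_le[rotated]) auto
  then show ?thesis by (simp add: card_cartesian_product)
qed

lemma bridge_in_ball:
  fixes y z w :: "int^'d"
  assumes "z \<in> ball1 y (int R)" "w \<in> ball1 y (int R)" and le: "\<And>e. e \<in> edges_in (ball1 y (int R)) \<Longrightarrow> t e \<le> c"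
  shows "\<exists>p. path_from_to p z w \<and> ptime t p \<le> of_nat (2 * R) * c"
proof -
  have half: "\<exists>p. path_from_to p x y \<and> ptime t p \<le> of_nat R * c" if x: "x \<in> ball1 y (int R)" for x
  proof -
    obtain p where p: "path_from_to p (x - y) 0" "length p = nat (l1 (x - y)) + 1" "\<forall>z\<in>set p. l1 z \<le> l1 (x - y)"
      using path_to_center by blast
    define q where "q = map (\<lambda>z. z + y) p"
    have q: "path_from_to q x y"
      using p(1) by (auto simp: q_def path_from_to_iff successively_map hd_map last_map)
    have qB: "set q \<subseteq> ball1 y (int R)" using p(3) x by (auto simp: q_def ball1_def)
    have "ptime t q \<le> of_nat (length q - 1) * c"
    proof (rule ptime_le_const)
      fix z w assume c: "consec q z w"
      then have "adj z w" using consec_adj q by (auto simp: path_from_to_iff)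
      then show "t {z, w} \<le> c" using consec_in_set[OF c] qB by (intro le) auto
    qed
    also have "length q - 1 \<le> R" using p(2) x by (simp add: q_def ball1_def)
    then have "of_nat (length q - 1) * c \<le> of_nat R * c" by (intro mult_right_mono) auto
    finally show ?thesis using q by blast
  qed
  obtain p q where p: "path_from_to p z y" "ptime t p \<le> of_nat R * c" and q: "path_from_to q w y" "ptime t q \<le> of_nat R * c"
    using half assms(1,2) by meson
  have "ptime t (butlast p @ rev q) \<le> of_nat R * c + of_nat R * c"
    unfolding ptime_join[OF p(1) path_rev[OF q(1)]] ptime_rev using p(2) q(2) by (rule add_mono)
  also have "\<dots> = of_nat (2 * R) * c" by (simp add: mult_2 distrib_right)
  finally show ?thesis using path_join[OF p(1) path_rev[OF q(1)]] by blast
qed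

lemma translated_route:
  fixes y :: "int^'d"
  assumes "corridor Lv (int R) (a - y) (b - y) u' v' P1 P2"
  shows "route (ball1 y (int R)) {z. l1 (z - y) < int R} {z. z - y \<in> box Lv} a b (u' + y) (v' + y)
    (map (\<lambda>z. z + y) P1) (map (\<lambda>z. z + y) P2)"
proof -
  have P1: "P1 \<noteq> []" "successively adj P1" "hd P1 = a - y" "last P1 = u'"
    and P2: "P2 \<noteq> []" "successively adj P2" "hd P2 = v'" "last P2 = b - y"
    and dist: "distinct (P1 @ P2)" and L: "set P1 \<inter> box Lv = {u'}" "set P2 \<inter> box Lv = {v'}"
    and small: "\<forall>x\<in>set P1 \<union> set P2. x \<noteq> a - y \<and> x \<noteq> b - y \<longrightarrow> l1 x < int R"
    and la: "l1 (a - y) = int R" and lb: "l1 (b - y) = int R" and Lb: "\<forall>x\<in>box Lv. l1 x < int R"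
    using assms by (auto simp: corridor_def path_from_to_iff)
  show ?thesis
  proof
    show "w \<in> ball1 y (int R)" if "z \<in> {z. l1 (z - y) < int R}" "adj z w" for z w
      using adj_l1_diff[OF that(2), of y] that(1) by (auto simp: ball1_def)
    show "set (map (\<lambda>z. z + y) P1) \<union> set (map (\<lambda>z. z + y) P2) \<subseteq> {z. l1 (z - y) < int R} \<union> {a, b}"
    proof
      fix x assume "x \<in> set (map (\<lambda>z. z + y) P1) \<union> set (map (\<lambda>z. z + y) P2)"
      then have "x - y \<in> set P1 \<union> set P2" by auto
      then have "l1 (x - y) < int R \<or> x - y = a - y \<or> x - y = b - y" using small by blast
      then show "x \<in> {z. l1 (z - y) < int R} \<union> {a, b}" by auto
    qed
    show "path_from_to (map (\<lambda>z. z + y) P1) a (u' + y)"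
      using P1 by (auto simp: path_from_to_iff successively_map hd_map last_map)
    show "path_from_to (map (\<lambda>z. z + y) P2) (v' + y) b"
      using P2 by (auto simp: path_from_to_iff successively_map hd_map last_map)
    show "distinct (map (\<lambda>z. z + y) P1 @ map (\<lambda>z. z + y) P2)"
      using dist by (simp flip: map_append add: distinct_map inj_on_def)
    show "set (map (\<lambda>z. z + y) P1) \<inter> {z. z - y \<in> box Lv} = {u' + y}" using L(1) by force
    show "set (map (\<lambda>z. z + y) P2) \<inter> {z. z - y \<in> box Lv} = {v' + y}" using L(2) by force
  qed (use la lb Lb in \<open>auto simp: ball1_def\<close>)
qed

context fpp_pattern begin

text \<open>The condition on \<open>k0\<close> makes the new route through the ball, of at most \<open>2 * R + K0\<close> cheap edges and
  a pattern, faster than the two crossings of a good ball by the old geodesic.\<close>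

lemma resampling_step:
  assumes R: "R \<ge> 1" and pat: "measure Om (pat K 0) > 0" "K \<ge> 0"
    and corr: "\<And>a b. l1 a = int R \<Longrightarrow> l1 b = int R \<Longrightarrow> a \<noteq> b \<Longrightarrow>
     (\<exists>P1 P2 u' v'. {u', v'} = {u, v} \<and> corridor Lv (int R) a b u' v' P1 P2 \<and> length P1 + length P2 \<le> 2 * R + K0)"
    and \<delta>: "\<delta> > 0" and k0: "k0 \<ge> 0" "(\<tau> + \<delta>) * real (2 * R + K0) + K < 2 * (\<tau> * real R + k0)"
    and bd: "measure L {of_nat (2 * R) * bd..} > 0"
  shows "\<exists>\<eta>>0. \<forall>x k y a b. 0 \<notin> ball1 y (int R) \<longrightarrow> x \<notin> ball1 y (int R) \<longrightarrow>
     measure Om (visit bd k0 R x k y a b) * \<eta> \<le>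
     measure Om (few x (k + card (ball1 (0 :: int^'d) (int R)) * card (box Lv)) \<inter> forced x y)"
proof -
  define c where "c = min (measure L {..ennreal (\<tau> + \<delta>)}) (measure L {of_nat (2 * R) * bd..})"
  have c: "0 < c" "c \<le> 1" using \<tau>(3)[OF \<delta>] bd by (auto simp: c_def min_le_iff_disj)
  define NE where "NE = card (ball1 (0 :: int^'d) (int R)) * card (ball1 (0 :: int^'d) (int R))"
  define \<eta> where "\<eta> = c ^ NE * measure Om (pat K 0)"
  have "\<eta> > 0" using c pat by (simp add: \<eta>_def)
  moreover have "measure Om (visit bd k0 R x k y a b) * \<eta> \<le>
     measure Om (few x (k + card (ball1 (0 :: int^'d) (int R)) * card (box Lv)) \<inter> forced x y)"
    if out: "0 \<notin> ball1 y (int R)" "x \<notin> ball1 y (int R)" for x k y a b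
  proof (cases "l1 (a - y) = int R \<and> l1 (b - y) = int R \<and> a \<noteq> b")
    case False
    then have "visit bd k0 R x k y a b = {}" by (auto simp: visit_def passes_def)
    then show ?thesis by simp
  next
    case True
    then obtain P1' P2' u' v' where C: "{u', v'} = {u, v}" "corridor Lv (int R) (a - y) (b - y) u' v' P1' P2'"
      "length P1' + length P2' \<le> 2 * R + K0" using corr[of "a - y" "b - y"] by auto
    define P1 where "P1 = map (\<lambda>z. z + y) P1'"
    define P2 where "P2 = map (\<lambda>z. z + y) P2'"
    define B where "B = ball1 y (int R)"
    interpret r: route B "{z. l1 (z - y) < int R}" "Lam y" a b "u' + y" "v' + y" P1 P2
      using translated_route[OF C(2)] by (simp add: B_def Lam_def P1_def P2_def)
    define Er where "Er = {{z, w} | z w. consec P1 z w \<or> consec P2 z w}"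
    define Eo where "Eo = edges_in B - edges_in (Lam y)"
    define V where "V e = (if e \<in> Er then {..ennreal (\<tau> + \<delta>)} else {of_nat (2 * R) * bd..})" for e
    define Cy where "Cy = {t \<in> space Om. \<forall>e\<in>Eo. t e \<in> V e}"
    define H where "H = Cy \<inter> pat K y"
    have finB: "finite B" by (simp add: B_def)
    have Eo: "finite Eo" "Eo \<subseteq> lattice_edges" using finB edges_in_subset by (auto simp: Eo_def)
    have V: "V e \<in> sets L" for e using sets_L by (auto simp: V_def)
    have Cy_sets: "Cy \<in> sets Om"
      unfolding Cy_def
    proof (rule sets.sets_Collect_finite_All)
      fix e assume "e \<in> Eo"
      then have e: "e \<in> lattice_edges" using Eo by auto
      show "{t \<in> space Om. t e \<in> V e} \<in> sets Om" using measure_event_L[OF e, of "V e"] V sets_L by auto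
    qed (use Eo in auto)
    have Cy_dep: "depends_on Eo Cy" by (rule depends_onI) (auto simp: Cy_def)
    have "emeasure Om Cy = (\<Prod>e\<in>Eo. emeasure L (V e))"
      unfolding Cy_def by (rule P.emeasure_PiM_Collect) (use Eo V in auto)
    then have "measure Om Cy = (\<Prod>e\<in>Eo. measure L (V e))"
      by (simp add: P.emeasure_eq_measure emeasure_eq_measure prod_ennreal prod_nonneg)
    also have "\<dots> \<ge> (\<Prod>e\<in>Eo. c)" using c by (intro prod_mono) (auto simp: V_def c_def)
    finally have "c ^ card Eo \<le> measure Om Cy" by simp
    moreover have "c ^ NE \<le> c ^ card Eo"
    proof (rule power_decreasing)
      have "card Eo \<le> card (edges_in B)" using finB by (intro card_mono) (auto simp: Eo_def)
      also have "\<dots> \<le> card B * card B" by (rule card_edges_in_le[OF finB])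
      finally show "card Eo \<le> NE" using card_ball1[of y "int R"] by (simp add: NE_def B_def)
    qed (use c in auto)
    ultimately have Cy_prob: "c ^ NE \<le> measure Om Cy" by simp
    have LamB: "Lam y \<subseteq> B" by (rule r.P_facts(17))
    have "measure Om H = measure Om Cy * measure Om (pat K y)"
      unfolding H_def by (rule indep_depends_on[OF Eo(2) Cy_sets Cy_dep pat_sets pat_depends])
        (use edges_in_subset in \<open>auto simp: Eo_def\<close>)
    moreover have "\<eta> = c ^ NE * measure Om (pat K y)" unfolding \<eta>_def pat_translate[of K y] ..
    ultimately have \<eta>H: "\<eta> \<le> measure Om H" using Cy_prob by (simp add: mult_right_mono)
    have JE: "Eo \<subseteq> edges_in B" "edges_in (Lam y) \<subseteq> edges_in B" using edges_in_mono[OF LamB] by (auto simp: Eo_def)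
    have H_dep: "depends_on (edges_in B) H"
      unfolding H_def by (intro depends_on_Int depends_on_mono[OF Cy_dep JE(1)] depends_on_mono[OF pat_depends JE(2)])
    have H_sets: "H \<in> sets Om" unfolding H_def using Cy_sets pat_sets by (rule sets.Int)
    have "measure Om (visit bd k0 R x k y a b) * measure Om H \<le>
      measure Om (few x (k + card (ball1 (0 :: int^'d) (int R)) * card (box Lv)) \<inter> forced x y)"
    proof (rule resample[OF edges_in_subset[of B] visit_sets H_sets H_dep])
      show "few x (k + card (ball1 (0 :: int^'d) (int R)) * card (box Lv)) \<inter> forced x y \<in> sets Om"
        using few_sets forced_sets by (rule sets.Int)
      fix t s r' assume tF: "t \<in> visit bd k0 R x k y a b" and sH: "s \<in> H" and rs: "r' \<in> space Om"
        and r1: "\<And>e. e \<in> edges_in B \<Longrightarrow> r' e = s e" and r2: "\<And>e. e \<in> lattice_edges - edges_in B \<Longrightarrow> r' e = t e"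
      have ss: "s \<in> space Om" using sH H_sets sets.sets_into_space by blast
      have rH: "r' \<in> H" using depends_onD[OF H_dep ss rs] r1 sH by metis
      have tgood: "t \<in> slow (ennreal (\<tau> * real R + k0)) y R" "\<And>e. e \<in> edges_in B \<Longrightarrow> t e \<le> bd"
        using tF by (auto simp: visit_def good_def B_def)
      obtain g where g: "is_geodesic t 0 x g" "N_pat Lv u v A t g < k" "passes R y a b g" and fin: "geotime t 0 x < \<infinity>"
        using tF by (auto simp: visit_def)
      obtain \<gamma>1 \<gamma>2 \<gamma>3 where gs: "g = \<gamma>1 @ a # \<gamma>2 @ b # \<gamma>3" "set \<gamma>1 \<inter> B = {}" "set \<gamma>3 \<inter> B = {}" "y \<in> set \<gamma>2"
        using g(3) unfolding passes_def B_def by blast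
      have agree: "r' {z, w} = t {z, w}" if "adj z w" "r.outside z w" for z w
        by (rule r2) (use that in \<open>auto simp: r.outside_def\<close>)
      have wall': "of_nat (2 * R) * bd \<le> r' {z, w}" if zw: "adj z w" "z \<in> B" "w \<in> B" "\<not> r.on_route z w" for z w
      proof -
        have "{z, w} \<in> Eo" using zw by (auto simp: Eo_def r.on_route_def)
        moreover have "{z, w} \<notin> Er" using zw(4) by (auto simp: Er_def r.on_route_def doubleton_eq_iff)
        ultimately show ?thesis using rH by (auto simp: H_def Cy_def V_def)
      qed
      have bridge: "\<exists>p. path_from_to p z w \<and> ptime t p \<le> of_nat (2 * R) * bd" if "z \<in> B" "w \<in> B" for z w
        using bridge_in_ball[of z y R w t bd] that tgood(2) by (auto simp: B_def)
      have rpat: "r' \<in> pat K y" using rH by (simp add: H_def)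
      obtain \<sigma>' where \<sigma>': "path_from_to \<sigma>' (u + y) (v + y)" "set \<sigma>' \<subseteq> Lam y" "ptime r' \<sigma>' \<le> ennreal K"
        using rpat by (auto simp: pat_def)
      obtain \<sigma>0 where \<sigma>0: "path_from_to \<sigma>0 (u' + y) (v' + y)" "set \<sigma>0 \<subseteq> Lam y" "ptime r' \<sigma>0 \<le> ennreal K"
      proof -
        consider "u' = u" "v' = v" | "u' = v" "v' = u" using C(1) by (auto simp: doubleton_eq_iff)
        then show ?thesis
        proof cases
          case 1
          then show ?thesis using that[of \<sigma>'] \<sigma>' by simp
        next
          case 2
          then show ?thesis using that[of "rev \<sigma>'"] \<sigma>' path_rev[OF \<sigma>'(1)] by (simp add: ptime_rev)
        qed
      qed
      have cheap: "ptime r' P \<le> ennreal ((\<tau> + \<delta>) * real (length P))" if P: "P = P1 \<or> P = P2" for P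
      proof -
        have "ptime r' P \<le> of_nat (length P - 1) * ennreal (\<tau> + \<delta>)"
        proof (rule ptime_le_const)
          fix z w assume c: "consec P z w"
          have dP: "distinct P" "set P \<subseteq> B" "successively adj P" "\<exists>q. set P \<inter> Lam y \<subseteq> {q}"
            using P r.P_facts(2,3,12,13) r.P1 r.P2 r.P1_Lam r.P2_Lam by (auto simp: path_from_to_iff)
          have zw: "adj z w" "z \<in> set P" "w \<in> set P" using consec_adj[OF dP(3) c] consec_in_set[OF c] by auto
          then have "z \<noteq> w" by auto
          then have "{z, w} \<in> Eo" using dP zw by (auto simp: Eo_def)
          moreover have "{z, w} \<in> Er" using c P by (auto simp: Er_def)
          ultimately show "r' {z, w} \<le> ennreal (\<tau> + \<delta>)" using rH by (auto simp: H_def Cy_def V_def)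
        qed
        also have "of_nat (length P - 1) * ennreal (\<tau> + \<delta>) = ennreal ((\<tau> + \<delta>) * real (length P - 1))"
          using \<tau>(1) \<delta> by (simp add: ennreal_of_nat_eq_real_of_nat ennreal_mult[symmetric] mult.commute del: ennreal_plus)
        also have "\<dots> \<le> ennreal ((\<tau> + \<delta>) * real (length P))"
          using \<tau>(1) \<delta> by (intro ennreal_leI mult_left_mono) auto
        finally show ?thesis .
      qed
      have gain: "ptime r' P1 + (ptime r' \<sigma>0 + ptime r' P2) < ptime t (a # \<gamma>2 @ [b])"
      proof -
        have "ptime r' P1 + (ptime r' \<sigma>0 + ptime r' P2) \<le>
           ennreal ((\<tau> + \<delta>) * real (length P1)) + (ennreal K + ennreal ((\<tau> + \<delta>) * real (length P2)))"
          using cheap \<sigma>0(3) by (intro add_mono) auto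
        also have "\<dots> = ennreal ((\<tau> + \<delta>) * real (length P1 + length P2) + K)"
          using \<tau>(1) \<delta> pat(2) by (simp add: ennreal_plus[symmetric] algebra_simps del: ennreal_plus)
        also have "\<dots> \<le> ennreal ((\<tau> + \<delta>) * real (2 * R + K0) + K)"
          using C(3) \<tau>(1) \<delta> by (intro ennreal_leI add_right_mono mult_left_mono, unfold of_nat_le_iff) (auto simp: P1_def P2_def)
        also have "\<dots> < ennreal (2 * (\<tau> * real R + k0))"
        proof (rule ennreal_lessI[OF _ k0(2)])
          have "0 \<le> (\<tau> + \<delta>) * real (2 * R + K0) + K"
            using \<tau>(1) \<delta> pat(2) by (intro add_nonneg_nonneg mult_nonneg_nonneg) auto
          then show "0 < 2 * (\<tau> * real R + k0)" using k0(2) by linarith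
        qed
        also have "\<dots> = ennreal (\<tau> * real R + k0) + ennreal (\<tau> * real R + k0)"
          using k0 \<tau>(1) by (simp add: ennreal_plus[symmetric] del: ennreal_plus)
        also have "\<dots> \<le> ptime t (a # \<gamma>2 @ [b])"
        proof (rule slow_passage[OF R tgood(1) _ gs(4)])
          have "successively adj g" using g(1) by (simp add: is_geodesic_def path_from_to_iff)
          then have "successively adj (\<gamma>1 @ (a # \<gamma>2 @ [b]) @ \<gamma>3)" by (simp add: gs(1))
          then show "successively adj (a # \<gamma>2 @ [b])" by (simp only: successively_append_iff)
        qed (use True in auto)
        finally show ?thesis .
      qed
      note prems = agree wall' bridge out[folded B_def] finite_Lam g(1)[unfolded gs(1)] fin gs(2,3) \<sigma>0(1,2) gain
      have mg: "geotime r' 0 x < \<infinity>" by (rule r.modified_geodesic(1)) (fact prems)+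
      have "\<exists>mid. mid \<noteq> [] \<and> set mid \<subseteq> B \<and> is_geodesic r' 0 x (\<gamma>1 @ mid @ \<gamma>3)"
        by (rule r.modified_geodesic(2)) (fact prems)+
      then obtain mid where mid: "mid \<noteq> []" "set mid \<subseteq> B" "is_geodesic r' 0 x (\<gamma>1 @ mid @ \<gamma>3)"
        by blast
      have "N_pat Lv u v A r' (\<gamma>1 @ mid @ \<gamma>3) \<le> N_pat Lv u v A t (\<gamma>1 @ (a # \<gamma>2 @ [b]) @ \<gamma>3) + card B * card (box Lv)"
      proof (rule N_pat_modified[OF _ _ mid(1,2) _ finB])
        show "distinct (\<gamma>1 @ (a # \<gamma>2 @ [b]) @ \<gamma>3)" using g(1) gs(1) by (simp add: is_geodesic_def)
        show "distinct (\<gamma>1 @ mid @ \<gamma>3)" using mid(3) by (simp add: is_geodesic_def)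
        show "r' {z, w} = t {z, w}" if "adj z w" "\<not> (z \<in> B \<and> w \<in> B)" for z w
          using agree that by (simp add: r.outside_def)
      qed
      also have "\<gamma>1 @ (a # \<gamma>2 @ [b]) @ \<gamma>3 = g" by (simp add: gs(1))
      finally have "N_pat Lv u v A r' (\<gamma>1 @ mid @ \<gamma>3) < k + card (ball1 (0 :: int^'d) (int R)) * card (box Lv)"
        using g(2) card_ball1[of y "int R"] by (simp add: B_def)
      then have 1: "r' \<in> few x (k + card (ball1 (0 :: int^'d) (int R)) * card (box Lv))"
        using rs mg mid(3) by (auto simp: few_def)
      have 2: "r' \<in> forced x y"
        unfolding forced_def
      proof (intro CollectI conjI allI impI rs)
        fix \<pi> assume \<pi>: "is_geodesic r' 0 x \<pi>"
        have "\<exists>\<sigma> p1 p2. \<pi> = p1 @ \<sigma> @ p2 \<and> \<sigma> \<noteq> [] \<and> set \<sigma> \<subseteq> Lam y \<and> {hd \<sigma>, last \<sigma>} = {u' + y, v' + y}"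
          by (rule r.modified_geodesic(3)) (fact prems \<pi>)+
        then obtain \<sigma> p1 p2 where s: "\<pi> = p1 @ \<sigma> @ p2" "\<sigma> \<noteq> []" "set \<sigma> \<subseteq> Lam y" "{hd \<sigma>, last \<sigma>} = {u' + y, v' + y}"
          by blast
        have "{u' + y, v' + y} = {u + y, v + y}" using C(1) by (auto simp: doubleton_eq_iff)
        then have "{hd \<sigma>, last \<sigma>} = {u + y, v + y}" using s(4) by simp
        moreover have "\<forall>z\<in>set \<sigma>. z - y \<in> box Lv" using s(3) by (auto simp: Lam_def)
        moreover have "distinct \<pi>" using \<pi> by (simp add: is_geodesic_def)
        moreover have "in_event Lv A (shift_conf y r')" using rpat by (simp add: pat_def)
        ultimately show "satisfies_cond Lv u v A r' \<pi> y" using satisfies_cond_iff s(1,2) by blast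
      qed
      show "r' \<in> few x (k + card (ball1 (0 :: int^'d) (int R)) * card (box Lv)) \<inter> forced x y" using 1 2 by blast
    qed
    moreover have "measure Om (visit bd k0 R x k y a b) * \<eta> \<le> measure Om (visit bd k0 R x k y a b) * measure Om H"
      using \<eta>H by (intro mult_left_mono) auto
    ultimately show ?thesis by linarith
  qed
  ultimately show ?thesis by blast
qed

end

section \<open>Counting good balls\<close>

lemma (in finite_measure) measure_mult_le_sum:
  assumes S: "S \<in> sets M" and V: "finite J" "\<And>i. i \<in> J \<Longrightarrow> V i \<in> sets M"
    and le: "\<And>t. t \<in> S \<Longrightarrow> c \<le> (\<Sum>i\<in>J. indicator (V i) t)"
  shows "c * measure M S \<le> (\<Sum>i\<in>J. measure M (V i))"
proof -
  have "c * measure M S = (\<integral>t. c * indicator S t \<partial>M)" using S by simp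
  also have "\<dots> \<le> (\<integral>t. (\<Sum>i\<in>J. indicator (V i) t) \<partial>M)"
  proof (rule integral_mono)
    show "integrable M (\<lambda>t. c * indicator S t)" using S by (simp add: emeasure_eq_measure)
    show "integrable M (\<lambda>t. \<Sum>i\<in>J. indicator (V i) t :: real)" using V by (intro Bochner_Integration.integrable_sum) (simp add: emeasure_eq_measure)
    fix t
    show "c * indicator S t \<le> (\<Sum>i\<in>J. indicator (V i) t)"
      using le[of t] by (cases "t \<in> S") (auto intro: sum_nonneg)
  qed
  also have "\<dots> = (\<Sum>i\<in>J. measure M (V i))"
    using V by (subst Bochner_Integration.integral_sum) (auto simp: emeasure_eq_measure)
  finally show ?thesis .
qed

lemma (in finite_measure) sum_measure_le_mult:
  assumes S: "S \<in> sets M" and W: "finite J" "\<And>i. i \<in> J \<Longrightarrow> W i \<in> sets M"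
    and le: "\<And>t. t \<in> S \<Longrightarrow> (\<Sum>i\<in>J. indicator (W i) t) \<le> c"
  shows "(\<Sum>i\<in>J. measure M (S \<inter> W i)) \<le> c * measure M S"
proof -
  have "(\<Sum>i\<in>J. measure M (S \<inter> W i)) = (\<integral>t. (\<Sum>i\<in>J. indicator (S \<inter> W i) t) \<partial>M)"
    using S W by (subst Bochner_Integration.integral_sum) (auto simp: emeasure_eq_measure)
  also have "\<dots> \<le> (\<integral>t. c * indicator S t \<partial>M)"
  proof (rule integral_mono)
    show "integrable M (\<lambda>t. c * indicator S t)" using S by (simp add: emeasure_eq_measure)
    show "integrable M (\<lambda>t. \<Sum>i\<in>J. indicator (S \<inter> W i) t :: real)"
      using S W by (intro Bochner_Integration.integrable_sum) (simp add: emeasure_eq_measure)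
    fix t
    show "(\<Sum>i\<in>J. indicator (S \<inter> W i) t) \<le> c * indicator S t"
      using le[of t] by (cases "t \<in> S") (auto simp: indicator_inter_arith)
  qed
  also have "\<dots> = c * measure M S" using S by simp
  finally show ?thesis .
qed

context fpp_pattern begin

definition tile_set :: "nat \<Rightarrow> int^'d \<Rightarrow> (int^'d) set" where
  "tile_set R j = {y. tile (int R) y = j}"

definition bad_tile :: "ennreal \<Rightarrow> real \<Rightarrow> nat \<Rightarrow> int^'d \<Rightarrow> ((int^'d) set \<Rightarrow> ennreal) set" where
  "bad_tile bd k0 R j = (\<Union>y\<in>tile_set R j. space Om - good bd k0 R y)"

definition tile_nbhd :: "nat \<Rightarrow> int^'d \<Rightarrow> (int^'d) set set" where
  "tile_nbhd R j = edges_in (\<Union>y\<in>tile_set R j. ball1 y (int R))"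

lemma tile_set_sub:
  assumes "R \<ge> 1" shows "tile_set R j \<subseteq> ball1 (\<chi> i. int R * j $ i) (int (CARD('d) * R))"
proof
  fix y assume "y \<in> tile_set R j"
  then have j: "j $ i = y $ i div int R" for i by (auto simp: tile_set_def tile_def)
  have "l1 (y - (\<chi> i. int R * j $ i)) \<le> (\<Sum>i\<in>(UNIV :: 'd set). int R)"
    unfolding l1_def
  proof (rule sum_mono)
    fix i
    have "y $ i = int R * (y $ i div int R) + y $ i mod int R" "0 \<le> y $ i mod int R" "y $ i mod int R < int R"
      using assms by auto
    then have "\<bar>y $ i - int R * (y $ i div int R)\<bar> \<le> int R" by linarith
    then show "\<bar>(y - (\<chi> i. int R * j $ i)) $ i\<bar> \<le> int R" by (simp add: j)
  qed
  then show "y \<in> ball1 (\<chi> i. int R * j $ i) (int (CARD('d) * R))" by (simp add: ball1_def)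
qed

lemma tile_set_finite: "R \<ge> 1 \<Longrightarrow> finite (tile_set R j)"
  using finite_subset[OF tile_set_sub] by simp

lemma tile_set_card: "R \<ge> 1 \<Longrightarrow> card (tile_set R j) \<le> (2 * (CARD('d) * R) + 1) ^ CARD('d)"
  using card_mono[OF _ tile_set_sub[of R j]] card_ball1_le[where R = "CARD('d) * R"] by (meson finite_ball1 order_trans)

lemma good_depends: "depends_on (edges_in (ball1 y (int R))) (good bd k0 R y)"
proof (rule depends_onI)
  fix t s assume ts: "t \<in> space Om" "s \<in> space Om" and eq: "\<And>e. e \<in> edges_in (ball1 y (int R)) \<Longrightarrow> t e = s e"
    and t: "t \<in> good bd k0 R y"
  have "ptime t p = ptime s p" if p: "crossing y R p" for p
  proof (rule ptime_cong)
    show "successively adj p" using p by (simp add: crossing_def)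
    show "t {z, w} = s {z, w}" if "adj z w" "z \<in> set p" "w \<in> set p" for z w
      using that p by (intro eq) (auto simp: crossing_def)
  qed
  then have "s \<in> slow (ennreal (\<tau> * real R + k0)) y R"
    using t ts by (auto simp: good_def slow_def)
  moreover have "\<forall>e\<in>edges_in (ball1 y (int R)). s e \<le> bd" using t eq by (auto simp: good_def)
  ultimately show "s \<in> good bd k0 R y" using ts by (simp add: good_def)
qed

lemma bad_tile_sets: "R \<ge> 1 \<Longrightarrow> bad_tile bd k0 R j \<in> sets Om"
  unfolding bad_tile_def using tile_set_finite good_sets by (intro sets.finite_UN) auto

lemma bad_tile_depends: "depends_on (tile_nbhd R j) (bad_tile bd k0 R j)"
proof (rule depends_onI)
  fix t s assume ts: "t \<in> space Om" "s \<in> space Om" and eq: "\<And>e. e \<in> tile_nbhd R j \<Longrightarrow> t e = s e"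
    and t: "t \<in> bad_tile bd k0 R j"
  obtain y where y: "y \<in> tile_set R j" "t \<notin> good bd k0 R y" using t by (auto simp: bad_tile_def)
  have "edges_in (ball1 y (int R)) \<subseteq> tile_nbhd R j"
    unfolding tile_nbhd_def using y(1) by (intro edges_in_mono) auto
  then have "s \<notin> good bd k0 R y"
    using depends_onD[OF good_depends ts(2,1)] y(2) eq by (metis subsetD)
  then show "s \<in> bad_tile bd k0 R j" using y(1) ts by (auto simp: bad_tile_def)
qed

lemma tile_nbhd_disjoint:
  assumes R: "R \<ge> 1" and cl: "(\<chi> i. j $ i mod 3) = (\<chi> i. j' $ i mod 3)" and ne: "j \<noteq> j'"
  shows "tile_nbhd R j \<inter> tile_nbhd R j' = {}"
proof (rule ccontr)
  assume "tile_nbhd R j \<inter> tile_nbhd R j' \<noteq> {}"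
  then obtain e where e: "e \<in> tile_nbhd R j" "e \<in> tile_nbhd R j'" by blast
  then obtain z where z: "z \<in> e" by (auto simp: tile_nbhd_def edges_in_def lattice_edges_def)
  have "z \<in> (\<Union>y\<in>tile_set R j. ball1 y (int R))" "z \<in> (\<Union>y\<in>tile_set R j'. ball1 y (int R))"
    using e z unfolding tile_nbhd_def edges_in_def by blast+
  then obtain y y' where "y \<in> tile_set R j" "z \<in> ball1 y (int R)" "y' \<in> tile_set R j'" "z \<in> ball1 y' (int R)"
    by blast
  moreover have "j $ i mod 3 = j' $ i mod 3" for i using cl by (simp add: vec_eq_iff)
  ultimately show False
    using tile_neighbourhoods_disjoint[of "int R" j j' y z y'] R ne by (auto simp: tile_set_def ball1_def)
qed

lemma bad_tile_prob:
  assumes R: "R \<ge> 1" and a: "\<And>y. measure Om (space Om - slow (ennreal (\<tau> * real R + k0)) y R) \<le> a"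
  shows "measure Om (bad_tile bd k0 R j) \<le> real ((2 * (CARD('d) * R) + 1) ^ CARD('d)) *
    (a + real (card (ball1 (0 :: int^'d) (int R)) * card (ball1 (0 :: int^'d) (int R))) * measure L {bd<..})"
proof -
  have g: "measure Om (space Om - good bd k0 R y) \<le> a + real (card (ball1 (0 :: int^'d) (int R)) * card (ball1 (0 :: int^'d) (int R))) * measure L {bd<..}" for y
  proof -
    let ?E = "edges_in (ball1 y (int R))"
    have e: "measure Om {t \<in> space Om. t e \<in> {bd<..}} = measure L {bd<..} \<and> {t \<in> space Om. t e \<in> {bd<..}} \<in> sets Om" if "e \<in> ?E" for e
    proof -
      have "e \<in> lattice_edges" using that edges_in_subset by blast
      then show ?thesis by (rule measure_event_L) simp
    qed
    have sub: "space Om - good bd k0 R y \<subseteq> (space Om - slow (ennreal (\<tau> * real R + k0)) y R) \<union> (\<Union>e\<in>?E. {t \<in> space Om. t e \<in> {bd<..}})"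
      by (auto simp: good_def not_le)
    have s1: "space Om - slow (ennreal (\<tau> * real R + k0)) y R \<in> sets Om" using slow_sets by auto
    have s2: "(\<Union>e\<in>?E. {t \<in> space Om. t e \<in> {bd<..}}) \<in> sets Om" using e by (intro sets.finite_UN) auto
    have "measure Om (space Om - good bd k0 R y) \<le>
       measure Om ((space Om - slow (ennreal (\<tau> * real R + k0)) y R) \<union> (\<Union>e\<in>?E. {t \<in> space Om. t e \<in> {bd<..}}))"
      using sub s1 s2 by (intro P.finite_measure_mono) auto
    also have "\<dots> \<le> measure Om (space Om - slow (ennreal (\<tau> * real R + k0)) y R) + measure Om (\<Union>e\<in>?E. {t \<in> space Om. t e \<in> {bd<..}})"
      using s1 s2 by (intro measure_subadditive) auto
    also have "measure Om (\<Union>e\<in>?E. {t \<in> space Om. t e \<in> {bd<..}}) \<le> (\<Sum>e\<in>?E. measure Om {t \<in> space Om. t e \<in> {bd<..}})"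
      using e by (intro P.finite_measure_subadditive_finite) auto
    also have "(\<Sum>e\<in>?E. measure Om {t \<in> space Om. t e \<in> {bd<..}}) = (\<Sum>e\<in>?E. measure L {bd<..})"
      using e by (intro sum.cong) auto
    also have "\<dots> = real (card ?E) * measure L {bd<..}" by simp
    also have "\<dots> \<le> real (card (ball1 (0 :: int^'d) (int R)) * card (ball1 (0 :: int^'d) (int R))) * measure L {bd<..}"
    proof (rule mult_right_mono)
      have "card ?E \<le> card (ball1 y (int R)) * card (ball1 y (int R))" by (rule card_edges_in_le) simp
      then show "real (card ?E) \<le> real (card (ball1 (0 :: int^'d) (int R)) * card (ball1 (0 :: int^'d) (int R)))"
        unfolding card_ball1[of y] of_nat_le_iff .
    qed simp
    finally show ?thesis using a[of y] by linarith
  qed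
  have "measure Om (bad_tile bd k0 R j) \<le> (\<Sum>y\<in>tile_set R j. measure Om (space Om - good bd k0 R y))"
    unfolding bad_tile_def using tile_set_finite[OF R] good_sets
    by (intro P.finite_measure_subadditive_finite) auto
  also have "\<dots> \<le> (\<Sum>y\<in>tile_set R j. a + real (card (ball1 (0 :: int^'d) (int R)) * card (ball1 (0 :: int^'d) (int R))) * measure L {bd<..})"
    by (intro sum_mono g)
  also have "\<dots> = real (card (tile_set R j)) * (a + real (card (ball1 (0 :: int^'d) (int R)) * card (ball1 (0 :: int^'d) (int R))) * measure L {bd<..})"
    by simp
  also have "\<dots> \<le> real ((2 * (CARD('d) * R) + 1) ^ CARD('d)) * (a + real (card (ball1 (0 :: int^'d) (int R)) * card (ball1 (0 :: int^'d) (int R))) * measure L {bd<..})"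
  proof (rule mult_right_mono)
    show "real (card (tile_set R j)) \<le> real ((2 * (CARD('d) * R) + 1) ^ CARD('d))"
      using tile_set_card[OF R] unfolding of_nat_le_iff .
    show "0 \<le> a + real (card (ball1 (0 :: int^'d) (int R)) * card (ball1 (0 :: int^'d) (int R))) * measure L {bd<..}"
      using g[of 0] measure_nonneg order_trans by blast
  qed
  finally show ?thesis .
qed

lemma few_bad_tiles_many_visits:
  assumes R: "R \<ge> 1" and t: "t \<in> few x k" and bad: "\<forall>js\<in>saws (2 * K * h) (0 :: int^'d). card {j \<in> set js. t \<in> bad_tile bd k0 R j} \<le> K * h"
    and x: "int (2 * K * h) \<le> l1 (tile (int R) x)"
  defines "Y \<equiv> {y \<in> (\<Union>js\<in>saws (2 * K * h) 0. \<Union>j\<in>set js. tile_set R j). 0 \<notin> ball1 y (int R) \<and> x \<notin> ball1 y (int R)}"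
  shows "real (K * h) - real (2 * card (ball1 (0 :: int^'d) (int R))) \<le>
     real (card {y \<in> Y. \<exists>a b. a \<in> ball1 y (int R) \<and> b \<in> ball1 y (int R) \<and> t \<in> visit bd k0 R x k y a b})"
proof -
  let ?V = "{y \<in> Y. \<exists>a b. a \<in> ball1 y (int R) \<and> b \<in> ball1 y (int R) \<and> t \<in> visit bd k0 R x k y a b}"
  obtain g where g: "is_geodesic t 0 x g" "N_pat Lv u v A t g < k" and fin: "geotime t 0 x < \<infinity>" and ts: "t \<in> space Om"
    using t by (auto simp: few_def)
  have gp: "path_from_to g 0 x" "distinct g" using g by (auto simp: is_geodesic_def)
  obtain js where js: "js \<in> saws (2 * K * h) 0" "set js \<subseteq> tile (int R) ` set g"
    using coarse_saw[OF _ gp(1) x] R by auto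
  define J where "J = {j \<in> set js. t \<notin> bad_tile bd k0 R j}"
  have "card (set js) = Suc (2 * K * h)" using js(1) distinct_card[of js] by (simp add: saws_def)
  moreover have "set js = J \<union> {j \<in> set js. t \<in> bad_tile bd k0 R j}" by (auto simp: J_def)
  then have "card (set js) \<le> card J + card {j \<in> set js. t \<in> bad_tile bd k0 R j}" using card_Un_le by metis
  moreover have "card {j \<in> set js. t \<in> bad_tile bd k0 R j} \<le> K * h" using bad js(1) by blast
  ultimately have J: "K * h \<le> card J" by (simp add: algebra_simps)
  have "\<exists>f. \<forall>j\<in>J. f j \<in> set g \<and> tile (int R) (f j) = j"
    using js(2) by (intro bchoice) (auto simp: J_def)
  then obtain f where f: "\<And>j. j \<in> J \<Longrightarrow> f j \<in> set g \<and> tile (int R) (f j) = j" by blast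
  have finj: "inj_on f J" using f by (metis inj_onI)
  have finJ: "finite J" by (simp add: J_def)
  have sub: "f ` J \<subseteq> ?V \<union> (ball1 0 (int R) \<union> ball1 x (int R))"
  proof
    fix y assume "y \<in> f ` J"
    then obtain j where j: "j \<in> J" "y = f j" by blast
    show "y \<in> ?V \<union> (ball1 0 (int R) \<union> ball1 x (int R))"
    proof (cases "y \<in> ball1 0 (int R) \<union> ball1 x (int R)")
      case False
      then have out: "0 \<notin> ball1 y (int R)" "x \<notin> ball1 y (int R)"
        by (auto simp: ball1_def l1_minus_commute[of x y])
      have yt: "y \<in> tile_set R j" using f j by (simp add: tile_set_def)
      then have yY: "y \<in> Y" using out js(1) j(1) unfolding Y_def J_def by blast
      have yg: "y \<in> set g" using f j by blast
      have gd: "t \<in> good bd k0 R y" using j(1) yt ts by (auto simp: J_def bad_tile_def)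
      obtain \<gamma>1 a \<gamma>2 b \<gamma>3 where d: "g = \<gamma>1 @ a # \<gamma>2 @ b # \<gamma>3" "set \<gamma>1 \<inter> ball1 y (int R) = {}" "set \<gamma>3 \<inter> ball1 y (int R) = {}"
        "l1 (a - y) = int R" "l1 (b - y) = int R" "a \<noteq> b" "y \<in> set \<gamma>2"
        using ball_crossing_decomposition[OF R gp out yg] by (elim exE conjE)
      then have "passes R y a b g" unfolding passes_def by blast
      then have "t \<in> visit bd k0 R x k y a b" using gd g fin ts unfolding visit_def by blast
      moreover have "a \<in> ball1 y (int R)" "b \<in> ball1 y (int R)" using d by (auto simp: ball1_def)
      ultimately show ?thesis using yY by blast
    qed simp
  qed
  have "finite (\<Union>js\<in>saws (2 * K * h) 0. \<Union>j\<in>set js. tile_set R j)"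
    by (intro finite_UN_I saws_count(1) tile_set_finite[OF R] finite_set)
  then have finY: "finite Y" by (rule finite_subset[rotated]) (auto simp: Y_def)
  have "card J = card (f ` J)" by (rule card_image[OF finj, symmetric])
  also have "\<dots> \<le> card (?V \<union> (ball1 0 (int R) \<union> ball1 x (int R)))"
    using sub finY by (intro card_mono) auto
  also have "\<dots> \<le> card ?V + (card (ball1 (0 :: int^'d) (int R)) + card (ball1 x (int R)))"
    by (meson add_left_mono card_Un_le order_trans)
  also have "\<dots> = card ?V + 2 * card (ball1 (0 :: int^'d) (int R))" using card_ball1[of x "int R"] by simp
  finally have "K * h \<le> card ?V + 2 * card (ball1 (0 :: int^'d) (int R))" using J by linarith
  then have "real (K * h) \<le> real (card ?V + 2 * card (ball1 (0 :: int^'d) (int R)))" unfolding of_nat_le_iff .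
  then show ?thesis by simp
qed

text \<open>Double counting of the pairs of a configuration and a centre \<open>y\<close>: a configuration in \<open>few x (k + C)\<close>
  can be in \<open>forced x y\<close> for fewer than \<open>k + C\<close> centres \<open>y\<close>.\<close>

lemma few_recursion:
  assumes R: "R \<ge> 1" and \<eta>: "\<eta> > 0"
    and res: "\<And>x k y a b. 0 \<notin> ball1 y (int R) \<Longrightarrow> x \<notin> ball1 y (int R) \<Longrightarrow>
      measure Om (visit bd k0 R x k y a b) * \<eta> \<le> measure Om (few x (k + C) \<inter> forced x y)"
    and G: "G \<in> sets Om" "\<forall>t\<in>space Om - G. \<forall>js\<in>saws (2 * K * h) (0 :: int^'d). card {j \<in> set js. t \<in> bad_tile bd k0 R j} \<le> K * h"
    and x: "int (2 * K * h) \<le> l1 (tile (int R) x)"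
  shows "(real (K * h) - real (2 * card (ball1 (0 :: int^'d) (int R)))) * measure Om (few x k - G) \<le>
     real (card (ball1 (0 :: int^'d) (int R))) ^ 2 / \<eta> * (real (k + C) * measure Om (few x (k + C)))"
proof -
  define b where "b = card (ball1 (0 :: int^'d) (int R))"
  define Y where "Y = {y \<in> (\<Union>js\<in>saws (2 * K * h) 0. \<Union>j\<in>set js. tile_set R j). 0 \<notin> ball1 y (int R) \<and> x \<notin> ball1 y (int R)}"
  have "finite (\<Union>js\<in>saws (2 * K * h) 0. \<Union>j\<in>set js. tile_set R j)"
    by (intro finite_UN_I saws_count(1) tile_set_finite[OF R] finite_set)
  then have finY: "finite Y" by (rule finite_subset[rotated]) (auto simp: Y_def)
  define I where "I = (SIGMA y:Y. ball1 y (int R) \<times> ball1 y (int R))"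
  have finI: "finite I" unfolding I_def using finY by auto
  define V where "V i = (case i of (y, a, b) \<Rightarrow> visit bd k0 R x k y a b)" for i
  have "(real (K * h) - real (2 * b)) * measure Om (few x k - G) \<le> (\<Sum>i\<in>I. measure Om (V i))"
  proof (rule P.measure_mult_le_sum[OF _ finI])
    show "few x k - G \<in> sets Om" using few_sets G(1) by auto
    show "V i \<in> sets Om" for i unfolding V_def using visit_sets by (cases i) auto
    fix t assume t: "t \<in> few x k - G"
    then have "t \<in> space Om - G" by (auto simp: few_def)
    then have "real (K * h) - real (2 * b) \<le> real (card {y \<in> Y. \<exists>a b. a \<in> ball1 y (int R) \<and> b \<in> ball1 y (int R) \<and> t \<in> visit bd k0 R x k y a b})"
      unfolding Y_def b_def using t G(2) by (intro few_bad_tiles_many_visits[OF R _ _ x]) auto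
    also have "\<dots> \<le> real (card {i \<in> I. t \<in> V i})"
    proof -
      have "{y \<in> Y. \<exists>a b. a \<in> ball1 y (int R) \<and> b \<in> ball1 y (int R) \<and> t \<in> visit bd k0 R x k y a b} \<subseteq> fst ` {i \<in> I. t \<in> V i}"
      proof
        fix y assume "y \<in> {y \<in> Y. \<exists>a b. a \<in> ball1 y (int R) \<and> b \<in> ball1 y (int R) \<and> t \<in> visit bd k0 R x k y a b}"
        then obtain a b where "y \<in> Y" "a \<in> ball1 y (int R)" "b \<in> ball1 y (int R)" "t \<in> visit bd k0 R x k y a b" by auto
        then show "y \<in> fst ` {i \<in> I. t \<in> V i}"
          by (intro image_eqI[of _ _ "(y, a, b)"]) (auto simp: I_def V_def)
      qed
      then show ?thesis unfolding of_nat_le_iff using finI by (intro surj_card_le) auto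
    qed
    also have "real (card {i \<in> I. t \<in> V i}) = (\<Sum>i\<in>I. indicator (V i) t)"
    proof -
      have "(\<Sum>i\<in>I. indicator (V i) t) = (\<Sum>i\<in>I. if t \<in> V i then 1 else 0 :: real)" by (intro sum.cong) (auto simp: indicator_def)
      also have "\<dots> = (\<Sum>i\<in>{i \<in> I. t \<in> V i}. 1)" using finI by (subst sum.inter_filter) auto
      finally show ?thesis by simp
    qed
    finally show "real (K * h) - real (2 * b) \<le> (\<Sum>i\<in>I. indicator (V i) t)" .
  qed
  also have "(\<Sum>i\<in>I. measure Om (V i)) \<le> (\<Sum>i\<in>I. (1 / \<eta>) * measure Om (few x (k + C) \<inter> forced x (fst i)))"
  proof (rule sum_mono)
    fix i assume "i \<in> I"
    then obtain y a b where i: "i = (y, a, b)" "0 \<notin> ball1 y (int R)" "x \<notin> ball1 y (int R)" by (auto simp: I_def Y_def)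
    then show "measure Om (V i) \<le> (1 / \<eta>) * measure Om (few x (k + C) \<inter> forced x (fst i))"
      using res[OF i(2,3), of k a b] \<eta> by (simp add: V_def field_simps)
  qed
  also have "\<dots> = (\<Sum>y\<in>Y. \<Sum>z\<in>ball1 y (int R) \<times> ball1 y (int R). (1 / \<eta>) * measure Om (few x (k + C) \<inter> forced x y))"
    unfolding I_def using finY by (subst sum.Sigma) (auto intro!: sum.cong)
  also have "\<dots> = (\<Sum>y\<in>Y. real b ^ 2 / \<eta> * measure Om (few x (k + C) \<inter> forced x y))"
  proof (rule sum.cong[OF refl])
    fix y
    show "(\<Sum>z\<in>ball1 y (int R) \<times> ball1 y (int R). (1 / \<eta>) * measure Om (few x (k + C) \<inter> forced x y)) =
       real b ^ 2 / \<eta> * measure Om (few x (k + C) \<inter> forced x y)"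
      using card_ball1[of y "int R"] by (simp add: card_cartesian_product b_def power2_eq_square)
  qed
  also have "\<dots> = real b ^ 2 / \<eta> * (\<Sum>y\<in>Y. measure Om (few x (k + C) \<inter> forced x y))" by (simp add: sum_distrib_left)
  also have "\<dots> \<le> real b ^ 2 / \<eta> * (real (k + C) * measure Om (few x (k + C)))"
  proof (rule mult_left_mono)
    show "(\<Sum>y\<in>Y. measure Om (few x (k + C) \<inter> forced x y)) \<le> real (k + C) * measure Om (few x (k + C))"
    proof (rule P.sum_measure_le_mult[OF few_sets finY forced_sets])
      fix t assume "t \<in> few x (k + C)"
      then obtain g where g: "is_geodesic t 0 x g" "N_pat Lv u v A t g < k + C" by (auto simp: few_def)
      have "(\<Sum>y\<in>Y. indicator (forced x y) t) = (\<Sum>y\<in>Y. if t \<in> forced x y then 1 else 0 :: real)"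
        by (intro sum.cong) (auto simp: indicator_def)
      also have "\<dots> = (\<Sum>y\<in>{y \<in> Y. t \<in> forced x y}. 1)" using finY by (subst sum.inter_filter) auto
      also have "\<dots> = real (card {y \<in> Y. t \<in> forced x y})" by simp
      also have "\<dots> \<le> real (N_pat Lv u v A t g)"
        unfolding of_nat_le_iff N_pat_def using g(1) finite_satisfies_cond by (intro card_mono) (auto simp: forced_def)
      also have "\<dots> \<le> real (k + C)" using g(2) by simp
      finally show "(\<Sum>y\<in>Y. indicator (forced x y) t) \<le> real (k + C)" .
    qed
  qed (use \<eta> in simp)
  finally show ?thesis unfolding b_def .
qed

end

lemma halving_iteration:
  fixes p :: "nat \<Rightarrow> real"
  assumes "\<And>k. real (k + C) \<le> H \<Longrightarrow> p k \<le> p (k + C) / 2 + e" "\<And>k. p k \<le> 1" "0 \<le> e"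
    and "real (k + i * C) \<le> H"
  shows "p k \<le> (1 / 2) ^ i + 2 * e"
  using assms(4)
proof (induction i arbitrary: k)
  case 0
  then show ?case using assms(2)[of k] assms(3) by simp
next
  case (Suc i)
  have "real (k + C + i * C) \<le> H" using Suc.prems by (simp add: algebra_simps)
  then have 1: "p (k + C) \<le> (1 / 2) ^ i + 2 * e" by (rule Suc.IH)
  have "real (k + C) \<le> real (k + Suc i * C)" by simp
  then have "p k \<le> p (k + C) / 2 + e" using Suc.prems by (intro assms(1)) linarith
  then show ?case using 1 by simp
qed

context fpp_pattern begin

theorem few_bound:
  "\<exists>R K H0 C c. R \<ge> 1 \<and> K \<ge> 1 \<and> C \<ge> 1 \<and> c > 0 \<and>
    (\<forall>x h k i. h \<ge> H0 \<longrightarrow> int (2 * K * h) \<le> l1 (tile (int R) x) \<longrightarrow> real (k + i * C) \<le> c * real h \<longrightarrow>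
      measure Om (few x k) \<le> (1 / 2) ^ i + 4 * (1 / 2) ^ h)"
proof -
  obtain K where K: "K \<ge> 0" "measure Om (pat K 0) > 0" using pat_pos by blast
  obtain K0 r1 where corr: "r1 \<ge> 1" "\<And>R a b. R \<ge> r1 \<Longrightarrow> l1 a = int R \<Longrightarrow> l1 b = int R \<Longrightarrow> a \<noteq> b \<Longrightarrow>
     (\<exists>P1 P2 u' v'. {u', v'} = {u, v} \<and> corridor Lv (int R) a b u' v' P1 P2 \<and> length P1 + length P2 \<le> 2 * R + K0)"
    using corridor_exists[OF dim uv] by blast
  define k0 where "k0 = (\<tau> * real K0 + 1 + K) / 2 + 1"
  have k0: "k0 \<ge> 0" using \<tau>(1) K(1) by (simp add: k0_def)
  obtain a where a: "\<And>R y. measure Om (space Om - slow (ennreal (\<tau> * real R + k0)) y R) \<le> a R"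
    "\<And>m. (\<lambda>R. real R ^ m * a R) \<longlonglongrightarrow> 0"
    using crossing_speed[OF \<tau>(1,2) crit, of k0] by blast
  have a0: "a R \<ge> 0" for R using a(1)[of R 0] measure_nonneg order_trans by blast
  define C3 where "C3 = {z :: int^'d. \<forall>i. 0 \<le> z $ i \<and> z $ i \<le> 2}"
  have C3: "finite C3" unfolding C3_def by (rule finite_int_cube)
  define Kc where "Kc = card C3"
  have "0 \<in> C3" by (simp add: C3_def)
  then have Kc: "Kc \<ge> 1" using C3 by (auto simp: Kc_def Suc_le_eq card_gt_0_iff)
  define cls where "cls j = (\<chi> i. j $ i mod 3)" for j :: "int^'d"
  have cls: "cls j \<in> C3" for j
  proof -
    have "j $ i mod 3 \<le> 2" for i using pos_mod_bound[of 3 "j $ i"] by linarith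
    then show ?thesis by (simp add: cls_def C3_def)
  qed
  define b1 where "b1 = card (ball1 (0 :: int^'d) 1)"
  have "0 \<in> ball1 (0 :: int^'d) 1" by (simp add: ball1_def)
  then have b1: "b1 \<ge> 1" by (auto simp: b1_def Suc_le_eq card_gt_0_iff)
  define \<epsilon> where "\<epsilon> = 1 / (2 * real (2 * b1) ^ (2 * Kc))"
  have \<epsilon>: "\<epsilon> > 0" "\<epsilon> * real (2 * b1) ^ (2 * Kc) \<le> 1 / 2" using b1 by (auto simp: \<epsilon>_def)
  let ?d = "CARD('d)"
  have "(\<lambda>R. real (3 * ?d) ^ ?d * (real R ^ ?d * a R)) \<longlonglongrightarrow> real (3 * ?d) ^ ?d * 0"
    by (intro tendsto_mult tendsto_const a)
  then have "eventually (\<lambda>R. real (3 * ?d) ^ ?d * (real R ^ ?d * a R) < \<epsilon> / 2) sequentially"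
    by (rule order_tendstoD(2)) (use \<epsilon>(1) in simp)
  then have "eventually (\<lambda>R. real (3 * ?d) ^ ?d * (real R ^ ?d * a R) < \<epsilon> / 2 \<and> R \<ge> r1) sequentially"
    using eventually_ge_at_top by (rule eventually_conj)
  then obtain R where R: "real (3 * ?d) ^ ?d * (real R ^ ?d * a R) < \<epsilon> / 2" "R \<ge> r1"
    by (auto simp: eventually_sequentially)
  have R1: "R \<ge> 1" using R(2) corr(1) by simp
  define TC where "TC = (2 * (?d * R) + 1) ^ ?d"
  have TC: "real TC * a R \<le> \<epsilon> / 2"
  proof -
    have "?d * R \<ge> 1" using R1 by (simp add: Suc_le_eq)
    then have "2 * (?d * R) + 1 \<le> 3 * ?d * R" by simp
    then have "TC \<le> (3 * ?d * R) ^ ?d" unfolding TC_def by (rule power_mono) simp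
    then have "real TC \<le> real ((3 * ?d * R) ^ ?d)" unfolding of_nat_le_iff .
    then have "real TC * a R \<le> real ((3 * ?d * R) ^ ?d) * a R" using a0 by (intro mult_right_mono) auto
    also have "\<dots> = real (3 * ?d) ^ ?d * (real R ^ ?d * a R)" by (simp add: power_mult_distrib)
    finally show ?thesis using R(1) by simp
  qed
  define bR where "bR = card (ball1 (0 :: int^'d) (int R))"
  have "0 \<in> ball1 (0 :: int^'d) (int R)" by (simp add: ball1_def)
  then have bR: "bR \<ge> 1" by (auto simp: bR_def Suc_le_eq card_gt_0_iff)
  have "TC > 0" by (simp add: TC_def)
  then have TC0: "real TC > 0" by (simp only: of_nat_0_less_iff)
  have "\<epsilon> / (2 * real TC * real (bR * bR)) > 0"
    using \<epsilon>(1) bR TC0 by (intro divide_pos_pos mult_pos_pos) auto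
  then obtain bd where bd: "measure L {bd<..} \<le> \<epsilon> / (2 * real TC * real (bR * bR))" "measure L {of_nat (2 * R) * bd..} > 0"
    using wall by blast
  have bad: "measure Om (bad_tile bd k0 R j) \<le> \<epsilon>" for j
  proof -
    have "measure Om (bad_tile bd k0 R j) \<le> real TC * (a R + real (bR * bR) * measure L {bd<..})"
      unfolding TC_def bR_def by (rule bad_tile_prob[OF R1 a(1)])
    also have "\<dots> \<le> real TC * (a R + real (bR * bR) * (\<epsilon> / (2 * real TC * real (bR * bR))))"
      using bd(1) by (intro mult_left_mono add_left_mono) auto
    also have "\<dots> = real TC * a R + \<epsilon> / 2" using bR TC0 by (simp add: field_simps)
    finally show ?thesis using TC by simp
  qed
  define \<delta> where "\<delta> = 1 / real (2 * R + K0)"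
  have \<delta>: "\<delta> > 0" using R1 by (simp add: \<delta>_def)
  have "\<delta> * real (2 * R + K0) = 1" using R1 by (simp add: \<delta>_def)
  moreover have "2 * k0 = \<tau> * real K0 + 3 + K" unfolding k0_def by (simp add: field_simps)
  ultimately have k0': "(\<tau> + \<delta>) * real (2 * R + K0) + K < 2 * (\<tau> * real R + k0)"
    by (simp add: algebra_simps)
  define C where "C = bR * card (box Lv)"
  obtain \<eta> where \<eta>: "\<eta> > 0" "\<And>x k y a b. 0 \<notin> ball1 y (int R) \<Longrightarrow> x \<notin> ball1 y (int R) \<Longrightarrow>
     measure Om (visit bd k0 R x k y a b) * \<eta> \<le> measure Om (few x (k + C) \<inter> forced x y)"
    using resampling_step[OF R1 K(2,1) corr(2)[OF R(2)] \<delta> k0 k0' bd(2)] unfolding C_def bR_def by blast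
  have "u \<in> box Lv" using uv(1) by (simp add: boundary_def)
  then have "card (box Lv) \<ge> 1" by (auto simp: Suc_le_eq card_gt_0_iff)
  then have C1: "C \<ge> 1" using bR by (simp add: C_def)
  define c where "c = \<eta> * real Kc / (4 * real bR ^ 2)"
  have c: "c > 0" using \<eta>(1) Kc bR by (simp add: c_def)
  define H0 where "H0 = 4 * bR"
  have main: "measure Om (few x k) \<le> (1 / 2) ^ i + 4 * (1 / 2) ^ h"
    if h: "h \<ge> H0" and x: "int (2 * Kc * h) \<le> l1 (tile (int R) x)" and ki: "real (k + i * C) \<le> c * real h" for x h k i
  proof -
    interpret iid_product L "lattice_edges :: (int^'d) set set" by unfold_locales
    obtain G where G: "G \<in> sets Om" "measure Om G \<le> 2 * (1 / 2) ^ h"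
      "\<forall>t\<in>space Om - G. \<forall>js\<in>saws (2 * Kc * h) (0 :: int^'d). card {j \<in> set js. t \<in> bad_tile bd k0 R j} \<le> Kc * h"
    proof -
      have "\<exists>G\<in>sets Om. measure Om G \<le> 2 * (1 / 2) ^ h \<and>
        (\<forall>t\<in>space Om - G. \<forall>js\<in>saws (2 * Kc * h) (0 :: int^'d). card {j \<in> set js. t \<in> bad_tile bd k0 R j} \<le> Kc * h)"
      proof (rule peierls[where cls = cls and C = C3 and N' = "tile_nbhd R" and \<epsilon> = \<epsilon>])
        show "bad_tile bd k0 R j \<in> sets Om" for j by (rule bad_tile_sets[OF R1])
        show "depends_on (tile_nbhd R j) (bad_tile bd k0 R j)" for j by (rule bad_tile_depends)
        show "tile_nbhd R j \<subseteq> lattice_edges" for j unfolding tile_nbhd_def by (rule edges_in_subset)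
        show "tile_nbhd R i \<inter> tile_nbhd R j = {}" if "cls i = cls j" "i \<noteq> j" for i j
          using tile_nbhd_disjoint[OF R1 _ that(2)] that(1) by (simp add: cls_def)
        show "card C3 \<le> Kc" by (simp add: Kc_def)
        show "\<epsilon> * real (2 * card (ball1 (0 :: int^'d) 1)) ^ (2 * Kc) \<le> 1 / 2" using \<epsilon>(2) by (simp add: b1_def)
      qed (use bad C3 cls \<epsilon> in auto)
      then show ?thesis using that by blast
    qed
    have rec: "measure Om (few x k) \<le> measure Om (few x (k + C)) / 2 + 2 * (1 / 2) ^ h"
      if kC: "real (k + C) \<le> c * real h" for k
    proof -
      have hb: "real h \<ge> 4 * real bR" using h unfolding H0_def by (metis of_nat_le_iff of_nat_mult of_nat_numeral)
      have hpos: "real h > 0" using hb bR by linarith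
      have "(real (Kc * h) - real (2 * bR)) * measure Om (few x k - G) \<le>
         real bR ^ 2 / \<eta> * (real (k + C) * measure Om (few x (k + C)))"
        unfolding bR_def by (rule few_recursion[OF R1 \<eta>(1) \<eta>(2) G(1,3) x])
      moreover have "real (Kc * h) / 2 \<le> real (Kc * h) - real (2 * bR)"
      proof -
        have "1 * real h \<le> real Kc * real h" using Kc by (intro mult_right_mono) auto
        then show ?thesis using hb by simp
      qed
      then have "real (Kc * h) / 2 * measure Om (few x k - G) \<le> (real (Kc * h) - real (2 * bR)) * measure Om (few x k - G)"
        by (rule mult_right_mono) simp
      moreover have "real bR ^ 2 / \<eta> * (real (k + C) * measure Om (few x (k + C))) \<le>
         real bR ^ 2 / \<eta> * ((c * real h) * measure Om (few x (k + C)))"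
        using kC \<eta>(1) by (intro mult_left_mono mult_right_mono) auto
      moreover have "real bR ^ 2 / \<eta> * ((c * real h) * measure Om (few x (k + C))) = real (Kc * h) / 4 * measure Om (few x (k + C))"
        using \<eta>(1) bR by (simp add: c_def field_simps)
      moreover have "real (Kc * h) / 2 * (measure Om (few x (k + C)) / 2) = real (Kc * h) / 4 * measure Om (few x (k + C))"
        by simp
      ultimately have "real (Kc * h) / 2 * measure Om (few x k - G) \<le> real (Kc * h) / 2 * (measure Om (few x (k + C)) / 2)"
        by linarith
      then have 1: "measure Om (few x k - G) \<le> measure Om (few x (k + C)) / 2"
        using Kc hpos by (subst (asm) mult_le_cancel_left_pos) auto
      have "measure Om (few x k) \<le> measure Om ((few x k - G) \<union> G)"
        using few_sets G(1) by (intro P.finite_measure_mono) auto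
      also have "\<dots> \<le> measure Om (few x k - G) + measure Om G"
        using few_sets G(1) by (intro measure_subadditive) auto
      finally show ?thesis using 1 G(2) by linarith
    qed
    have "measure Om (few x k) \<le> (1 / 2) ^ i + 2 * (2 * (1 / 2) ^ h)"
      using halving_iteration[where p = "\<lambda>k. measure Om (few x k)" and C = C and H = "c * real h" and e = "2 * (1 / 2) ^ h", OF rec _ _ ki]
      by simp
    then show ?thesis by simp
  qed
  show ?thesis
    by (rule exI[of _ R], rule exI[of _ Kc], rule exI[of _ H0], rule exI[of _ C], rule exI[of _ c])
      (use R1 Kc C1 c main in blast)
qed

theorem few_exponential:
  "\<exists>\<alpha>>0. \<exists>\<beta>1>0. \<exists>\<beta>2>0. \<forall>x :: int^'d. \<forall>k. real k \<le> \<alpha> * real_of_int (l1 x) + 1 \<longrightarrow>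
     measure Om (few x k) \<le> \<beta>1 * exp (- \<beta>2 * real_of_int (l1 x))"
proof -
  obtain R K H0 C c where B: "R \<ge> 1" "K \<ge> 1" "C \<ge> 1" "c > 0"
    "\<And>x h k i. h \<ge> H0 \<Longrightarrow> int (2 * K * h) \<le> l1 (tile (int R) x) \<Longrightarrow> real (k + i * C) \<le> c * real h \<Longrightarrow>
      measure Om (few x k) \<le> (1 / 2) ^ i + 4 * (1 / 2) ^ h"
    using few_bound by blast
  define H where "H = 4 * K * R"
  have H: "H \<ge> 1" using B by (simp add: H_def Suc_le_eq)
  define \<alpha> where "\<alpha> = c / (4 * real H)"
  define \<gamma> where "\<gamma> = ln 2 * c / (2 * real C)"
  define \<beta> where "\<beta> = min \<gamma> (ln 2) / real H"
  have pos: "\<alpha> > 0" "\<gamma> > 0" "\<beta> > 0" using B H by (auto simp: \<alpha>_def \<gamma>_def \<beta>_def)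
  obtain n1 :: nat where n1: "real (H * (H0 + 1)) + real (2 * R * CARD('d)) + (1 + c / 2) / \<alpha> \<le> real n1"
    using real_arch_simple by blast
  define \<beta>1 where "\<beta>1 = 2 * exp \<gamma> + 8 + exp (\<beta> * real n1)"
  have "\<beta>1 > 0" unfolding \<beta>1_def by (simp add: add_pos_pos)
  moreover have "measure Om (few x k) \<le> \<beta>1 * exp (- \<beta> * real_of_int (l1 x))"
    if k: "real k \<le> \<alpha> * real_of_int (l1 x) + 1" for x :: "int^'d" and k
  proof -
    define n where "n = nat (l1 x)"
    have n: "l1 x = int n" by (simp add: n_def)
    show ?thesis
    proof (cases "n \<ge> n1")
      case False
      have "measure Om (few x k) \<le> 1" by simp
      also have "1 \<le> exp (\<beta> * real n1) * exp (- \<beta> * real n)"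
        using False pos by (simp add: exp_add[symmetric])
      also have "\<dots> \<le> \<beta>1 * exp (- \<beta> * real n)" by (intro mult_right_mono) (auto simp: \<beta>1_def add_nonneg_nonneg)
      finally show ?thesis by (simp add: n)
    next
      case True
      define h where "h = n div H"
      have hn: "H * h \<le> n" unfolding h_def by (rule times_div_less_eq_dividend)
      have "n < H * (h + 1)" unfolding h_def using H by (simp add: dividend_less_times_div)
      then have "real n < real (H * (h + 1))" by (simp only: of_nat_less_iff)
      then have hr: "real n / real H - 1 \<le> real h" using H by (simp add: field_simps)
      have n1n: "real n1 \<le> real n" using True by simp
      have p1: "(1 + c / 2) / \<alpha> \<ge> 0" using pos B by simp
      have "real (H * (H0 + 1)) \<le> real n" using n1 n1n p1 by linarith
      then have "H * (H0 + 1) \<le> n" by (simp only: of_nat_le_iff)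
      then have "(H * (H0 + 1)) div H \<le> h" unfolding h_def by (rule div_le_mono)
      then have hH: "H0 \<le> h" using H by simp
      have "real (2 * R * CARD('d)) \<le> real n" using n1 n1n p1 by linarith
      then have nd: "2 * R * CARD('d) \<le> n" by (simp only: of_nat_le_iff)
      have tl: "int (2 * K * h) \<le> l1 (tile (int R) x)"
      proof -
        have "int n \<le> int R * (l1 (tile (int R) x) + int CARD('d))" using l1_tile[of "int R" x] B(1) n by simp
        moreover have "2 * (int R * int CARD('d)) \<le> int n" using nd by (metis mult.assoc of_nat_le_iff of_nat_mult of_nat_numeral)
        moreover have "2 * (int R * int (2 * K * h)) \<le> int n"
        proof -
          have "2 * (int R * int (2 * K * h)) = int (H * h)" by (simp add: H_def)
          also have "\<dots> \<le> int n" using hn by (simp only: of_nat_le_iff)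
          finally show ?thesis .
        qed
        ultimately have "int R * int (2 * K * h) \<le> int R * l1 (tile (int R) x)" by (simp only: distrib_left)
        then show ?thesis using B(1) by simp
      qed
      define i where "i = nat \<lfloor>c * real h / (2 * real C)\<rfloor>"
      have iC: "real i \<le> c * real h / (2 * real C)" "c * real h / (2 * real C) - 1 \<le> real i"
        using B(4) by (auto simp: i_def)
      have "(1 + c / 2) / \<alpha> \<le> real n" using n1 n1n by (smt (verit) of_nat_0_le_iff)
      then have "1 + c / 2 \<le> \<alpha> * real n" using pos by (simp add: field_simps)
      moreover have "c * (real n / real H - 1) \<le> c * real h" using hr B(4) by (intro mult_left_mono) auto
      then have "4 * (\<alpha> * real n) - c \<le> c * real h" using H by (simp add: \<alpha>_def algebra_simps)
      ultimately have "\<alpha> * real n + 1 \<le> c * real h / 2" by linarith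
      then have "real k \<le> c * real h / 2" using k n by simp
      moreover have "real (i * C) \<le> c * real h / 2"
        using mult_right_mono[OF iC(1), of "real C"] B(3) by simp
      ultimately have ki: "real (k + i * C) \<le> c * real h" by simp
      have half: "(1 / 2) ^ m = exp (- ln 2 * real m)" for m :: nat
        by (simp add: exp_of_nat2_mult[symmetric] exp_minus mult.commute exp_of_nat_mult[symmetric] power_one_over inverse_eq_divide)
          (simp add: exp_of_nat_mult exp_minus power_one_over inverse_eq_divide)
      have b1: "\<beta> * real n \<le> \<gamma> * (real n / real H)" "\<beta> * real n \<le> ln 2 * (real n / real H)"
      proof -
        have "min \<gamma> (ln 2) * (real n / real H) \<le> \<gamma> * (real n / real H)" "min \<gamma> (ln 2) * (real n / real H) \<le> ln 2 * (real n / real H)"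
          by (intro mult_right_mono; simp)+
        then show "\<beta> * real n \<le> \<gamma> * (real n / real H)" "\<beta> * real n \<le> ln 2 * (real n / real H)" by (auto simp: \<beta>_def)
      qed
      have "(1 / 2 :: real) ^ i \<le> exp (- ln 2 * (c * real h / (2 * real C) - 1))"
        unfolding half using iC(2) by simp
      also have "\<dots> = 2 * exp (- \<gamma> * real h)"
        by (simp add: \<gamma>_def algebra_simps exp_diff exp_minus) (simp add: field_simps exp_diff exp_minus)
      also have "\<dots> \<le> 2 * exp (\<gamma> - \<gamma> * (real n / real H))"
        using mult_left_mono[OF hr, of \<gamma>] pos by (simp add: algebra_simps)
      also have "\<dots> \<le> 2 * exp (\<gamma> - \<beta> * real n)" using b1(1) by simp
      finally have e1: "(1 / 2 :: real) ^ i \<le> 2 * exp \<gamma> * exp (- \<beta> * real n)" by (simp add: exp_diff exp_minus field_simps)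
      have "(1 / 2 :: real) ^ h \<le> exp (ln 2 - ln 2 * (real n / real H))"
        unfolding half using mult_left_mono[OF hr, of "ln 2"] by (simp add: algebra_simps)
      also have "\<dots> \<le> exp (ln 2 - \<beta> * real n)" using b1(2) by simp
      finally have e2: "(1 / 2 :: real) ^ h \<le> 2 * exp (- \<beta> * real n)" by (simp add: exp_diff exp_minus field_simps)
      have "measure Om (few x k) \<le> (1 / 2) ^ i + 4 * (1 / 2) ^ h" by (rule B(5)[OF hH tl ki])
      also have "\<dots> \<le> (2 * exp \<gamma> + 8) * exp (- \<beta> * real n)" using e1 e2 by (simp add: algebra_simps)
      also have "\<dots> \<le> \<beta>1 * exp (- \<beta> * real n)" by (intro mult_right_mono) (auto simp: \<beta>1_def)
      finally show ?thesis by (simp add: n)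
    qed
  qed
  ultimately show ?thesis using pos by blast
qed

end

section \<open>Transfer to the probability space\<close>

lemma emeasure_open_disjoint_support:
  assumes L: "sets L = sets borel" and U: "open U" "U \<inter> support L = {}"
  shows "emeasure L U = 0"
proof -
  define F where "F = {V. open V \<and> emeasure L V = 0}"
  obtain F' where F': "F' \<subseteq> F" "countable F'" "\<Union>F' = \<Union>F"
    using Lindelof[of F] by (auto simp: F_def)
  have "U \<subseteq> \<Union>F"
  proof
    fix t assume "t \<in> U"
    then have "t \<notin> support L" using U(2) by blast
    then show "t \<in> \<Union>F" by (auto simp: support_def F_def not_gr_zero)
  qed
  then have "emeasure L U \<le> emeasure L (\<Union>V\<in>F'. V)"
    using F' L by (intro emeasure_mono) (auto simp: F_def intro!: borel_open)
  also have "\<dots> = 0"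
  proof -
    have "V \<in> null_sets L" if "V \<in> F'" for V using that F'(1) L by (auto simp: F_def null_sets_def)
    then show ?thesis using null_sets_UN'[OF F'(2), of "\<lambda>V. V" L] by auto
  qed
  finally show ?thesis by simp
qed

lemma measure_open_pos:
  assumes "prob_space L" "open U" "t \<in> U" "t \<in> support L"
  shows "measure L U > 0"
proof -
  interpret prob_space L by fact
  have "emeasure L U > 0" using assms by (simp add: support_def)
  then show ?thesis by (simp add: emeasure_eq_measure)
qed

lemma measure_lessThan_Inf_support:
  assumes "sets L = sets borel"
  shows "measure L {..<Inf (support L)} = 0"
proof -
  have "{..<Inf (support L)} \<inter> support L = {}"
    using not_le by (auto dest: Inf_lower)
  then show ?thesis using emeasure_open_disjoint_support[OF assms] by (simp add: measure_def)
qed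

lemma measure_atMost_pos:
  assumes "prob_space L" "sets L = sets borel" "Inf (support L) < c"
  shows "measure L {..c} > 0"
proof -
  interpret prob_space L by fact
  obtain t where "t \<in> support L" "t < c" using assms(3) by (auto simp: Inf_less_iff)
  then have "0 < measure L {..<c}" by (intro measure_open_pos[OF assms(1), of _ t]) auto
  also have "\<dots> \<le> measure L {..c}" using assms(2) by (intro finite_measure_mono) auto
  finally show ?thesis .
qed

lemma measure_greaterThan_small:
  fixes L :: "ennreal measure"
  assumes "prob_space L" "sets L = sets borel" "measure L {\<infinity>} = 0" "\<epsilon> > 0"
  shows "\<exists>m. measure L {of_nat m<..} \<le> \<epsilon>"
proof -
  interpret prob_space L by fact
  have "decseq (\<lambda>m. {of_nat m :: ennreal<..})"
  proof (rule decseq_SucI)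
    have "(of_nat m :: ennreal) \<le> of_nat (Suc m)" for m by (rule of_nat_mono) simp
    then show "{of_nat (Suc m) :: ennreal<..} \<subseteq> {of_nat m<..}" for m by (meson greaterThan_subset_iff)
  qed
  moreover have "range (\<lambda>m. {of_nat m :: ennreal<..}) \<subseteq> sets L"
    unfolding assms(2) image_subset_iff by simp
  ultimately have "(\<lambda>m. measure L {of_nat m<..}) \<longlonglongrightarrow> measure L (\<Inter>m. {of_nat m<..})"
    by (rule finite_Lim_measure_decseq[rotated])
  also have "(\<Inter>m. {of_nat m<..}) = {\<infinity> :: ennreal}"
  proof -
    have "x = \<infinity>" if x: "\<And>m. of_nat m < x" for x :: ennreal
    proof (rule ccontr)
      assume "x \<noteq> \<infinity>"
      then obtain n where "x < of_nat n" using ennreal_Ex_less_of_nat[of x] by (auto simp: less_top)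
      then show False using x[of n] by simp
    qed
    then show ?thesis by (auto simp: of_nat_less_top)
  qed
  finally have "eventually (\<lambda>m. measure L {of_nat m<..} < \<epsilon>) sequentially"
    using assms(3,4) by (intro order_tendstoD(2)) auto
  then show ?thesis by (auto simp: eventually_sequentially intro: less_imp_le)
qed

lemma wall_exists:
  assumes L: "prob_space L" "sets L = sets borel" and \<epsilon>: "\<epsilon> > 0"
    and cond: "measure L {\<infinity>} > 0 \<or> measure L {\<infinity>} = 0 \<and> support_unbounded L"
  shows "\<exists>b. measure L {b<..} \<le> \<epsilon> \<and> measure L {of_nat n * b..} > 0"
proof -
  interpret prob_space L by fact
  consider "measure L {\<infinity>} > 0" | "measure L {\<infinity>} = 0" "support_unbounded L" using cond by blast
  then show ?thesis
  proof cases
    case 1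
    have "measure L {\<infinity>} \<le> measure L {of_nat n * \<infinity>..}" using L(2) by (intro finite_measure_mono) auto
    moreover have "{\<infinity><..} = ({} :: ennreal set)" by auto
    ultimately show ?thesis using 1 \<epsilon> by (intro exI[of _ \<infinity>]) simp
  next
    case 2
    obtain m where m: "measure L {of_nat m<..} \<le> \<epsilon>" using measure_greaterThan_small[OF L 2(1) \<epsilon>] by blast
    define r :: ennreal where "r = of_nat n * of_nat m"
    have "r = ennreal (real (n * m))" by (simp add: r_def ennreal_of_nat_eq_real_of_nat ennreal_mult)
    then obtain t where t: "t \<in> support L" "t > r" using 2(2) by (auto simp: support_unbounded_def)
    then have "0 < measure L {r<..}" by (intro measure_open_pos[OF L(1), of _ t]) auto
    also have "\<dots> \<le> measure L {r..}" using L(2) by (intro finite_measure_mono) auto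
    finally show ?thesis using m by (intro exI[of _ "of_nat m"]) (simp add: r_def)
  qed
qed

context
  fixes t t' :: "(int^'d) set \<Rightarrow> ennreal"
  assumes agree: "\<And>e. e \<in> lattice_edges \<Longrightarrow> t e = t' e"
begin

lemma ptime_agree: "path_from_to p x y \<Longrightarrow> ptime t p = ptime t' p"
  by (rule ptime_cong) (auto simp: path_from_to_iff agree)

lemma geotime_agree: "geotime t x y = geotime t' x y"
  unfolding geotime_def by (rule INF_cong) (auto intro: ptime_agree)

lemma is_geodesic_agree: "is_geodesic t x y g \<longleftrightarrow> is_geodesic t' x y g"
  using ptime_agree[of g x y] by (auto simp: is_geodesic_def geotime_agree)

lemma in_event_agree: "in_event Lv A t \<longleftrightarrow> in_event Lv A t'"
proof -
  have "restrict t (edges_in (box Lv)) = restrict t' (edges_in (box Lv))"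
    by (rule restrict_ext) (use edges_in_subset agree in blast)
  then show ?thesis by (simp add: in_event_def)
qed

lemma N_pat_agree: "N_pat Lv u v A t g = N_pat Lv u v A t' g"
proof -
  have "in_event Lv A (shift_conf x t) \<longleftrightarrow> in_event Lv A (shift_conf x t')" for x
    by (rule in_event_shift_cong) (simp add: agree)
  then show ?thesis by (simp add: N_pat_def satisfies_cond_def)
qed

end

lemma ptime_less_top_edge:
  assumes "path_from_to p u v" "u \<noteq> v" "ptime t p < \<infinity>"
  shows "\<exists>e\<in>lattice_edges. t e < \<infinity>"
proof -
  obtain y q where "p = u # y # q"
    using assms(1,2) by (cases p; cases "tl p") (auto simp: path_from_to_iff)
  then show ?thesis using assms(1,3) by (intro bexI[of _ "{u, y}"]) (auto simp: path_from_to_iff ennreal_add_less_top)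
qed

lemma countable_lattice_edges: "countable (lattice_edges :: (int^'d::finite) set set)"
proof -
  have "lattice_edges \<subseteq> (\<lambda>(x, y). {x, y :: int^'d}) ` UNIV" by (auto simp: lattice_edges_def)
  then show ?thesis by (rule countable_subset) simp
qed

theorem theorem1p4:
  fixes M :: "'a measure"
    and T :: "(int^'d) set \<Rightarrow> 'a \<Rightarrow> ennreal"
    and L :: "ennreal measure"
    and Lv :: "nat^'d" and u v :: "int^'d"
    and A :: "((int^'d) set \<Rightarrow> ennreal) set"
  assumes dim: "CARD('d) \<ge> 2"
    and prob: "prob_space M"
    and indep: "prob_space.indep_vars M (\<lambda>_. borel) T lattice_edges"
    and distr: "\<And>e. e \<in> lattice_edges \<Longrightarrow> distr M borel (T e) = L"
    and useful: "useful TYPE('d) L"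
    and cond: "(measure L {\<infinity>} > 0 \<and> measure L {t. t < \<infinity>} > p_c TYPE('d))
             \<or> (measure L {\<infinity>} = 0 \<and> support_unbounded L)"
    and valid: "valid_pattern M T L Lv u v A"
  shows "\<exists>\<alpha>>0. \<exists>\<beta>1>0. \<exists>\<beta>2>0. \<forall>x :: int^'d.
           (let E = {w \<in> space M. geotime (\<lambda>e. T e w) 0 x < \<infinity> \<and>
                       (\<exists>g. is_geodesic (\<lambda>e. T e w) 0 x g \<and>
                            real (N_pat Lv u v A (\<lambda>e. T e w) g) < \<alpha> * real_of_int (l1 x))}
            in E \<in> sets M \<and> measure M E \<le> \<beta>1 * exp (- \<beta>2 * real_of_int (l1 x)))"
proof -
  interpret M: prob_space M by (rule prob)
  define I where "I = (lattice_edges :: (int^'d) set set)"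
  have rv: "T e \<in> borel_measurable M" if "e \<in> I" for e
    using indep that unfolding M.indep_vars_def I_def by blast
  have "{0, 0 + axis i 1} \<in> I" for i :: 'd unfolding I_def edge_in_lattice by (rule adj_axis) simp
  then have I: "I \<noteq> {}" by blast
  then obtain e0 where e0: "e0 \<in> I" by blast
  have L0: "L = distr M borel (T e0)" using distr e0 by (simp add: I_def)
  have L: "prob_space L" "sets L = sets borel"
    unfolding L0 using rv[OF e0] by (auto intro: M.prob_space_distr)
  interpret F: fpp L "TYPE('d)"
    using L by (simp add: fpp_def fpp_axioms_def)
  define \<Phi> where "\<Phi> w = (\<lambda>e\<in>I. T e w)" for w
  have \<Phi>: "distr M F.Om \<Phi> = F.Om" "\<Phi> \<in> M \<rightarrow>\<^sub>M F.Om"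
  proof -
    have "distr M (PiM I (\<lambda>_. borel)) \<Phi> = PiM I (\<lambda>i. distr M borel (T i))"
      using M.indep_vars_iff_distr_eq_PiM'[where I = I and X = T and M' = "\<lambda>_. borel"] I rv indep unfolding \<Phi>_def I_def by blast
    also have "PiM I (\<lambda>i. distr M borel (T i)) = F.Om"
      unfolding I_def by (intro PiM_cong) (auto simp: distr)
    finally have *: "distr M (PiM I (\<lambda>_. borel)) \<Phi> = F.Om" .
    have s: "sets F.Om = sets (PiM I (\<lambda>_. borel))"
      unfolding I_def by (intro sets_PiM_cong) (auto simp: L)
    show "distr M F.Om \<Phi> = F.Om" using * distr_cong[OF refl s, of M \<Phi> \<Phi>] by simp
    have "\<Phi> \<in> M \<rightarrow>\<^sub>M PiM I (\<lambda>_. borel)" unfolding \<Phi>_def using rv by (intro measurable_restrict)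
    then show "\<Phi> \<in> M \<rightarrow>\<^sub>M F.Om" using measurable_cong_sets[OF refl s] by blast
  qed
  have pull: "measure M {w \<in> space M. \<Phi> w \<in> S} = measure F.Om S \<and> {w \<in> space M. \<Phi> w \<in> S} \<in> sets M"
    if S: "S \<in> sets F.Om" for S
  proof -
    have "{w \<in> space M. \<Phi> w \<in> S} = \<Phi> -` S \<inter> space M" by auto
    then show ?thesis using measurable_sets[OF \<Phi>(2) S] measure_distr[OF \<Phi>(2) S] \<Phi>(1) by simp
  qed
  have \<Phi>_space: "\<Phi> w \<in> space F.Om" for w
    by (auto simp: \<Phi>_def space_PiM I_def)
  have agree: "(\<lambda>e. T e w) e = \<Phi> w e" if "e \<in> lattice_edges" for e w
    using that by (simp add: \<Phi>_def I_def)
  note V = valid[unfolded valid_pattern_def]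
  have A: "A \<in> sets (PiM (edges_in (box Lv)) (\<lambda>_. borel :: ennreal measure))" using V by blast
  let ?P = "\<lambda>t. in_event Lv A t \<and> (\<exists>p. path_from_to p u v \<and> set p \<subseteq> box Lv \<and> ptime t p < \<infinity>)"
  have P_sets: "{t \<in> space F.Om. ?P t} \<in> sets F.Om"
  proof (intro sets.sets_Collect_conj)
    have "shift_conf 0 t = t" for t :: "(int^'d) set \<Rightarrow> ennreal" by (rule ext) (simp add: shift_conf_def)
    then show "{t \<in> space F.Om. in_event Lv A t} \<in> sets F.Om" using F.in_event_shift_sets[OF A, of 0] by simp
    have "{t \<in> space F.Om. \<exists>p. (path_from_to p u v \<and> set p \<subseteq> box Lv) \<and> ptime t p < \<infinity>} \<in> sets F.Om"
    proof (rule F.ex_measurable)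
      fix p assume "path_from_to p u v \<and> set p \<subseteq> box Lv"
      then have "(\<lambda>t. ptime t p) \<in> borel_measurable F.Om"
        by (auto simp: path_from_to_iff intro: F.ptime_measurable)
      then show "{t \<in> space F.Om. ptime t p < \<infinity>} \<in> sets F.Om" by measurable
    qed
    then show "{t \<in> space F.Om. \<exists>p. path_from_to p u v \<and> set p \<subseteq> box Lv \<and> ptime t p < \<infinity>} \<in> sets F.Om"
      by (simp add: conj_assoc)
  qed
  have "{w \<in> space M. \<Phi> w \<in> {t \<in> space F.Om. ?P t}} = {w \<in> space M. in_event Lv A (\<lambda>e. T e w)}"
    (is "_ = ?E")
  proof -
    have "ptime (\<Phi> w) p = ptime (\<lambda>e. T e w) p" if "path_from_to p u v" for p w
      using ptime_agree[where t = "\<lambda>e. T e w" and t' = "\<Phi> w", OF agree that] by simp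
    moreover have "in_event Lv A (\<Phi> w) \<longleftrightarrow> in_event Lv A (\<lambda>e. T e w)" for w
      using in_event_agree[where t = "\<lambda>e. T e w" and t' = "\<Phi> w", OF agree] by simp
    ultimately show ?thesis using V \<Phi>_space by (auto; metis)
  qed
  then have E: "measure F.Om {t \<in> space F.Om. ?P t} = measure M ?E" "?E \<in> sets M"
    using pull[OF P_sets] by simp_all
  have E0: "measure M ?E > 0" using V by blast
  have fin: "Inf (support L) < \<infinity>"
  proof (rule ccontr)
    assume "\<not> Inf (support L) < \<infinity>"
    then have "Inf (support L) = \<infinity>" by (metis infinity_ennreal_def less_top)
    then have L_inf: "measure L {..<\<infinity>} = 0" using measure_lessThan_Inf_support[OF L(2)] by (simp only:)
    have "T e -` {..<\<infinity>} \<inter> space M \<in> null_sets M" if "e \<in> I" for e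
    proof (rule null_setsI)
      show "T e -` {..<\<infinity>} \<inter> space M \<in> sets M" using rv[OF that] by (rule measurable_sets) simp
      have "measure M (T e -` {..<\<infinity>} \<inter> space M) = measure (distr M borel (T e)) {..<\<infinity>}"
        using rv[OF that] by (intro measure_distr[symmetric]) auto
      also have "\<dots> = 0" using L_inf distr that by (simp add: I_def)
      finally show "emeasure M (T e -` {..<\<infinity>} \<inter> space M) = 0" by (simp add: M.emeasure_eq_measure)
    qed
    then have null: "(\<Union>e\<in>I. T e -` {..<\<infinity>} \<inter> space M) \<in> null_sets M"
      using countable_lattice_edges by (intro null_sets_UN') (auto simp: I_def)
    have "?E \<subseteq> (\<Union>e\<in>I. T e -` {..<\<infinity>} \<inter> space M)"
    proof
      fix w assume w: "w \<in> ?E"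
      then obtain p where "path_from_to p u v" "ptime (\<lambda>e. T e w) p < \<infinity>" using V by blast
      then have "\<exists>e\<in>lattice_edges. T e w < \<infinity>" using V by (intro ptime_less_top_edge) auto
      then show "w \<in> (\<Union>e\<in>I. T e -` {..<\<infinity>} \<inter> space M)" using w by (auto simp: I_def)
    qed
    then have "?E \<in> null_sets M" using null E(2) null_sets_subset by blast
    then show False using E0 by (simp add: measure_eq_0_null_sets)
  qed
  define \<tau> where "\<tau> = enn2real (Inf (support L))"
  have \<tau>: "ennreal \<tau> = Inf (support L)" "\<tau> \<ge> 0" unfolding \<tau>_def using fin by simp_all
  interpret FP: fpp_pattern L "TYPE('d)" Lv u v A \<tau>
  proof
    show "2 \<le> CARD('d)" by (rule dim)
    show "u \<in> boundary (box Lv)" "v \<in> boundary (box Lv)" "u \<noteq> v" using V by blast+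
    show "A \<in> sets (PiM (edges_in (box Lv)) (\<lambda>_. borel))" by (rule A)
    show "0 < measure F.Om {t \<in> space F.Om. ?P t}" using E E0 by simp
    show "0 \<le> \<tau>" by (rule \<tau>)
    show "measure L {..<ennreal \<tau>} = 0" unfolding \<tau> by (rule measure_lessThan_Inf_support[OF L(2)])
    show "measure L {..ennreal (\<tau> + \<delta>)} > 0" if "\<delta> > 0" for \<delta>
      using \<tau> that by (intro measure_atMost_pos[OF L]) (simp add: \<tau>(1)[symmetric] ennreal_less_iff)
    show "measure L {ennreal \<tau>} < p_c TYPE('d)" if "\<tau> = 0"
      using useful that \<tau>(1) by (simp add: useful_def Let_def)
    show "measure L {ennreal \<tau>} < oriented_p_c TYPE('d)" if "\<tau> > 0"
    proof -
      have "Inf (support L) > 0" using that \<tau>(1) by (simp add: ennreal_less_zero_iff flip: \<tau>(1))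
      then show ?thesis using useful \<tau>(1) by (simp add: useful_def Let_def)
    qed
    show "\<exists>b. measure L {b<..} \<le> \<epsilon> \<and> measure L {of_nat n * b..} > 0" if "\<epsilon> > 0" for \<epsilon> n
      using wall_exists[OF L that] cond by blast
  qed
  obtain \<alpha> \<beta>1 \<beta>2 where B: "\<alpha> > 0" "\<beta>1 > 0" "\<beta>2 > 0"
    "\<And>x k. real k \<le> \<alpha> * real_of_int (l1 x) + 1 \<Longrightarrow> measure F.Om (FP.few x k) \<le> \<beta>1 * exp (- \<beta>2 * real_of_int (l1 x))"
    using FP.few_exponential by blast
  have "{w \<in> space M. geotime (\<lambda>e. T e w) 0 x < \<infinity> \<and> (\<exists>g. is_geodesic (\<lambda>e. T e w) 0 x g \<and>
            real (N_pat Lv u v A (\<lambda>e. T e w) g) < \<alpha> * real_of_int (l1 x))}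
      = {w \<in> space M. \<Phi> w \<in> FP.few x (nat \<lceil>\<alpha> * real_of_int (l1 x)\<rceil>)}" for x
    using geotime_agree[where t = "\<lambda>e. T e w" and t' = "\<Phi> w" for w, OF agree]
      is_geodesic_agree[where t = "\<lambda>e. T e w" and t' = "\<Phi> w" for w, OF agree]
      N_pat_agree[where t = "\<lambda>e. T e w" and t' = "\<Phi> w" for w, OF agree] \<Phi>_space
    by (simp add: FP.few_def zless_nat_eq_int_zless less_ceiling_iff)
  moreover have "real (nat \<lceil>\<alpha> * real_of_int (l1 x)\<rceil>) \<le> \<alpha> * real_of_int (l1 x) + 1" for x :: "int^'d"
  proof -
    have "\<alpha> * real_of_int (l1 x) \<ge> 0" using B(1) by (simp add: l1_nonneg)
    then show ?thesis by (simp add: of_nat_nat)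
  qed
  ultimately show ?thesis
    unfolding Let_def using B pull[OF FP.few_sets]
    by (intro exI[of _ \<alpha>] exI[of _ \<beta>1] exI[of _ \<beta>2] conjI allI) auto
qed

end
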